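(* Let $C$ be a coalgebra over a field, let $e\in C$ be a group-like element, and let $P$ be the pullback of $\pi_1:P_1\rightarrow P_{12}$ and $\pi_2:P_2\rightarrow P_{12}$ in the category ${}_e^C\mathbf{Alg}_e^C$ of unital algebras with $e$-coaugmented left and right $C$-coactions. If $\pi_1$ or $\pi_2$ is surjective and both $P_1$ and $P_2$ are principal $e$-coaugmented $C$-extensions, then $P$ is also a principal $e$-coaugmented $C$-extension.
   Context: All algebras and coalgebras are over a fixed field, and $\otimes$ is the tensor product over it. Let $C$ be a coalgebra with comultiplication $\Delta$ and counit $\varepsilon$, and $e\in C$ group-like. Category. Objects of ${}_e^C\mathbf{Alg}_e^C$ are unital algebras $P$ equipped with a right coaction $\Delta_P:P\to P\otimes C$, $\Delta_P(p)=p_{(0)}\otimes p_{(1)}$, and a left coaction ${}_P\Delta:P\to C\otimes P$ (not assumed to commute with each other, nor to be algebra maps) such that $\Delta_P(1)=1\otimes e$ and ${}_P\Delta(1)=e\otimes 1$ (this is called $e$-coaugmented). Morphisms are unital algebra homomorphisms that are both left and right $C$-colinear. The pullback of $\pi_1,\pi_2$ is the fibre product algebra $P=\{(p,q)\in P_1\times P_2 \mid \pi_1(p)=\pi_2(q)\}$ with the componentwise left and right coactions. Principality. For $P$ with right coaction $\Delta_P$, put $B:=P^{\mathrm{co}C}:=\{b\in P\mid \Delta_P(bp)=b\Delta_P(p)\ \forall p\in P\}$. The $C$-extension $B\subseteq P$ is called principal ($e$-coaugmented) if: (i) the canonical map $\mathsf{can}:P\otimes_BP\to P\otimes C$, $p\otimes_B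 p'\mapsto p\Delta_P(p')$, is bijective; (ii) $\Delta_P(1)=1\otimes e$; (iii) the canonical entwining $\psi:C\otimes P\to P\otimes C$, $\psi(c\otimes p)=\mathsf{can}(\mathsf{can}^{-1}(1\otimes c)\,p)$, is bijective (here $P\otimes_BP$ is a right $P$-module via multiplication on the right factor); (iv) there is a left $B$-linear and right $C$-colinear splitting of the multiplication map $B\otimes P\to P$. Convention: principal extensions are viewed as objects of ${}_e^C\mathbf{Alg}_e^C$ with the right coaction being the one defining the principal extension and the left coaction being ${}_P\Delta(p)=\psi^{-1}(p\otimes e)$, where $\psi$ is the canonical entwining. So an object of ${}_e^C\mathbf{Alg}_e^C$ is called principal if its right coaction satisfies (i)–(iv) and its left coaction is given by this formula. *)

theory Defs
  imports "HOL-Algebra.Module" "HOL-Algebra.AbelCoset"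
begin

section \<open>Modules by generators and relations, tensor products\<close>

text \<open>
  Vector spaces over a field \<open>K\<close> are HOL-Algebra modules over \<open>K\<close>. The record type of modules
  extends the one of rings; for a mere vector space the fields \<open>mult\<close> and \<open>one\<close> are irrelevant
  (and left undefined below).
\<close>

definition free_mod :: "('k, 'r) ring_scheme \<Rightarrow> 'x set \<Rightarrow> ('k, 'x \<Rightarrow> 'k) module" where
  "free_mod K X =
    \<lparr>carrier = {f. (\<forall>x. f x \<in> carrier K) \<and> finite {x. f x \<noteq> \<zero>\<^bsub>K\<^esub>} \<and> (\<forall>x. x \<notin> X \<longrightarrow> f x = \<zero>\<^bsub>K\<^esub>)},
     mult = undefined, one = undefined,
     zero = (\<lambda>x. \<zero>\<^bsub>K\<^esub>), add = (\<lambda>f g x. f x \<oplus>\<^bsub>K\<^esub> g x),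
     smult = (\<lambda>a f x. a \<otimes>\<^bsub>K\<^esub> f x)\<rparr>"

definition free_gen :: "('k, 'r) ring_scheme \<Rightarrow> 'x \<Rightarrow> 'x \<Rightarrow> 'k" where
  "free_gen K x = (\<lambda>y. if y = x then \<one>\<^bsub>K\<^esub> else \<zero>\<^bsub>K\<^esub>)"

definition mod_span :: "('k, 'r) ring_scheme \<Rightarrow> ('k, 'v, 'n) module_scheme \<Rightarrow> 'v set \<Rightarrow> 'v set" where
  "mod_span K M S = \<Inter>{N. submodule N K M \<and> S \<subseteq> N}"

definition quot_mod :: "('k, 'v, 'n) module_scheme \<Rightarrow> 'v set \<Rightarrow> ('k, 'v set) module" where
  "quot_mod M N =
    \<lparr>carrier = a_rcosets\<^bsub>M\<^esub> N, mult = undefined, one = undefined,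
     zero = N, add = (\<lambda>X Y. X <+>\<^bsub>M\<^esub> Y),
     smult = (\<lambda>a X. \<Union>x\<in>X. N +>\<^bsub>M\<^esub> (a \<odot>\<^bsub>M\<^esub> x))\<rparr>"

text \<open>The module with generators \<open>X\<close> and relators \<open>R\<close>, and the class of a generator.\<close>

definition pres_mod :: "('k, 'r) ring_scheme \<Rightarrow> 'x set \<Rightarrow> ('x \<Rightarrow> 'k) set \<Rightarrow> ('k, ('x \<Rightarrow> 'k) set) module" where
  "pres_mod K X R = quot_mod (free_mod K X) (mod_span K (free_mod K X) R)"

definition pres_gen :: "('k, 'r) ring_scheme \<Rightarrow> 'x set \<Rightarrow> ('x \<Rightarrow> 'k) set \<Rightarrow> 'x \<Rightarrow> ('x \<Rightarrow> 'k) set" where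
  "pres_gen K X R x = mod_span K (free_mod K X) R +>\<^bsub>free_mod K X\<^esub> free_gen K x"

text \<open>
  The linear map \<open>pres_mod K X R \<rightarrow> M\<close> sending the class of each generator \<open>x\<close> to \<open>\<beta> x\<close>. It does not
  depend on the chosen representative \<open>f\<close> of the class \<open>t\<close> as soon as \<open>\<beta>\<close> respects the relators \<open>R\<close>
  (for tensor products: as soon as \<open>\<beta>\<close> is bilinear, respectively bilinear and balanced).
\<close>

definition pres_lift ::
  "('k, 'r) ring_scheme \<Rightarrow> ('k, 'v, 'n) module_scheme \<Rightarrow> ('x \<Rightarrow> 'v) \<Rightarrow> ('x \<Rightarrow> 'k) set \<Rightarrow> 'v" where
  "pres_lift K M \<beta> t =
    (let f = (SOME f. f \<in> t) in \<Oplus>\<^bsub>M\<^esub>x\<in>{x. f x \<noteq> \<zero>\<^bsub>K\<^esub>}. f x \<odot>\<^bsub>M\<^esub> \<beta> x)"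

definition tensor_rels ::
  "('k, 'r) ring_scheme \<Rightarrow> ('k, 'v, 'm) module_scheme \<Rightarrow> ('k, 'w, 'n) module_scheme
    \<Rightarrow> ('v \<times> 'w \<Rightarrow> 'k) set" where
  "tensor_rels K V W =
    (let F = free_mod K (carrier V \<times> carrier W); \<delta> = free_gen K in
      {\<delta> (v \<oplus>\<^bsub>V\<^esub> v', w) \<ominus>\<^bsub>F\<^esub> (\<delta> (v, w) \<oplus>\<^bsub>F\<^esub> \<delta> (v', w)) | v v' w.
          v \<in> carrier V \<and> v' \<in> carrier V \<and> w \<in> carrier W} \<union>
      {\<delta> (v, w \<oplus>\<^bsub>W\<^esub> w') \<ominus>\<^bsub>F\<^esub> (\<delta> (v, w) \<oplus>\<^bsub>F\<^esub> \<delta> (v, w')) | v w w'.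
          v \<in> carrier V \<and> w \<in> carrier W \<and> w' \<in> carrier W} \<union>
      {\<delta> (a \<odot>\<^bsub>V\<^esub> v, w) \<ominus>\<^bsub>F\<^esub> a \<odot>\<^bsub>F\<^esub> \<delta> (v, w) | a v w.
          a \<in> carrier K \<and> v \<in> carrier V \<and> w \<in> carrier W} \<union>
      {\<delta> (v, a \<odot>\<^bsub>W\<^esub> w) \<ominus>\<^bsub>F\<^esub> a \<odot>\<^bsub>F\<^esub> \<delta> (v, w) | a v w.
          a \<in> carrier K \<and> v \<in> carrier V \<and> w \<in> carrier W})"

definition tensor ::
  "('k, 'r) ring_scheme \<Rightarrow> ('k, 'v, 'm) module_scheme \<Rightarrow> ('k, 'w, 'n) module_scheme
    \<Rightarrow> ('k, ('v \<times> 'w \<Rightarrow> 'k) set) module" where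
  "tensor K V W = pres_mod K (carrier V \<times> carrier W) (tensor_rels K V W)"

definition tens ::
  "('k, 'r) ring_scheme \<Rightarrow> ('k, 'v, 'm) module_scheme \<Rightarrow> ('k, 'w, 'n) module_scheme
    \<Rightarrow> 'v \<Rightarrow> 'w \<Rightarrow> ('v \<times> 'w \<Rightarrow> 'k) set" where
  "tens K V W v w = pres_gen K (carrier V \<times> carrier W) (tensor_rels K V W) (v, w)"

text \<open>
  \<open>P \<otimes>\<^sub>B P\<close> for a subset \<open>B\<close> of a \<open>K\<close>-algebra \<open>P\<close>. For a unital subalgebra \<open>B\<close> the \<open>K\<close>-bilinearity
  relations are part of \<open>B\<close>-balancedness and biadditivity, so this is the usual tensor product
  over \<open>B\<close> with its \<open>K\<close>-module structure.
\<close>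

definition btensor_rels ::
  "('k, 'r) ring_scheme \<Rightarrow> ('k, 'p, 'm) module_scheme \<Rightarrow> 'p set \<Rightarrow> ('p \<times> 'p \<Rightarrow> 'k) set" where
  "btensor_rels K P B = tensor_rels K P P \<union>
    {free_gen K (p \<otimes>\<^bsub>P\<^esub> b, q) \<ominus>\<^bsub>free_mod K (carrier P \<times> carrier P)\<^esub> free_gen K (p, b \<otimes>\<^bsub>P\<^esub> q) | p b q.
        p \<in> carrier P \<and> b \<in> B \<and> q \<in> carrier P}"

definition btensor ::
  "('k, 'r) ring_scheme \<Rightarrow> ('k, 'p, 'm) module_scheme \<Rightarrow> 'p set \<Rightarrow> ('k, ('p \<times> 'p \<Rightarrow> 'k) set) module" where
  "btensor K P B = pres_mod K (carrier P \<times> carrier P) (btensor_rels K P B)"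

definition btens ::
  "('k, 'r) ring_scheme \<Rightarrow> ('k, 'p, 'm) module_scheme \<Rightarrow> 'p set \<Rightarrow> 'p \<Rightarrow> 'p \<Rightarrow> ('p \<times> 'p \<Rightarrow> 'k) set" where
  "btens K P B p q = pres_gen K (carrier P \<times> carrier P) (btensor_rels K P B) (p, q)"

text \<open>\<open>f \<otimes> g\<close> with values in \<open>V' \<otimes> W'\<close> (the domain need not be mentioned).\<close>

definition tmap ::
  "('k, 'r) ring_scheme \<Rightarrow> ('k, 'v2, 'm) module_scheme \<Rightarrow> ('k, 'w2, 'n) module_scheme
    \<Rightarrow> ('v \<Rightarrow> 'v2) \<Rightarrow> ('w \<Rightarrow> 'w2) \<Rightarrow> ('v \<times> 'w \<Rightarrow> 'k) set \<Rightarrow> ('v2 \<times> 'w2 \<Rightarrow> 'k) set" where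
  "tmap K V' W' f g = pres_lift K (tensor K V' W') (\<lambda>(v, w). tens K V' W' (f v) (g w))"

text \<open>The associator \<open>U \<otimes> (V \<otimes> W) \<rightarrow> (U \<otimes> V) \<otimes> W\<close>.\<close>

definition tassoc ::
  "('k, 'r) ring_scheme \<Rightarrow> ('k, 'u, 'l) module_scheme \<Rightarrow> ('k, 'v, 'm) module_scheme
    \<Rightarrow> ('k, 'w, 'n) module_scheme
    \<Rightarrow> ('u \<times> ('v \<times> 'w \<Rightarrow> 'k) set \<Rightarrow> 'k) set \<Rightarrow> (('u \<times> 'v \<Rightarrow> 'k) set \<times> 'w \<Rightarrow> 'k) set" where
  "tassoc K U V W =
    (let T = tensor K (tensor K U V) W in
      pres_lift K T (\<lambda>(u, t).
        pres_lift K T (\<lambda>(v, w). tens K (tensor K U V) W (tens K U V u v) w) t))"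

definition linear_maps ::
  "('k, 'r) ring_scheme \<Rightarrow> ('k, 'v, 'm) module_scheme \<Rightarrow> ('k, 'w, 'n) module_scheme
    \<Rightarrow> ('v \<Rightarrow> 'w) set" where
  "linear_maps K V W =
    {f \<in> carrier V \<rightarrow> carrier W.
      (\<forall>x\<in>carrier V. \<forall>y\<in>carrier V. f (x \<oplus>\<^bsub>V\<^esub> y) = f x \<oplus>\<^bsub>W\<^esub> f y) \<and>
      (\<forall>a\<in>carrier K. \<forall>x\<in>carrier V. f (a \<odot>\<^bsub>V\<^esub> x) = a \<odot>\<^bsub>W\<^esub> f x)}"


section \<open>Coalgebras and coactions\<close>

record ('k, 'c) coalg = "('k, 'c) module" +
  comult :: "'c \<Rightarrow> ('c \<times> 'c \<Rightarrow> 'k) set"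
  counit :: "'c \<Rightarrow> 'k"

definition right_coaction ::
  "('k, 'r) ring_scheme \<Rightarrow> ('k, 'c, 'n) coalg_scheme \<Rightarrow> ('k, 'v, 'm) module_scheme
    \<Rightarrow> ('v \<Rightarrow> ('v \<times> 'c \<Rightarrow> 'k) set) \<Rightarrow> bool" where
  "right_coaction K C V \<rho> \<longleftrightarrow>
    \<rho> \<in> linear_maps K V (tensor K V C) \<and>
    (\<forall>v\<in>carrier V. tmap K (tensor K V C) C \<rho> id (\<rho> v) =
        tassoc K V C C (tmap K V (tensor K C C) id (comult C) (\<rho> v))) \<and>
    (\<forall>v\<in>carrier V. pres_lift K V (\<lambda>(x, c). counit C c \<odot>\<^bsub>V\<^esub> x) (\<rho> v) = v)"

definition left_coaction ::
  "('k, 'r) ring_scheme \<Rightarrow> ('k, 'c, 'n) coalg_scheme \<Rightarrow> ('k, 'v, 'm) module_scheme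
    \<Rightarrow> ('v \<Rightarrow> ('c \<times> 'v \<Rightarrow> 'k) set) \<Rightarrow> bool" where
  "left_coaction K C V \<sigma> \<longleftrightarrow>
    \<sigma> \<in> linear_maps K V (tensor K C V) \<and>
    (\<forall>v\<in>carrier V. tassoc K C C V (tmap K C (tensor K C V) id \<sigma> (\<sigma> v)) =
        tmap K (tensor K C C) V (comult C) id (\<sigma> v)) \<and>
    (\<forall>v\<in>carrier V. pres_lift K V (\<lambda>(c, x). counit C c \<odot>\<^bsub>V\<^esub> x) (\<sigma> v) = v)"

text \<open>The last two conjuncts contain coassociativity and the two counit laws.\<close>

definition coalgebra :: "('k, 'r) ring_scheme \<Rightarrow> ('k, 'c, 'n) coalg_scheme \<Rightarrow> bool" where
  "coalgebra K C \<longleftrightarrow>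
    module K C \<and>
    counit C \<in> carrier C \<rightarrow> carrier K \<and>
    (\<forall>x\<in>carrier C. \<forall>y\<in>carrier C. counit C (x \<oplus>\<^bsub>C\<^esub> y) = counit C x \<oplus>\<^bsub>K\<^esub> counit C y) \<and>
    (\<forall>a\<in>carrier K. \<forall>x\<in>carrier C. counit C (a \<odot>\<^bsub>C\<^esub> x) = a \<otimes>\<^bsub>K\<^esub> counit C x) \<and>
    right_coaction K C C (comult C) \<and> left_coaction K C C (comult C)"

definition group_like :: "('k, 'r) ring_scheme \<Rightarrow> ('k, 'c, 'n) coalg_scheme \<Rightarrow> 'c \<Rightarrow> bool" where
  "group_like K C e \<longleftrightarrow>
    e \<in> carrier C \<and> comult C e = tens K C C e e \<and> counit C e = \<one>\<^bsub>K\<^esub>"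


section \<open>Algebras with coaugmented left and right coactions\<close>

text \<open>The library's \<open>algebra\<close> locale is restricted to commutative algebras.\<close>

definition unital_algebra :: "('k, 'r) ring_scheme \<Rightarrow> ('k, 'p, 'm) module_scheme \<Rightarrow> bool" where
  "unital_algebra K P \<longleftrightarrow>
    module K P \<and> ring P \<and>
    (\<forall>a\<in>carrier K. \<forall>x\<in>carrier P. \<forall>y\<in>carrier P.
      (a \<odot>\<^bsub>P\<^esub> x) \<otimes>\<^bsub>P\<^esub> y = a \<odot>\<^bsub>P\<^esub> (x \<otimes>\<^bsub>P\<^esub> y) \<and>
      x \<otimes>\<^bsub>P\<^esub> (a \<odot>\<^bsub>P\<^esub> y) = a \<odot>\<^bsub>P\<^esub> (x \<otimes>\<^bsub>P\<^esub> y))"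

record ('k, 'p, 'c) coact_alg = "('k, 'p) module" +
  rcoact :: "'p \<Rightarrow> ('p \<times> 'c \<Rightarrow> 'k) set"
  lcoact :: "'p \<Rightarrow> ('c \<times> 'p \<Rightarrow> 'k) set"

definition coaug_alg ::
  "('k, 'r) ring_scheme \<Rightarrow> ('k, 'c, 'n) coalg_scheme \<Rightarrow> 'c \<Rightarrow> ('k, 'p, 'c) coact_alg \<Rightarrow> bool" where
  "coaug_alg K C e P \<longleftrightarrow>
    unital_algebra K P \<and>
    right_coaction K C P (rcoact P) \<and> left_coaction K C P (lcoact P) \<and>
    rcoact P \<one>\<^bsub>P\<^esub> = tens K P C \<one>\<^bsub>P\<^esub> e \<and> lcoact P \<one>\<^bsub>P\<^esub> = tens K C P e \<one>\<^bsub>P\<^esub>"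

text \<open>Unital algebra homomorphisms (\<open>ring_hom\<close> includes preservation of \<open>\<one>\<close>) that are colinear on both sides.\<close>

definition coaug_alg_hom ::
  "('k, 'r) ring_scheme \<Rightarrow> ('k, 'c, 'n) coalg_scheme \<Rightarrow> ('k, 'p, 'c) coact_alg
    \<Rightarrow> ('k, 'q, 'c) coact_alg \<Rightarrow> ('p \<Rightarrow> 'q) \<Rightarrow> bool" where
  "coaug_alg_hom K C P Q f \<longleftrightarrow>
    f \<in> ring_hom P Q \<and> f \<in> linear_maps K P Q \<and>
    (\<forall>p\<in>carrier P. rcoact Q (f p) = tmap K Q C f id (rcoact P p)) \<and>
    (\<forall>p\<in>carrier P. lcoact Q (f p) = tmap K C Q id f (lcoact P p))"

definition fibre_alg ::
  "('k, 'p, 'm) module_scheme \<Rightarrow> ('k, 'q, 'n) module_scheme \<Rightarrow> ('p \<Rightarrow> 's) \<Rightarrow> ('q \<Rightarrow> 's)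
    \<Rightarrow> ('k, 'p \<times> 'q) module" where
  "fibre_alg P1 P2 \<pi>1 \<pi>2 =
    \<lparr>carrier = {(p, q). p \<in> carrier P1 \<and> q \<in> carrier P2 \<and> \<pi>1 p = \<pi>2 q},
     mult = (\<lambda>(p, q) (p', q'). (p \<otimes>\<^bsub>P1\<^esub> p', q \<otimes>\<^bsub>P2\<^esub> q')), one = (\<one>\<^bsub>P1\<^esub>, \<one>\<^bsub>P2\<^esub>),
     zero = (\<zero>\<^bsub>P1\<^esub>, \<zero>\<^bsub>P2\<^esub>), add = (\<lambda>(p, q) (p', q'). (p \<oplus>\<^bsub>P1\<^esub> p', q \<oplus>\<^bsub>P2\<^esub> q')),
     smult = (\<lambda>a (p, q). (a \<odot>\<^bsub>P1\<^esub> p, a \<odot>\<^bsub>P2\<^esub> q))\<rparr>"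

text \<open>
  The pullback: the fibre product algebra \<open>P\<close> with componentwise coactions. The coaction of \<open>(p, q)\<close>
  is the element of \<open>P \<otimes> C\<close> whose components in \<open>P1 \<otimes> C\<close> and \<open>P2 \<otimes> C\<close> are the coactions of \<open>p\<close> and
  of \<open>q\<close>. For colinear \<open>\<pi>1\<close>, \<open>\<pi>2\<close> it exists and is unique: over a field \<open>- \<otimes> C\<close> is exact, so \<open>P \<otimes> C\<close>
  is via the two projections the fibre product of \<open>P1 \<otimes> C\<close> and \<open>P2 \<otimes> C\<close>.
\<close>

definition pullback_alg ::
  "('k, 'r) ring_scheme \<Rightarrow> ('k, 'c, 'n) coalg_scheme \<Rightarrow> ('k, 'p, 'c) coact_alg
    \<Rightarrow> ('k, 'q, 'c) coact_alg \<Rightarrow> ('p \<Rightarrow> 's) \<Rightarrow> ('q \<Rightarrow> 's) \<Rightarrow> ('k, 'p \<times> 'q, 'c) coact_alg" where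
  "pullback_alg K C P1 P2 \<pi>1 \<pi>2 =
    (let P = fibre_alg P1 P2 \<pi>1 \<pi>2 in
      module.extend P
        \<lparr>rcoact = (\<lambda>x. THE t. t \<in> carrier (tensor K P C) \<and>
            tmap K P1 C fst id t = rcoact P1 (fst x) \<and> tmap K P2 C snd id t = rcoact P2 (snd x)),
         lcoact = (\<lambda>x. THE t. t \<in> carrier (tensor K C P) \<and>
            tmap K C P1 id fst t = lcoact P1 (fst x) \<and> tmap K C P2 id snd t = lcoact P2 (snd x))\<rparr>)"


section \<open>Principal extensions\<close>

definition coinvariants ::
  "('k, 'r) ring_scheme \<Rightarrow> ('k, 'c, 'n) coalg_scheme \<Rightarrow> ('k, 'p, 'c) coact_alg \<Rightarrow> 'p set" where
  "coinvariants K C P =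
    {b \<in> carrier P. \<forall>p\<in>carrier P.
      rcoact P (b \<otimes>\<^bsub>P\<^esub> p) = tmap K P C (\<lambda>q. b \<otimes>\<^bsub>P\<^esub> q) id (rcoact P p)}"

definition can_map ::
  "('k, 'r) ring_scheme \<Rightarrow> ('k, 'c, 'n) coalg_scheme \<Rightarrow> ('k, 'p, 'c) coact_alg
    \<Rightarrow> ('p \<times> 'p \<Rightarrow> 'k) set \<Rightarrow> ('p \<times> 'c \<Rightarrow> 'k) set" where
  "can_map K C P =
    pres_lift K (tensor K P C) (\<lambda>(p, p'). tmap K P C (\<lambda>q. p \<otimes>\<^bsub>P\<^esub> q) id (rcoact P p'))"

definition can_bijective ::
  "('k, 'r) ring_scheme \<Rightarrow> ('k, 'c, 'n) coalg_scheme \<Rightarrow> ('k, 'p, 'c) coact_alg \<Rightarrow> bool" where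
  "can_bijective K C P \<longleftrightarrow>
    bij_betw (can_map K C P) (carrier (btensor K P (coinvariants K C P))) (carrier (tensor K P C))"

text \<open>The canonical entwining \<open>c \<otimes> p \<mapsto> can (can\<^sup>-\<^sup>1 (1 \<otimes> c) p)\<close>.\<close>

definition entwining ::
  "('k, 'r) ring_scheme \<Rightarrow> ('k, 'c, 'n) coalg_scheme \<Rightarrow> ('k, 'p, 'c) coact_alg
    \<Rightarrow> ('c \<times> 'p \<Rightarrow> 'k) set \<Rightarrow> ('p \<times> 'c \<Rightarrow> 'k) set" where
  "entwining K C P =
    (let B = coinvariants K C P;
         can_inv = inv_into (carrier (btensor K P B)) (can_map K C P);
         act = (\<lambda>p. pres_lift K (btensor K P B) (\<lambda>(q, q'). btens K P B q (q' \<otimes>\<^bsub>P\<^esub> p)))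
     in pres_lift K (tensor K P C)
          (\<lambda>(c, p). can_map K C P (act p (can_inv (tens K P C \<one>\<^bsub>P\<^esub> c)))))"

text \<open>\<open>B \<otimes> P\<close> carries the left action \<open>b (b' \<otimes> p) = b b' \<otimes> p\<close> and the right coaction \<open>id \<otimes> rcoact P\<close>.\<close>

definition colinear_splitting ::
  "('k, 'r) ring_scheme \<Rightarrow> ('k, 'c, 'n) coalg_scheme \<Rightarrow> ('k, 'p, 'c) coact_alg
    \<Rightarrow> ('p \<Rightarrow> ('p \<times> 'p \<Rightarrow> 'k) set) \<Rightarrow> bool" where
  "colinear_splitting K C P s \<longleftrightarrow>
    (let B = P\<lparr>carrier := coinvariants K C P\<rparr> in
      s \<in> linear_maps K P (tensor K B P) \<and>
      (\<forall>p\<in>carrier P. pres_lift K P (\<lambda>(b, q). b \<otimes>\<^bsub>P\<^esub> q) (s p) = p) \<and>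
      (\<forall>b\<in>carrier B. \<forall>p\<in>carrier P. s (b \<otimes>\<^bsub>P\<^esub> p) = tmap K B P (\<lambda>b'. b \<otimes>\<^bsub>P\<^esub> b') id (s p)) \<and>
      (\<forall>p\<in>carrier P. tassoc K B P C (tmap K B (tensor K P C) id (rcoact P) (s p)) =
          tmap K (tensor K B P) C s id (rcoact P p)))"

definition principal_extension ::
  "('k, 'r) ring_scheme \<Rightarrow> ('k, 'c, 'n) coalg_scheme \<Rightarrow> 'c \<Rightarrow> ('k, 'p, 'c) coact_alg \<Rightarrow> bool" where
  "principal_extension K C e P \<longleftrightarrow>
    can_bijective K C P \<and>
    rcoact P \<one>\<^bsub>P\<^esub> = tens K P C \<one>\<^bsub>P\<^esub> e \<and>
    bij_betw (entwining K C P) (carrier (tensor K C P)) (carrier (tensor K P C)) \<and>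
    (\<exists>s. colinear_splitting K C P s)"

text \<open>Principal objects of the category: the left coaction is the one induced by the entwining.\<close>

definition principal_coaug_alg ::
  "('k, 'r) ring_scheme \<Rightarrow> ('k, 'c, 'n) coalg_scheme \<Rightarrow> 'c \<Rightarrow> ('k, 'p, 'c) coact_alg \<Rightarrow> bool" where
  "principal_coaug_alg K C e P \<longleftrightarrow>
    coaug_alg K C e P \<and> principal_extension K C e P \<and>
    (\<forall>p\<in>carrier P.
      lcoact P p = inv_into (carrier (tensor K C P)) (entwining K C P) (tens K P C p e))"

end

theory Submission
  imports Defs
begin

text \<open>
  An extension is principal if and only if it admits a strong connection: a bicolinear map \<open>l : C \<rightarrow> P \<otimes> P\<close>
  with \<open>m l = \<epsilon>\<close>, such that \<open>c \<otimes> p \<mapsto> l(c)\<^sub>1 \<rho> (l(c)\<^sub>2 p)\<close> is an injective entwining inducing both coactions. In one direction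
  \<open>l\<close> is the translation map followed by the splitting; in the other, \<open>p \<otimes> c \<mapsto> p l(c)\<close> inverts the canonical map and
  \<open>p \<mapsto> p\<^sub>0 l(p\<^sub>1)\<close> is the splitting.

  Let \<open>\<pi>2\<close> be surjective. A linear section on coinvariants, spread out by the strong connection \<open>l2\<close>, yields
  a left and a right colinear section of \<open>\<pi>2\<close>, hence colinear lifts \<open>fL, fR : P1 \<rightarrow> P2\<close> of \<open>\<pi>1\<close> and
  \<open>jL = (id, fL), jR = (id, fR) : P1 \<rightarrow> P\<close>. Then \<open>(jL \<otimes> jR) l1\<close> is bicolinear, but its product in the second
  component is \<open>m (fL \<otimes> fR) l1 = \<epsilon> - t\<close>, where \<open>\<pi>2 t = 0\<close>. Since \<open>\<epsilon> = (\<epsilon> - t) + t\<close>, the error is cancelled by adding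
  \<open>t * w\<close>, where \<open>w = (fL \<otimes> jR) l1 + l2 * t\<close>; the factors \<open>t\<close> are moved into \<open>P\<close> through the kernel of \<open>\<pi>2\<close>.
\<close>

section \<open>Linear algebra over a field\<close>

text \<open>The base \<open>B\<close>, and with it the balanced tensor product, changes under
  pullback, so bijectivity of the canonical map is awkward to inherit directly. A strong connection
  takes values in \<open>P \<otimes> P\<close> over the field, where a map can be assembled from
  components. The coactions are not algebra maps:
  \<open>\<rho> (p q) = p_0 \<psi>(p_1 \<otimes> q)\<close>. The two sides therefore have to be
  treated separately, and only one-sided colinear sections are built: \<open>fL\<close> serves the
  left leg, \<open>fR\<close> the right leg. Their product along \<open>l1\<close> need not be the
  counit, which is the origin of \<open>t\<close>. With convolution written \<open>*\<close>, the
  product of the legs of \<open>w\<close> is \<open>m' + \<epsilon> * t = \<epsilon>\<close>, and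
  that of the legs of \<open>l\<close> in the second component is
  \<open>m' + t * \<epsilon> = \<epsilon>\<close>. In the first component both corrections vanish.
  The entwining of \<open>P\<close> inherits injectivity and its relation to the coactions, because
  \<open>P \<otimes> C\<close> and \<open>C \<otimes> P\<close> embed into the pairs of tensor
  products of \<open>P1\<close> and \<open>P2\<close>. Its surjectivity is obtained from the strong
  connection instead, by an explicit preimage.\<close>

locale vector_spaces =
  fixes K :: "'k ring"
  assumes field_K: "field K"
begin

lemma cring_K: "cring K"
  using field_K by (simp add: field_def domain_def)

lemma ring_K: "ring K"
  using cring_K by (simp add: cring_def)

lemma K_simps [simp]:
  "\<zero>\<^bsub>K\<^esub> \<in> carrier K" "\<one>\<^bsub>K\<^esub> \<in> carrier K"
  "a \<in> carrier K \<Longrightarrow> b \<in> carrier K \<Longrightarrow> a \<oplus>\<^bsub>K\<^esub> b \<in> carrier K"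
  "a \<in> carrier K \<Longrightarrow> b \<in> carrier K \<Longrightarrow> a \<otimes>\<^bsub>K\<^esub> b \<in> carrier K"
  "a \<in> carrier K \<Longrightarrow> \<ominus>\<^bsub>K\<^esub> a \<in> carrier K"
  using ring_K by (auto simp: ring.ring_simprules)

lemma smult_simps [simp]:
  assumes "module K V"
  shows "a \<in> carrier K \<Longrightarrow> x \<in> carrier V \<Longrightarrow> a \<odot>\<^bsub>V\<^esub> x \<in> carrier V"
    and "x \<in> carrier V \<Longrightarrow> \<one>\<^bsub>K\<^esub> \<odot>\<^bsub>V\<^esub> x = x"
    and "x \<in> carrier V \<Longrightarrow> \<zero>\<^bsub>K\<^esub> \<odot>\<^bsub>V\<^esub> x = \<zero>\<^bsub>V\<^esub>"
    and "a \<in> carrier K \<Longrightarrow> a \<odot>\<^bsub>V\<^esub> \<zero>\<^bsub>V\<^esub> = \<zero>\<^bsub>V\<^esub>"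
    and "\<zero>\<^bsub>V\<^esub> \<in> carrier V"
    and "x \<in> carrier V \<Longrightarrow> y \<in> carrier V \<Longrightarrow> x \<oplus>\<^bsub>V\<^esub> y \<in> carrier V"
    and "x \<in> carrier V \<Longrightarrow> \<ominus>\<^bsub>V\<^esub> x \<in> carrier V"
    and "x \<in> carrier V \<Longrightarrow> y \<in> carrier V \<Longrightarrow> x \<ominus>\<^bsub>V\<^esub> y \<in> carrier V"
    and "x \<in> carrier V \<Longrightarrow> \<zero>\<^bsub>V\<^esub> \<oplus>\<^bsub>V\<^esub> x = x"
    and "x \<in> carrier V \<Longrightarrow> x \<oplus>\<^bsub>V\<^esub> \<zero>\<^bsub>V\<^esub> = x"
    and "x \<in> carrier V \<Longrightarrow> x \<oplus>\<^bsub>V\<^esub> \<ominus>\<^bsub>V\<^esub> x = \<zero>\<^bsub>V\<^esub>"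
    and "x \<in> carrier V \<Longrightarrow> \<ominus>\<^bsub>V\<^esub> x \<oplus>\<^bsub>V\<^esub> x = \<zero>\<^bsub>V\<^esub>"
    and "x \<in> carrier V \<Longrightarrow> x \<ominus>\<^bsub>V\<^esub> x = \<zero>\<^bsub>V\<^esub>"
proof -
  interpret module K V by fact
  show "a \<in> carrier K \<Longrightarrow> x \<in> carrier V \<Longrightarrow> a \<odot>\<^bsub>V\<^esub> x \<in> carrier V"
    and "x \<in> carrier V \<Longrightarrow> \<one>\<^bsub>K\<^esub> \<odot>\<^bsub>V\<^esub> x = x"
    and "x \<in> carrier V \<Longrightarrow> \<zero>\<^bsub>K\<^esub> \<odot>\<^bsub>V\<^esub> x = \<zero>\<^bsub>V\<^esub>"
    and "a \<in> carrier K \<Longrightarrow> a \<odot>\<^bsub>V\<^esub> \<zero>\<^bsub>V\<^esub> = \<zero>\<^bsub>V\<^esub>"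
    and "\<zero>\<^bsub>V\<^esub> \<in> carrier V"
    and "x \<in> carrier V \<Longrightarrow> y \<in> carrier V \<Longrightarrow> x \<oplus>\<^bsub>V\<^esub> y \<in> carrier V"
    and "x \<in> carrier V \<Longrightarrow> \<ominus>\<^bsub>V\<^esub> x \<in> carrier V"
    and "x \<in> carrier V \<Longrightarrow> y \<in> carrier V \<Longrightarrow> x \<ominus>\<^bsub>V\<^esub> y \<in> carrier V"
    and "x \<in> carrier V \<Longrightarrow> \<zero>\<^bsub>V\<^esub> \<oplus>\<^bsub>V\<^esub> x = x"
    and "x \<in> carrier V \<Longrightarrow> x \<oplus>\<^bsub>V\<^esub> \<zero>\<^bsub>V\<^esub> = x"
    and "x \<in> carrier V \<Longrightarrow> x \<oplus>\<^bsub>V\<^esub> \<ominus>\<^bsub>V\<^esub> x = \<zero>\<^bsub>V\<^esub>"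
    and "x \<in> carrier V \<Longrightarrow> \<ominus>\<^bsub>V\<^esub> x \<oplus>\<^bsub>V\<^esub> x = \<zero>\<^bsub>V\<^esub>"
    and "x \<in> carrier V \<Longrightarrow> x \<ominus>\<^bsub>V\<^esub> x = \<zero>\<^bsub>V\<^esub>"
    by (auto simp: M.r_neg M.l_neg M.minus_eq)
qed

lemma linear_mapsI:
  assumes "\<And>x. x \<in> carrier V \<Longrightarrow> f x \<in> carrier W"
    and "\<And>x y. x \<in> carrier V \<Longrightarrow> y \<in> carrier V \<Longrightarrow> f (x \<oplus>\<^bsub>V\<^esub> y) = f x \<oplus>\<^bsub>W\<^esub> f y"
    and "\<And>a x. a \<in> carrier K \<Longrightarrow> x \<in> carrier V \<Longrightarrow> f (a \<odot>\<^bsub>V\<^esub> x) = a \<odot>\<^bsub>W\<^esub> f x"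
  shows "f \<in> linear_maps K V W"
  using assms by (auto simp: linear_maps_def)

lemma linear_closed: "f \<in> linear_maps K V W \<Longrightarrow> x \<in> carrier V \<Longrightarrow> f x \<in> carrier W"
  and linear_add: "f \<in> linear_maps K V W \<Longrightarrow> x \<in> carrier V \<Longrightarrow> y \<in> carrier V \<Longrightarrow>
    f (x \<oplus>\<^bsub>V\<^esub> y) = f x \<oplus>\<^bsub>W\<^esub> f y"
  and linear_smult: "f \<in> linear_maps K V W \<Longrightarrow> a \<in> carrier K \<Longrightarrow> x \<in> carrier V \<Longrightarrow>
    f (a \<odot>\<^bsub>V\<^esub> x) = a \<odot>\<^bsub>W\<^esub> f x"
  by (auto simp: linear_maps_def)

lemma linear_zero:
  assumes "f \<in> linear_maps K V W" "module K V" "module K W"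
  shows "f \<zero>\<^bsub>V\<^esub> = \<zero>\<^bsub>W\<^esub>"
proof -
  have "f (\<zero>\<^bsub>K\<^esub> \<odot>\<^bsub>V\<^esub> \<zero>\<^bsub>V\<^esub>) = \<zero>\<^bsub>K\<^esub> \<odot>\<^bsub>W\<^esub> f \<zero>\<^bsub>V\<^esub>"
    using assms by (intro linear_smult) auto
  then show ?thesis using assms linear_closed[OF assms(1), of "\<zero>\<^bsub>V\<^esub>"] by simp
qed

lemma neg_eq_smult:
  assumes "module K V" "x \<in> carrier V"
  shows "\<ominus>\<^bsub>V\<^esub> x = (\<ominus>\<^bsub>K\<^esub> \<one>\<^bsub>K\<^esub>) \<odot>\<^bsub>V\<^esub> x"
proof -
  interpret module K V by fact
  show ?thesis using assms by (simp add: smult_l_minus)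
qed

lemma linear_neg:
  assumes "f \<in> linear_maps K V W" "module K V" "module K W" "x \<in> carrier V"
  shows "f (\<ominus>\<^bsub>V\<^esub> x) = \<ominus>\<^bsub>W\<^esub> f x"
  using assms linear_closed[OF assms(1)] by (simp add: neg_eq_smult linear_smult)

lemma linear_diff:
  assumes "f \<in> linear_maps K V W" "module K V" "module K W" "x \<in> carrier V" "y \<in> carrier V"
  shows "f (x \<ominus>\<^bsub>V\<^esub> y) = f x \<ominus>\<^bsub>W\<^esub> f y"
  using assms linear_closed[OF assms(1)] by (simp add: a_minus_def linear_neg linear_add)

lemma diff_add_cancel:
  assumes "module K V" "x \<in> carrier V" "y \<in> carrier V"
  shows "(x \<ominus>\<^bsub>V\<^esub> y) \<oplus>\<^bsub>V\<^esub> y = x" "y \<oplus>\<^bsub>V\<^esub> (x \<ominus>\<^bsub>V\<^esub> y) = x"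
proof -
  interpret module K V by fact
  show "(x \<ominus>\<^bsub>V\<^esub> y) \<oplus>\<^bsub>V\<^esub> y = x" using assms by (simp add: M.minus_eq M.a_assoc)
  then show "y \<oplus>\<^bsub>V\<^esub> (x \<ominus>\<^bsub>V\<^esub> y) = x" using assms by (simp add: M.a_comm)
qed

lemma diff_eq_zero_iff:
  assumes "module K V" "x \<in> carrier V" "y \<in> carrier V"
  shows "x \<ominus>\<^bsub>V\<^esub> y = \<zero>\<^bsub>V\<^esub> \<longleftrightarrow> x = y"
  using diff_add_cancel(1)[OF assms] assms by auto

lemma add_ac:
  assumes "module K V" "x \<in> carrier V" "y \<in> carrier V" "z \<in> carrier V"
  shows "(x \<oplus>\<^bsub>V\<^esub> y) \<oplus>\<^bsub>V\<^esub> z = x \<oplus>\<^bsub>V\<^esub> (y \<oplus>\<^bsub>V\<^esub> z)"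
    and "x \<oplus>\<^bsub>V\<^esub> y = y \<oplus>\<^bsub>V\<^esub> x"
    and "x \<oplus>\<^bsub>V\<^esub> (y \<oplus>\<^bsub>V\<^esub> z) = y \<oplus>\<^bsub>V\<^esub> (x \<oplus>\<^bsub>V\<^esub> z)"
proof -
  interpret module K V by fact
  show "(x \<oplus>\<^bsub>V\<^esub> y) \<oplus>\<^bsub>V\<^esub> z = x \<oplus>\<^bsub>V\<^esub> (y \<oplus>\<^bsub>V\<^esub> z)" "x \<oplus>\<^bsub>V\<^esub> y = y \<oplus>\<^bsub>V\<^esub> x"
    "x \<oplus>\<^bsub>V\<^esub> (y \<oplus>\<^bsub>V\<^esub> z) = y \<oplus>\<^bsub>V\<^esub> (x \<oplus>\<^bsub>V\<^esub> z)"
    using assms by (simp_all add: M.a_ac)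
qed

lemma add_swap:
  assumes V: "module K V" and [simp]: "x \<in> carrier V" "y \<in> carrier V" "z \<in> carrier V" "u \<in> carrier V"
  shows "(x \<oplus>\<^bsub>V\<^esub> y) \<oplus>\<^bsub>V\<^esub> (z \<oplus>\<^bsub>V\<^esub> u) = (x \<oplus>\<^bsub>V\<^esub> z) \<oplus>\<^bsub>V\<^esub> (y \<oplus>\<^bsub>V\<^esub> u)"
proof -
  interpret module K V by fact
  show ?thesis using assms by (simp add: M.a_ac)
qed

lemma add_diff_cancel:
  assumes V: "module K V" and "x \<in> carrier V" "y \<in> carrier V" "z \<in> carrier V"
  shows "(x \<oplus>\<^bsub>V\<^esub> y) \<ominus>\<^bsub>V\<^esub> (z \<oplus>\<^bsub>V\<^esub> y) = x \<ominus>\<^bsub>V\<^esub> z"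
proof -
  interpret module K V by fact
  have "(x \<oplus>\<^bsub>V\<^esub> y) \<ominus>\<^bsub>V\<^esub> (z \<oplus>\<^bsub>V\<^esub> y) = (x \<oplus>\<^bsub>V\<^esub> y) \<oplus>\<^bsub>V\<^esub> (\<ominus>\<^bsub>V\<^esub> z \<oplus>\<^bsub>V\<^esub> \<ominus>\<^bsub>V\<^esub> y)"
    using assms by (simp add: M.minus_eq M.minus_add)
  also have "\<dots> = (x \<oplus>\<^bsub>V\<^esub> \<ominus>\<^bsub>V\<^esub> z) \<oplus>\<^bsub>V\<^esub> (y \<oplus>\<^bsub>V\<^esub> \<ominus>\<^bsub>V\<^esub> y)" using assms by (intro add_swap) auto
  finally show ?thesis using assms by (simp add: M.minus_eq M.r_neg)
qed

lemma smult_distribs: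
  assumes "module K V"
  shows "a \<in> carrier K \<Longrightarrow> b \<in> carrier K \<Longrightarrow> x \<in> carrier V \<Longrightarrow>
      (a \<oplus>\<^bsub>K\<^esub> b) \<odot>\<^bsub>V\<^esub> x = a \<odot>\<^bsub>V\<^esub> x \<oplus>\<^bsub>V\<^esub> b \<odot>\<^bsub>V\<^esub> x"
    and "a \<in> carrier K \<Longrightarrow> x \<in> carrier V \<Longrightarrow> y \<in> carrier V \<Longrightarrow>
      a \<odot>\<^bsub>V\<^esub> (x \<oplus>\<^bsub>V\<^esub> y) = a \<odot>\<^bsub>V\<^esub> x \<oplus>\<^bsub>V\<^esub> a \<odot>\<^bsub>V\<^esub> y"
    and "a \<in> carrier K \<Longrightarrow> b \<in> carrier K \<Longrightarrow> x \<in> carrier V \<Longrightarrow>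
      (a \<otimes>\<^bsub>K\<^esub> b) \<odot>\<^bsub>V\<^esub> x = a \<odot>\<^bsub>V\<^esub> (b \<odot>\<^bsub>V\<^esub> x)"
    and "a \<in> carrier K \<Longrightarrow> b \<in> carrier K \<Longrightarrow> x \<in> carrier V \<Longrightarrow>
      a \<odot>\<^bsub>V\<^esub> (b \<odot>\<^bsub>V\<^esub> x) = b \<odot>\<^bsub>V\<^esub> (a \<odot>\<^bsub>V\<^esub> x)"
proof -
  interpret module K V by fact
  show "a \<in> carrier K \<Longrightarrow> b \<in> carrier K \<Longrightarrow> x \<in> carrier V \<Longrightarrow>
      (a \<oplus>\<^bsub>K\<^esub> b) \<odot>\<^bsub>V\<^esub> x = a \<odot>\<^bsub>V\<^esub> x \<oplus>\<^bsub>V\<^esub> b \<odot>\<^bsub>V\<^esub> x"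
    and "a \<in> carrier K \<Longrightarrow> x \<in> carrier V \<Longrightarrow> y \<in> carrier V \<Longrightarrow>
      a \<odot>\<^bsub>V\<^esub> (x \<oplus>\<^bsub>V\<^esub> y) = a \<odot>\<^bsub>V\<^esub> x \<oplus>\<^bsub>V\<^esub> a \<odot>\<^bsub>V\<^esub> y"
    and "a \<in> carrier K \<Longrightarrow> b \<in> carrier K \<Longrightarrow> x \<in> carrier V \<Longrightarrow>
      (a \<otimes>\<^bsub>K\<^esub> b) \<odot>\<^bsub>V\<^esub> x = a \<odot>\<^bsub>V\<^esub> (b \<odot>\<^bsub>V\<^esub> x)"
    by (auto simp: smult_l_distr smult_r_distr smult_assoc1)
  show "a \<in> carrier K \<Longrightarrow> b \<in> carrier K \<Longrightarrow> x \<in> carrier V \<Longrightarrow>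
      a \<odot>\<^bsub>V\<^esub> (b \<odot>\<^bsub>V\<^esub> x) = b \<odot>\<^bsub>V\<^esub> (a \<odot>\<^bsub>V\<^esub> x)"
    by (metis R.m_comm smult_assoc1)
qed

lemma submoduleI':
  assumes "module K V" "N \<subseteq> carrier V" "\<zero>\<^bsub>V\<^esub> \<in> N"
    "\<And>x y. x \<in> N \<Longrightarrow> y \<in> N \<Longrightarrow> x \<oplus>\<^bsub>V\<^esub> y \<in> N"
    "\<And>a x. a \<in> carrier K \<Longrightarrow> x \<in> N \<Longrightarrow> a \<odot>\<^bsub>V\<^esub> x \<in> N"
  shows "submodule N K V"
  using assms by (intro module.submoduleI) (auto simp: neg_eq_smult subset_iff)

lemma submodule_simps:
  assumes "submodule N K V" "module K V"
  shows "x \<in> N \<Longrightarrow> x \<in> carrier V" "\<zero>\<^bsub>V\<^esub> \<in> N"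
    "x \<in> N \<Longrightarrow> y \<in> N \<Longrightarrow> x \<oplus>\<^bsub>V\<^esub> y \<in> N" "a \<in> carrier K \<Longrightarrow> x \<in> N \<Longrightarrow> a \<odot>\<^bsub>V\<^esub> x \<in> N"
    "x \<in> N \<Longrightarrow> y \<in> N \<Longrightarrow> x \<ominus>\<^bsub>V\<^esub> y \<in> N"
proof -
  interpret module K V by fact
  note E = submoduleE[OF assms(1)]
  show a: "x \<in> N \<Longrightarrow> x \<in> carrier V" for x using E(1) by auto
  show "x \<in> N \<Longrightarrow> y \<in> N \<Longrightarrow> x \<oplus>\<^bsub>V\<^esub> y \<in> N" "a \<in> carrier K \<Longrightarrow> x \<in> N \<Longrightarrow> a \<odot>\<^bsub>V\<^esub> x \<in> N"
    using E by auto
  show "x \<in> N \<Longrightarrow> y \<in> N \<Longrightarrow> x \<ominus>\<^bsub>V\<^esub> y \<in> N" using E a by (simp add: M.minus_eq)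
  obtain z where "z \<in> N" using E(2) by auto
  then show "\<zero>\<^bsub>V\<^esub> \<in> N" using E(4)[of "\<zero>\<^bsub>K\<^esub>" z] a assms(2) by simp
qed

lemma linear_id [intro, simp]: "(\<lambda>x. x) \<in> linear_maps K V V"
  by (auto simp: linear_maps_def)

lemma linear_comp:
  "g \<in> linear_maps K V W \<Longrightarrow> f \<in> linear_maps K U V \<Longrightarrow> (\<lambda>x. g (f x)) \<in> linear_maps K U W"
  by (auto simp: linear_maps_def Pi_iff)

lemma linear_plus:
  assumes "module K W" "f \<in> linear_maps K V W" "g \<in> linear_maps K V W"
  shows "(\<lambda>x. f x \<oplus>\<^bsub>W\<^esub> g x) \<in> linear_maps K V W"
  using assms linear_closed[OF assms(2)] linear_closed[OF assms(3)]
  by (intro linear_mapsI) (auto simp: linear_add linear_smult smult_distribs add_swap)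

lemma linear_scale:
  assumes "module K W" "f \<in> linear_maps K V W" "a \<in> carrier K"
  shows "(\<lambda>x. a \<odot>\<^bsub>W\<^esub> f x) \<in> linear_maps K V W"
  using assms linear_closed[OF assms(2)]
  by (intro linear_mapsI) (auto simp: linear_add linear_smult smult_distribs)

lemma linear_cong:
  assumes "f \<in> linear_maps K V W" "module K V" "\<And>x. x \<in> carrier V \<Longrightarrow> f x = g x"
  shows "g \<in> linear_maps K V W"
  using assms linear_closed[OF assms(1)]
  by (intro linear_mapsI) (auto simp flip: assms(3) simp: linear_add linear_smult)

lemma linear_minus:
  assumes "module K W" "module K V" "f \<in> linear_maps K V W" "g \<in> linear_maps K V W"
  shows "(\<lambda>x. f x \<ominus>\<^bsub>W\<^esub> g x) \<in> linear_maps K V W"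
  by (rule linear_cong[of "\<lambda>x. f x \<oplus>\<^bsub>W\<^esub> (\<ominus>\<^bsub>K\<^esub> \<one>\<^bsub>K\<^esub>) \<odot>\<^bsub>W\<^esub> g x"])
    (use assms linear_closed[OF assms(4)] in
      \<open>auto intro!: linear_plus linear_scale simp: a_minus_def neg_eq_smult\<close>)

lemma linear_zero_map: "module K W \<Longrightarrow> (\<lambda>x. \<zero>\<^bsub>W\<^esub>) \<in> linear_maps K V W"
  by (rule linear_mapsI) simp_all

lemma submodule_preimage:
  assumes "module K V" "module K W" "f \<in> linear_maps K V W" "submodule N K W"
  shows "submodule {x \<in> carrier V. f x \<in> N} K V"
  using assms submodule_simps[OF assms(4,2)]
  by (intro submoduleI') (auto simp: linear_add linear_smult linear_zero)

lemma submodule_image: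
  assumes "module K V" "module K W" "f \<in> linear_maps K V W" "submodule N K V"
  shows "submodule (f ` N) K W"
proof (rule submoduleI')
  note N = submodule_simps[OF assms(4,1)]
  show "f ` N \<subseteq> carrier W" using linear_closed[OF assms(3)] N by auto
  show "\<zero>\<^bsub>W\<^esub> \<in> f ` N" using linear_zero[OF assms(3,1,2)] N(2) by (metis imageI)
  show "x \<oplus>\<^bsub>W\<^esub> y \<in> f ` N" if "x \<in> f ` N" "y \<in> f ` N" for x y
  proof -
    obtain u v where "u \<in> N" "v \<in> N" "x = f u" "y = f v"
      using \<open>x \<in> f ` N\<close> \<open>y \<in> f ` N\<close> by blast
    then show ?thesis using linear_add[OF assms(3)] N by (intro image_eqI[of _ _ "u \<oplus>\<^bsub>V\<^esub> v"]) auto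
  qed
  show "a \<odot>\<^bsub>W\<^esub> x \<in> f ` N" if a: "a \<in> carrier K" and "x \<in> f ` N" for a x
  proof -
    obtain u where "u \<in> N" "x = f u" using \<open>x \<in> f ` N\<close> by blast
    then show ?thesis using linear_smult[OF assms(3)] N a by (intro image_eqI[of _ _ "a \<odot>\<^bsub>V\<^esub> u"]) auto
  qed
qed fact

lemma submodule_zero: "module K V \<Longrightarrow> submodule {\<zero>\<^bsub>V\<^esub>} K V"
  by (rule submoduleI') auto

lemma submodule_carrier: "module K V \<Longrightarrow> submodule (carrier V) K V"
  by (rule module.carrier_is_submodule)

text \<open>Zorn's lemma gives a submodule \<open>M\<close> maximal among those meeting
  \<open>N\<close> trivially. A vector \<open>x\<close> outside \<open>M + N\<close> could be
  adjoined to it: if \<open>m + a x\<close> lies in \<open>N\<close> with \<open>a\<close> nonzero,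
  division by \<open>a\<close> puts \<open>x\<close> into \<open>M + N\<close>.\<close>

lemma complement_exists:
  assumes V: "module K V" and N: "submodule N K V"
  obtains M where "submodule M K V" "M \<inter> N = {\<zero>\<^bsub>V\<^esub>}"
    "\<And>x. x \<in> carrier V \<Longrightarrow> \<exists>m\<in>M. \<exists>n\<in>N. x = m \<oplus>\<^bsub>V\<^esub> n"
proof -
  interpret V: module K V by fact
  note Ns = submodule_simps[OF N V]
  let ?A = "{M. submodule M K V \<and> M \<inter> N = {\<zero>\<^bsub>V\<^esub>}}"
  have "\<exists>M\<in>?A. \<forall>X\<in>?A. M \<subseteq> X \<longrightarrow> X = M"
  proof (rule subset_Zorn_nonempty)
    show "?A \<noteq> {}" using submodule_zero[OF V] Ns by blast
    fix C assume "C \<noteq> {}" and ch: "subset.chain ?A C"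
    have "submodule (\<Union>C) K V"
    proof (rule submoduleI'[OF V])
      have sub: "submodule M K V" if "M \<in> C" for M using ch that by (auto simp: subset_chain_def)
      note s = submodule_simps[OF sub V]
      show "\<Union>C \<subseteq> carrier V" using s(1) by blast
      show "\<zero>\<^bsub>V\<^esub> \<in> \<Union>C" using s(2) \<open>C \<noteq> {}\<close> by blast
      show "a \<odot>\<^bsub>V\<^esub> x \<in> \<Union>C" if "a \<in> carrier K" "x \<in> \<Union>C" for a x using s(4) that by blast
      show "x \<oplus>\<^bsub>V\<^esub> y \<in> \<Union>C" if "x \<in> \<Union>C" "y \<in> \<Union>C" for x y
      proof -
        obtain X Y where XY: "X \<in> C" "Y \<in> C" "x \<in> X" "y \<in> Y" using \<open>x \<in> \<Union>C\<close> \<open>y \<in> \<Union>C\<close> by blast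
        then have "X \<subseteq> Y \<or> Y \<subseteq> X" using ch by (auto simp: subset_chain_def)
        then show ?thesis using XY s(3)[of X x y] s(3)[of Y x y] by blast
      qed
    qed
    moreover have "\<Union>C \<inter> N = {\<zero>\<^bsub>V\<^esub>}" using ch \<open>C \<noteq> {}\<close> by (fastforce simp: subset_chain_def)
    ultimately show "\<Union>C \<in> ?A" by simp
  qed
  then obtain M where M: "submodule M K V" and MN: "M \<inter> N = {\<zero>\<^bsub>V\<^esub>}"
    and max: "\<And>X. submodule X K V \<Longrightarrow> X \<inter> N = {\<zero>\<^bsub>V\<^esub>} \<Longrightarrow> M \<subseteq> X \<Longrightarrow> X = M"
    by auto
  note Ms = submodule_simps[OF M V]
  have "\<exists>m\<in>M. \<exists>n\<in>N. x = m \<oplus>\<^bsub>V\<^esub> n" if x: "x \<in> carrier V" for x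
  proof (rule ccontr)
    assume no: "\<not> ?thesis"
    let ?X = "{m \<oplus>\<^bsub>V\<^esub> a \<odot>\<^bsub>V\<^esub> x | m a. m \<in> M \<and> a \<in> carrier K}"
    have "submodule ?X K V"
    proof (rule submoduleI'[OF V])
      show "?X \<subseteq> carrier V" using Ms x V by auto
      show "\<zero>\<^bsub>V\<^esub> \<in> ?X" using Ms(2) V x by (intro CollectI exI[of _ "\<zero>\<^bsub>V\<^esub>"] exI[of _ "\<zero>\<^bsub>K\<^esub>"]) auto
      show "u \<oplus>\<^bsub>V\<^esub> v \<in> ?X" if uv: "u \<in> ?X" "v \<in> ?X" for u v
      proof -
        obtain m a where ma: "u = m \<oplus>\<^bsub>V\<^esub> a \<odot>\<^bsub>V\<^esub> x" "m \<in> M" "a \<in> carrier K" using uv by blast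
        obtain n b where nb: "v = n \<oplus>\<^bsub>V\<^esub> b \<odot>\<^bsub>V\<^esub> x" "n \<in> M" "b \<in> carrier K" using uv by blast
        have "u \<oplus>\<^bsub>V\<^esub> v = (m \<oplus>\<^bsub>V\<^esub> n) \<oplus>\<^bsub>V\<^esub> (a \<oplus>\<^bsub>K\<^esub> b) \<odot>\<^bsub>V\<^esub> x"
          using ma nb V x Ms(1) by (simp add: add_swap smult_distribs)
        then show ?thesis using Ms(3) ma nb
          by (intro CollectI exI[of _ "m \<oplus>\<^bsub>V\<^esub> n"] exI[of _ "a \<oplus>\<^bsub>K\<^esub> b"]) auto
      qed
      show "b \<odot>\<^bsub>V\<^esub> u \<in> ?X" if b: "b \<in> carrier K" and u: "u \<in> ?X" for b u
      proof -
        obtain m a where ma: "u = m \<oplus>\<^bsub>V\<^esub> a \<odot>\<^bsub>V\<^esub> x" "m \<in> M" "a \<in> carrier K" using u by blast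
        have "b \<odot>\<^bsub>V\<^esub> u = (b \<odot>\<^bsub>V\<^esub> m) \<oplus>\<^bsub>V\<^esub> (b \<otimes>\<^bsub>K\<^esub> a) \<odot>\<^bsub>V\<^esub> x"
          using ma b V x Ms(1) by (simp add: smult_distribs(2,3))
        then show ?thesis using Ms(4) b ma
          by (intro CollectI exI[of _ "b \<odot>\<^bsub>V\<^esub> m"] exI[of _ "b \<otimes>\<^bsub>K\<^esub> a"]) auto
      qed
    qed
    moreover have "?X \<inter> N = {\<zero>\<^bsub>V\<^esub>}"
    proof -
      have "v = \<zero>\<^bsub>V\<^esub>" if vX: "v \<in> ?X" and vN: "v \<in> N" for v
      proof -
        obtain m a where ma: "v = m \<oplus>\<^bsub>V\<^esub> a \<odot>\<^bsub>V\<^esub> x" "m \<in> M" "a \<in> carrier K" using vX by blast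
        have a0: "a = \<zero>\<^bsub>K\<^esub>"
        proof (rule ccontr)
          assume "a \<noteq> \<zero>\<^bsub>K\<^esub>"
          then have "a \<in> Units K" using ma field_K by (simp add: field.field_Units)
          then obtain b where b: "b \<in> carrier K" "b \<otimes>\<^bsub>K\<^esub> a = \<one>\<^bsub>K\<^esub>" by (auto simp: Units_def)
          have "b \<odot>\<^bsub>V\<^esub> v = b \<odot>\<^bsub>V\<^esub> m \<oplus>\<^bsub>V\<^esub> x"
            using ma b V x Ms(1) smult_distribs(3)[OF V b(1) ma(3) x] by (simp add: smult_distribs(2))
          then have "x = (\<ominus>\<^bsub>V\<^esub> (b \<odot>\<^bsub>V\<^esub> m)) \<oplus>\<^bsub>V\<^esub> b \<odot>\<^bsub>V\<^esub> v"
            using ma b V x Ms(1) by (simp add: V.M.r_neg1)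
          moreover have "\<ominus>\<^bsub>V\<^esub> (b \<odot>\<^bsub>V\<^esub> m) \<in> M" "b \<odot>\<^bsub>V\<^esub> v \<in> N"
            using ma b V Ms Ns vN by (auto simp: neg_eq_smult)
          ultimately show False using no by blast
        qed
        then have "v \<in> M" using ma Ms(1) V x by simp
        then show ?thesis using vN MN by blast
      qed
      moreover have "\<zero>\<^bsub>V\<^esub> \<in> ?X" using \<open>submodule ?X K V\<close> V by (rule submodule_simps)
      ultimately show ?thesis using Ns(2) by blast
    qed
    moreover have "M \<subseteq> ?X"
    proof
      fix m assume "m \<in> M"
      then show "m \<in> ?X" using Ms(1) V x by (intro CollectI exI[of _ m] exI[of _ "\<zero>\<^bsub>K\<^esub>"]) auto
    qed
    ultimately have "?X = M" by (rule max)
    moreover have "x \<in> ?X" using Ms(2) V x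
      by (intro CollectI exI[of _ "\<zero>\<^bsub>V\<^esub>"] exI[of _ "\<one>\<^bsub>K\<^esub>"]) auto
    ultimately have "x \<in> M" by simp
    then show False using no Ns(2) V x by (metis smult_simps(10))
  qed
  then show thesis using that M MN by blast
qed

text \<open>The projection takes the component in \<open>N\<close> along a complement
  \<open>M\<close>. The component is unique, since the difference of two candidates lies in
  \<open>M \<inter> N\<close>.\<close>

lemma projection_exists:
  assumes V: "module K V" and N: "submodule N K V"
  obtains p where "p \<in> linear_maps K V V" "\<And>x. x \<in> carrier V \<Longrightarrow> p x \<in> N" "\<And>x. x \<in> N \<Longrightarrow> p x = x"
proof -
  interpret V: module K V by fact
  obtain M where M: "submodule M K V" and MN: "M \<inter> N = {\<zero>\<^bsub>V\<^esub>}"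
    and sum: "\<And>x. x \<in> carrier V \<Longrightarrow> \<exists>m\<in>M. \<exists>n\<in>N. x = m \<oplus>\<^bsub>V\<^esub> n"
    using complement_exists[OF V N] by blast
  note Ms = submodule_simps[OF M V] and Ns = submodule_simps[OF N V]
  have uniq: "n = n'" if n: "n \<in> N" "n' \<in> N" and m: "m \<in> M" "m' \<in> M"
    and eq: "m \<oplus>\<^bsub>V\<^esub> n = m' \<oplus>\<^bsub>V\<^esub> n'" for m m' n n'
  proof -
    have "m \<ominus>\<^bsub>V\<^esub> m' = n' \<ominus>\<^bsub>V\<^esub> n"
    proof -
      have c: "m \<in> carrier V" "m' \<in> carrier V" "n \<in> carrier V" "n' \<in> carrier V"
        using n m Ms(1) Ns(1) by auto
      have "m \<ominus>\<^bsub>V\<^esub> m' = (m \<oplus>\<^bsub>V\<^esub> n) \<ominus>\<^bsub>V\<^esub> (m' \<oplus>\<^bsub>V\<^esub> n)"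
        by (rule add_diff_cancel[symmetric]) (use c V in auto)
      also have "\<dots> = (n' \<oplus>\<^bsub>V\<^esub> m') \<ominus>\<^bsub>V\<^esub> (n \<oplus>\<^bsub>V\<^esub> m')"
        unfolding eq using c V by (simp add: V.M.a_comm)
      also have "\<dots> = n' \<ominus>\<^bsub>V\<^esub> n" by (rule add_diff_cancel) (use c V in auto)
      finally show ?thesis .
    qed
    then have "n' \<ominus>\<^bsub>V\<^esub> n \<in> M \<inter> N" using n m Ms(5) Ns(5) by (metis IntI)
    then have "n' \<ominus>\<^bsub>V\<^esub> n = \<zero>\<^bsub>V\<^esub>" unfolding MN by simp
    then show ?thesis using n Ns(1) by (simp add: diff_eq_zero_iff[OF V])
  qed
  define p where "p x = (THE n. n \<in> N \<and> (\<exists>m\<in>M. x = m \<oplus>\<^bsub>V\<^esub> n))" for x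
  have p: "p (m \<oplus>\<^bsub>V\<^esub> n) = n" if "m \<in> M" "n \<in> N" for m n
    unfolding p_def using that uniq by (intro the_equality) blast+
  have pN: "p x \<in> N" if "x \<in> carrier V" for x using sum[OF that] p by auto
  moreover have "p x = x" if "x \<in> N" for x using p[OF Ms(2) that] Ns(1)[OF that] V by simp
  moreover have "p \<in> linear_maps K V V"
  proof (rule linear_mapsI)
    show "p x \<in> carrier V" if "x \<in> carrier V" for x using pN[OF that] Ns(1) by blast
    show "p (x \<oplus>\<^bsub>V\<^esub> y) = p x \<oplus>\<^bsub>V\<^esub> p y" if "x \<in> carrier V" "y \<in> carrier V" for x y
    proof -
      obtain m n m' n' where mn: "m \<in> M" "n \<in> N" "m' \<in> M" "n' \<in> N" "x = m \<oplus>\<^bsub>V\<^esub> n" "y = m' \<oplus>\<^bsub>V\<^esub> n'"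
        using sum \<open>x \<in> carrier V\<close> \<open>y \<in> carrier V\<close> by meson
      then have "x \<oplus>\<^bsub>V\<^esub> y = (m \<oplus>\<^bsub>V\<^esub> m') \<oplus>\<^bsub>V\<^esub> (n \<oplus>\<^bsub>V\<^esub> n')" using V Ms(1) Ns(1) by (simp add: add_swap)
      then show ?thesis using p mn Ms(3) Ns(3) by simp
    qed
    show "p (a \<odot>\<^bsub>V\<^esub> x) = a \<odot>\<^bsub>V\<^esub> p x" if a: "a \<in> carrier K" and "x \<in> carrier V" for a x
    proof -
      obtain m n where mn: "m \<in> M" "n \<in> N" "x = m \<oplus>\<^bsub>V\<^esub> n" using sum \<open>x \<in> carrier V\<close> by meson
      then have "a \<odot>\<^bsub>V\<^esub> x = (a \<odot>\<^bsub>V\<^esub> m) \<oplus>\<^bsub>V\<^esub> (a \<odot>\<^bsub>V\<^esub> n)" using V a Ms(1) Ns(1) by (simp add: smult_distribs)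
      then show ?thesis using p mn a Ms(4) Ns(4) by simp
    qed
  qed
  ultimately show thesis using that by blast
qed

text \<open>A uniform source of linear choices: for surjective \<open>d\<close> the map
  \<open>h\<close> is a section, for injective \<open>d\<close> a retraction, and always
  \<open>x \<mapsto> x - h (d x)\<close> is a projection onto the kernel of
  \<open>d\<close>.\<close>

lemma pseudo_inverse_exists:
  assumes V: "module K V" and W: "module K W" and d: "d \<in> linear_maps K V W"
  obtains h where "h \<in> linear_maps K W V" "\<And>x. x \<in> carrier V \<Longrightarrow> d (h (d x)) = d x"
proof -
  have ker: "submodule {x \<in> carrier V. d x \<in> {\<zero>\<^bsub>W\<^esub>}} K V"
    by (rule submodule_preimage[OF V W d submodule_zero[OF W]])
  obtain p where p: "p \<in> linear_maps K V V"
    and p0: "\<And>x. x \<in> carrier V \<Longrightarrow> d (p x) = \<zero>\<^bsub>W\<^esub>"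
    and p1: "\<And>x. x \<in> carrier V \<Longrightarrow> d x = \<zero>\<^bsub>W\<^esub> \<Longrightarrow> p x = x"
    by (rule projection_exists[OF V ker]) simp
  obtain q where q: "q \<in> linear_maps K W W"
    and q0: "\<And>y. y \<in> carrier W \<Longrightarrow> q y \<in> d ` carrier V" and q1: "\<And>y. y \<in> d ` carrier V \<Longrightarrow> q y = y"
    by (rule projection_exists[OF W submodule_image[OF V W d submodule_carrier[OF V]]], rule that)
  note dc = linear_closed[OF d] and pc = linear_closed[OF p]
  \<comment> \<open>A preimage minus its component in the kernel depends only on its value under
    \<open>d\<close>. This makes \<open>h\<close> linear although the choice function
    \<open>s\<close> need not be.\<close>
  have wd: "x \<ominus>\<^bsub>V\<^esub> p x = y \<ominus>\<^bsub>V\<^esub> p y" if "x \<in> carrier V" "y \<in> carrier V" "d x = d y" for x y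
  proof -
    have "d (x \<ominus>\<^bsub>V\<^esub> y) = \<zero>\<^bsub>W\<^esub>" using that V W d dc by (simp add: linear_diff)
    then have "p (x \<ominus>\<^bsub>V\<^esub> y) = x \<ominus>\<^bsub>V\<^esub> y" using that V p1 by simp
    then have e: "p x \<ominus>\<^bsub>V\<^esub> p y = x \<ominus>\<^bsub>V\<^esub> y" using that V p by (simp add: linear_diff)
    interpret module K V by fact
    have "(x \<ominus>\<^bsub>V\<^esub> p x) \<ominus>\<^bsub>V\<^esub> (y \<ominus>\<^bsub>V\<^esub> p y) = (x \<ominus>\<^bsub>V\<^esub> y) \<ominus>\<^bsub>V\<^esub> (p x \<ominus>\<^bsub>V\<^esub> p y)"
      using that pc by (simp add: M.minus_eq M.minus_add M.a_ac)
    also have "\<dots> = \<zero>\<^bsub>V\<^esub>" using that V by (simp add: e)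
    finally show ?thesis using that pc V by (simp add: diff_eq_zero_iff)
  qed
  define s where "s y = (SOME x. x \<in> carrier V \<and> d x = q y)" for y
  have s: "s y \<in> carrier V" "d (s y) = q y" if "y \<in> carrier W" for y
  proof -
    have "\<exists>x. x \<in> carrier V \<and> d x = q y" using q0[OF that] by (metis imageE)
    from someI_ex[OF this] show "s y \<in> carrier V" "d (s y) = q y" unfolding s_def by blast+
  qed
  define h where "h y = s y \<ominus>\<^bsub>V\<^esub> p (s y)" for y
  have hI: "h y = x \<ominus>\<^bsub>V\<^esub> p x" if "y \<in> carrier W" "x \<in> carrier V" "d x = q y" for x y
    unfolding h_def using that s by (intro wd) auto
  interpret V: module K V by fact
  have "h \<in> linear_maps K W V"
  proof (rule linear_mapsI)
    show "h y \<in> carrier V" if "y \<in> carrier W" for y using that s pc V by (simp add: h_def)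
    show "h (x \<oplus>\<^bsub>W\<^esub> y) = h x \<oplus>\<^bsub>V\<^esub> h y" if [simp]: "x \<in> carrier W" "y \<in> carrier W" for x y
    proof -
      have "h (x \<oplus>\<^bsub>W\<^esub> y) = (s x \<oplus>\<^bsub>V\<^esub> s y) \<ominus>\<^bsub>V\<^esub> p (s x \<oplus>\<^bsub>V\<^esub> s y)"
        using s q d V W by (intro hI) (auto simp: linear_add)
      also have "\<dots> = h x \<oplus>\<^bsub>V\<^esub> h y"
        using s pc p by (simp add: h_def linear_add V.M.minus_eq V.M.minus_add V.M.a_ac)
      finally show ?thesis .
    qed
    show "h (a \<odot>\<^bsub>W\<^esub> y) = a \<odot>\<^bsub>V\<^esub> h y" if [simp]: "a \<in> carrier K" "y \<in> carrier W" for a y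
    proof -
      have "h (a \<odot>\<^bsub>W\<^esub> y) = (a \<odot>\<^bsub>V\<^esub> s y) \<ominus>\<^bsub>V\<^esub> p (a \<odot>\<^bsub>V\<^esub> s y)"
        using s q d V W by (intro hI) (auto simp: linear_smult)
      also have "\<dots> = a \<odot>\<^bsub>V\<^esub> h y"
        using s pc p by (simp add: h_def linear_smult V.M.minus_eq V.smult_r_distr V.smult_r_minus)
      finally show ?thesis .
    qed
  qed
  moreover have "d (h (d x)) = d x" if "x \<in> carrier V" for x
  proof -
    have "d (h (d x)) = d (x \<ominus>\<^bsub>V\<^esub> p x)" using hI[of "d x" x] that dc q1 by simp
    also have "\<dots> = d x \<ominus>\<^bsub>W\<^esub> \<zero>\<^bsub>W\<^esub>" using that pc V W d p0 dc by (simp add: linear_diff)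
    also have "\<dots> = d x" using diff_add_cancel(1)[of W "d x" "\<zero>\<^bsub>W\<^esub>"] that dc W by simp
    finally show ?thesis .
  qed
  ultimately show thesis using that by blast
qed

end

section \<open>Modules by generators and relations\<close>

context vector_spaces
begin

lemma free_mod_carrier:
  "f \<in> carrier (free_mod K X) \<longleftrightarrow>
    (\<forall>x. f x \<in> carrier K) \<and> finite {x. f x \<noteq> \<zero>\<^bsub>K\<^esub>} \<and> (\<forall>x. x \<notin> X \<longrightarrow> f x = \<zero>\<^bsub>K\<^esub>)"
  by (simp add: free_mod_def)

lemma free_mod_ops [simp]:
  "\<zero>\<^bsub>free_mod K X\<^esub> = (\<lambda>x. \<zero>\<^bsub>K\<^esub>)"
  "f \<oplus>\<^bsub>free_mod K X\<^esub> g = (\<lambda>x. f x \<oplus>\<^bsub>K\<^esub> g x)"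
  "a \<odot>\<^bsub>free_mod K X\<^esub> f = (\<lambda>x. a \<otimes>\<^bsub>K\<^esub> f x)"
  by (simp_all add: free_mod_def)

lemma free_mod_closed:
  shows "f \<in> carrier (free_mod K X) \<Longrightarrow> g \<in> carrier (free_mod K X) \<Longrightarrow>
      (\<lambda>x. f x \<oplus>\<^bsub>K\<^esub> g x) \<in> carrier (free_mod K X)"
    and "f \<in> carrier (free_mod K X) \<Longrightarrow> a \<in> carrier K \<Longrightarrow>
      (\<lambda>x. a \<otimes>\<^bsub>K\<^esub> f x) \<in> carrier (free_mod K X)"
    and "(\<lambda>x. \<zero>\<^bsub>K\<^esub>) \<in> carrier (free_mod K X)"
proof -
  interpret cring K by (rule cring_K)
  show "(\<lambda>x. f x \<oplus>\<^bsub>K\<^esub> g x) \<in> carrier (free_mod K X)"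
    if "f \<in> carrier (free_mod K X)" "g \<in> carrier (free_mod K X)"
  proof -
    have "finite {x. f x \<oplus>\<^bsub>K\<^esub> g x \<noteq> \<zero>\<^bsub>K\<^esub>}"
      by (rule finite_subset[of _ "{x. f x \<noteq> \<zero>\<^bsub>K\<^esub>} \<union> {x. g x \<noteq> \<zero>\<^bsub>K\<^esub>}"])
        (use that in \<open>auto simp: free_mod_carrier\<close>)
    then show ?thesis using that by (simp add: free_mod_carrier)
  qed
  show "(\<lambda>x. a \<otimes>\<^bsub>K\<^esub> f x) \<in> carrier (free_mod K X)"
    if "f \<in> carrier (free_mod K X)" "a \<in> carrier K"
  proof -
    have "finite {x. a \<otimes>\<^bsub>K\<^esub> f x \<noteq> \<zero>\<^bsub>K\<^esub>}"
      by (rule finite_subset[of _ "{x. f x \<noteq> \<zero>\<^bsub>K\<^esub>}"]) (use that in \<open>auto simp: free_mod_carrier\<close>)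
    then show ?thesis using that by (simp add: free_mod_carrier)
  qed
qed (simp add: free_mod_carrier)

lemma module_free_mod: "module K (free_mod K X)"
proof (rule moduleI)
  interpret cring K by (rule cring_K)
  have c: "f x \<in> carrier K" if "f \<in> carrier (free_mod K X)" for f x
    using that by (simp add: free_mod_carrier)
  show "abelian_group (free_mod K X)"
  proof (rule abelian_groupI)
    fix f assume f: "f \<in> carrier (free_mod K X)"
    have "(\<lambda>x. (\<ominus>\<^bsub>K\<^esub> \<one>\<^bsub>K\<^esub>) \<otimes>\<^bsub>K\<^esub> f x) \<in> carrier (free_mod K X)"
      using f by (intro free_mod_closed) auto
    moreover have "(\<ominus>\<^bsub>K\<^esub> \<one>\<^bsub>K\<^esub>) \<otimes>\<^bsub>K\<^esub> f x \<oplus>\<^bsub>K\<^esub> f x = \<zero>\<^bsub>K\<^esub>" for x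
      using c[OF f, of x] by (simp add: l_minus l_neg)
    ultimately show "\<exists>y\<in>carrier (free_mod K X). y \<oplus>\<^bsub>free_mod K X\<^esub> f = \<zero>\<^bsub>free_mod K X\<^esub>"
      by (intro bexI[of _ "\<lambda>x. (\<ominus>\<^bsub>K\<^esub> \<one>\<^bsub>K\<^esub>) \<otimes>\<^bsub>K\<^esub> f x"]) auto
  qed (auto intro!: free_mod_closed ext simp: c a_ac)
  show "a \<odot>\<^bsub>free_mod K X\<^esub> f \<in> carrier (free_mod K X)"
    if "a \<in> carrier K" "f \<in> carrier (free_mod K X)" for a f
    using that by (simp add: free_mod_closed)
qed (auto intro!: ext simp: cring_K free_mod_carrier cring.cring_simprules[OF cring_K]
    monoid.r_one[OF ring.is_monoid[OF ring_K]])

lemma free_gen_closed [simp]: "x \<in> X \<Longrightarrow> free_gen K x \<in> carrier (free_mod K X)"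
  by (auto simp: free_mod_carrier free_gen_def)

definition lincomb :: "('k, 'v, 'm) module_scheme \<Rightarrow> ('x \<Rightarrow> 'v) \<Rightarrow> ('x \<Rightarrow> 'k) \<Rightarrow> 'v" where
  "lincomb M \<beta> f = (\<Oplus>\<^bsub>M\<^esub>x\<in>{x. f x \<noteq> \<zero>\<^bsub>K\<^esub>}. f x \<odot>\<^bsub>M\<^esub> \<beta> x)"

lemma lincomb_eq:
  assumes M: "module K M" and f: "f \<in> carrier (free_mod K X)" and \<beta>: "\<And>x. x \<in> X \<Longrightarrow> \<beta> x \<in> carrier M"
    and A: "finite A" "A \<subseteq> X" "{x. f x \<noteq> \<zero>\<^bsub>K\<^esub>} \<subseteq> A"
  shows "lincomb M \<beta> f = (\<Oplus>\<^bsub>M\<^esub>x\<in>A. f x \<odot>\<^bsub>M\<^esub> \<beta> x)"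
proof -
  interpret M: module K M by fact
  show ?thesis unfolding lincomb_def
    by (rule M.add.finprod_mono_neutral_cong_left) (use A f \<beta> in \<open>auto simp: free_mod_carrier\<close>)
qed

lemma finsum_smult:
  assumes M: "module K M" and "a \<in> carrier K" "\<And>x. x \<in> A \<Longrightarrow> \<beta> x \<in> carrier M"
  shows "a \<odot>\<^bsub>M\<^esub> (\<Oplus>\<^bsub>M\<^esub>x\<in>A. \<beta> x) = (\<Oplus>\<^bsub>M\<^esub>x\<in>A. a \<odot>\<^bsub>M\<^esub> \<beta> x)"
proof -
  interpret module K M by fact
  show ?thesis
  proof (cases "finite A")
    case True then show ?thesis using assms by (intro finsum_smult_ldistr) auto
  next
    case False then show ?thesis using assms by (simp add: M.finsum_infinite)
  qed
qed

lemma lincomb_linear: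
  assumes M: "module K M" and \<beta>: "\<And>x. x \<in> X \<Longrightarrow> \<beta> x \<in> carrier M"
  shows "lincomb M \<beta> \<in> linear_maps K (free_mod K X) M"
proof (rule linear_mapsI)
  interpret M: module K M by fact
  note F = smult_simps[OF module_free_mod[of X], unfolded free_mod_ops]
  have supp: "finite {x. f x \<noteq> \<zero>\<^bsub>K\<^esub>}" "{x. f x \<noteq> \<zero>\<^bsub>K\<^esub>} \<subseteq> X" "f x \<in> carrier K"
    if "f \<in> carrier (free_mod K X)" for f x using that by (auto simp: free_mod_carrier)
  show "lincomb M \<beta> f \<in> carrier M" if "f \<in> carrier (free_mod K X)" for f
    unfolding lincomb_def using supp[OF that] \<beta> M by (intro M.finsum_closed) auto
  show "lincomb M \<beta> (f \<oplus>\<^bsub>free_mod K X\<^esub> g) = lincomb M \<beta> f \<oplus>\<^bsub>M\<^esub> lincomb M \<beta> g"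
    if f: "f \<in> carrier (free_mod K X)" and g: "g \<in> carrier (free_mod K X)" for f g
  proof -
    let ?A = "{x. f x \<noteq> \<zero>\<^bsub>K\<^esub>} \<union> {x. g x \<noteq> \<zero>\<^bsub>K\<^esub>}"
    have A: "finite ?A" "?A \<subseteq> X" using supp[OF f] supp[OF g] by auto
    have fg: "(\<lambda>x. f x \<oplus>\<^bsub>K\<^esub> g x) \<in> carrier (free_mod K X)" using f g by (intro F)
    have "lincomb M \<beta> (\<lambda>x. f x \<oplus>\<^bsub>K\<^esub> g x) = (\<Oplus>\<^bsub>M\<^esub>x\<in>?A. (f x \<oplus>\<^bsub>K\<^esub> g x) \<odot>\<^bsub>M\<^esub> \<beta> x)"
      by (rule lincomb_eq[OF M fg]) (use A \<beta> ring.ring_simprules[OF ring_K] in auto)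
    also have "\<dots> = (\<Oplus>\<^bsub>M\<^esub>x\<in>?A. f x \<odot>\<^bsub>M\<^esub> \<beta> x \<oplus>\<^bsub>M\<^esub> g x \<odot>\<^bsub>M\<^esub> \<beta> x)"
      using A \<beta> supp(3)[OF f] supp(3)[OF g] M
      by (intro M.finsum_cong') (auto simp: smult_distribs)
    also have "\<dots> = (\<Oplus>\<^bsub>M\<^esub>x\<in>?A. f x \<odot>\<^bsub>M\<^esub> \<beta> x) \<oplus>\<^bsub>M\<^esub> (\<Oplus>\<^bsub>M\<^esub>x\<in>?A. g x \<odot>\<^bsub>M\<^esub> \<beta> x)"
      using A \<beta> supp(3)[OF f] supp(3)[OF g] M by (intro M.finsum_addf) auto
    also have "\<dots> = lincomb M \<beta> f \<oplus>\<^bsub>M\<^esub> lincomb M \<beta> g"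
      using lincomb_eq[OF M f \<beta> A] lincomb_eq[OF M g \<beta> A] by simp
    finally show ?thesis by simp
  qed
  show "lincomb M \<beta> (a \<odot>\<^bsub>free_mod K X\<^esub> f) = a \<odot>\<^bsub>M\<^esub> lincomb M \<beta> f"
    if a: "a \<in> carrier K" and f: "f \<in> carrier (free_mod K X)" for a f
  proof -
    let ?A = "{x. f x \<noteq> \<zero>\<^bsub>K\<^esub>}"
    have af: "(\<lambda>x. a \<otimes>\<^bsub>K\<^esub> f x) \<in> carrier (free_mod K X)" using f a by (intro F)
    have "lincomb M \<beta> (\<lambda>x. a \<otimes>\<^bsub>K\<^esub> f x) = (\<Oplus>\<^bsub>M\<^esub>x\<in>?A. (a \<otimes>\<^bsub>K\<^esub> f x) \<odot>\<^bsub>M\<^esub> \<beta> x)"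
      by (rule lincomb_eq[OF M af]) (use supp[OF f] a \<beta> cring.cring_simprules[OF cring_K] in auto)
    also have "\<dots> = (\<Oplus>\<^bsub>M\<^esub>x\<in>?A. a \<odot>\<^bsub>M\<^esub> (f x \<odot>\<^bsub>M\<^esub> \<beta> x))"
      using supp[OF f] a \<beta> M by (intro M.finsum_cong') (auto simp: smult_distribs(3))
    also have "\<dots> = a \<odot>\<^bsub>M\<^esub> lincomb M \<beta> f"
      unfolding lincomb_def using supp[OF f] a \<beta> M by (intro finsum_smult[symmetric]) auto
    finally show ?thesis by simp
  qed
qed

lemma lincomb_free_gen:
  assumes M: "module K M" and \<beta>: "\<beta> x \<in> carrier M"
  shows "lincomb M \<beta> (free_gen K x) = \<beta> x"
proof -
  interpret M: module K M by fact
  interpret K: field K by (rule field_K)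
  have "lincomb M \<beta> (free_gen K x) = (\<Oplus>\<^bsub>M\<^esub>y\<in>{x}. free_gen K x y \<odot>\<^bsub>M\<^esub> \<beta> y)"
    by (rule lincomb_eq[OF M, of _ "{x}"]) (use \<beta> in \<open>auto simp: free_gen_def free_mod_carrier\<close>)
  also have "\<dots> = \<beta> x" using \<beta> M by (simp add: free_gen_def)
  finally show ?thesis .
qed

text \<open>Induction on a finite set containing the support: deleting the value at one point splits
  off a multiple of a generator and shrinks the support.\<close>

lemma free_mod_linear_eq:
  assumes M: "module K M" and g: "g \<in> linear_maps K (free_mod K X) M" and "h \<in> linear_maps K (free_mod K X) M"
    and eq: "\<And>x. x \<in> X \<Longrightarrow> g (free_gen K x) = h (free_gen K x)"
    and f: "f \<in> carrier (free_mod K X)"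
  shows "g f = h f"
proof -
  interpret cring K by (rule cring_K)
  have "g f = h f" if "finite A" "f \<in> carrier (free_mod K X)" "{x. f x \<noteq> \<zero>\<^bsub>K\<^esub>} \<subseteq> A" for A f
    using that
  proof (induction A arbitrary: f rule: finite_induct)
    case empty
    then have "f = \<zero>\<^bsub>free_mod K X\<^esub>" by auto
    then show ?case using linear_zero[OF g module_free_mod M] linear_zero[OF assms(3) module_free_mod M]
      by simp
  next
    case (insert a A)
    show ?case
    proof (cases "f a = \<zero>\<^bsub>K\<^esub>")
      case True
      then have "{x. f x \<noteq> \<zero>\<^bsub>K\<^esub>} \<subseteq> A" using insert.prems by auto
      then show ?thesis using insert by blast
    next
      case False
      then have aX: "a \<in> X" using insert.prems by (auto simp: free_mod_carrier)
      define f' where "f' = f(a := \<zero>\<^bsub>K\<^esub>)"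
      have c: "f x \<in> carrier K" for x using insert.prems by (simp add: free_mod_carrier)
      have "finite {x. f' x \<noteq> \<zero>\<^bsub>K\<^esub>}"
        by (rule finite_subset[of _ "{x. f x \<noteq> \<zero>\<^bsub>K\<^esub>}"])
          (use insert.prems in \<open>auto simp: f'_def free_mod_carrier\<close>)
      then have f': "f' \<in> carrier (free_mod K X)"
        using insert.prems by (auto simp: free_mod_carrier f'_def)
      have supp: "{x. f' x \<noteq> \<zero>\<^bsub>K\<^esub>} \<subseteq> A" using insert.prems by (auto simp: f'_def)
      have dec: "f = f' \<oplus>\<^bsub>free_mod K X\<^esub> (f a \<odot>\<^bsub>free_mod K X\<^esub> free_gen K a)"
        using c by (auto simp: f'_def free_gen_def)
      have step: "k f = k f' \<oplus>\<^bsub>M\<^esub> f a \<odot>\<^bsub>M\<^esub> k (free_gen K a)" if k: "k \<in> linear_maps K (free_mod K X) M" for k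
        using f' c aX smult_simps[OF module_free_mod[of X]]
        by (subst dec, subst linear_add[OF k]) (simp_all add: linear_smult[OF k] del: free_mod_ops)
      show ?thesis unfolding step[OF g] step[OF assms(3)] insert.IH[OF f' supp] eq[OF aX] ..
    qed
  qed
  then show ?thesis using f by (auto simp: free_mod_carrier)
qed

lemma mod_span_submodule:
  assumes M: "module K M" and S: "S \<subseteq> carrier M"
  shows "submodule (mod_span K M S) K M"
proof (rule submoduleI'[OF M])
  have s: "x \<in> mod_span K M S \<longleftrightarrow> (\<forall>N. submodule N K M \<longrightarrow> S \<subseteq> N \<longrightarrow> x \<in> N)" for x
    by (auto simp: mod_span_def)
  show "mod_span K M S \<subseteq> carrier M" using S submodule_carrier[OF M] by (auto simp: s)
qed (auto simp: mod_span_def dest: submodule_simps[OF _ M])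

lemma mod_span_vanish:
  assumes M: "module K M" and W: "module K W" and g: "g \<in> linear_maps K M W"
    and "S \<subseteq> carrier M" "\<And>s. s \<in> S \<Longrightarrow> g s = \<zero>\<^bsub>W\<^esub>" and x: "x \<in> mod_span K M S"
  shows "g x = \<zero>\<^bsub>W\<^esub>"
proof -
  have "x \<in> {x \<in> carrier M. g x \<in> {\<zero>\<^bsub>W\<^esub>}}"
    using x submodule_preimage[OF M W g submodule_zero[OF W]] assms(4,5)
    by (auto simp: mod_span_def)
  then show ?thesis by simp
qed

text \<open>The module axioms pass along a surjection that respects the operations, so that none of
  them has to be verified on cosets.\<close>

lemma module_surj:
  assumes V: "module K V"
    and surj: "\<And>X. X \<in> carrier Q \<Longrightarrow> \<exists>x\<in>carrier V. X = g x"
    and closed: "\<And>x. x \<in> carrier V \<Longrightarrow> g x \<in> carrier Q"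
    and zero: "\<zero>\<^bsub>Q\<^esub> = g \<zero>\<^bsub>V\<^esub>"
    and add: "\<And>x y. x \<in> carrier V \<Longrightarrow> y \<in> carrier V \<Longrightarrow> g x \<oplus>\<^bsub>Q\<^esub> g y = g (x \<oplus>\<^bsub>V\<^esub> y)"
    and smult: "\<And>a x. a \<in> carrier K \<Longrightarrow> x \<in> carrier V \<Longrightarrow> a \<odot>\<^bsub>Q\<^esub> g x = g (a \<odot>\<^bsub>V\<^esub> x)"
  shows "module K Q"
proof (rule moduleI)
  show "abelian_group Q"
  proof (rule abelian_groupI)
    show "\<exists>Y\<in>carrier Q. Y \<oplus>\<^bsub>Q\<^esub> X = \<zero>\<^bsub>Q\<^esub>" if "X \<in> carrier Q" for X
    proof -
      obtain x where "x \<in> carrier V" "X = g x" using surj[OF \<open>X \<in> carrier Q\<close>] by blast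
      then show ?thesis using closed add zero V by (intro bexI[of _ "g (\<ominus>\<^bsub>V\<^esub> x)"]) auto
    qed
  qed (auto dest!: surj simp: closed zero add V, auto simp: add_ac[OF V])
qed (auto dest!: surj simp: cring_K closed add smult V smult_distribs)

section \<open>Quotients by a submodule\<close>

context
  fixes V :: "('k, 'v, 'm) module_scheme" and N
  assumes V: "module K V" and N: "submodule N K V"
begin

interpretation V: module K V by (rule V)
interpretation N: abelian_subgroup N V
  by (intro abelian_subgroupI3 additive_subgroupI submodule.axioms[OF N]) unfold_locales

lemma quot_ops:
  "\<zero>\<^bsub>quot_mod V N\<^esub> = N +>\<^bsub>V\<^esub> \<zero>\<^bsub>V\<^esub>"
  "X \<in> carrier (quot_mod V N) \<longleftrightarrow> (\<exists>x\<in>carrier V. X = N +>\<^bsub>V\<^esub> x)"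
  "x \<in> carrier V \<Longrightarrow> y \<in> carrier V \<Longrightarrow>
    (N +>\<^bsub>V\<^esub> x) \<oplus>\<^bsub>quot_mod V N\<^esub> (N +>\<^bsub>V\<^esub> y) = N +>\<^bsub>V\<^esub> (x \<oplus>\<^bsub>V\<^esub> y)"
  "a \<in> carrier K \<Longrightarrow> x \<in> carrier V \<Longrightarrow> a \<odot>\<^bsub>quot_mod V N\<^esub> (N +>\<^bsub>V\<^esub> x) = N +>\<^bsub>V\<^esub> (a \<odot>\<^bsub>V\<^esub> x)"
proof -
  show "\<zero>\<^bsub>quot_mod V N\<^esub> = N +>\<^bsub>V\<^esub> \<zero>\<^bsub>V\<^esub>" by (simp add: quot_mod_def N.a_rcos_const)
  show "X \<in> carrier (quot_mod V N) \<longleftrightarrow> (\<exists>x\<in>carrier V. X = N +>\<^bsub>V\<^esub> x)"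
    by (auto simp: quot_mod_def A_RCOSETS_def')
  show "x \<in> carrier V \<Longrightarrow> y \<in> carrier V \<Longrightarrow>
    (N +>\<^bsub>V\<^esub> x) \<oplus>\<^bsub>quot_mod V N\<^esub> (N +>\<^bsub>V\<^esub> y) = N +>\<^bsub>V\<^esub> (x \<oplus>\<^bsub>V\<^esub> y)"
    by (simp add: quot_mod_def N.a_rcos_sum)
  show "a \<odot>\<^bsub>quot_mod V N\<^esub> (N +>\<^bsub>V\<^esub> x) = N +>\<^bsub>V\<^esub> (a \<odot>\<^bsub>V\<^esub> x)" if a: "a \<in> carrier K" and x: "x \<in> carrier V"
  proof -
    \<comment> \<open>The scalar multiple of a coset is defined as a union over its elements; all
      the cosets in this union coincide.\<close>
    have e: "N +>\<^bsub>V\<^esub> (a \<odot>\<^bsub>V\<^esub> y) = N +>\<^bsub>V\<^esub> (a \<odot>\<^bsub>V\<^esub> x)" if y: "y \<in> N +>\<^bsub>V\<^esub> x" for y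
    proof -
      have yV: "y \<in> carrier V" using x y by (rule N.a_elemrcos_carrier)
      have "a \<odot>\<^bsub>V\<^esub> (y \<oplus>\<^bsub>V\<^esub> \<ominus>\<^bsub>V\<^esub> x) \<in> N"
        using N V a N.a_rcos_module_imp[OF x y] by (rule submodule_simps)
      then have "a \<odot>\<^bsub>V\<^esub> y \<oplus>\<^bsub>V\<^esub> \<ominus>\<^bsub>V\<^esub> (a \<odot>\<^bsub>V\<^esub> x) \<in> N"
        unfolding V.smult_r_distr[OF a yV V.M.a_inv_closed[OF x]] V.smult_r_minus[OF a x] .
      then have "a \<odot>\<^bsub>V\<^esub> y \<in> N +>\<^bsub>V\<^esub> (a \<odot>\<^bsub>V\<^esub> x)" using a x yV by (intro N.a_rcos_module_rev) auto
      then show ?thesis using N.a_repr_independence'[of "a \<odot>\<^bsub>V\<^esub> y" "a \<odot>\<^bsub>V\<^esub> x"] a x by simp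
    qed
    have "N +>\<^bsub>V\<^esub> x \<noteq> {}" using N.a_rcos_self[OF x] by blast
    then have "(\<Union>y\<in>N +>\<^bsub>V\<^esub> x. N +>\<^bsub>V\<^esub> (a \<odot>\<^bsub>V\<^esub> y)) = N +>\<^bsub>V\<^esub> (a \<odot>\<^bsub>V\<^esub> x)"
      using e by (rule SUP_eq_const)
    then show ?thesis by (simp add: quot_mod_def)
  qed
qed

lemma module_quot_mod: "module K (quot_mod V N)"
  by (rule module_surj[OF V, where g = "\<lambda>x. N +>\<^bsub>V\<^esub> x"]) (auto simp: quot_ops)

lemma quot_proj_linear: "(\<lambda>x. N +>\<^bsub>V\<^esub> x) \<in> linear_maps K V (quot_mod V N)"
  by (rule linear_mapsI) (auto simp: quot_ops)

text \<open>Controls the representative at which \<open>pres_lift\<close> evaluates.\<close>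

lemma some_in_coset:
  assumes "x \<in> carrier V"
  shows "(SOME y. y \<in> N +>\<^bsub>V\<^esub> x) \<in> carrier V"
    and "(SOME y. y \<in> N +>\<^bsub>V\<^esub> x) \<ominus>\<^bsub>V\<^esub> x \<in> N"
proof -
  have s: "(SOME y. y \<in> N +>\<^bsub>V\<^esub> x) \<in> N +>\<^bsub>V\<^esub> x" using N.a_rcos_self[OF assms] by (rule someI)
  then show "(SOME y. y \<in> N +>\<^bsub>V\<^esub> x) \<in> carrier V" "(SOME y. y \<in> N +>\<^bsub>V\<^esub> x) \<ominus>\<^bsub>V\<^esub> x \<in> N"
    using N.a_elemrcos_carrier[OF assms s] N.a_rcos_module_imp[OF assms s] by (simp_all add: V.M.minus_eq)
qed

end

lemma pres_lift_eq: "pres_lift K M \<beta> t = lincomb M \<beta> (SOME f. f \<in> t)"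
  by (simp add: pres_lift_def lincomb_def Let_def)

context
  fixes X :: "'x set" and R
  assumes R: "R \<subseteq> carrier (free_mod K X)"
begin

interpretation F: module K "free_mod K X" by (rule module_free_mod)

lemma span_R: "submodule (mod_span K (free_mod K X) R) K (free_mod K X)"
  using module_free_mod R by (rule mod_span_submodule)

lemma module_pres_mod: "module K (pres_mod K X R)"
  unfolding pres_mod_def using module_free_mod span_R by (rule module_quot_mod)

lemma pres_carrier:
  "t \<in> carrier (pres_mod K X R) \<longleftrightarrow>
    (\<exists>f\<in>carrier (free_mod K X). t = mod_span K (free_mod K X) R +>\<^bsub>free_mod K X\<^esub> f)"
  unfolding pres_mod_def by (rule quot_ops[OF module_free_mod span_R])

lemma pres_some: "t \<in> carrier (pres_mod K X R) \<Longrightarrow> (SOME f. f \<in> t) \<in> carrier (free_mod K X)"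
  using some_in_coset(1)[OF module_free_mod span_R] by (auto simp: pres_carrier)

context
  fixes M :: "('k, 'v, 'm) module_scheme" and \<beta>
  assumes M: "module K M" and \<beta>: "\<And>x. x \<in> X \<Longrightarrow> \<beta> x \<in> carrier M"
begin

lemma pres_lift_closed: "t \<in> carrier (pres_mod K X R) \<Longrightarrow> pres_lift K M \<beta> t \<in> carrier M"
  unfolding pres_lift_eq by (rule linear_closed[OF lincomb_linear[OF M \<beta>] pres_some])

text \<open>The chosen representative differs from \<open>f\<close> by an element of the span of
  \<open>R\<close>, on which the linear extension of \<open>\<beta>\<close> vanishes.\<close>

lemma pres_lift_class:
  assumes "\<And>r. r \<in> R \<Longrightarrow> lincomb M \<beta> r = \<zero>\<^bsub>M\<^esub>" and f: "f \<in> carrier (free_mod K X)"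
  shows "pres_lift K M \<beta> (mod_span K (free_mod K X) R +>\<^bsub>free_mod K X\<^esub> f) = lincomb M \<beta> f"
proof -
  let ?g = "SOME g. g \<in> mod_span K (free_mod K X) R +>\<^bsub>free_mod K X\<^esub> f"
  note g = some_in_coset[OF module_free_mod span_R f]
  have lin: "lincomb M \<beta> \<in> linear_maps K (free_mod K X) M" using M \<beta> by (rule lincomb_linear)
  have "lincomb M \<beta> (?g \<ominus>\<^bsub>free_mod K X\<^esub> f) = \<zero>\<^bsub>M\<^esub>"
    by (rule mod_span_vanish[OF module_free_mod M lin R]) (use assms g in auto)
  then have "lincomb M \<beta> ?g \<ominus>\<^bsub>M\<^esub> lincomb M \<beta> f = \<zero>\<^bsub>M\<^esub>"
    using linear_diff[OF lin module_free_mod M g(1) f] by simp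
  then show ?thesis using linear_closed[OF lin] g(1) f by (simp add: pres_lift_eq diff_eq_zero_iff[OF M])
qed

lemma pres_lift_linear:
  assumes "\<And>r. r \<in> R \<Longrightarrow> lincomb M \<beta> r = \<zero>\<^bsub>M\<^esub>"
  shows "pres_lift K M \<beta> \<in> linear_maps K (pres_mod K X R) M"
proof (rule linear_mapsI)
  have lin: "lincomb M \<beta> \<in> linear_maps K (free_mod K X) M" using M \<beta> by (rule lincomb_linear)
  note q = quot_ops[OF module_free_mod span_R, folded pres_mod_def]
  note cl = pres_lift_class[OF assms]
  show "pres_lift K M \<beta> t \<in> carrier M" if "t \<in> carrier (pres_mod K X R)" for t
    using that by (rule pres_lift_closed)
  show "pres_lift K M \<beta> (t \<oplus>\<^bsub>pres_mod K X R\<^esub> u) = pres_lift K M \<beta> t \<oplus>\<^bsub>M\<^esub> pres_lift K M \<beta> u"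
    if "t \<in> carrier (pres_mod K X R)" "u \<in> carrier (pres_mod K X R)" for t u
    using that linear_add[OF lin] smult_simps(6)[OF module_free_mod[of X]]
    by (auto simp: q cl simp del: free_mod_ops)
  show "pres_lift K M \<beta> (a \<odot>\<^bsub>pres_mod K X R\<^esub> t) = a \<odot>\<^bsub>M\<^esub> pres_lift K M \<beta> t"
    if "a \<in> carrier K" "t \<in> carrier (pres_mod K X R)" for a t
    using that linear_smult[OF lin] smult_simps(1)[OF module_free_mod[of X]]
    by (auto simp: q cl simp del: free_mod_ops)
qed

lemma pres_lift_gen:
  assumes "\<And>r. r \<in> R \<Longrightarrow> lincomb M \<beta> r = \<zero>\<^bsub>M\<^esub>" and x: "x \<in> X"
  shows "pres_lift K M \<beta> (pres_gen K X R x) = \<beta> x"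
  unfolding pres_gen_def using x
  by (subst pres_lift_class) (auto intro!: assms lincomb_free_gen M \<beta> free_gen_closed)

end

lemma pres_lift_cong:
  assumes "t \<in> carrier (pres_mod K X R)" "\<And>x. x \<in> X \<Longrightarrow> \<beta> x = \<gamma> x" "module K M"
    "\<And>x. x \<in> X \<Longrightarrow> \<gamma> x \<in> carrier M"
  shows "pres_lift K M \<beta> t = pres_lift K M \<gamma> t"
proof -
  interpret M: module K M by fact
  let ?f = "SOME f. f \<in> t"
  have "?f x \<in> carrier K" "?f x \<noteq> \<zero>\<^bsub>K\<^esub> \<Longrightarrow> x \<in> X" for x
    using pres_some[OF assms(1)] by (auto simp: free_mod_carrier)
  then show ?thesis unfolding pres_lift_eq lincomb_def
    by (intro M.finsum_cong') (auto simp: assms(2-4))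
qed

text \<open>Both sides are evaluated at the same representative of \<open>t\<close>, so this is
  linearity of \<open>g\<close> on the free module, whatever values \<open>\<beta>\<close> takes on
  the generators.\<close>

lemma pres_lift_push:
  assumes t: "t \<in> carrier (pres_mod K X R)" and M: "module K M" and W: "module K W"
    and g: "g \<in> linear_maps K M W" and \<beta>: "\<And>x. x \<in> X \<Longrightarrow> \<beta> x \<in> carrier M"
  shows "g (pres_lift K M \<beta> t) = pres_lift K W (\<lambda>x. g (\<beta> x)) t"
proof -
  have gb: "x \<in> X \<Longrightarrow> g (\<beta> x) \<in> carrier W" for x using \<beta> linear_closed[OF g] by blast
  show ?thesis unfolding pres_lift_eq
  proof (rule free_mod_linear_eq[OF W _ _ _ pres_some[OF t]])
    show "(\<lambda>f. g (lincomb M \<beta> f)) \<in> linear_maps K (free_mod K X) W"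
      by (intro linear_comp[OF g] lincomb_linear M \<beta>)
    show "lincomb W (\<lambda>x. g (\<beta> x)) \<in> linear_maps K (free_mod K X) W"
      by (intro lincomb_linear W gb)
    show "g (lincomb M \<beta> (free_gen K x)) = lincomb W (\<lambda>x. g (\<beta> x)) (free_gen K x)" if "x \<in> X" for x
      using that \<beta> gb by (simp add: lincomb_free_gen M W)
  qed
qed

lemma pres_linear_eq:
  assumes W: "module K W" and g: "g \<in> linear_maps K (pres_mod K X R) W"
    and h: "h \<in> linear_maps K (pres_mod K X R) W"
    and eq: "\<And>x. x \<in> X \<Longrightarrow> g (pres_gen K X R x) = h (pres_gen K X R x)"
    and t: "t \<in> carrier (pres_mod K X R)"
  shows "g t = h t"
proof -
  let ?q = "\<lambda>f. mod_span K (free_mod K X) R +>\<^bsub>free_mod K X\<^esub> f"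
  have q: "?q \<in> linear_maps K (free_mod K X) (pres_mod K X R)"
    unfolding pres_mod_def using module_free_mod span_R by (rule quot_proj_linear)
  have "g (?q f) = h (?q f)" if "f \<in> carrier (free_mod K X)" for f
    by (rule free_mod_linear_eq[OF W linear_comp[OF g q] linear_comp[OF h q] _ that])
      (use eq in \<open>simp add: pres_gen_def\<close>)
  then show ?thesis using t by (auto simp: pres_carrier)
qed

end

end

section \<open>Tensor products\<close>

text \<open>
  Linearity and typing are derived syntax-directedly, by \<open>(assumption | rule mlin)+\<close>: \<open>mlin\<close> contains rules for
  membership in carriers and in \<open>linear_maps\<close>, the latter for functions of the form \<open>\<lambda>u. \<dots>\<close>.
\<close>

named_theorems mlin

context vector_spaces
begin

definition bilin ::
  "('k, 'v, 'l) module_scheme \<Rightarrow> ('k, 'w, 'm) module_scheme \<Rightarrow> ('k, 'x, 'n) module_scheme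
    \<Rightarrow> ('v \<Rightarrow> 'w \<Rightarrow> 'x) \<Rightarrow> bool" where
  "bilin V W M \<beta> \<longleftrightarrow>
    (\<forall>v\<in>carrier V. (\<lambda>w. \<beta> v w) \<in> linear_maps K W M) \<and> (\<forall>w\<in>carrier W. (\<lambda>v. \<beta> v w) \<in> linear_maps K V M)"

definition trilin ::
  "('k, 'u, 'j) module_scheme \<Rightarrow> ('k, 'v, 'l) module_scheme \<Rightarrow> ('k, 'w, 'm) module_scheme
    \<Rightarrow> ('k, 'x, 'n) module_scheme \<Rightarrow> ('u \<Rightarrow> 'v \<Rightarrow> 'w \<Rightarrow> 'x) \<Rightarrow> bool" where
  "trilin U V W M \<beta> \<longleftrightarrow>
    (\<forall>u\<in>carrier U. bilin V W M (\<beta> u)) \<and>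
    (\<forall>v\<in>carrier V. \<forall>w\<in>carrier W. (\<lambda>u. \<beta> u v w) \<in> linear_maps K U M)"

text \<open>Takes the place of Sweedler notation: \<open>tlift M \<beta> (\<Delta> c)\<close> reads
  as \<open>\<beta>(c_1, c_2)\<close>, and nested lifts as iterated coproducts and coactions. An
  identity in an iterated tensor product becomes an equality of lifts of an arbitrary multilinear
  map.\<close>

abbreviation tlift ::
  "('k, 'x, 'n) module_scheme \<Rightarrow> ('v \<Rightarrow> 'w \<Rightarrow> 'x) \<Rightarrow> ('v \<times> 'w \<Rightarrow> 'k) set \<Rightarrow> 'x" where
  "tlift M \<beta> \<equiv> pres_lift K M (case_prod \<beta>)"

lemma bilinI [mlin]:
  "(\<And>v. v \<in> carrier V \<Longrightarrow> (\<lambda>w. \<beta> v w) \<in> linear_maps K W M) \<Longrightarrow>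
    (\<And>w. w \<in> carrier W \<Longrightarrow> (\<lambda>v. \<beta> v w) \<in> linear_maps K V M) \<Longrightarrow> bilin V W M \<beta>"
  by (simp add: bilin_def)

lemma trilinI [mlin]:
  "(\<And>u v. u \<in> carrier U \<Longrightarrow> v \<in> carrier V \<Longrightarrow> (\<lambda>w. \<beta> u v w) \<in> linear_maps K W M) \<Longrightarrow>
    (\<And>u w. u \<in> carrier U \<Longrightarrow> w \<in> carrier W \<Longrightarrow> (\<lambda>v. \<beta> u v w) \<in> linear_maps K V M) \<Longrightarrow>
    (\<And>v w. v \<in> carrier V \<Longrightarrow> w \<in> carrier W \<Longrightarrow> (\<lambda>u. \<beta> u v w) \<in> linear_maps K U M) \<Longrightarrow>
    trilin U V W M \<beta>"
  by (simp add: trilin_def bilin_def)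

lemma bilinD:
  assumes "bilin V W M \<beta>"
  shows "v \<in> carrier V \<Longrightarrow> \<beta> v \<in> linear_maps K W M"
    and "w \<in> carrier W \<Longrightarrow> (\<lambda>v. \<beta> v w) \<in> linear_maps K V M"
    and "v \<in> carrier V \<Longrightarrow> w \<in> carrier W \<Longrightarrow> \<beta> v w \<in> carrier M"
  using assms by (auto simp: bilin_def dest: linear_closed)

lemma trilinD:
  assumes "trilin U V W M \<beta>"
  shows "u \<in> carrier U \<Longrightarrow> bilin V W M (\<beta> u)"
    and "v \<in> carrier V \<Longrightarrow> w \<in> carrier W \<Longrightarrow> (\<lambda>u. \<beta> u v w) \<in> linear_maps K U M"
    and "u \<in> carrier U \<Longrightarrow> w \<in> carrier W \<Longrightarrow> (\<lambda>v. \<beta> u v w) \<in> linear_maps K V M"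
    and "u \<in> carrier U \<Longrightarrow> v \<in> carrier V \<Longrightarrow> \<beta> u v \<in> linear_maps K W M"
    and "u \<in> carrier U \<Longrightarrow> v \<in> carrier V \<Longrightarrow> w \<in> carrier W \<Longrightarrow> \<beta> u v w \<in> carrier M"
  using assms by (auto simp: trilin_def bilin_def dest: linear_closed)

lemma tensor_rels_closed:
  assumes "module K V" "module K W"
  shows "tensor_rels K V W \<subseteq> carrier (free_mod K (carrier V \<times> carrier W))"
  using assms smult_simps[OF module_free_mod[of "carrier V \<times> carrier W"]]
  by (auto simp: tensor_rels_def Let_def simp del: free_mod_ops)

lemma tensor_relsI:
  fixes V :: "('k, 'v, 'l) module_scheme" and W :: "('k, 'w, 'm) module_scheme"
  defines "F \<equiv> free_mod K (carrier V \<times> carrier W)"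
  shows "v \<in> carrier V \<Longrightarrow> v' \<in> carrier V \<Longrightarrow> w \<in> carrier W \<Longrightarrow>
      free_gen K (v \<oplus>\<^bsub>V\<^esub> v', w) \<ominus>\<^bsub>F\<^esub> (free_gen K (v, w) \<oplus>\<^bsub>F\<^esub> free_gen K (v', w)) \<in> tensor_rels K V W"
    and "v \<in> carrier V \<Longrightarrow> w \<in> carrier W \<Longrightarrow> w' \<in> carrier W \<Longrightarrow>
      free_gen K (v, w \<oplus>\<^bsub>W\<^esub> w') \<ominus>\<^bsub>F\<^esub> (free_gen K (v, w) \<oplus>\<^bsub>F\<^esub> free_gen K (v, w')) \<in> tensor_rels K V W"
    and "a \<in> carrier K \<Longrightarrow> v \<in> carrier V \<Longrightarrow> w \<in> carrier W \<Longrightarrow>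
      free_gen K (a \<odot>\<^bsub>V\<^esub> v, w) \<ominus>\<^bsub>F\<^esub> a \<odot>\<^bsub>F\<^esub> free_gen K (v, w) \<in> tensor_rels K V W"
    and "a \<in> carrier K \<Longrightarrow> v \<in> carrier V \<Longrightarrow> w \<in> carrier W \<Longrightarrow>
      free_gen K (v, a \<odot>\<^bsub>W\<^esub> w) \<ominus>\<^bsub>F\<^esub> a \<odot>\<^bsub>F\<^esub> free_gen K (v, w) \<in> tensor_rels K V W"
  unfolding tensor_rels_def Let_def F_def by blast+

lemma lincomb_tensor_rels:
  assumes V: "module K V" and W: "module K W" and M: "module K M" and \<beta>: "bilin V W M \<beta>"
    and r: "r \<in> tensor_rels K V W"
  shows "lincomb M (case_prod \<beta>) r = \<zero>\<^bsub>M\<^esub>"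
proof -
  let ?X = "carrier V \<times> carrier W"
  have c: "\<And>x. x \<in> ?X \<Longrightarrow> case_prod \<beta> x \<in> carrier M" using bilinD(3)[OF \<beta>] by auto
  note lin = lincomb_linear[OF M c]
  note F = smult_simps[OF module_free_mod[of ?X]]
  show ?thesis using r V W M F bilinD[OF \<beta>]
    by (auto simp: tensor_rels_def Let_def linear_diff[OF lin module_free_mod M] linear_add[OF lin]
        linear_smult[OF lin] lincomb_free_gen diff_eq_zero_iff
        linear_add[OF bilinD(1)[OF \<beta>]] linear_add[OF bilinD(2)[OF \<beta>]]
        linear_smult[OF bilinD(1)[OF \<beta>]] linear_smult[OF bilinD(2)[OF \<beta>]] simp del: free_mod_ops)
qed

lemma btensor_rels_closed:
  assumes "module K P" "ring P" "B \<subseteq> carrier P"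
  shows "btensor_rels K P B \<subseteq> carrier (free_mod K (carrier P \<times> carrier P))"
  using assms smult_simps[OF module_free_mod[of "carrier P \<times> carrier P"]] tensor_rels_closed[of P P]
  by (auto simp: btensor_rels_def subset_iff ring.ring_simprules simp del: free_mod_ops)

lemma lincomb_btensor_rels:
  assumes P: "module K P" "ring P" "B \<subseteq> carrier P" and M: "module K M" and \<beta>: "bilin P P M \<beta>"
    and bal: "\<And>p b q. p \<in> carrier P \<Longrightarrow> b \<in> B \<Longrightarrow> q \<in> carrier P \<Longrightarrow> \<beta> (p \<otimes>\<^bsub>P\<^esub> b) q = \<beta> p (b \<otimes>\<^bsub>P\<^esub> q)"
    and r: "r \<in> btensor_rels K P B"
  shows "lincomb M (case_prod \<beta>) r = \<zero>\<^bsub>M\<^esub>"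
proof -
  let ?X = "carrier P \<times> carrier P"
  have c: "\<And>x. x \<in> ?X \<Longrightarrow> case_prod \<beta> x \<in> carrier M" using bilinD(3)[OF \<beta>] by auto
  note lin = lincomb_linear[OF M c]
  have B: "b \<in> carrier P" if "b \<in> B" for b using that P by auto
  show ?thesis using r unfolding btensor_rels_def
  proof
    assume "r \<in> tensor_rels K P P"
    then show ?thesis using lincomb_tensor_rels[OF P(1,1) M \<beta>] by blast
  next
    assume "r \<in> {free_gen K (p \<otimes>\<^bsub>P\<^esub> b, q) \<ominus>\<^bsub>free_mod K ?X\<^esub> free_gen K (p, b \<otimes>\<^bsub>P\<^esub> q) | p b q.
        p \<in> carrier P \<and> b \<in> B \<and> q \<in> carrier P}"
    then show ?thesis using P M B bilinD(3)[OF \<beta>]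
      by (auto simp: linear_diff[OF lin module_free_mod M] lincomb_free_gen bal ring.ring_simprules
          diff_eq_zero_iff simp del: free_mod_ops)
  qed
qed

lemma pres_rel_zero:
  assumes R: "R \<subseteq> carrier (free_mod K X)" and r: "r \<in> R"
  shows "mod_span K (free_mod K X) R +>\<^bsub>free_mod K X\<^esub> r = \<zero>\<^bsub>pres_mod K X R\<^esub>"
proof -
  interpret F: module K "free_mod K X" by (rule module_free_mod)
  interpret N: abelian_subgroup "mod_span K (free_mod K X) R" "free_mod K X"
    by (intro abelian_subgroupI3 additive_subgroupI submodule.axioms[OF span_R[OF R]]) unfold_locales
  have "r \<in> mod_span K (free_mod K X) R" using r by (auto simp: mod_span_def)
  then show ?thesis by (simp add: N.a_rcos_const pres_mod_def quot_mod_def)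
qed

lemma pres_proj_linear:
  assumes R: "R \<subseteq> carrier (free_mod K X)"
  shows "(\<lambda>f. mod_span K (free_mod K X) R +>\<^bsub>free_mod K X\<^esub> f) \<in> linear_maps K (free_mod K X) (pres_mod K X R)"
  unfolding pres_mod_def using module_free_mod span_R[OF R] by (rule quot_proj_linear)

text \<open>Stated for every set \<open>R\<close> of relators that contains the bilinearity
  relators, so as to serve the tensor product over \<open>K\<close> and the balanced one
  alike.\<close>

lemma pres_gen_bilin:
  assumes V: "module K V" and W: "module K W" and R: "R \<subseteq> carrier (free_mod K (carrier V \<times> carrier W))"
    and sub: "tensor_rels K V W \<subseteq> R"
  shows "bilin V W (pres_mod K (carrier V \<times> carrier W) R)
    (\<lambda>v w. pres_gen K (carrier V \<times> carrier W) R (v, w))"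
proof -
  let ?X = "carrier V \<times> carrier W" and ?Q = "pres_mod K (carrier V \<times> carrier W) R"
  define q where "q f = mod_span K (free_mod K ?X) R +>\<^bsub>free_mod K ?X\<^esub> f" for f
  have q: "q \<in> linear_maps K (free_mod K ?X) ?Q" unfolding q_def by (rule pres_proj_linear[OF R])
  have Q: "module K ?Q" by (rule module_pres_mod[OF R])
  have F: "module K (free_mod K ?X)" by (rule module_free_mod)
  have z: "q r = \<zero>\<^bsub>?Q\<^esub>" if "r \<in> tensor_rels K V W" for r
    unfolding q_def using R that sub by (intro pres_rel_zero) auto
  have eq: "q x = q y" if "x \<ominus>\<^bsub>free_mod K ?X\<^esub> y \<in> tensor_rels K V W" "x \<in> carrier (free_mod K ?X)"
    "y \<in> carrier (free_mod K ?X)" for x y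
    using z[OF that(1)] that(2,3) linear_closed[OF q] by (simp add: linear_diff[OF q F Q] diff_eq_zero_iff[OF Q])
  note [simp del] = free_mod_ops
  note [simp] = smult_simps[OF F] smult_simps[OF V] smult_simps[OF W]
  have a1: "q (free_gen K (v \<oplus>\<^bsub>V\<^esub> v', w)) = q (free_gen K (v, w)) \<oplus>\<^bsub>?Q\<^esub> q (free_gen K (v', w))"
    if "v \<in> carrier V" "v' \<in> carrier V" "w \<in> carrier W" for v v' w
    using that by (simp flip: linear_add[OF q]) (rule eq; simp add: tensor_relsI)
  have a2: "q (free_gen K (v, w \<oplus>\<^bsub>W\<^esub> w')) = q (free_gen K (v, w)) \<oplus>\<^bsub>?Q\<^esub> q (free_gen K (v, w'))"
    if "v \<in> carrier V" "w' \<in> carrier W" "w \<in> carrier W" for v w' w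
    using that by (simp flip: linear_add[OF q]) (rule eq; simp add: tensor_relsI)
  have s1: "q (free_gen K (a \<odot>\<^bsub>V\<^esub> v, w)) = a \<odot>\<^bsub>?Q\<^esub> q (free_gen K (v, w))"
    if "a \<in> carrier K" "v \<in> carrier V" "w \<in> carrier W" for a v w
    using that by (simp flip: linear_smult[OF q]) (rule eq; simp add: tensor_relsI)
  have s2: "q (free_gen K (v, a \<odot>\<^bsub>W\<^esub> w)) = a \<odot>\<^bsub>?Q\<^esub> q (free_gen K (v, w))"
    if "a \<in> carrier K" "v \<in> carrier V" "w \<in> carrier W" for a v w
    using that by (simp flip: linear_smult[OF q]) (rule eq; simp add: tensor_relsI)
  have g: "pres_gen K ?X R x = q (free_gen K x)" for x by (simp add: pres_gen_def q_def)
  show ?thesis unfolding g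
    by (intro bilinI linear_mapsI) (auto simp: a1 a2 s1 s2 linear_closed[OF q])
qed

lemma module_tensor [simp, mlin]: "module K V \<Longrightarrow> module K W \<Longrightarrow> module K (tensor K V W)"
  unfolding tensor_def by (intro module_pres_mod tensor_rels_closed)

lemma tens_bilin: "module K V \<Longrightarrow> module K W \<Longrightarrow> bilin V W (tensor K V W) (tens K V W)"
  using pres_gen_bilin[of V W "tensor_rels K V W"] tensor_rels_closed[of V W]
  by (simp add: tensor_def tens_def[abs_def])

lemma tens_closed [simp, mlin]: "module K V \<Longrightarrow> module K W \<Longrightarrow> v \<in> carrier V \<Longrightarrow> w \<in> carrier W \<Longrightarrow>
    tens K V W v w \<in> carrier (tensor K V W)"
  by (rule bilinD(3)[OF tens_bilin])

lemma module_btensor: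
  "module K P \<Longrightarrow> ring P \<Longrightarrow> B \<subseteq> carrier P \<Longrightarrow> module K (btensor K P B)"
  unfolding btensor_def by (intro module_pres_mod btensor_rels_closed)

lemma btens_bilin:
  "module K P \<Longrightarrow> ring P \<Longrightarrow> B \<subseteq> carrier P \<Longrightarrow> bilin P P (btensor K P B) (btens K P B)"
  using pres_gen_bilin[of P P "btensor_rels K P B"] btensor_rels_closed[of P B]
  by (simp add: btensor_def btens_def[abs_def] btensor_rels_def)

lemma btens_balanced:
  assumes P: "module K P" "ring P" "B \<subseteq> carrier P" and "p \<in> carrier P" "b \<in> B" "q \<in> carrier P"
  shows "btens K P B (p \<otimes>\<^bsub>P\<^esub> b) q = btens K P B p (b \<otimes>\<^bsub>P\<^esub> q)"
proof -
  let ?X = "carrier P \<times> carrier P" and ?R = "btensor_rels K P B"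
  define g where "g f = mod_span K (free_mod K ?X) ?R +>\<^bsub>free_mod K ?X\<^esub> f" for f
  have R: "?R \<subseteq> carrier (free_mod K ?X)" using P by (rule btensor_rels_closed)
  have g: "g \<in> linear_maps K (free_mod K ?X) (pres_mod K ?X ?R)"
    unfolding g_def by (rule pres_proj_linear[OF R])
  have Q: "module K (pres_mod K ?X ?R)" by (rule module_pres_mod[OF R])
  let ?x = "free_gen K (p \<otimes>\<^bsub>P\<^esub> b, q)" and ?y = "free_gen K (p, b \<otimes>\<^bsub>P\<^esub> q)"
  have xy: "?x \<in> carrier (free_mod K ?X)" "?y \<in> carrier (free_mod K ?X)"
    using assms by (auto intro!: free_gen_closed simp: ring.ring_simprules subset_iff)
  have "?x \<ominus>\<^bsub>free_mod K ?X\<^esub> ?y \<in> ?R" using assms by (auto simp: btensor_rels_def)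
  then have "g (?x \<ominus>\<^bsub>free_mod K ?X\<^esub> ?y) = \<zero>\<^bsub>pres_mod K ?X ?R\<^esub>" unfolding g_def by (intro pres_rel_zero R)
  then have "g ?x = g ?y"
    using xy linear_closed[OF g] by (simp add: linear_diff[OF g module_free_mod Q] diff_eq_zero_iff[OF Q])
  then show ?thesis by (simp add: btens_def pres_gen_def g_def)
qed

section \<open>The universal property of the tensor product\<close>

context
  fixes V :: "('k, 'v, 'l) module_scheme" and W :: "('k, 'w, 'm) module_scheme"
  assumes V: "module K V" and W: "module K W"
begin

lemmas R = tensor_rels_closed[OF V W]

lemma tlift_closed:
  "t \<in> carrier (tensor K V W) \<Longrightarrow> module K M \<Longrightarrow>
    (\<And>v w. v \<in> carrier V \<Longrightarrow> w \<in> carrier W \<Longrightarrow> \<beta> v w \<in> carrier M) \<Longrightarrow> tlift M \<beta> t \<in> carrier M"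
  unfolding tensor_def by (rule pres_lift_closed[OF R]) auto

lemma tlift_linear:
  assumes M: "module K M" and \<beta>: "bilin V W M \<beta>"
  shows "tlift M \<beta> \<in> linear_maps K (tensor K V W) M"
  unfolding tensor_def
  by (rule pres_lift_linear[OF R M _ lincomb_tensor_rels[OF V W M \<beta>]]) (use bilinD(3)[OF \<beta>] in auto)

lemma tlift_tens:
  assumes M: "module K M" and \<beta>: "bilin V W M \<beta>" and "v \<in> carrier V" "w \<in> carrier W"
  shows "tlift M \<beta> (tens K V W v w) = \<beta> v w"
  unfolding tens_def
  by (subst pres_lift_gen[OF R M _ lincomb_tensor_rels[OF V W M \<beta>]]) (use assms bilinD(3)[OF \<beta>] in auto)

lemma tlift_cong:
  assumes "t \<in> carrier (tensor K V W)" "module K M"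
    "\<And>v w. v \<in> carrier V \<Longrightarrow> w \<in> carrier W \<Longrightarrow> \<beta> v w = \<gamma> v w"
    "\<And>v w. v \<in> carrier V \<Longrightarrow> w \<in> carrier W \<Longrightarrow> \<gamma> v w \<in> carrier M"
  shows "tlift M \<beta> t = tlift M \<gamma> t"
  using assms unfolding tensor_def by (intro pres_lift_cong[OF R]) auto

lemma tlift_push:
  assumes "g \<in> linear_maps K M N" "t \<in> carrier (tensor K V W)" "module K M" "module K N"
    "\<And>v w. v \<in> carrier V \<Longrightarrow> w \<in> carrier W \<Longrightarrow> \<beta> v w \<in> carrier M"
  shows "g (tlift M \<beta> t) = tlift N (\<lambda>v w. g (\<beta> v w)) t"
proof -
  have "g (tlift M \<beta> t) = pres_lift K N (\<lambda>x. g (case_prod \<beta> x)) t"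
    using assms unfolding tensor_def by (intro pres_lift_push[OF R]) auto
  then show ?thesis by (simp add: case_prod_unfold)
qed

lemma tensor_eqI:
  assumes "module K M" "g \<in> linear_maps K (tensor K V W) M" "h \<in> linear_maps K (tensor K V W) M"
    "\<And>v w. v \<in> carrier V \<Longrightarrow> w \<in> carrier W \<Longrightarrow> g (tens K V W v w) = h (tens K V W v w)"
    "t \<in> carrier (tensor K V W)"
  shows "g t = h t"
  by (rule pres_linear_eq[OF R assms(1) assms(2)[unfolded tensor_def] assms(3)[unfolded tensor_def]
      _ assms(5)[unfolded tensor_def]])
    (auto simp: assms(4)[unfolded tens_def])

text \<open>The tensor \<open>t\<close> is fixed, so all three lifts are finite sums over one and
  the same representative.\<close>

lemma tlift_add:
  assumes t: "t \<in> carrier (tensor K V W)" and M: "module K M"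
    and \<beta>: "\<And>v w. v \<in> carrier V \<Longrightarrow> w \<in> carrier W \<Longrightarrow> \<beta> v w \<in> carrier M"
    and \<gamma>: "\<And>v w. v \<in> carrier V \<Longrightarrow> w \<in> carrier W \<Longrightarrow> \<gamma> v w \<in> carrier M"
  shows "tlift M (\<lambda>v w. \<beta> v w \<oplus>\<^bsub>M\<^esub> \<gamma> v w) t = tlift M \<beta> t \<oplus>\<^bsub>M\<^esub> tlift M \<gamma> t"
proof -
  interpret M: module K M by fact
  let ?f = "SOME f. f \<in> t"
  have f: "?f \<in> carrier (free_mod K (carrier V \<times> carrier W))"
    using pres_some[OF R] t by (simp add: tensor_def)
  have c1: "?f x \<in> carrier K" "?f x \<noteq> \<zero>\<^bsub>K\<^esub> \<Longrightarrow> x \<in> carrier V \<times> carrier W" for x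
    using f unfolding free_mod_carrier by blast+
  have c2: "\<beta> (fst x) (snd x) \<in> carrier M" "\<gamma> (fst x) (snd x) \<in> carrier M" if "?f x \<noteq> \<zero>\<^bsub>K\<^esub>" for x
    using c1(2)[OF that] \<beta> \<gamma> by (auto simp: mem_Times_iff)
  note c = c1 c2
  have "tlift M (\<lambda>v w. \<beta> v w \<oplus>\<^bsub>M\<^esub> \<gamma> v w) t =
    (\<Oplus>\<^bsub>M\<^esub>x\<in>{x. ?f x \<noteq> \<zero>\<^bsub>K\<^esub>}. ?f x \<odot>\<^bsub>M\<^esub> \<beta> (fst x) (snd x) \<oplus>\<^bsub>M\<^esub> ?f x \<odot>\<^bsub>M\<^esub> \<gamma> (fst x) (snd x))"
    unfolding pres_lift_eq lincomb_def using c M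
    by (intro M.finsum_cong') (auto simp: case_prod_unfold smult_distribs(2))
  also have "\<dots> = tlift M \<beta> t \<oplus>\<^bsub>M\<^esub> tlift M \<gamma> t"
    unfolding pres_lift_eq lincomb_def case_prod_unfold using c M by (intro M.finsum_addf) auto
  finally show ?thesis .
qed

lemma tlift_smult:
  assumes "t \<in> carrier (tensor K V W)" "module K M" "a \<in> carrier K"
    "\<And>v w. v \<in> carrier V \<Longrightarrow> w \<in> carrier W \<Longrightarrow> \<beta> v w \<in> carrier M"
  shows "tlift M (\<lambda>v w. a \<odot>\<^bsub>M\<^esub> \<beta> v w) t = a \<odot>\<^bsub>M\<^esub> tlift M \<beta> t"
  using assms by (intro tlift_push[where g = "\<lambda>x. a \<odot>\<^bsub>M\<^esub> x", symmetric] linear_scale) auto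

lemma tlift_diff:
  assumes t: "t \<in> carrier (tensor K V W)" and M: "module K M"
    and \<beta>: "\<And>v w. v \<in> carrier V \<Longrightarrow> w \<in> carrier W \<Longrightarrow> \<beta> v w \<in> carrier M"
    and \<gamma>: "\<And>v w. v \<in> carrier V \<Longrightarrow> w \<in> carrier W \<Longrightarrow> \<gamma> v w \<in> carrier M"
  shows "tlift M (\<lambda>v w. \<beta> v w \<ominus>\<^bsub>M\<^esub> \<gamma> v w) t = tlift M \<beta> t \<ominus>\<^bsub>M\<^esub> tlift M \<gamma> t"
proof -
  have "tlift M (\<lambda>v w. \<beta> v w \<ominus>\<^bsub>M\<^esub> \<gamma> v w) t =
      tlift M (\<lambda>v w. \<beta> v w \<oplus>\<^bsub>M\<^esub> (\<ominus>\<^bsub>K\<^esub> \<one>\<^bsub>K\<^esub>) \<odot>\<^bsub>M\<^esub> \<gamma> v w) t"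
    using assms by (intro tlift_cong) (auto simp: a_minus_def neg_eq_smult)
  also have "\<dots> = tlift M \<beta> t \<oplus>\<^bsub>M\<^esub> (\<ominus>\<^bsub>K\<^esub> \<one>\<^bsub>K\<^esub>) \<odot>\<^bsub>M\<^esub> tlift M \<gamma> t"
    using assms by (subst tlift_add) (auto simp: tlift_smult)
  finally show ?thesis using M tlift_closed[OF t M \<gamma>] by (simp add: a_minus_def neg_eq_smult)
qed

lemma linear_tlift_arg:
  "f \<in> linear_maps K U (tensor K V W) \<Longrightarrow> bilin V W M \<beta> \<Longrightarrow> module K M \<Longrightarrow>
    (\<lambda>u. tlift M \<beta> (f u)) \<in> linear_maps K U M"
  by (rule linear_comp[OF tlift_linear])

text \<open>Treats a variable that occurs in the integrand; with the tensor \<open>t\<close> fixed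
  this reduces to \<open>tlift_add\<close> and \<open>tlift_smult\<close>. A variable in the tensor
  itself is the matter of \<open>linear_tlift_arg\<close>.\<close>

lemma linear_tlift_par:
  assumes t: "t \<in> carrier (tensor K V W)"
    and \<beta>: "\<And>v w. v \<in> carrier V \<Longrightarrow> w \<in> carrier W \<Longrightarrow> (\<lambda>u. \<beta> u v w) \<in> linear_maps K U M"
    and U: "module K U" and M: "module K M"
  shows "(\<lambda>u. tlift M (\<beta> u) t) \<in> linear_maps K U M"
proof (rule linear_mapsI)
  note c = linear_closed[OF \<beta>]
  show "tlift M (\<beta> u) t \<in> carrier M" if "u \<in> carrier U" for u
    using that c by (intro tlift_closed[OF t M])
  show "tlift M (\<beta> (u \<oplus>\<^bsub>U\<^esub> u')) t = tlift M (\<beta> u) t \<oplus>\<^bsub>M\<^esub> tlift M (\<beta> u') t"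
    if "u \<in> carrier U" "u' \<in> carrier U" for u u'
    using that c M by (subst tlift_add[OF t M, symmetric]) (auto intro!: tlift_cong[OF t M] simp: linear_add[OF \<beta>])
  show "tlift M (\<beta> (a \<odot>\<^bsub>U\<^esub> u)) t = a \<odot>\<^bsub>M\<^esub> tlift M (\<beta> u) t"
    if "a \<in> carrier K" "u \<in> carrier U" for a u
    using that c M by (subst tlift_smult[OF t M, symmetric]) (auto intro!: tlift_cong[OF t M] simp: linear_smult[OF \<beta>])
qed

lemma linear_tens1: "w \<in> carrier W \<Longrightarrow> f \<in> linear_maps K U V \<Longrightarrow>
    (\<lambda>u. tens K V W (f u) w) \<in> linear_maps K U (tensor K V W)"
  using linear_comp[OF bilinD(2)[OF tens_bilin[OF V W]]] .

lemma linear_tens2: "v \<in> carrier V \<Longrightarrow> f \<in> linear_maps K U W \<Longrightarrow>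
    (\<lambda>u. tens K V W v (f u)) \<in> linear_maps K U (tensor K V W)"
  using linear_comp[OF bilinD(1)[OF tens_bilin[OF V W]]] .

lemma tlift_id: "t \<in> carrier (tensor K V W) \<Longrightarrow> tlift (tensor K V W) (tens K V W) t = t"
  by (rule tensor_eqI[of "tensor K V W" _ "\<lambda>t. t"])
    (auto simp: V W tlift_tens tens_bilin intro!: tlift_linear)

lemma smult_tens:
  assumes "a \<in> carrier K" "v \<in> carrier V" "w \<in> carrier W"
  shows "tens K V W (a \<odot>\<^bsub>V\<^esub> v) w = a \<odot>\<^bsub>tensor K V W\<^esub> tens K V W v w"
    and "tens K V W v (a \<odot>\<^bsub>W\<^esub> w) = a \<odot>\<^bsub>tensor K V W\<^esub> tens K V W v w"
  using assms linear_smult[OF bilinD(1)[OF tens_bilin[OF V W]]] linear_smult[OF bilinD(2)[OF tens_bilin[OF V W]]]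
  by auto

end

text \<open>The rotation lets the premise on the tensor be solved first: it determines
  \<open>V\<close> and \<open>W\<close>, which the conclusion of the two lift rules does not
  mention, before the premises that these are modules come up.\<close>

lemmas [mlin] = linear_id linear_tlift_arg[rotated 2] linear_tlift_par[rotated 2] linear_tens1 linear_tens2

lemma linear_smult2 [mlin]:
  "f \<in> linear_maps K U M \<Longrightarrow> module K M \<Longrightarrow> a \<in> carrier K \<Longrightarrow>
    (\<lambda>u. a \<odot>\<^bsub>M\<^esub> f u) \<in> linear_maps K U M"
  by (rule linear_scale)

lemma tlift_trilin_right:
  assumes "module K U" "module K V" "module K W" "module K M" "trilin U V W M \<beta>"
  shows "bilin U (tensor K V W) M (\<lambda>u s. tlift M (\<beta> u) s)"
  using assms trilinD[OF assms(5)] by (intro bilinI tlift_linear linear_tlift_par) auto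

lemma tlift_trilin_left:
  assumes "module K U" "module K V" "module K W" "module K M" "trilin U V W M \<beta>"
  shows "bilin (tensor K U V) W M (\<lambda>s w. tlift M (\<lambda>u v. \<beta> u v w) s)"
  using assms trilinD[OF assms(5)] by (intro bilinI tlift_linear linear_tlift_par) auto

text \<open>Eliminates the associator: against a trilinear map both bracketings give the same
  iterated lift. Coassociativity can thus be used as an exchange of nested lifts.\<close>

lemma tassoc_eval:
  assumes [mlin]: "module K U" "module K V" "module K W" "module K M" and \<beta>: "trilin U V W M \<beta>"
    and t: "t \<in> carrier (tensor K U (tensor K V W))"
  shows "tlift M (\<lambda>s w. tlift M (\<lambda>u v. \<beta> u v w) s) (tassoc K U V W t) =
    tlift M (\<lambda>u s. tlift M (\<beta> u) s) t"
proof -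
  note [simp] = assms(1-4)
  let ?UV = "tensor K U V" and ?VW = "tensor K V W" and ?T = "tensor K (tensor K U V) W"
  let ?g = "tlift M (\<lambda>s w. tlift M (\<lambda>u v. \<beta> u v w) s)"
  note \<beta>' = trilinD[OF \<beta>]
  have left: "bilin ?UV W M (\<lambda>s w. tlift M (\<lambda>u v. \<beta> u v w) s)"
    using \<beta> by (intro tlift_trilin_left) auto
  then have g: "?g \<in> linear_maps K ?T M" by (intro tlift_linear) auto
  have uv: "bilin U V M (\<lambda>u v. \<beta> u v w)" if "w \<in> carrier W" for w
    using \<beta>' that by (intro bilinI) auto
  have tt: "tens K ?UV W (tens K U V u v) w \<in> carrier ?T"
    if "u \<in> carrier U" "v \<in> carrier V" "w \<in> carrier W" for u v w using that by simp
  have in1: "tlift ?T (\<lambda>v w. tens K ?UV W (tens K U V u v) w) s \<in> carrier ?T"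
    if "u \<in> carrier U" "s \<in> carrier ?VW" for u s
    using that by (intro tlift_closed[of V W]) auto
  have "?g (tassoc K U V W t) =
      tlift M (\<lambda>u s. ?g (tlift ?T (\<lambda>v w. tens K ?UV W (tens K U V u v) w) s)) t"
    unfolding tassoc_def Let_def by (rule tlift_push[OF _ _ g t]) (auto intro: in1)
  also have "\<dots> = tlift M (\<lambda>u s. tlift M (\<beta> u) s) t"
  proof (rule tlift_cong[OF _ _ t])
    fix u s assume u: "u \<in> carrier U" and s: "s \<in> carrier ?VW"
    have "?g (tlift ?T (\<lambda>v w. tens K ?UV W (tens K U V u v) w) s) =
        tlift M (\<lambda>v w. ?g (tens K ?UV W (tens K U V u v) w)) s"
      by (rule tlift_push[OF _ _ g s]) (auto simp: u)
    also have "\<dots> = tlift M (\<beta> u) s"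
      using u \<beta>'(5)[OF u]
      by (intro tlift_cong[OF _ _ s]) (auto simp: tlift_tens[OF _ _ _ left] tlift_tens[OF _ _ _ uv])
    finally show "?g (tlift ?T (\<lambda>v w. tens K ?UV W (tens K U V u v) w) s) = tlift M (\<beta> u) s" .
  qed (use \<beta>' in \<open>auto intro!: tlift_closed[of V W]\<close>)
  finally show ?thesis .
qed

lemma tmap_eval:
  assumes "module K V" "module K W" "module K V'" "module K W'" "module K M" and \<beta>: "bilin V' W' M \<beta>"
    and t: "t \<in> carrier (tensor K V W)"
    and f: "\<And>x. x \<in> carrier V \<Longrightarrow> f x \<in> carrier V'" and g: "\<And>x. x \<in> carrier W \<Longrightarrow> g x \<in> carrier W'"
  shows "tlift M \<beta> (tmap K V' W' f g t) = tlift M (\<lambda>x y. \<beta> (f x) (g y)) t"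
proof -
  have "tlift M \<beta> (tmap K V' W' f g t) = tlift M (\<lambda>x y. tlift M \<beta> (tens K V' W' (f x) (g y))) t"
    unfolding tmap_def using assms by (intro tlift_push tlift_linear) auto
  also have "\<dots> = tlift M (\<lambda>x y. \<beta> (f x) (g y)) t"
    using assms bilinD(3)[OF \<beta>] by (intro tlift_cong[OF _ _ t]) (auto simp: tlift_tens)
  finally show ?thesis .
qed

lemma tmap_linear:
  assumes "module K V" "module K W" "module K V'" "module K W'"
    and f: "f \<in> linear_maps K V V'" and g: "g \<in> linear_maps K W W'"
  shows "tmap K V' W' f g \<in> linear_maps K (tensor K V W) (tensor K V' W')"
  unfolding tmap_def using assms linear_closed[OF f] linear_closed[OF g]
  by (intro tlift_linear bilinI linear_tens1 linear_tens2) auto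

lemma tmap_tens:
  assumes "module K V" "module K W" "module K V'" "module K W'"
    and f: "f \<in> linear_maps K V V'" and g: "g \<in> linear_maps K W W'"
    and "v \<in> carrier V" "w \<in> carrier W"
  shows "tmap K V' W' f g (tens K V W v w) = tens K V' W' (f v) (g w)"
  unfolding tmap_def using assms linear_closed[OF f] linear_closed[OF g]
  by (subst tlift_tens) (auto intro!: bilinI linear_tens1 linear_tens2)

end

section \<open>Coalgebras and coactions\<close>

locale coalgebra_point = vector_spaces K for K :: "'k ring" +
  fixes C :: "('k, 'c) coalg" and e :: 'c
  assumes coalgebra: "coalgebra K C" and group_like: "group_like K C e"
begin

abbreviation "\<epsilon> \<equiv> counit C"
abbreviation "\<Delta> \<equiv> comult C"

lemma module_C [simp, mlin]: "module K C"
  and counit_closed [simp]: "c \<in> carrier C \<Longrightarrow> \<epsilon> c \<in> carrier K"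
  and right_comult: "right_coaction K C C \<Delta>"
  and left_comult: "left_coaction K C C \<Delta>"
  using coalgebra by (auto simp: coalgebra_def)

lemma comult_linear [mlin]: "\<Delta> \<in> linear_maps K C (tensor K C C)"
  using right_comult by (simp add: right_coaction_def)

lemmas comult_closed [simp, mlin] = linear_closed[OF comult_linear]

lemma e_closed [simp, mlin]: "e \<in> carrier C"
  using group_like by (auto simp: group_like_def)

lemma linear_counit [mlin]:
  assumes V: "module K V" and x: "x \<in> carrier V" and f: "f \<in> linear_maps K U C"
  shows "(\<lambda>u. \<epsilon> (f u) \<odot>\<^bsub>V\<^esub> x) \<in> linear_maps K U V"
proof (rule linear_comp[of "\<lambda>c. \<epsilon> c \<odot>\<^bsub>V\<^esub> x", OF _ f])
  show "(\<lambda>c. \<epsilon> c \<odot>\<^bsub>V\<^esub> x) \<in> linear_maps K C V"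
    using coalgebra V x by (intro linear_mapsI) (auto simp: coalgebra_def smult_distribs)
qed

lemma linear_counit2 [mlin]:
  "module K V \<Longrightarrow> c \<in> carrier C \<Longrightarrow> f \<in> linear_maps K U V \<Longrightarrow>
    (\<lambda>u. \<epsilon> c \<odot>\<^bsub>V\<^esub> f u) \<in> linear_maps K U V"
  by (intro linear_scale) auto

lemma right_coaction_closed: "right_coaction K C V \<rho> \<Longrightarrow> v \<in> carrier V \<Longrightarrow> \<rho> v \<in> carrier (tensor K V C)"
  and left_coaction_closed: "left_coaction K C V \<sigma> \<Longrightarrow> v \<in> carrier V \<Longrightarrow> \<sigma> v \<in> carrier (tensor K C V)"
  by (auto simp: right_coaction_def left_coaction_def linear_maps_def)

text \<open>Coassociativity tested against a trilinear map:
  \<open>\<beta>(v_00, v_01, v_1) = \<beta>(v_0, v_11, v_12)\<close>, where the indices on the right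
  split the coalgebra leg. The proof removes \<open>tmap\<close> and \<open>tassoc\<close> from the
  defining equation by their evaluation rules.\<close>

lemma right_coassoc:
  assumes \<rho>: "right_coaction K C V \<rho>" and V [simp, mlin]: "module K V" and M [simp, mlin]: "module K M"
    and \<beta>: "trilin V C C M \<beta>" and v: "v \<in> carrier V"
  shows "tlift M (\<lambda>x c. tlift M (\<lambda>y d. \<beta> y d c) (\<rho> x)) (\<rho> v) =
    tlift M (\<lambda>x c. tlift M (\<beta> x) (\<Delta> c)) (\<rho> v)"
proof -
  let ?VC = "tensor K V C" and ?CC = "tensor K C C"
  note \<rho>c = right_coaction_closed[OF \<rho>]
  note rv = \<rho>c[OF v]
  have \<rho>l: "\<rho> \<in> linear_maps K V ?VC" using \<rho> by (simp add: right_coaction_def)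
  have eq: "tmap K ?VC C \<rho> id (\<rho> v) = tassoc K V C C (tmap K V ?CC id \<Delta> (\<rho> v))"
    using \<rho> v by (simp add: right_coaction_def)
  have left: "bilin ?VC C M (\<lambda>s c. tlift M (\<lambda>y d. \<beta> y d c) s)" using \<beta> by (intro tlift_trilin_left) auto
  have right: "bilin V ?CC M (\<lambda>x s. tlift M (\<beta> x) s)" using \<beta> by (intro tlift_trilin_right) auto
  have "tlift M (\<lambda>x c. tlift M (\<lambda>y d. \<beta> y d c) (\<rho> x)) (\<rho> v) =
      tlift M (\<lambda>s c. tlift M (\<lambda>y d. \<beta> y d c) s) (tmap K ?VC C \<rho> id (\<rho> v))"
    using \<rho>c by (subst tmap_eval[OF _ _ _ _ _ left rv]) auto
  also have "\<dots> = tlift M (\<lambda>x s. tlift M (\<beta> x) s) (tmap K V ?CC id \<Delta> (\<rho> v))"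
    unfolding eq using \<beta> rv comult_linear
    by (intro tassoc_eval linear_closed[OF tmap_linear[where V = V and W = C]]) (auto simp: id_def)
  also have "\<dots> = tlift M (\<lambda>x c. tlift M (\<beta> x) (\<Delta> c)) (\<rho> v)"
    by (subst tmap_eval[OF _ _ _ _ _ right rv]) auto
  finally show ?thesis .
qed

lemma left_coassoc:
  assumes \<sigma>: "left_coaction K C V \<sigma>" and V [simp, mlin]: "module K V" and M [simp, mlin]: "module K M"
    and \<beta>: "trilin C C V M \<beta>" and v: "v \<in> carrier V"
  shows "tlift M (\<lambda>c x. tlift M (\<beta> c) (\<sigma> x)) (\<sigma> v) =
    tlift M (\<lambda>c x. tlift M (\<lambda>d d'. \<beta> d d' x) (\<Delta> c)) (\<sigma> v)"
proof -
  let ?CV = "tensor K C V" and ?CC = "tensor K C C"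
  note \<sigma>c = left_coaction_closed[OF \<sigma>]
  note sv = \<sigma>c[OF v]
  have \<sigma>l: "\<sigma> \<in> linear_maps K V ?CV" using \<sigma> by (simp add: left_coaction_def)
  have eq: "tassoc K C C V (tmap K C ?CV id \<sigma> (\<sigma> v)) = tmap K ?CC V \<Delta> id (\<sigma> v)"
    using \<sigma> v by (simp add: left_coaction_def)
  have left: "bilin ?CC V M (\<lambda>s x. tlift M (\<lambda>d d'. \<beta> d d' x) s)" using \<beta> by (intro tlift_trilin_left) auto
  have right: "bilin C ?CV M (\<lambda>c s. tlift M (\<beta> c) s)" using \<beta> by (intro tlift_trilin_right) auto
  have "tlift M (\<lambda>c x. tlift M (\<beta> c) (\<sigma> x)) (\<sigma> v) =
      tlift M (\<lambda>c s. tlift M (\<beta> c) s) (tmap K C ?CV id \<sigma> (\<sigma> v))"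
    using \<sigma>c by (subst tmap_eval[OF _ _ _ _ _ right sv]) auto
  also have "\<dots> = tlift M (\<lambda>s x. tlift M (\<lambda>d d'. \<beta> d d' x) s) (tassoc K C C V (tmap K C ?CV id \<sigma> (\<sigma> v)))"
    using \<beta> sv \<sigma>l
    by (intro tassoc_eval[symmetric] linear_closed[OF tmap_linear[where V = C and W = V]]) (auto simp: id_def)
  also have "\<dots> = tlift M (\<lambda>c x. tlift M (\<lambda>d d'. \<beta> d d' x) (\<Delta> c)) (\<sigma> v)"
    unfolding eq by (subst tmap_eval[OF _ _ _ _ _ left sv]) auto
  finally show ?thesis .
qed

lemma right_counit:
  assumes \<rho>: "right_coaction K C V \<rho>" and V: "module K V" and M: "module K M"
    and g: "g \<in> linear_maps K V M" and v: "v \<in> carrier V"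
  shows "tlift M (\<lambda>x c. \<epsilon> c \<odot>\<^bsub>M\<^esub> g x) (\<rho> v) = g v"
proof -
  note rv = right_coaction_closed[OF \<rho> v]
  have "g v = g (tlift V (\<lambda>x c. \<epsilon> c \<odot>\<^bsub>V\<^esub> x) (\<rho> v))" using \<rho> v by (simp add: right_coaction_def)
  also have "\<dots> = tlift M (\<lambda>x c. g (\<epsilon> c \<odot>\<^bsub>V\<^esub> x)) (\<rho> v)"
    using rv V M by (intro tlift_push[OF _ _ g]) auto
  also have "\<dots> = tlift M (\<lambda>x c. \<epsilon> c \<odot>\<^bsub>M\<^esub> g x) (\<rho> v)"
    using V M linear_closed[OF g] by (intro tlift_cong[OF _ _ rv]) (auto simp: linear_smult[OF g])
  finally show ?thesis by simp
qed

lemma left_counit: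
  assumes \<sigma>: "left_coaction K C V \<sigma>" and V: "module K V" and M: "module K M"
    and g: "g \<in> linear_maps K V M" and v: "v \<in> carrier V"
  shows "tlift M (\<lambda>c x. \<epsilon> c \<odot>\<^bsub>M\<^esub> g x) (\<sigma> v) = g v"
proof -
  note sv = left_coaction_closed[OF \<sigma> v]
  have "g v = g (tlift V (\<lambda>c x. \<epsilon> c \<odot>\<^bsub>V\<^esub> x) (\<sigma> v))" using \<sigma> v by (simp add: left_coaction_def)
  also have "\<dots> = tlift M (\<lambda>c x. g (\<epsilon> c \<odot>\<^bsub>V\<^esub> x)) (\<sigma> v)"
    using sv V M by (intro tlift_push[OF _ _ g]) auto
  also have "\<dots> = tlift M (\<lambda>c x. \<epsilon> c \<odot>\<^bsub>M\<^esub> g x) (\<sigma> v)"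
    using V M linear_closed[OF g] by (intro tlift_cong[OF _ _ sv]) (auto simp: linear_smult[OF g])
  finally show ?thesis by simp
qed

end

context vector_spaces
begin

lemma tlift_closed' [mlin]:
  "t \<in> carrier (tensor K V W) \<Longrightarrow> module K V \<Longrightarrow> module K W \<Longrightarrow> module K M \<Longrightarrow>
    (\<And>v w. v \<in> carrier V \<Longrightarrow> w \<in> carrier W \<Longrightarrow> \<beta> v w \<in> carrier M) \<Longrightarrow> tlift M \<beta> t \<in> carrier M"
  by (rule tlift_closed)

lemma tlift_cong2:
  assumes t: "t \<in> carrier (tensor K V W)"
    and s: "\<And>x y. x \<in> carrier V \<Longrightarrow> y \<in> carrier W \<Longrightarrow> s x y \<in> carrier (tensor K V' W')"
    and V: "module K V" "module K W" "module K V'" "module K W'" and M: "module K M"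
    and eq: "\<And>x y z w. x \<in> carrier V \<Longrightarrow> y \<in> carrier W \<Longrightarrow> z \<in> carrier V' \<Longrightarrow> w \<in> carrier W' \<Longrightarrow>
      \<beta> x y z w = \<gamma> x y z w"
    and cl: "\<And>x y z w. x \<in> carrier V \<Longrightarrow> y \<in> carrier W \<Longrightarrow> z \<in> carrier V' \<Longrightarrow> w \<in> carrier W' \<Longrightarrow>
      \<gamma> x y z w \<in> carrier M"
  shows "tlift M (\<lambda>x y. tlift M (\<beta> x y) (s x y)) t = tlift M (\<lambda>x y. tlift M (\<gamma> x y) (s x y)) t"
  by (rule tlift_cong[OF V(1,2) t M], rule tlift_cong[OF V(3,4) s M])
    (auto simp: eq intro!: cl tlift_closed[OF V(3,4) s M])

lemma tlift_push2:
  assumes g: "g \<in> linear_maps K M N" and t: "t \<in> carrier (tensor K V W)"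
    and s: "\<And>x y. x \<in> carrier V \<Longrightarrow> y \<in> carrier W \<Longrightarrow> s x y \<in> carrier (tensor K V' W')"
    and V: "module K V" "module K W" "module K V'" "module K W'" and M: "module K M" "module K N"
    and cl: "\<And>x y z w. x \<in> carrier V \<Longrightarrow> y \<in> carrier W \<Longrightarrow> z \<in> carrier V' \<Longrightarrow> w \<in> carrier W' \<Longrightarrow>
      \<beta> x y z w \<in> carrier M"
  shows "g (tlift M (\<lambda>x y. tlift M (\<beta> x y) (s x y)) t) = tlift N (\<lambda>x y. tlift N (\<lambda>z w. g (\<beta> x y z w)) (s x y)) t"
proof -
  have "g (tlift M (\<lambda>x y. tlift M (\<beta> x y) (s x y)) t) = tlift N (\<lambda>x y. g (tlift M (\<beta> x y) (s x y))) t"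
    by (rule tlift_push[OF V(1,2) g t M]) (rule tlift_closed[OF V(3,4) s M(1) cl])
  also have "\<dots> = tlift N (\<lambda>x y. tlift N (\<lambda>z w. g (\<beta> x y z w)) (s x y)) t"
    by (rule tlift_cong[OF V(1,2) t M(2)], rule tlift_push[OF V(3,4) g s M cl])
      (auto intro!: tlift_closed[OF V(3,4) s M(2)] linear_closed[OF g] cl)
  finally show ?thesis .
qed

text \<open>Fubini for two independent tensors: both sides are linear in \<open>t\<close>, and for a
  pure tensor \<open>t\<close> the lift over \<open>t\<close> is a mere evaluation.\<close>

lemma tlift_swap:
  assumes t: "t \<in> carrier (tensor K V W)" and s: "s \<in> carrier (tensor K V' W')"
    and V: "module K V" "module K W" "module K V'" "module K W'" and M: "module K M"
    and \<beta>: "\<And>z w. z \<in> carrier V' \<Longrightarrow> w \<in> carrier W' \<Longrightarrow> bilin V W M (\<lambda>x y. \<beta> x y z w)"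
  shows "tlift M (\<lambda>x y. tlift M (\<beta> x y) s) t = tlift M (\<lambda>z w. tlift M (\<lambda>x y. \<beta> x y z w) t) s"
proof (rule tensor_eqI[OF V(1,2) M _ _ _ t, where g = "tlift M (\<lambda>x y. tlift M (\<beta> x y) s)"])
  note cl = bilinD(3)[OF \<beta>]
  have b: "bilin V W M (\<lambda>x y. tlift M (\<beta> x y) s)"
    by (intro bilinI linear_tlift_par[OF V(3,4) s] bilinD[OF \<beta>] V M)
  then show "tlift M (\<lambda>x y. tlift M (\<beta> x y) s) \<in> linear_maps K (tensor K V W) M"
    by (rule tlift_linear[OF V(1,2) M])
  show "(\<lambda>t. tlift M (\<lambda>z w. tlift M (\<lambda>x y. \<beta> x y z w) t) s) \<in> linear_maps K (tensor K V W) M"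
    by (intro linear_tlift_par[OF V(3,4) s] tlift_linear \<beta> V M module_tensor)
  show "tlift M (\<lambda>x y. tlift M (\<beta> x y) s) (tens K V W v w) =
      tlift M (\<lambda>z w'. tlift M (\<lambda>x y. \<beta> x y z w') (tens K V W v w)) s"
    if "v \<in> carrier V" "w \<in> carrier W" for v w
    unfolding tlift_tens[OF V(1,2) M b that] using that
    by (intro tlift_cong[OF V(3,4) s M]) (auto simp: tlift_tens[OF V(1,2) M \<beta>] intro!: cl)
qed

text \<open>Lets an identity in \<open>U \<otimes> (V \<otimes> W)\<close>, stated once for the
  universal trilinear map, imply the same identity for every trilinear map into every
  module.\<close>

lemma trilin_factor:
  assumes V: "module K U" "module K V" "module K W" "module K M" and \<beta>: "trilin U V W M \<beta>"
  obtains F where "F \<in> linear_maps K (tensor K U (tensor K V W)) M"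
    "\<And>u v w. u \<in> carrier U \<Longrightarrow> v \<in> carrier V \<Longrightarrow> w \<in> carrier W \<Longrightarrow> F (tens K U (tensor K V W) u (tens K V W v w)) = \<beta> u v w"
proof
  note right = tlift_trilin_right[OF V \<beta>]
  show "tlift M (\<lambda>u s. tlift M (\<beta> u) s) \<in> linear_maps K (tensor K U (tensor K V W)) M"
    using V right by (intro tlift_linear) auto
  show "tlift M (\<lambda>u s. tlift M (\<beta> u) s) (tens K U (tensor K V W) u (tens K V W v w)) = \<beta> u v w"
    if "u \<in> carrier U" "v \<in> carrier V" "w \<in> carrier W" for u v w
    using V that by (simp add: tlift_tens[OF _ _ _ right] tlift_tens[OF _ _ _ trilinD(1)[OF \<beta>]])
qed

lemma unital_algebraD:
  assumes "unital_algebra K P"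
  shows "module K P" "ring P"
    and "\<one>\<^bsub>P\<^esub> \<in> carrier P"
    and "x \<in> carrier P \<Longrightarrow> y \<in> carrier P \<Longrightarrow> x \<otimes>\<^bsub>P\<^esub> y \<in> carrier P"
    and "x \<in> carrier P \<Longrightarrow> y \<in> carrier P \<Longrightarrow> z \<in> carrier P \<Longrightarrow> (x \<otimes>\<^bsub>P\<^esub> y) \<otimes>\<^bsub>P\<^esub> z = x \<otimes>\<^bsub>P\<^esub> (y \<otimes>\<^bsub>P\<^esub> z)"
    and "x \<in> carrier P \<Longrightarrow> x \<otimes>\<^bsub>P\<^esub> \<one>\<^bsub>P\<^esub> = x"
    and "x \<in> carrier P \<Longrightarrow> \<one>\<^bsub>P\<^esub> \<otimes>\<^bsub>P\<^esub> x = x"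
    and "a \<in> carrier K \<Longrightarrow> x \<in> carrier P \<Longrightarrow> y \<in> carrier P \<Longrightarrow> (a \<odot>\<^bsub>P\<^esub> x) \<otimes>\<^bsub>P\<^esub> y = a \<odot>\<^bsub>P\<^esub> (x \<otimes>\<^bsub>P\<^esub> y)"
    and "a \<in> carrier K \<Longrightarrow> x \<in> carrier P \<Longrightarrow> y \<in> carrier P \<Longrightarrow> x \<otimes>\<^bsub>P\<^esub> (a \<odot>\<^bsub>P\<^esub> y) = a \<odot>\<^bsub>P\<^esub> (x \<otimes>\<^bsub>P\<^esub> y)"
proof -
  interpret ring P using assms by (simp add: unital_algebra_def)
  show "module K P" "ring P" "\<one>\<^bsub>P\<^esub> \<in> carrier P"
    "x \<in> carrier P \<Longrightarrow> y \<in> carrier P \<Longrightarrow> x \<otimes>\<^bsub>P\<^esub> y \<in> carrier P"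
    "x \<in> carrier P \<Longrightarrow> y \<in> carrier P \<Longrightarrow> z \<in> carrier P \<Longrightarrow> (x \<otimes>\<^bsub>P\<^esub> y) \<otimes>\<^bsub>P\<^esub> z = x \<otimes>\<^bsub>P\<^esub> (y \<otimes>\<^bsub>P\<^esub> z)"
    "x \<in> carrier P \<Longrightarrow> x \<otimes>\<^bsub>P\<^esub> \<one>\<^bsub>P\<^esub> = x" "x \<in> carrier P \<Longrightarrow> \<one>\<^bsub>P\<^esub> \<otimes>\<^bsub>P\<^esub> x = x"
    "a \<in> carrier K \<Longrightarrow> x \<in> carrier P \<Longrightarrow> y \<in> carrier P \<Longrightarrow> (a \<odot>\<^bsub>P\<^esub> x) \<otimes>\<^bsub>P\<^esub> y = a \<odot>\<^bsub>P\<^esub> (x \<otimes>\<^bsub>P\<^esub> y)"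
    "a \<in> carrier K \<Longrightarrow> x \<in> carrier P \<Longrightarrow> y \<in> carrier P \<Longrightarrow> x \<otimes>\<^bsub>P\<^esub> (a \<odot>\<^bsub>P\<^esub> y) = a \<odot>\<^bsub>P\<^esub> (x \<otimes>\<^bsub>P\<^esub> y)"
    using assms by (auto simp: unital_algebra_def m_assoc)
qed

lemma linear_mult1:
  "unital_algebra K P \<Longrightarrow> a \<in> carrier P \<Longrightarrow> f \<in> linear_maps K U P \<Longrightarrow> (\<lambda>u. f u \<otimes>\<^bsub>P\<^esub> a) \<in> linear_maps K U P"
  by (rule linear_comp[of "\<lambda>x. x \<otimes>\<^bsub>P\<^esub> a"])
    (auto intro!: linear_mapsI simp: unital_algebraD ring.ring_simprules)

lemma linear_mult2:
  "unital_algebra K P \<Longrightarrow> a \<in> carrier P \<Longrightarrow> f \<in> linear_maps K U P \<Longrightarrow> (\<lambda>u. a \<otimes>\<^bsub>P\<^esub> f u) \<in> linear_maps K U P"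
  by (rule linear_comp[of "\<lambda>x. a \<otimes>\<^bsub>P\<^esub> x"])
    (auto intro!: linear_mapsI simp: unital_algebraD ring.ring_simprules)

end

section \<open>Algebras with coaugmented coactions, their coinvariants and the canonical map\<close>

locale coaug = coalgebra_point K C e
  for K :: "'k ring" and C :: "('k, 'c) coalg" and e :: 'c +
  fixes P :: "('k, 'p, 'c) coact_alg"
  assumes coaug_alg: "coaug_alg K C e P"
begin

abbreviation "\<rho> \<equiv> rcoact P"
abbreviation "\<sigma> \<equiv> lcoact P"
abbreviation "PC \<equiv> tensor K P C"
abbreviation "CP \<equiv> tensor K C P"

lemma alg: "unital_algebra K P"
  and right_coaction: "right_coaction K C P \<rho>"
  and left_coaction: "left_coaction K C P \<sigma>"
  and \<rho>_one: "\<rho> \<one>\<^bsub>P\<^esub> = tens K P C \<one>\<^bsub>P\<^esub> e"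
  and \<sigma>_one: "\<sigma> \<one>\<^bsub>P\<^esub> = tens K C P e \<one>\<^bsub>P\<^esub>"
  using coaug_alg by (auto simp: coaug_alg_def)

lemmas module_P [simp, mlin] = unital_algebraD(1)[OF alg]
lemmas ring_P [simp] = unital_algebraD(2)[OF alg]
lemmas mult_closed [simp, mlin] = unital_algebraD(3,4)[OF alg]
lemmas mult_one [simp] = unital_algebraD(6,7)[OF alg]
lemmas mult_assoc = unital_algebraD(5)[OF alg]
lemmas mult_smult = unital_algebraD(8,9)[OF alg]
lemmas linear_mult [mlin] = linear_mult1[OF alg] linear_mult2[OF alg]

lemma \<rho>_linear [mlin]: "\<rho> \<in> linear_maps K P PC"
  and \<sigma>_linear [mlin]: "\<sigma> \<in> linear_maps K P CP"
  using right_coaction left_coaction by (auto simp: right_coaction_def left_coaction_def)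

lemmas \<rho>_closed [simp, mlin] = linear_closed[OF \<rho>_linear]
lemmas \<sigma>_closed [simp, mlin] = linear_closed[OF \<sigma>_linear]
lemmas \<rho>_linear_comp [mlin] = linear_comp[OF \<rho>_linear]
lemmas \<sigma>_linear_comp [mlin] = linear_comp[OF \<sigma>_linear]

lemma mult_bilin: "bilin P P P (mult P)"
  by (assumption | rule mlin)+

definition lmul :: "'p \<Rightarrow> ('p \<times> 'c \<Rightarrow> 'k) set \<Rightarrow> ('p \<times> 'c \<Rightarrow> 'k) set" where
  "lmul p s = tlift PC (\<lambda>q d. tens K P C (p \<otimes>\<^bsub>P\<^esub> q) d) s"

lemma lmul_bilin: "bilin P PC PC lmul"
  unfolding lmul_def[abs_def] by (assumption | rule mlin)+

lemmas lmul_closed [simp, mlin] = bilinD(3)[OF lmul_bilin]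
lemmas lmul_linear [mlin] = linear_comp[OF bilinD(1)[OF lmul_bilin]] linear_comp[OF bilinD(2)[OF lmul_bilin]]

lemma tmap_lmul: "tmap K P C (\<lambda>q. p \<otimes>\<^bsub>P\<^esub> q) id = lmul p"
  by (simp add: fun_eq_iff tmap_def lmul_def)

lemma lmul_tens [simp]:
  assumes "p \<in> carrier P" "q \<in> carrier P" "d \<in> carrier C"
  shows "lmul p (tens K P C q d) = tens K P C (p \<otimes>\<^bsub>P\<^esub> q) d"
proof -
  have "bilin P C PC (\<lambda>q d. tens K P C (p \<otimes>\<^bsub>P\<^esub> q) d)" by (assumption | rule assms mlin)+
  then show ?thesis unfolding lmul_def using assms by (simp add: tlift_tens)
qed

lemma lmul_lmul:
  assumes "p \<in> carrier P" "q \<in> carrier P" "s \<in> carrier PC"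
  shows "lmul p (lmul q s) = lmul (p \<otimes>\<^bsub>P\<^esub> q) s"
  by (rule tensor_eqI[of P C PC "\<lambda>s. lmul p (lmul q s)"])
    (assumption | rule assms mlin | simp add: assms mult_assoc)+

lemma lmul_one [simp]:
  assumes "s \<in> carrier PC"
  shows "lmul \<one>\<^bsub>P\<^esub> s = s"
  by (rule tensor_eqI[of P C PC "\<lambda>s. lmul \<one>\<^bsub>P\<^esub> s" "\<lambda>s. s"])
    (assumption | rule assms mlin | simp add: assms)+

lemma tlift_lmul:
  assumes "module K M" "bilin P C M \<beta>" "p \<in> carrier P" "s \<in> carrier PC"
  shows "tlift M \<beta> (lmul p s) = tlift M (\<lambda>q d. \<beta> (p \<otimes>\<^bsub>P\<^esub> q) d) s"
  unfolding lmul_def using assms tmap_eval[of P C P C M \<beta> s "\<lambda>q. p \<otimes>\<^bsub>P\<^esub> q" "\<lambda>d. d"]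
  by (simp add: tmap_def)

abbreviation "B \<equiv> coinvariants K C P"

lemma coinvariants_iff: "b \<in> B \<longleftrightarrow> b \<in> carrier P \<and> (\<forall>p\<in>carrier P. \<rho> (b \<otimes>\<^bsub>P\<^esub> p) = lmul b (\<rho> p))"
  by (simp add: coinvariants_def tmap_lmul)

lemma coinvariants_closed: "b \<in> B \<Longrightarrow> b \<in> carrier P"
  and coinvariants_mult: "b \<in> B \<Longrightarrow> p \<in> carrier P \<Longrightarrow> \<rho> (b \<otimes>\<^bsub>P\<^esub> p) = lmul b (\<rho> p)"
  by (auto simp: coinvariants_iff)

lemma coinvariants_\<rho>: "b \<in> B \<Longrightarrow> \<rho> b = tens K P C b e"
  using coinvariants_mult[of b "\<one>\<^bsub>P\<^esub>"] coinvariants_closed[of b] by (simp add: \<rho>_one)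

lemma coinvariants_submodule: "submodule B K P"
proof (rule submoduleI')
  have z: "\<zero>\<^bsub>P\<^esub> \<otimes>\<^bsub>P\<^esub> p = \<zero>\<^bsub>P\<^esub>" if "p \<in> carrier P" for p using that by (simp add: ring.ring_simprules)
  show "\<zero>\<^bsub>P\<^esub> \<in> B" using linear_zero[OF bilinD(2)[OF lmul_bilin]] linear_zero[OF \<rho>_linear]
    by (simp add: coinvariants_iff z)
  show "x \<oplus>\<^bsub>P\<^esub> y \<in> B" if "x \<in> B" "y \<in> B" for x y
    using that linear_add[OF bilinD(2)[OF lmul_bilin]] linear_add[OF \<rho>_linear]
    by (simp add: coinvariants_iff ring.ring_simprules)
  show "a \<odot>\<^bsub>P\<^esub> x \<in> B" if "a \<in> carrier K" "x \<in> B" for a x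
    using that linear_smult[OF bilinD(2)[OF lmul_bilin]] linear_smult[OF \<rho>_linear]
    by (simp add: coinvariants_iff mult_smult)
qed (auto dest: coinvariants_closed)

lemma coinvariants_mult_closed:
  assumes "a \<in> B" "b \<in> B"
  shows "a \<otimes>\<^bsub>P\<^esub> b \<in> B"
  using assms by (simp add: coinvariants_iff mult_assoc lmul_lmul)

text \<open>The canonical map before balancing. A lift is a function on cosets, whatever the
  relators, so the same constant applied to cosets in \<open>BT\<close> is the canonical map proper;
  \<open>can_map_eq\<close> and \<open>can_linear\<close> rely on this.\<close>

definition canT :: "('p \<times> 'p \<Rightarrow> 'k) set \<Rightarrow> ('p \<times> 'c \<Rightarrow> 'k) set" where
  "canT = tlift PC (\<lambda>x y. lmul x (\<rho> y))"

lemma canT_linear: "canT \<in> linear_maps K (tensor K P P) PC"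
  unfolding canT_def by (rule tlift_linear; (assumption | rule mlin)+)

end

section \<open>Strong connections\<close>

locale pre_connection = coaug K C e P
  for K :: "'k ring" and C :: "('k, 'c) coalg" and e :: 'c and P :: "('k, 'p, 'c) coact_alg" +
  fixes l :: "'c \<Rightarrow> ('p \<times> 'p \<Rightarrow> 'k) set"
  assumes l_linear [mlin]: "l \<in> linear_maps K C (tensor K P P)"
begin

lemmas l_closed [simp, mlin] = linear_closed[OF l_linear]

text \<open>
  If \<open>canT (l c) = 1 \<otimes> c\<close>, this is the canonical entwining \<open>can (can\<^sup>-\<^sup>1 (1 \<otimes> c) p)\<close>, but it makes sense before
  the canonical map is known to be bijective.
\<close>

definition psi :: "'c \<Rightarrow> 'p \<Rightarrow> ('p \<times> 'c \<Rightarrow> 'k) set" where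
  "psi c p = tlift PC (\<lambda>x y. lmul x (\<rho> (y \<otimes>\<^bsub>P\<^esub> p))) (l c)"

lemma psi_bilin: "bilin C P PC psi"
  unfolding psi_def[abs_def] by (assumption | rule mlin)+

lemmas psi_closed [simp, mlin] = bilinD(3)[OF psi_bilin]
lemmas psi_linear [mlin] = linear_comp[OF bilinD(1)[OF psi_bilin]] linear_comp[OF bilinD(2)[OF psi_bilin]]

text \<open>The right \<open>P\<close>-module structure of \<open>P \<otimes> C\<close> given by the entwining.\<close>

definition ract :: "('p \<times> 'c \<Rightarrow> 'k) set \<Rightarrow> 'p \<Rightarrow> ('p \<times> 'c \<Rightarrow> 'k) set" where
  "ract s p = tlift PC (\<lambda>q d. lmul q (psi d p)) s"

lemma ract_bilin: "bilin PC P PC ract"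
  unfolding ract_def[abs_def] by (assumption | rule mlin)+

lemmas ract_closed [simp, mlin] = bilinD(3)[OF ract_bilin]
lemmas ract_linear [mlin] = linear_comp[OF bilinD(1)[OF ract_bilin]] linear_comp[OF bilinD(2)[OF ract_bilin]]

lemma ract_tens [simp]:
  assumes "p \<in> carrier P" "q \<in> carrier P" "d \<in> carrier C"
  shows "ract (tens K P C q d) p = lmul q (psi d p)"
  unfolding ract_def by (rule tlift_tens; (assumption | rule assms mlin)+)

lemma ract_lmul:
  assumes "p \<in> carrier P" "q \<in> carrier P" "s \<in> carrier PC"
  shows "ract (lmul q s) p = lmul q (ract s p)"
  by (rule tensor_eqI[of P C PC "\<lambda>s. ract (lmul q s) p"])
    (assumption | rule assms mlin | simp add: assms lmul_lmul)+

definition Psi :: "('c \<times> 'p \<Rightarrow> 'k) set \<Rightarrow> ('p \<times> 'c \<Rightarrow> 'k) set" where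
  "Psi = tlift PC psi"

lemma Psi_linear: "Psi \<in> linear_maps K CP PC"
  unfolding Psi_def by (rule tlift_linear; (assumption | rule mlin psi_bilin)+)

lemma Psi_tens: "c \<in> carrier C \<Longrightarrow> p \<in> carrier P \<Longrightarrow> Psi (tens K C P c p) = psi c p"
  unfolding Psi_def by (rule tlift_tens; (assumption | rule mlin psi_bilin)+)

text \<open>In Sweedler notation \<open>p_0 l(p_1)\<close>, the future splitting of the
  multiplication. It is kept in \<open>P \<otimes> P\<close> until its first leg is known to be
  coinvariant.\<close>

definition rsplit :: "'p \<Rightarrow> ('p \<times> 'p \<Rightarrow> 'k) set" where
  "rsplit p = tlift (tensor K P P) (\<lambda>p0 c. tlift (tensor K P P) (\<lambda>x y. tens K P P (p0 \<otimes>\<^bsub>P\<^esub> x) y) (l c)) (\<rho> p)"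

text \<open>The mirror image \<open>l(p_(-1)) p_(0)\<close> of \<open>rsplit\<close>, built from the
  left coaction; here the second leg turns out to be coinvariant.\<close>

definition lsplit :: "'p \<Rightarrow> ('p \<times> 'p \<Rightarrow> 'k) set" where
  "lsplit p = tlift (tensor K P P) (\<lambda>c p0. tlift (tensor K P P) (\<lambda>x y. tens K P P x (y \<otimes>\<^bsub>P\<^esub> p0)) (l c)) (\<sigma> p)"

lemma rsplit_linear [mlin]: "rsplit \<in> linear_maps K P (tensor K P P)"
  unfolding rsplit_def[abs_def] by (assumption | rule mlin)+

lemma lsplit_linear [mlin]: "lsplit \<in> linear_maps K P (tensor K P P)"
  unfolding lsplit_def[abs_def] by (assumption | rule mlin)+

lemmas rsplit_closed [simp, mlin] = linear_closed[OF rsplit_linear]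
lemmas lsplit_closed [simp, mlin] = linear_closed[OF lsplit_linear]

lemma tlift_rsplit:
  assumes M [simp, mlin]: "module K M" and F: "bilin P P M F" and p: "p \<in> carrier P"
  shows "tlift M F (rsplit p) = tlift M (\<lambda>p0 c. tlift M (\<lambda>x y. F (p0 \<otimes>\<^bsub>P\<^esub> x) y) (l c)) (\<rho> p)"
proof -
  have F1: "tlift M F \<in> linear_maps K (tensor K P P) M" using F by (intro tlift_linear) auto
  have F2: "tlift M F (tens K P P x y) = F x y" if "x \<in> carrier P" "y \<in> carrier P" for x y
    using that F by (intro tlift_tens) auto
  have "tlift M F (rsplit p) = tlift M (\<lambda>p0 c. tlift M (\<lambda>x y. tlift M F (tens K P P (p0 \<otimes>\<^bsub>P\<^esub> x) y)) (l c)) (\<rho> p)"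
    unfolding rsplit_def by (rule tlift_push2[OF F1]; (assumption | rule p mlin)+)
  also have "\<dots> = tlift M (\<lambda>p0 c. tlift M (\<lambda>x y. F (p0 \<otimes>\<^bsub>P\<^esub> x) y) (l c)) (\<rho> p)"
    by (rule tlift_cong2; (assumption | rule p mlin bilinD(3)[OF F] F2)+)
  finally show ?thesis .
qed

lemma tlift_lsplit:
  assumes M [simp, mlin]: "module K M" and F: "bilin P P M F" and p: "p \<in> carrier P"
  shows "tlift M F (lsplit p) = tlift M (\<lambda>c p0. tlift M (\<lambda>x y. F x (y \<otimes>\<^bsub>P\<^esub> p0)) (l c)) (\<sigma> p)"
proof -
  have F1: "tlift M F \<in> linear_maps K (tensor K P P) M" using F by (intro tlift_linear) auto
  have F2: "tlift M F (tens K P P x y) = F x y" if "x \<in> carrier P" "y \<in> carrier P" for x y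
    using that F by (intro tlift_tens) auto
  have "tlift M F (lsplit p) = tlift M (\<lambda>c p0. tlift M (\<lambda>x y. tlift M F (tens K P P x (y \<otimes>\<^bsub>P\<^esub> p0))) (l c)) (\<sigma> p)"
    unfolding lsplit_def by (rule tlift_push2[OF F1]; (assumption | rule p mlin)+)
  also have "\<dots> = tlift M (\<lambda>c p0. tlift M (\<lambda>x y. F x (y \<otimes>\<^bsub>P\<^esub> p0)) (l c)) (\<sigma> p)"
    by (rule tlift_cong2; (assumption | rule p mlin bilinD(3)[OF F] F2)+)
  finally show ?thesis .
qed

text \<open>\<open>canT\<close> carries right multiplication on the second leg to
  \<open>ract\<close>, because \<open>ract\<close> commutes with left multiplication. Hence the
  right-hand side depends on \<open>u\<close> only through \<open>canT u\<close>.\<close>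

lemma ract_canT:
  assumes E1: "\<And>p q. p \<in> carrier P \<Longrightarrow> q \<in> carrier P \<Longrightarrow> \<rho> (p \<otimes>\<^bsub>P\<^esub> q) = ract (\<rho> p) q"
    and u: "u \<in> carrier (tensor K P P)" and p: "p \<in> carrier P"
  shows "ract (canT u) p = tlift PC (\<lambda>x y. lmul x (\<rho> (y \<otimes>\<^bsub>P\<^esub> p))) u"
proof -
  have "ract (canT u) p = tlift PC (\<lambda>x y. ract (lmul x (\<rho> y)) p) u"
    unfolding canT_def by (rule tlift_push; (assumption | rule u p mlin)+)
  also have "\<dots> = tlift PC (\<lambda>x y. lmul x (\<rho> (y \<otimes>\<^bsub>P\<^esub> p))) u"
    by (rule tlift_cong; (assumption | rule u p mlin | simp add: ract_lmul p E1)+)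
  finally show ?thesis .
qed

end

text \<open>Isolates what can be established for the fibre product before its entwining is studied.
  Colinearity is assumed for the universal trilinear map only, since a locale assumption cannot
  range over modules of all types; \<open>l_right\<close> recovers the general form.\<close>

locale right_connection = pre_connection K C e P l
  for K :: "'k ring" and C :: "('k, 'c) coalg" and e :: 'c and P :: "('k, 'p, 'c) coact_alg"
    and l :: "'c \<Rightarrow> ('p \<times> 'p \<Rightarrow> 'k) set" +
  assumes l_mult: "c \<in> carrier C \<Longrightarrow> tlift P (mult P) (l c) = \<epsilon> c \<odot>\<^bsub>P\<^esub> \<one>\<^bsub>P\<^esub>"
    and l_right': "c \<in> carrier C \<Longrightarrow>
      tlift (tensor K P PC) (\<lambda>x y. tlift (tensor K P PC) (\<lambda>z d. tens K P PC x (tens K P C z d)) (\<rho> y)) (l c) =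
      tlift (tensor K P PC) (\<lambda>c1 c2. tlift (tensor K P PC) (\<lambda>x y. tens K P PC x (tens K P C y c2)) (l c1)) (\<Delta> c)"
begin

lemma l_right:
  assumes M [simp, mlin]: "module K M" and \<beta>: "trilin P P C M \<beta>" and c: "c \<in> carrier C"
  shows "tlift M (\<lambda>x y. tlift M (\<beta> x) (\<rho> y)) (l c) =
    tlift M (\<lambda>c1 c2. tlift M (\<lambda>x y. \<beta> x y c2) (l c1)) (\<Delta> c)"
proof -
  obtain F where F: "F \<in> linear_maps K (tensor K P PC) M"
    and F': "\<And>u v w. u \<in> carrier P \<Longrightarrow> v \<in> carrier P \<Longrightarrow> w \<in> carrier C \<Longrightarrow> F (tens K P PC u (tens K P C v w)) = \<beta> u v w"
    by (rule trilin_factor[OF _ _ _ _ \<beta>]) auto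
  have "tlift M (\<lambda>x y. tlift M (\<beta> x) (\<rho> y)) (l c) =
      tlift M (\<lambda>x y. tlift M (\<lambda>z d. F (tens K P PC x (tens K P C z d))) (\<rho> y)) (l c)"
    by (rule tlift_cong2; (assumption | rule c F'[symmetric] linear_closed[OF F] mlin)+)
  also have "\<dots> = F (tlift (tensor K P PC) (\<lambda>x y. tlift (tensor K P PC) (\<lambda>z d. tens K P PC x (tens K P C z d)) (\<rho> y)) (l c))"
    by (rule tlift_push2[OF F, symmetric]; (assumption | rule c mlin)+)
  also have "\<dots> = tlift M (\<lambda>c1 c2. tlift M (\<lambda>x y. F (tens K P PC x (tens K P C y c2))) (l c1)) (\<Delta> c)"
    unfolding l_right'[OF c] by (rule tlift_push2[OF F]; (assumption | rule c mlin)+)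
  also have "\<dots> = tlift M (\<lambda>c1 c2. tlift M (\<lambda>x y. \<beta> x y c2) (l c1)) (\<Delta> c)"
    by (rule tlift_cong2; (assumption | rule c F' trilinD(5)[OF \<beta>] mlin)+)
  finally show ?thesis .
qed

lemma l_mult_lift:
  assumes M [simp, mlin]: "module K M" and g: "g \<in> linear_maps K P M" and c: "c \<in> carrier C"
  shows "tlift M (\<lambda>x y. g (x \<otimes>\<^bsub>P\<^esub> y)) (l c) = \<epsilon> c \<odot>\<^bsub>M\<^esub> g \<one>\<^bsub>P\<^esub>"
proof -
  have "tlift M (\<lambda>x y. g (x \<otimes>\<^bsub>P\<^esub> y)) (l c) = g (tlift P (mult P) (l c))"
    by (rule tlift_push[OF _ _ g, symmetric]; (assumption | rule c mlin)+)
  then show ?thesis using c linear_smult[OF g] by (simp add: l_mult)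
qed

text \<open>Right colinearity of \<open>l\<close> turns \<open>x \<rho>(y)\<close> into
  \<open>x y \<otimes> c_2\<close> with \<open>x \<otimes> y = l(c_1)\<close>; the product
  \<open>x y\<close> collapses to \<open>\<epsilon>(c_1)\<close>, and the counit law leaves
  \<open>1 \<otimes> c\<close>.\<close>

lemma canT_l:
  assumes c: "c \<in> carrier C"
  shows "canT (l c) = tens K P C \<one>\<^bsub>P\<^esub> c"
proof -
  have "canT (l c) = tlift PC (\<lambda>c1 c2. tlift PC (\<lambda>x y. tens K P C (x \<otimes>\<^bsub>P\<^esub> y) c2) (l c1)) (\<Delta> c)"
    unfolding canT_def lmul_def by (rule l_right; (assumption | rule c mlin)+)
  also have "\<dots> = tlift PC (\<lambda>c1 c2. \<epsilon> c1 \<odot>\<^bsub>PC\<^esub> tens K P C \<one>\<^bsub>P\<^esub> c2) (\<Delta> c)"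
  proof (rule tlift_cong[OF _ _ comult_closed[OF c]])
    show "tlift PC (\<lambda>x y. tens K P C (x \<otimes>\<^bsub>P\<^esub> y) c2) (l c1) = \<epsilon> c1 \<odot>\<^bsub>PC\<^esub> tens K P C \<one>\<^bsub>P\<^esub> c2"
      if "c1 \<in> carrier C" "c2 \<in> carrier C" for c1 c2
      by (rule l_mult_lift; (assumption | rule that mlin)+)
  qed auto
  also have "\<dots> = tens K P C \<one>\<^bsub>P\<^esub> c"
    by (rule left_counit[OF left_comult]; (assumption | rule c mlin)+)
  finally show ?thesis .
qed

end

text \<open>
  The last three assumptions say that \<open>psi\<close> is an entwining for which the coactions of \<open>P\<close> are the two
  coactions induced by \<open>e\<close>. The remaining axioms of an entwining are consequences.
\<close>

locale strong_connection = right_connection K C e P l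
  for K :: "'k ring" and C :: "('k, 'c) coalg" and e :: 'c and P :: "('k, 'p, 'c) coact_alg"
    and l :: "'c \<Rightarrow> ('p \<times> 'p \<Rightarrow> 'k) set" +
  assumes l_left': "c \<in> carrier C \<Longrightarrow>
      tlift (tensor K C (tensor K P P))
        (\<lambda>x y. tlift (tensor K C (tensor K P P)) (\<lambda>d z. tens K C (tensor K P P) d (tens K P P z y)) (\<sigma> x)) (l c) =
      tlift (tensor K C (tensor K P P))
        (\<lambda>c1 c2. tlift (tensor K C (tensor K P P)) (\<lambda>x y. tens K C (tensor K P P) c1 (tens K P P x y)) (l c2)) (\<Delta> c)"
    and \<rho>_mult: "p \<in> carrier P \<Longrightarrow> q \<in> carrier P \<Longrightarrow> \<rho> (p \<otimes>\<^bsub>P\<^esub> q) = ract (\<rho> p) q"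
    and Psi_\<sigma>: "p \<in> carrier P \<Longrightarrow> Psi (\<sigma> p) = tens K P C p e"
    and Psi_inj: "inj_on Psi (carrier CP)"
begin

lemma l_left:
  assumes M [simp, mlin]: "module K M" and \<beta>: "trilin C P P M \<beta>" and c: "c \<in> carrier C"
  shows "tlift M (\<lambda>x y. tlift M (\<lambda>d z. \<beta> d z y) (\<sigma> x)) (l c) =
    tlift M (\<lambda>c1 c2. tlift M (\<beta> c1) (l c2)) (\<Delta> c)"
proof -
  let ?T = "tensor K C (tensor K P P)"
  obtain F where F: "F \<in> linear_maps K ?T M"
    and F': "\<And>u v w. u \<in> carrier C \<Longrightarrow> v \<in> carrier P \<Longrightarrow> w \<in> carrier P \<Longrightarrow> F (tens K C (tensor K P P) u (tens K P P v w)) = \<beta> u v w"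
    by (rule trilin_factor[OF _ _ _ _ \<beta>]) auto
  have "tlift M (\<lambda>x y. tlift M (\<lambda>d z. \<beta> d z y) (\<sigma> x)) (l c) =
      tlift M (\<lambda>x y. tlift M (\<lambda>d z. F (tens K C (tensor K P P) d (tens K P P z y))) (\<sigma> x)) (l c)"
    by (rule tlift_cong2; (assumption | rule c F'[symmetric] linear_closed[OF F] mlin)+)
  also have "\<dots> = F (tlift ?T (\<lambda>x y. tlift ?T (\<lambda>d z. tens K C (tensor K P P) d (tens K P P z y)) (\<sigma> x)) (l c))"
    by (rule tlift_push2[OF F, symmetric]; (assumption | rule c mlin)+)
  also have "\<dots> = tlift M (\<lambda>c1 c2. tlift M (\<lambda>x y. F (tens K C (tensor K P P) c1 (tens K P P x y))) (l c2)) (\<Delta> c)"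
    unfolding l_left'[OF c] by (rule tlift_push2[OF F]; (assumption | rule c mlin)+)
  also have "\<dots> = tlift M (\<lambda>c1 c2. tlift M (\<beta> c1) (l c2)) (\<Delta> c)"
    by (rule tlift_cong2; (assumption | rule c F' trilinD(5)[OF \<beta>] mlin)+)
  finally show ?thesis .
qed

text \<open>Every lift \<open>u\<close> of \<open>1 \<otimes> c\<close> along \<open>canT\<close>
  computes the same entwining. Naturality of \<open>psi\<close> can therefore be proved for
  morphisms that do not respect the chosen connections.\<close>

lemma psi_of_lift:
  assumes "u \<in> carrier (tensor K P P)" "canT u = tens K P C \<one>\<^bsub>P\<^esub> c" "c \<in> carrier C" "p \<in> carrier P"
  shows "tlift PC (\<lambda>x y. lmul x (\<rho> (y \<otimes>\<^bsub>P\<^esub> p))) u = psi c p"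
  using ract_canT[OF \<rho>_mult assms(1,4)] assms by simp

text \<open>Compatibility of an entwining with multiplication; it is \<open>\<rho>_mult\<close> for
  \<open>(y p) q\<close>, applied under the lift over \<open>l c\<close>.\<close>

lemma psi_mult:
  assumes c: "c \<in> carrier C" and p: "p \<in> carrier P" and q: "q \<in> carrier P"
  shows "psi c (p \<otimes>\<^bsub>P\<^esub> q) = ract (psi c p) q"
proof -
  have "ract (psi c p) q = tlift PC (\<lambda>x y. ract (lmul x (\<rho> (y \<otimes>\<^bsub>P\<^esub> p))) q) (l c)"
    unfolding psi_def by (rule tlift_push; (assumption | rule c p q mlin)+)
  also have "\<dots> = psi c (p \<otimes>\<^bsub>P\<^esub> q)"
    unfolding psi_def
    by (rule tlift_cong; (assumption | rule c p q mlin | simp add: ract_lmul p q mult_assoc \<rho>_mult[symmetric])+)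
  finally show ?thesis by simp
qed

lemma psi_e: "q \<in> carrier P \<Longrightarrow> psi e q = \<rho> q"
  using \<rho>_mult[of "\<one>\<^bsub>P\<^esub>" q] by (simp add: \<rho>_one)

text \<open>With an entwining, \<open>\<rho> (b p) = b \<psi>(e \<otimes> p) = b \<rho>(p)\<close>
  as soon as \<open>\<rho> b = b \<otimes> e\<close>. Coinvariants thus become the kernel of a
  linear map.\<close>

lemma coinvariantsI:
  assumes "b \<in> carrier P" "\<rho> b = tens K P C b e"
  shows "b \<in> B"
  using assms by (simp add: coinvariants_iff \<rho>_mult psi_e)

text \<open>Left colinearity of \<open>l\<close> in terms of the entwining: it replaces
  \<open>c_1 \<otimes> l(c_2)\<close> by the left coaction on the first leg, and \<open>Psi\<close>
  sends \<open>\<sigma> x\<close> to \<open>x \<otimes> e\<close>.\<close>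

lemma l_left_psi:
  assumes M [simp, mlin]: "module K M" and \<beta>: "trilin P C P M \<beta>" and c: "c \<in> carrier C"
  shows "tlift M (\<lambda>c1 c2. tlift M (\<lambda>x y. tlift M (\<lambda>z d. \<beta> z d y) (psi c1 x)) (l c2)) (\<Delta> c) =
    tlift M (\<lambda>x y. \<beta> x e y) (l c)"
proof -
  have b [mlin]: "bilin P C M (\<lambda>z d. \<beta> z d y)" if "y \<in> carrier P" for y
    using trilinD[OF \<beta>] that by (intro bilinI) auto
  have b' [mlin]: "(\<lambda>y. \<beta> z d y) \<in> linear_maps K P M" if "z \<in> carrier P" "d \<in> carrier C" for z d
    using trilinD[OF \<beta>] that by auto
  have "tlift M (\<lambda>c1 c2. tlift M (\<lambda>x y. tlift M (\<lambda>z d. \<beta> z d y) (psi c1 x)) (l c2)) (\<Delta> c) =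
      tlift M (\<lambda>x y. tlift M (\<lambda>d z. tlift M (\<lambda>z d. \<beta> z d y) (psi d z)) (\<sigma> x)) (l c)"
    by (rule l_left[symmetric]; (assumption | rule c b b' mlin)+)
  also have "\<dots> = tlift M (\<lambda>x y. \<beta> x e y) (l c)"
  proof (rule tlift_cong[OF _ _ l_closed[OF c]])
    fix x y assume x: "x \<in> carrier P" and y: "y \<in> carrier P"
    have "tlift M (\<lambda>d z. tlift M (\<lambda>z d. \<beta> z d y) (psi d z)) (\<sigma> x) = tlift M (\<lambda>z d. \<beta> z d y) (Psi (\<sigma> x))"
      unfolding Psi_def using b[OF y]
      by (intro tlift_push[symmetric, of C P _ PC] tlift_linear) (auto simp: x)
    also have "\<dots> = \<beta> x e y" using x y b[OF y] by (simp add: Psi_\<sigma> tlift_tens)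
    finally show "tlift M (\<lambda>d z. tlift M (\<lambda>z d. \<beta> z d y) (psi d z)) (\<sigma> x) = \<beta> x e y" .
  qed (use trilinD(5)[OF \<beta>] in auto)
  finally show ?thesis .
qed

text \<open>Says that the first leg of \<open>p_0 l(p_1)\<close> is coinvariant. Indeed
  \<open>\<rho> (p_0 x) = p_00 \<psi>(p_01 \<otimes> x)\<close>; coassociativity makes the entwined
  factor and the argument of \<open>l\<close> two parts of the same coproduct, and
  \<open>l_left_psi\<close> gives \<open>e\<close>.\<close>

lemma rsplit_coinvariant:
  assumes M [simp, mlin]: "module K M" and \<beta>: "trilin P C P M \<beta>" and p: "p \<in> carrier P"
  shows "tlift M (\<lambda>u y. tlift M (\<lambda>z d. \<beta> z d y) (\<rho> u)) (rsplit p) = tlift M (\<lambda>u y. \<beta> u e y) (rsplit p)"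
proof -
  have b1 [mlin]: "bilin P C M (\<lambda>z d. \<beta> z d y)" if "y \<in> carrier P" for y
    using trilinD[OF \<beta>] that by (intro bilinI) auto
  note b2 [mlin] = linear_comp[OF trilinD(2)[OF \<beta>]] linear_comp[OF trilinD(3)[OF \<beta>]]
    linear_comp[OF trilinD(4)[OF \<beta>]] trilinD(5)[OF \<beta>]
  have eq: "tlift M (\<lambda>z d. \<beta> z d y) (\<rho> (p0 \<otimes>\<^bsub>P\<^esub> x)) =
      tlift M (\<lambda>z d. tlift M (\<lambda>z' d'. \<beta> (z \<otimes>\<^bsub>P\<^esub> z') d' y) (psi d x)) (\<rho> p0)"
    if p0: "p0 \<in> carrier P" and x: "x \<in> carrier P" and y: "y \<in> carrier P" for p0 x y
  proof -
    have "tlift M (\<lambda>z d. \<beta> z d y) (\<rho> (p0 \<otimes>\<^bsub>P\<^esub> x)) =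
        tlift M (\<lambda>z d. tlift M (\<lambda>z d. \<beta> z d y) (lmul z (psi d x))) (\<rho> p0)"
      unfolding \<rho>_mult[OF p0 x] ract_def
      by (rule tlift_push[OF _ _ tlift_linear]; (assumption | rule p0 x y mlin)+)
    also have "\<dots> = tlift M (\<lambda>z d. tlift M (\<lambda>z' d'. \<beta> (z \<otimes>\<^bsub>P\<^esub> z') d' y) (psi d x)) (\<rho> p0)"
      by (rule tlift_cong; (assumption | rule p0 x y tlift_lmul mlin)+)
    finally show ?thesis .
  qed
  have "tlift M (\<lambda>u y. tlift M (\<lambda>z d. \<beta> z d y) (\<rho> u)) (rsplit p) =
      tlift M (\<lambda>p0 c. tlift M (\<lambda>x y. tlift M (\<lambda>z d. \<beta> z d y) (\<rho> (p0 \<otimes>\<^bsub>P\<^esub> x))) (l c)) (\<rho> p)"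
    by (rule tlift_rsplit; (assumption | rule p mlin)+)
  also have "\<dots> = tlift M (\<lambda>p0 c. tlift M (\<lambda>x y.
      tlift M (\<lambda>z d. tlift M (\<lambda>z' d'. \<beta> (z \<otimes>\<^bsub>P\<^esub> z') d' y) (psi d x)) (\<rho> p0)) (l c)) (\<rho> p)"
    by (rule tlift_cong2; (assumption | rule p eq mlin)+)
  also have "\<dots> = tlift M (\<lambda>p0 c. tlift M (\<lambda>z d. tlift M (\<lambda>x y.
      tlift M (\<lambda>z' d'. \<beta> (z \<otimes>\<^bsub>P\<^esub> z') d' y) (psi d x)) (l c)) (\<rho> p0)) (\<rho> p)"
    by (rule tlift_cong, (assumption | rule p mlin)+, rule tlift_swap; (assumption | rule p mlin)+)
  also have "\<dots> = tlift M (\<lambda>p0 c. tlift M (\<lambda>c1 c2. tlift M (\<lambda>x y.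
      tlift M (\<lambda>z' d'. \<beta> (p0 \<otimes>\<^bsub>P\<^esub> z') d' y) (psi c1 x)) (l c2)) (\<Delta> c)) (\<rho> p)"
    by (rule right_coassoc[OF right_coaction]; (assumption | rule p mlin)+)
  also have "\<dots> = tlift M (\<lambda>p0 c. tlift M (\<lambda>x y. \<beta> (p0 \<otimes>\<^bsub>P\<^esub> x) e y) (l c)) (\<rho> p)"
    by (rule tlift_cong, (assumption | rule p mlin)+, rule l_left_psi; (assumption | rule p mlin)+)
  also have "\<dots> = tlift M (\<lambda>u y. \<beta> u e y) (rsplit p)"
    by (rule tlift_rsplit[symmetric]; (assumption | rule p mlin)+)
  finally show ?thesis .
qed

text \<open>The second leg is treated from the other side:
  \<open>\<rho> (y p0) = y_0 \<psi>(y_1 \<otimes> p0)\<close>, right colinearity of \<open>l\<close>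
  replaces \<open>y_1\<close> by a part of the coproduct of \<open>c\<close>, left coassociativity
  makes this the left coaction of \<open>p0\<close>, and \<open>Psi_\<sigma>\<close> gives
  \<open>e\<close>.\<close>

lemma lsplit_coinvariant:
  assumes M [simp, mlin]: "module K M" and \<beta>: "trilin P P C M \<beta>" and p: "p \<in> carrier P"
  shows "tlift M (\<lambda>x u. tlift M (\<beta> x) (\<rho> u)) (lsplit p) = tlift M (\<lambda>x u. \<beta> x u e) (lsplit p)"
proof -
  have b1 [mlin]: "bilin P C M (\<beta> x)" if "x \<in> carrier P" for x
    using trilinD[OF \<beta>] that by auto
  note b2 [mlin] = linear_comp[OF trilinD(2)[OF \<beta>]] linear_comp[OF trilinD(3)[OF \<beta>]]
    linear_comp[OF trilinD(4)[OF \<beta>]] trilinD(5)[OF \<beta>]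
  have eq: "tlift M (\<beta> x) (\<rho> (y \<otimes>\<^bsub>P\<^esub> p0)) = tlift M (\<lambda>z d. tlift M (\<beta> x) (lmul z (psi d p0))) (\<rho> y)"
    if p0: "p0 \<in> carrier P" and x: "x \<in> carrier P" and y: "y \<in> carrier P" for p0 x y
    unfolding \<rho>_mult[OF y p0] ract_def
    by (rule tlift_push[OF _ _ tlift_linear]; (assumption | rule p0 x y mlin)+)
  have eq2: "tlift M (\<lambda>d z. tlift M (\<beta> x) (lmul y (psi d z))) (\<sigma> p0) = \<beta> x (y \<otimes>\<^bsub>P\<^esub> p0) e"
    if p0: "p0 \<in> carrier P" and x: "x \<in> carrier P" and y: "y \<in> carrier P" for p0 x y
  proof -
    have "tlift M (\<lambda>d z. tlift M (\<beta> x) (lmul y (psi d z))) (\<sigma> p0) = tlift M (\<beta> x) (lmul y (Psi (\<sigma> p0)))"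
      unfolding Psi_def
      by (rule tlift_push[symmetric, where g = "\<lambda>s. tlift M (\<beta> x) (lmul y s)"]; (assumption | rule p0 x y mlin)+)
    then show ?thesis using p0 x y by (simp add: Psi_\<sigma> tlift_tens[OF _ _ _ b1])
  qed
  have "tlift M (\<lambda>x u. tlift M (\<beta> x) (\<rho> u)) (lsplit p) =
      tlift M (\<lambda>c p0. tlift M (\<lambda>x y. tlift M (\<beta> x) (\<rho> (y \<otimes>\<^bsub>P\<^esub> p0))) (l c)) (\<sigma> p)"
    by (rule tlift_lsplit; (assumption | rule p mlin)+)
  also have "\<dots> = tlift M (\<lambda>c p0. tlift M (\<lambda>x y.
      tlift M (\<lambda>z d. tlift M (\<beta> x) (lmul z (psi d p0))) (\<rho> y)) (l c)) (\<sigma> p)"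
    by (rule tlift_cong2; (assumption | rule p eq mlin)+)
  also have "\<dots> = tlift M (\<lambda>c p0. tlift M (\<lambda>c1 c2. tlift M (\<lambda>x y.
      tlift M (\<beta> x) (lmul y (psi c2 p0))) (l c1)) (\<Delta> c)) (\<sigma> p)"
    by (rule tlift_cong, (assumption | rule p mlin)+, rule l_right; (assumption | rule p mlin)+)
  also have "\<dots> = tlift M (\<lambda>c p0. tlift M (\<lambda>d z. tlift M (\<lambda>x y.
      tlift M (\<beta> x) (lmul y (psi d z))) (l c)) (\<sigma> p0)) (\<sigma> p)"
    by (rule left_coassoc[OF left_coaction, symmetric]; (assumption | rule p mlin)+)
  also have "\<dots> = tlift M (\<lambda>c p0. tlift M (\<lambda>x y. tlift M (\<lambda>d z.
      tlift M (\<beta> x) (lmul y (psi d z))) (\<sigma> p0)) (l c)) (\<sigma> p)"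
    by (rule tlift_cong, (assumption | rule p mlin)+, rule tlift_swap; (assumption | rule p mlin)+)
  also have "\<dots> = tlift M (\<lambda>c p0. tlift M (\<lambda>x y. \<beta> x (y \<otimes>\<^bsub>P\<^esub> p0) e) (l c)) (\<sigma> p)"
    by (rule tlift_cong2; (assumption | rule p eq2 mlin)+)
  also have "\<dots> = tlift M (\<lambda>x u. \<beta> x u e) (lsplit p)"
    by (rule tlift_lsplit[symmetric]; (assumption | rule p mlin)+)
  finally show ?thesis .
qed

end

section \<open>Strong connections give principal extensions\<close>

context coaug
begin

abbreviation "BT \<equiv> btensor K P B"

lemma B_subset: "B \<subseteq> carrier P"
  by (auto dest: coinvariants_closed)

lemma module_BT [simp, mlin]: "module K BT"
  by (intro module_btensor B_subset) auto

lemma btens_bilin_BT: "bilin P P BT (btens K P B)"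
  by (intro btens_bilin B_subset) auto

lemmas btens_closed [simp, mlin] = bilinD(3)[OF btens_bilin_BT]
lemmas btens_linear [mlin] =
  linear_comp[OF bilinD(1)[OF btens_bilin_BT]] linear_comp[OF bilinD(2)[OF btens_bilin_BT]]

lemma btens_move: "p \<in> carrier P \<Longrightarrow> b \<in> B \<Longrightarrow> q \<in> carrier P \<Longrightarrow>
    btens K P B (p \<otimes>\<^bsub>P\<^esub> b) q = btens K P B p (b \<otimes>\<^bsub>P\<^esub> q)"
  by (rule btens_balanced[OF _ _ B_subset]) auto

lemma BT_eqI:
  assumes M: "module K M" and g: "g \<in> linear_maps K BT M" and h: "h \<in> linear_maps K BT M"
    and eq: "\<And>x y. x \<in> carrier P \<Longrightarrow> y \<in> carrier P \<Longrightarrow> g (btens K P B x y) = h (btens K P B x y)"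
    and t: "t \<in> carrier BT"
  shows "g t = h t"
proof (rule pres_linear_eq[OF btensor_rels_closed[OF module_P ring_P B_subset] M])
  show "g (pres_gen K (carrier P \<times> carrier P) (btensor_rels K P B) x) =
      h (pres_gen K (carrier P \<times> carrier P) (btensor_rels K P B) x)" if "x \<in> carrier P \<times> carrier P" for x
  proof -
    obtain y z where "x = (y, z)" "y \<in> carrier P" "z \<in> carrier P" using \<open>x \<in> carrier P \<times> carrier P\<close> by blast
    then show ?thesis using eq[of y z] by (simp add: btens_def)
  qed
qed (use g h t in \<open>simp_all add: btensor_def\<close>)

context
  fixes M :: "('k, 'x, 'n) module_scheme" and \<beta>
  assumes M: "module K M" and \<beta>: "bilin P P M \<beta>"
    and bal: "\<And>p b q. p \<in> carrier P \<Longrightarrow> b \<in> B \<Longrightarrow> q \<in> carrier P \<Longrightarrow> \<beta> (p \<otimes>\<^bsub>P\<^esub> b) q = \<beta> p (b \<otimes>\<^bsub>P\<^esub> q)"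
begin

lemma BT_lift_linear: "tlift M \<beta> \<in> linear_maps K BT M"
  unfolding btensor_def
  by (rule pres_lift_linear[OF btensor_rels_closed[OF module_P ring_P B_subset] M])
    (auto intro: bilinD(3)[OF \<beta>] lincomb_btensor_rels[OF module_P ring_P B_subset M \<beta> bal])

lemma BT_lift_btens:
  assumes "x \<in> carrier P" "y \<in> carrier P"
  shows "tlift M \<beta> (btens K P B x y) = \<beta> x y"
  unfolding btens_def
  by (subst pres_lift_gen[OF btensor_rels_closed[OF module_P ring_P B_subset] M])
    (auto intro: assms bilinD(3)[OF \<beta>] lincomb_btensor_rels[OF module_P ring_P B_subset M \<beta> bal])

lemma BT_lift_proj:
  assumes u: "u \<in> carrier (tensor K P P)"
  shows "tlift M \<beta> (tlift BT (btens K P B) u) = tlift M \<beta> u"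
proof -
  have "tlift M \<beta> (tlift BT (btens K P B) u) = tlift M (\<lambda>x y. tlift M \<beta> (btens K P B x y)) u"
    by (rule tlift_push[OF _ _ BT_lift_linear u]) (auto simp: M)
  also have "\<dots> = tlift M \<beta> u"
    by (rule tlift_cong[OF _ _ u M]) (auto simp: BT_lift_btens intro: bilinD(3)[OF \<beta>])
  finally show ?thesis .
qed

end

lemma can_balanced: "p \<in> carrier P \<Longrightarrow> b \<in> B \<Longrightarrow> q \<in> carrier P \<Longrightarrow>
    lmul (p \<otimes>\<^bsub>P\<^esub> b) (\<rho> q) = lmul p (\<rho> (b \<otimes>\<^bsub>P\<^esub> q))"
  using coinvariants_closed[of b] by (simp add: coinvariants_mult lmul_lmul)

lemma can_bilin: "bilin P P PC (\<lambda>x y. lmul x (\<rho> y))"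
  by (assumption | rule mlin)+

lemma can_map_eq: "can_map K C P = canT"
  by (simp add: can_map_def canT_def tmap_lmul)

lemma can_linear: "canT \<in> linear_maps K BT PC"
  unfolding canT_def by (rule BT_lift_linear[OF _ can_bilin can_balanced]) auto

lemma can_btens: "x \<in> carrier P \<Longrightarrow> y \<in> carrier P \<Longrightarrow> canT (btens K P B x y) = lmul x (\<rho> y)"
  unfolding canT_def by (rule BT_lift_btens[OF _ can_bilin can_balanced]) auto

lemma can_proj: "u \<in> carrier (tensor K P P) \<Longrightarrow> canT (tlift BT (btens K P B) u) = canT u"
  unfolding canT_def by (rule BT_lift_proj[OF _ can_bilin can_balanced]) auto

abbreviation "BP \<equiv> P\<lparr>carrier := B\<rparr>"

lemma module_BP [simp, mlin]: "module K BP"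
  using submodule.submodule_is_module[OF coinvariants_submodule module_P] .

lemma BP_linear:
  assumes f: "f \<in> linear_maps K P M"
  shows "f \<in> linear_maps K BP M"
  using f coinvariants_closed by (auto simp: linear_maps_def)

end

context pre_connection
begin

text \<open>The preimage of \<open>1 \<otimes> c\<close> under the canonical map is the class of
  \<open>l c\<close>, and the right action on classes can be computed on that representative. The
  defining formula of the entwining then unfolds to \<open>psi\<close>.\<close>

lemma entwining_eq_Psi:
  assumes can: "can_bijective K C P" and canl: "\<And>c. c \<in> carrier C \<Longrightarrow> canT (l c) = tens K P C \<one>\<^bsub>P\<^esub> c"
    and t: "t \<in> carrier CP"
  shows "entwining K C P t = Psi t"
proof -
  let ?pr = "tlift BT (btens K P B)"
  define act where "act p = tlift BT (\<lambda>x y. btens K P B x (y \<otimes>\<^bsub>P\<^esub> p))" for p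
  have pr: "?pr (l c) \<in> carrier BT" if "c \<in> carrier C" for c by (assumption | rule that mlin)+
  have inj: "inj_on canT (carrier BT)" using can by (simp add: can_bijective_def can_map_eq bij_betw_def)
  have "canT (act p (inv_into (carrier BT) canT (tens K P C \<one>\<^bsub>P\<^esub> c))) = psi c p"
    if c: "c \<in> carrier C" and p: "p \<in> carrier P" for c p
  proof -
    have "inv_into (carrier BT) canT (tens K P C \<one>\<^bsub>P\<^esub> c) = ?pr (l c)"
      by (rule inv_into_f_eq[OF inj pr[OF c]]) (simp add: can_proj c canl)
    moreover have "act p (?pr (l c)) = tlift BT (\<lambda>x y. btens K P B x (y \<otimes>\<^bsub>P\<^esub> p)) (l c)"
      unfolding act_def
    proof (rule BT_lift_proj)
      show "bilin P P BT (\<lambda>x y. btens K P B x (y \<otimes>\<^bsub>P\<^esub> p))" by (assumption | rule p mlin)+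
    qed (auto simp: p c btens_move mult_assoc coinvariants_closed)
    moreover have "canT \<dots> = tlift PC (\<lambda>x y. canT (btens K P B x (y \<otimes>\<^bsub>P\<^esub> p))) (l c)"
      by (rule tlift_push[OF _ _ can_linear]; (assumption | rule p c mlin)+)
    moreover have "\<dots> = psi c p" unfolding psi_def
      by (rule tlift_cong[of P P]) (auto simp: c p can_btens)
    ultimately show ?thesis by simp
  qed
  then show ?thesis
    unfolding entwining_def Let_def Psi_def can_map_eq act_def
    by (intro tlift_cong[OF _ _ t]) auto
qed

end

context strong_connection
begin

text \<open>
  \<open>rsplit p\<close> lies in \<open>B \<otimes> P\<close>. Instead of identifying \<open>B \<otimes> P\<close> with a kernel in \<open>P \<otimes> P\<close>, its first leg is moved into
  \<open>B\<close> by a linear projection \<open>kappa\<close> of \<open>P\<close> onto \<open>B\<close>, which does not change it (\<open>kappa_rsplit\<close>).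
\<close>

definition coinv_defect :: "'p \<Rightarrow> ('p \<times> 'c \<Rightarrow> 'k) set" where
  "coinv_defect x = \<rho> x \<ominus>\<^bsub>PC\<^esub> tens K P C x e"

lemma coinv_defect_linear: "coinv_defect \<in> linear_maps K P PC"
  unfolding coinv_defect_def[abs_def] by (rule linear_minus; (assumption | rule mlin)+)

lemma coinv_defect_iff: "x \<in> carrier P \<Longrightarrow> coinv_defect x = \<zero>\<^bsub>PC\<^esub> \<longleftrightarrow> x \<in> B"
  using coinvariantsI coinvariants_\<rho> by (auto simp: coinv_defect_def diff_eq_zero_iff)

text \<open>A pseudo-inverse \<open>h\<close> of the defect \<open>d\<close>. Since \<open>B\<close>
  is the kernel of \<open>d\<close>, the map \<open>id - h d\<close> projects onto \<open>B\<close>;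
  this is \<open>kappa\<close>.\<close>

definition defect_inv :: "('p \<times> 'c \<Rightarrow> 'k) set \<Rightarrow> 'p" where
  "defect_inv = (SOME h. h \<in> linear_maps K PC P \<and>
    (\<forall>x\<in>carrier P. coinv_defect (h (coinv_defect x)) = coinv_defect x))"

lemma defect_inv_linear: "defect_inv \<in> linear_maps K PC P"
  and defect_inv: "x \<in> carrier P \<Longrightarrow> coinv_defect (defect_inv (coinv_defect x)) = coinv_defect x"
proof -
  have "\<exists>h. h \<in> linear_maps K PC P \<and> (\<forall>x\<in>carrier P. coinv_defect (h (coinv_defect x)) = coinv_defect x)"
    by (rule pseudo_inverse_exists[OF _ _ coinv_defect_linear]) auto
  from someI_ex[OF this] show "defect_inv \<in> linear_maps K PC P"
    "x \<in> carrier P \<Longrightarrow> coinv_defect (defect_inv (coinv_defect x)) = coinv_defect x"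
    unfolding defect_inv_def by blast+
qed

lemmas defect_closed [simp, mlin] = linear_closed[OF coinv_defect_linear] linear_closed[OF defect_inv_linear]
lemmas defect_linear_comp [mlin] = linear_comp[OF coinv_defect_linear] linear_comp[OF defect_inv_linear]

definition kappa :: "'p \<Rightarrow> 'p" where
  "kappa x = x \<ominus>\<^bsub>P\<^esub> defect_inv (coinv_defect x)"

lemma kappa_linear: "kappa \<in> linear_maps K P P"
  unfolding kappa_def[abs_def] by (rule linear_minus; (assumption | rule mlin)+)

lemmas kappa_closed [simp, mlin] = linear_closed[OF kappa_linear]

lemma kappa_coinvariant: "x \<in> carrier P \<Longrightarrow> kappa x \<in> B"
  using linear_diff[OF coinv_defect_linear, of x "defect_inv (coinv_defect x)"] defect_inv[of x]
  by (simp add: kappa_def flip: coinv_defect_iff)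

lemma kappa_id: "b \<in> B \<Longrightarrow> kappa b = b"
  using coinv_defect_iff[of b] coinvariants_closed[of b] linear_zero[OF defect_inv_linear]
    diff_add_cancel(1)[of P b "\<zero>\<^bsub>P\<^esub>"]
  by (simp add: kappa_def)

context
  fixes M :: "('k, 'x, 'n) module_scheme" and F :: "'p \<Rightarrow> 'p \<Rightarrow> 'x"
  assumes M [simp, mlin]: "module K M" and F: "bilin P P M F"
begin

text \<open>Here \<open>kappa u = u - (h(\<rho> u) - h(u \<otimes> e))\<close> with \<open>h\<close>
  the map \<open>defect_inv\<close>, and the two terms in the bracket have the same lift over
  \<open>rsplit p\<close> by \<open>rsplit_coinvariant\<close>.\<close>

lemma kappa_rsplit:
  assumes p: "p \<in> carrier P"
  shows "tlift M (\<lambda>u y. F (kappa u) y) (rsplit p) = tlift M F (rsplit p)"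
proof -
  note [mlin] = linear_comp[OF bilinD(1)[OF F]] linear_comp[OF bilinD(2)[OF F]] bilinD(3)[OF F]
  have t: "tlift M (\<lambda>z d. F (defect_inv (tens K P C z d)) y) (\<rho> u) = F (defect_inv (\<rho> u)) y"
    if u: "u \<in> carrier P" and y: "y \<in> carrier P" for u y
  proof -
    have "tlift M (\<lambda>z d. F (defect_inv (tens K P C z d)) y) (\<rho> u) = F (defect_inv (tlift PC (tens K P C) (\<rho> u))) y"
      by (rule tlift_push[symmetric, where g = "\<lambda>s. F (defect_inv s) y"]; (assumption | rule u y mlin)+)
    then show ?thesis using u by (simp add: tlift_id)
  qed
  have "tlift M (\<lambda>u y. F (defect_inv (\<rho> u)) y) (rsplit p) =
      tlift M (\<lambda>u y. tlift M (\<lambda>z d. F (defect_inv (tens K P C z d)) y) (\<rho> u)) (rsplit p)"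
    by (rule tlift_cong; (assumption | rule p t[symmetric] mlin)+)
  also have "\<dots> = tlift M (\<lambda>u y. F (defect_inv (tens K P C u e)) y) (rsplit p)"
    by (rule rsplit_coinvariant; (assumption | rule p mlin)+)
  finally have eq: "tlift M (\<lambda>u y. F (defect_inv (\<rho> u)) y) (rsplit p) =
    tlift M (\<lambda>u y. F (defect_inv (tens K P C u e)) y) (rsplit p)" .
  have k: "F (kappa u) y = F u y \<ominus>\<^bsub>M\<^esub> (F (defect_inv (\<rho> u)) y \<ominus>\<^bsub>M\<^esub> F (defect_inv (tens K P C u e)) y)"
    if "u \<in> carrier P" "y \<in> carrier P" for u y
    using that linear_diff[OF bilinD(2)[OF F]] linear_diff[OF defect_inv_linear]
    by (simp add: kappa_def coinv_defect_def)
  have cl: "F u y \<in> carrier M" "F (defect_inv (\<rho> u)) y \<in> carrier M" "F (defect_inv (tens K P C u e)) y \<in> carrier M"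
    if "u \<in> carrier P" "y \<in> carrier P" for u y
    using that by (auto intro!: bilinD(3)[OF F])
  have "tlift M (\<lambda>u y. F (kappa u) y) (rsplit p) = tlift M (\<lambda>u y.
      F u y \<ominus>\<^bsub>M\<^esub> (F (defect_inv (\<rho> u)) y \<ominus>\<^bsub>M\<^esub> F (defect_inv (tens K P C u e)) y)) (rsplit p)"
    using p by (intro tlift_cong[of P P]) (auto simp: k cl)
  also have "\<dots> = tlift M F (rsplit p) \<ominus>\<^bsub>M\<^esub> tlift M (\<lambda>u y.
      F (defect_inv (\<rho> u)) y \<ominus>\<^bsub>M\<^esub> F (defect_inv (tens K P C u e)) y) (rsplit p)"
    using p by (intro tlift_diff[of P P]) (auto simp: cl)
  also have "tlift M (\<lambda>u y. F (defect_inv (\<rho> u)) y \<ominus>\<^bsub>M\<^esub> F (defect_inv (tens K P C u e)) y) (rsplit p) = \<zero>\<^bsub>M\<^esub>"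
    using p tlift_closed[of P P "rsplit p" M] by (subst tlift_diff[of P P]) (auto simp: cl eq)
  also have "tlift M F (rsplit p) \<ominus>\<^bsub>M\<^esub> \<zero>\<^bsub>M\<^esub> = tlift M F (rsplit p)"
    using p tlift_closed[of P P "rsplit p" M F] diff_add_cancel(1)[OF M, of "tlift M F (rsplit p)" "\<zero>\<^bsub>M\<^esub>"]
    by (simp add: cl)
  finally show ?thesis .
qed

lemma kappa_lsplit:
  assumes p: "p \<in> carrier P"
  shows "tlift M (\<lambda>x u. F x (kappa u)) (lsplit p) = tlift M F (lsplit p)"
proof -
  note [mlin] = linear_comp[OF bilinD(1)[OF F]] linear_comp[OF bilinD(2)[OF F]] bilinD(3)[OF F]
  have t: "tlift M (\<lambda>z d. F x (defect_inv (tens K P C z d))) (\<rho> u) = F x (defect_inv (\<rho> u))"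
    if u: "u \<in> carrier P" and x: "x \<in> carrier P" for u x
  proof -
    have "tlift M (\<lambda>z d. F x (defect_inv (tens K P C z d))) (\<rho> u) = F x (defect_inv (tlift PC (tens K P C) (\<rho> u)))"
      by (rule tlift_push[symmetric, where g = "\<lambda>s. F x (defect_inv s)"]; (assumption | rule u x mlin)+)
    then show ?thesis using u by (simp add: tlift_id)
  qed
  have "tlift M (\<lambda>x u. F x (defect_inv (\<rho> u))) (lsplit p) =
      tlift M (\<lambda>x u. tlift M (\<lambda>z d. F x (defect_inv (tens K P C z d))) (\<rho> u)) (lsplit p)"
    by (rule tlift_cong; (assumption | rule p t[symmetric] mlin)+)
  also have "\<dots> = tlift M (\<lambda>x u. F x (defect_inv (tens K P C u e))) (lsplit p)"
    by (rule lsplit_coinvariant; (assumption | rule p mlin)+)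
  finally have eq: "tlift M (\<lambda>x u. F x (defect_inv (\<rho> u))) (lsplit p) =
    tlift M (\<lambda>x u. F x (defect_inv (tens K P C u e))) (lsplit p)" .
  have k: "F x (kappa u) = F x u \<ominus>\<^bsub>M\<^esub> (F x (defect_inv (\<rho> u)) \<ominus>\<^bsub>M\<^esub> F x (defect_inv (tens K P C u e)))"
    if "u \<in> carrier P" "x \<in> carrier P" for u x
    using that linear_diff[OF bilinD(1)[OF F]] linear_diff[OF defect_inv_linear]
    by (simp add: kappa_def coinv_defect_def)
  have cl: "F x u \<in> carrier M" "F x (defect_inv (\<rho> u)) \<in> carrier M" "F x (defect_inv (tens K P C u e)) \<in> carrier M"
    if "u \<in> carrier P" "x \<in> carrier P" for u x
    using that by (auto intro!: bilinD(3)[OF F])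
  have "tlift M (\<lambda>x u. F x (kappa u)) (lsplit p) = tlift M (\<lambda>x u.
      F x u \<ominus>\<^bsub>M\<^esub> (F x (defect_inv (\<rho> u)) \<ominus>\<^bsub>M\<^esub> F x (defect_inv (tens K P C u e)))) (lsplit p)"
    using p by (intro tlift_cong[of P P]) (auto simp: k cl)
  also have "\<dots> = tlift M F (lsplit p) \<ominus>\<^bsub>M\<^esub> tlift M (\<lambda>x u.
      F x (defect_inv (\<rho> u)) \<ominus>\<^bsub>M\<^esub> F x (defect_inv (tens K P C u e))) (lsplit p)"
    using p by (intro tlift_diff[of P P]) (auto simp: cl)
  also have "tlift M (\<lambda>x u. F x (defect_inv (\<rho> u)) \<ominus>\<^bsub>M\<^esub> F x (defect_inv (tens K P C u e))) (lsplit p) = \<zero>\<^bsub>M\<^esub>"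
    using p tlift_closed[of P P "lsplit p" M] by (subst tlift_diff[of P P]) (auto simp: cl eq)
  also have "tlift M F (lsplit p) \<ominus>\<^bsub>M\<^esub> \<zero>\<^bsub>M\<^esub> = tlift M F (lsplit p)"
    using p tlift_closed[of P P "lsplit p" M F] diff_add_cancel(1)[OF M, of "tlift M F (lsplit p)" "\<zero>\<^bsub>M\<^esub>"]
    by (simp add: cl)
  finally show ?thesis .
qed

end

lemma rsplit_mult:
  assumes p: "p \<in> carrier P"
  shows "tlift P (mult P) (rsplit p) = p"
proof -
  have "tlift P (mult P) (rsplit p) = tlift P (\<lambda>p0 c. tlift P (\<lambda>x y. (p0 \<otimes>\<^bsub>P\<^esub> x) \<otimes>\<^bsub>P\<^esub> y) (l c)) (\<rho> p)"
    by (rule tlift_rsplit[OF _ mult_bilin p]) simp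
  also have "\<dots> = tlift P (\<lambda>p0 c. \<epsilon> c \<odot>\<^bsub>P\<^esub> p0) (\<rho> p)"
  proof (rule tlift_cong[of P C])
    fix p0 c assume p0: "p0 \<in> carrier P" and c: "c \<in> carrier C"
    have "tlift P (\<lambda>x y. (p0 \<otimes>\<^bsub>P\<^esub> x) \<otimes>\<^bsub>P\<^esub> y) (l c) = tlift P (\<lambda>x y. p0 \<otimes>\<^bsub>P\<^esub> (x \<otimes>\<^bsub>P\<^esub> y)) (l c)"
      using p0 c by (intro tlift_cong[of P P]) (auto simp: mult_assoc)
    also have "\<dots> = \<epsilon> c \<odot>\<^bsub>P\<^esub> (p0 \<otimes>\<^bsub>P\<^esub> \<one>\<^bsub>P\<^esub>)"
      by (rule l_mult_lift; (assumption | rule p0 c mlin)+)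
    finally show "tlift P (\<lambda>x y. (p0 \<otimes>\<^bsub>P\<^esub> x) \<otimes>\<^bsub>P\<^esub> y) (l c) = \<epsilon> c \<odot>\<^bsub>P\<^esub> p0" using p0 by simp
  qed (use p in auto)
  also have "\<dots> = p"
    using right_counit[OF right_coaction module_P module_P linear_id p] .
  finally show ?thesis .
qed

lemma lsplit_mult:
  assumes p: "p \<in> carrier P"
  shows "tlift P (mult P) (lsplit p) = p"
proof -
  have "tlift P (mult P) (lsplit p) = tlift P (\<lambda>c p0. tlift P (\<lambda>x y. x \<otimes>\<^bsub>P\<^esub> (y \<otimes>\<^bsub>P\<^esub> p0)) (l c)) (\<sigma> p)"
    by (rule tlift_lsplit[OF _ mult_bilin p]) simp
  also have "\<dots> = tlift P (\<lambda>c p0. \<epsilon> c \<odot>\<^bsub>P\<^esub> p0) (\<sigma> p)"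
  proof (rule tlift_cong[of C P])
    fix p0 c assume p0: "p0 \<in> carrier P" and c: "c \<in> carrier C"
    have "tlift P (\<lambda>x y. x \<otimes>\<^bsub>P\<^esub> (y \<otimes>\<^bsub>P\<^esub> p0)) (l c) = tlift P (\<lambda>x y. (x \<otimes>\<^bsub>P\<^esub> y) \<otimes>\<^bsub>P\<^esub> p0) (l c)"
      using p0 c by (intro tlift_cong[of P P]) (auto simp: mult_assoc)
    also have "\<dots> = \<epsilon> c \<odot>\<^bsub>P\<^esub> (\<one>\<^bsub>P\<^esub> \<otimes>\<^bsub>P\<^esub> p0)"
      by (rule l_mult_lift; (assumption | rule p0 c mlin)+)
    finally show "tlift P (\<lambda>x y. x \<otimes>\<^bsub>P\<^esub> (y \<otimes>\<^bsub>P\<^esub> p0)) (l c) = \<epsilon> c \<odot>\<^bsub>P\<^esub> p0" using p0 by simp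
  qed (use p in auto)
  also have "\<dots> = p"
    using left_counit[OF left_coaction module_P module_P linear_id p] .
  finally show ?thesis .
qed

lemma lmul_canT:
  assumes "p \<in> carrier P" "u \<in> carrier (tensor K P P)"
  shows "lmul p (canT u) = tlift PC (\<lambda>x y. lmul (p \<otimes>\<^bsub>P\<^esub> x) (\<rho> y)) u"
proof -
  have "lmul p (canT u) = tlift PC (\<lambda>x y. lmul p (lmul x (\<rho> y))) u"
    unfolding canT_def by (rule tlift_push; (assumption | rule assms mlin)+)
  also have "\<dots> = tlift PC (\<lambda>x y. lmul (p \<otimes>\<^bsub>P\<^esub> x) (\<rho> y)) u"
    using assms by (intro tlift_cong[of P P]) (auto simp: lmul_lmul)
  finally show ?thesis .
qed

lemma can_bijective: "can_bijective K C P"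
proof -
  define L where "L = tlift BT (\<lambda>p c. tlift BT (\<lambda>x y. btens K P B (p \<otimes>\<^bsub>P\<^esub> x) y) (l c))"
  have Lb: "bilin P C BT (\<lambda>p c. tlift BT (\<lambda>x y. btens K P B (p \<otimes>\<^bsub>P\<^esub> x) y) (l c))"
    by (assumption | rule mlin)+
  have L: "L \<in> linear_maps K PC BT" unfolding L_def using Lb by (intro tlift_linear) auto
  have Lt: "L (tens K P C p c) = tlift BT (\<lambda>x y. btens K P B (p \<otimes>\<^bsub>P\<^esub> x) y) (l c)"
    if "p \<in> carrier P" "c \<in> carrier C" for p c
    unfolding L_def using Lb that by (intro tlift_tens) auto
  have cL: "canT (L s) = s" if s: "s \<in> carrier PC" for s
  proof (rule tensor_eqI[of P C PC "\<lambda>s. canT (L s)" "\<lambda>s. s", OF _ _ _ _ _ _ s])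
    fix p c assume p: "p \<in> carrier P" and c: "c \<in> carrier C"
    have "canT (L (tens K P C p c)) = tlift PC (\<lambda>x y. canT (btens K P B (p \<otimes>\<^bsub>P\<^esub> x) y)) (l c)"
      unfolding Lt[OF p c] by (rule tlift_push[OF _ _ can_linear]; (assumption | rule p c mlin)+)
    also have "\<dots> = tlift PC (\<lambda>x y. lmul (p \<otimes>\<^bsub>P\<^esub> x) (\<rho> y)) (l c)"
      using p c by (intro tlift_cong[of P P]) (auto simp: can_btens)
    also have "\<dots> = tens K P C p c" using p c by (simp flip: lmul_canT add: canT_l)
    finally show "canT (L (tens K P C p c)) = tens K P C p c" .
  qed (auto intro!: linear_comp[OF can_linear L])
  have Lc: "L (canT t) = t" if t: "t \<in> carrier BT" for t
  proof (rule BT_eqI[of BT "\<lambda>t. L (canT t)" "\<lambda>t. t", OF _ _ _ _ t])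
    fix p q assume p: "p \<in> carrier P" and q: "q \<in> carrier P"
    let ?F = "\<lambda>u y. btens K P B (p \<otimes>\<^bsub>P\<^esub> u) y"
    have F: "bilin P P BT ?F" by (assumption | rule p mlin)+
    have "L (canT (btens K P B p q)) = tlift BT (\<lambda>p0 c. tlift BT (\<lambda>x y. btens K P B ((p \<otimes>\<^bsub>P\<^esub> p0) \<otimes>\<^bsub>P\<^esub> x) y) (l c)) (\<rho> q)"
      unfolding can_btens[OF p q] L_def by (rule tlift_lmul[OF _ Lb]) (auto simp: p q)
    also have "\<dots> = tlift BT (\<lambda>p0 c. tlift BT (\<lambda>x y. ?F (p0 \<otimes>\<^bsub>P\<^esub> x) y) (l c)) (\<rho> q)"
      using p q by (intro tlift_cong2[of _ P C _ P P]) (auto simp: mult_assoc)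
    also have "\<dots> = tlift BT ?F (rsplit q)"
      by (rule tlift_rsplit[symmetric, OF _ F q]) auto
    \<comment> \<open>Balancing needs a factor that lies in \<open>B\<close> for each
      representative, not only after summation; \<open>kappa\<close> provides it without changing
      the value.\<close>
    also have "\<dots> = tlift BT (\<lambda>u y. ?F (kappa u) y) (rsplit q)"
      by (rule kappa_rsplit[symmetric, OF _ F q]) auto
    also have "\<dots> = tlift BT (\<lambda>u y. btens K P B p (kappa u \<otimes>\<^bsub>P\<^esub> y)) (rsplit q)"
      using p q by (intro tlift_cong[of P P]) (auto simp: btens_move kappa_coinvariant)
    also have "\<dots> = btens K P B p (tlift P (\<lambda>u y. kappa u \<otimes>\<^bsub>P\<^esub> y) (rsplit q))"
      by (rule tlift_push[symmetric, of P P "btens K P B p"]; (assumption | rule p q bilinD(1)[OF btens_bilin_BT] mlin)+)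
    also have "\<dots> = btens K P B p q"
      using q by (simp add: kappa_rsplit[OF _ mult_bilin] rsplit_mult)
    finally show "L (canT (btens K P B p q)) = btens K P B p q" .
  qed (auto intro!: linear_comp[OF L can_linear])
  show ?thesis unfolding can_bijective_def can_map_eq
    by (rule bij_betw_byWitness[of _ L])
      (use cL Lc linear_closed[OF L] linear_closed[OF can_linear] in \<open>auto simp: image_subset_iff\<close>)
qed

lemma entwining_Psi: "t \<in> carrier CP \<Longrightarrow> entwining K C P t = Psi t"
  by (rule entwining_eq_Psi[OF can_bijective canT_l])

text \<open>A preimage of \<open>p \<otimes> c\<close> is \<open>\<sigma>(p x) y\<close> with
  \<open>x \<otimes> y = l(c)\<close>: by \<open>psi_mult\<close>, \<open>Psi\<close> maps
  \<open>\<sigma>(q) y\<close> to \<open>ract (q \<otimes> e) y = q \<rho>(y)\<close>, and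
  \<open>p x \<rho>(y)\<close> sums up to \<open>p \<otimes> c\<close>.\<close>

lemma Psi_surj:
  assumes "s \<in> carrier PC"
  shows "s \<in> Psi ` carrier CP"
proof -
  define \<phi> where "\<phi> = tlift CP (\<lambda>p c. tlift CP (\<lambda>x y. tlift CP (\<lambda>d z. tens K C P d (z \<otimes>\<^bsub>P\<^esub> y)) (\<sigma> (p \<otimes>\<^bsub>P\<^esub> x))) (l c))"
  have b: "bilin P C CP (\<lambda>p c. tlift CP (\<lambda>x y. tlift CP (\<lambda>d z. tens K C P d (z \<otimes>\<^bsub>P\<^esub> y)) (\<sigma> (p \<otimes>\<^bsub>P\<^esub> x))) (l c))"
    by (assumption | rule mlin)+
  have \<phi>: "\<phi> \<in> linear_maps K PC CP" unfolding \<phi>_def using b by (intro tlift_linear) auto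
  have \<phi>t: "\<phi> (tens K P C p c) = tlift CP (\<lambda>x y. tlift CP (\<lambda>d z. tens K C P d (z \<otimes>\<^bsub>P\<^esub> y)) (\<sigma> (p \<otimes>\<^bsub>P\<^esub> x))) (l c)"
    if "p \<in> carrier P" "c \<in> carrier C" for p c
    unfolding \<phi>_def using b that by (intro tlift_tens) auto
  have inner: "Psi (tlift CP (\<lambda>d z. tens K C P d (z \<otimes>\<^bsub>P\<^esub> y)) (\<sigma> q)) = lmul q (\<rho> y)"
    if q: "q \<in> carrier P" and y: "y \<in> carrier P" for q y
  proof -
    have "Psi (tlift CP (\<lambda>d z. tens K C P d (z \<otimes>\<^bsub>P\<^esub> y)) (\<sigma> q)) =
        tlift PC (\<lambda>d z. Psi (tens K C P d (z \<otimes>\<^bsub>P\<^esub> y))) (\<sigma> q)"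
      by (rule tlift_push[OF _ _ Psi_linear]; (assumption | rule q y mlin)+)
    also have "\<dots> = tlift PC (\<lambda>d z. ract (psi d z) y) (\<sigma> q)"
      using q y by (intro tlift_cong[of C P]) (auto simp: Psi_tens psi_mult)
    also have "\<dots> = ract (Psi (\<sigma> q)) y"
      unfolding Psi_def by (rule tlift_push[symmetric, where g = "\<lambda>s. ract s y"]; (assumption | rule q y mlin)+)
    also have "\<dots> = lmul q (\<rho> y)" using q y by (simp add: Psi_\<sigma> psi_e)
    finally show ?thesis .
  qed
  have "Psi (\<phi> s) = s"
  proof (rule tensor_eqI[of P C PC "\<lambda>s. Psi (\<phi> s)" "\<lambda>s. s", OF _ _ _ _ _ _ assms])
    fix p c assume p: "p \<in> carrier P" and c: "c \<in> carrier C"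
    have "Psi (\<phi> (tens K P C p c)) = tlift PC (\<lambda>x y. Psi (tlift CP (\<lambda>d z. tens K C P d (z \<otimes>\<^bsub>P\<^esub> y)) (\<sigma> (p \<otimes>\<^bsub>P\<^esub> x)))) (l c)"
      unfolding \<phi>t[OF p c] by (rule tlift_push[OF _ _ Psi_linear]; (assumption | rule p c mlin)+)
    also have "\<dots> = tlift PC (\<lambda>x y. lmul (p \<otimes>\<^bsub>P\<^esub> x) (\<rho> y)) (l c)"
      using p c by (intro tlift_cong[of P P]) (auto simp: inner)
    also have "\<dots> = tens K P C p c" using p c by (simp flip: lmul_canT add: canT_l)
    finally show "Psi (\<phi> (tens K P C p c)) = tens K P C p c" .
  qed (auto intro!: linear_comp[OF Psi_linear \<phi>])
  then show ?thesis using linear_closed[OF \<phi> assms] by (metis imageI)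
qed

lemma entwining_bij: "bij_betw (entwining K C P) (carrier CP) (carrier PC)"
proof -
  have "bij_betw Psi (carrier CP) (carrier PC)"
    using Psi_inj Psi_surj linear_closed[OF Psi_linear] by (auto simp: bij_betw_def)
  then show ?thesis using bij_betw_cong[of "carrier CP" "entwining K C P" Psi] entwining_Psi by blast
qed

lemma \<sigma>_eq:
  assumes p: "p \<in> carrier P"
  shows "\<sigma> p = inv_into (carrier CP) (entwining K C P) (tens K P C p e)"
proof -
  have "inv_into (carrier CP) (entwining K C P) (tens K P C p e) = \<sigma> p"
    by (rule inv_into_f_eq) (use entwining_bij p in \<open>auto simp: bij_betw_def entwining_Psi Psi_\<sigma>\<close>)
  then show ?thesis by simp
qed

lemma kappa_linear_BP [mlin]: "f \<in> linear_maps K U P \<Longrightarrow> (\<lambda>u. kappa (f u)) \<in> linear_maps K U BP"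
proof (rule linear_comp[of kappa])
  show "kappa \<in> linear_maps K P BP"
    using kappa_linear kappa_coinvariant by (auto simp: linear_maps_def)
qed

lemma kappa_BP [mlin]: "x \<in> carrier P \<Longrightarrow> kappa x \<in> carrier BP"
  by (simp add: kappa_coinvariant)

definition splitting :: "'p \<Rightarrow> ('p \<times> 'p \<Rightarrow> 'k) set" where
  "splitting p = tlift (tensor K BP P) (\<lambda>u y. tens K BP P (kappa u) y) (rsplit p)"

lemma splitting_linear [mlin]: "splitting \<in> linear_maps K P (tensor K BP P)"
  unfolding splitting_def[abs_def] by (assumption | rule mlin)+

lemmas splitting_closed [simp, mlin] = linear_closed[OF splitting_linear]

lemma tlift_splitting:
  assumes M: "module K M" and F: "bilin BP P M F" and p: "p \<in> carrier P"
  shows "tlift M F (splitting p) = tlift M (\<lambda>u y. F (kappa u) y) (rsplit p)"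
proof -
  have "tlift M F (splitting p) = tlift M (\<lambda>u y. tlift M F (tens K BP P (kappa u) y)) (rsplit p)"
    unfolding splitting_def using F M
    by (intro tlift_push[of P P] tlift_linear) (auto simp: p kappa_coinvariant)
  also have "\<dots> = tlift M (\<lambda>u y. F (kappa u) y) (rsplit p)"
    using F M p bilinD(3)[OF F] by (intro tlift_cong[of P P]) (auto simp: tlift_tens kappa_coinvariant)
  finally show ?thesis .
qed

lemma tlift_rsplit_coinvariant:
  assumes M [simp, mlin]: "module K M" and F: "bilin P P M F" and b: "b \<in> B" and p: "p \<in> carrier P"
  shows "tlift M F (rsplit (b \<otimes>\<^bsub>P\<^esub> p)) = tlift M (\<lambda>u y. F (b \<otimes>\<^bsub>P\<^esub> u) y) (rsplit p)"
proof -
  note [mlin] = linear_comp[OF bilinD(1)[OF F]] linear_comp[OF bilinD(2)[OF F]] bilinD(3)[OF F]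
  note bP [mlin] = coinvariants_closed[OF b]
  have "tlift M F (rsplit (b \<otimes>\<^bsub>P\<^esub> p)) = tlift M (\<lambda>p0 c. tlift M (\<lambda>x y. F (p0 \<otimes>\<^bsub>P\<^esub> x) y) (l c)) (lmul b (\<rho> p))"
    using bP p by (simp add: tlift_rsplit[OF M F] coinvariants_mult[OF b])
  also have "\<dots> = tlift M (\<lambda>p0 c. tlift M (\<lambda>x y. F ((b \<otimes>\<^bsub>P\<^esub> p0) \<otimes>\<^bsub>P\<^esub> x) y) (l c)) (\<rho> p)"
    by (rule tlift_lmul; (assumption | rule p mlin)+)
  also have "\<dots> = tlift M (\<lambda>p0 c. tlift M (\<lambda>x y. F (b \<otimes>\<^bsub>P\<^esub> (p0 \<otimes>\<^bsub>P\<^esub> x)) y) (l c)) (\<rho> p)"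
    using bP p bilinD(3)[OF F] by (intro tlift_cong2[of _ P C _ P P]) (auto simp: mult_assoc)
  also have "\<dots> = tlift M (\<lambda>u y. F (b \<otimes>\<^bsub>P\<^esub> u) y) (rsplit p)"
    by (rule tlift_rsplit[symmetric]; (assumption | rule p mlin)+)
  finally show ?thesis .
qed

lemma colinear_splitting: "colinear_splitting K C P splitting"
proof -
  let ?BT = "tensor K BP P" and ?T = "tensor K (tensor K BP P) C"
  have [mlin]: "(\<lambda>u. u) \<in> linear_maps K BP P" by (rule BP_linear) simp
  have [mlin]: "x \<in> carrier P" if "x \<in> carrier BP" for x using that coinvariants_closed by simp
  have mult: "tlift P (\<lambda>b q. b \<otimes>\<^bsub>P\<^esub> q) (splitting p) = p" if p: "p \<in> carrier P" for p
  proof -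
    have "tlift P (\<lambda>b q. b \<otimes>\<^bsub>P\<^esub> q) (splitting p) = tlift P (\<lambda>u y. kappa u \<otimes>\<^bsub>P\<^esub> y) (rsplit p)"
      by (rule tlift_splitting; (assumption | rule p mlin)+)
    then show ?thesis using p by (simp add: kappa_rsplit[OF _ mult_bilin] rsplit_mult)
  qed
  have lin: "splitting (b \<otimes>\<^bsub>P\<^esub> p) = tmap K BP P (\<lambda>b'. b \<otimes>\<^bsub>P\<^esub> b') id (splitting p)"
    if b: "b \<in> B" and p: "p \<in> carrier P" for b p
  proof -
    note bP [mlin] = coinvariants_closed[OF b]
    have bm: "(\<lambda>u. b \<otimes>\<^bsub>P\<^esub> f u) \<in> linear_maps K U BP" if f: "f \<in> linear_maps K U BP" for f and U :: "('k, 'z, 'y) module_scheme"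
      using f b bP unfolding linear_maps_def
      by (auto simp: coinvariants_mult_closed Pi_iff coinvariants_closed mult_smult ring.ring_simprules)
    \<comment> \<open>\<open>b\<close> and \<open>kappa u\<close> lie in \<open>B\<close>, which is
      closed under products and fixed by \<open>kappa\<close>. This substitutes for
      \<open>B\<close>-linearity of \<open>kappa\<close>.\<close>
    have e: "kappa (b \<otimes>\<^bsub>P\<^esub> kappa u) = b \<otimes>\<^bsub>P\<^esub> kappa u" if "u \<in> carrier P" for u
      using that b by (simp add: kappa_id coinvariants_mult_closed kappa_coinvariant)
    have "splitting (b \<otimes>\<^bsub>P\<^esub> p) = tlift ?BT (\<lambda>u y. tens K BP P (kappa (b \<otimes>\<^bsub>P\<^esub> u)) y) (rsplit p)"
      unfolding splitting_def by (rule tlift_rsplit_coinvariant; (assumption | rule b p mlin)+)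
    also have "\<dots> = tlift ?BT (\<lambda>u y. tens K BP P (kappa (b \<otimes>\<^bsub>P\<^esub> kappa u)) y) (rsplit p)"
      by (rule kappa_rsplit[symmetric]; (assumption | rule p mlin)+)
    also have "\<dots> = tlift ?BT (\<lambda>u y. tens K BP P (b \<otimes>\<^bsub>P\<^esub> kappa u) y) (rsplit p)"
      using p b by (intro tlift_cong[of P P]) (auto simp: e coinvariants_mult_closed kappa_coinvariant)
    also have "\<dots> = tlift ?BT (\<lambda>b' q. tens K BP P (b \<otimes>\<^bsub>P\<^esub> b') q) (splitting p)"
      by (rule tlift_splitting[symmetric]; (assumption | rule p bm mlin
        | simp add: b coinvariants_mult_closed)+)
    finally show ?thesis by (simp add: tmap_def)
  qed
  \<comment> \<open>Right colinearity of \<open>l\<close> yields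
    \<open>p_0 l(p_11) \<otimes> p_12\<close>; coassociativity of the right coaction regroups this
    as \<open>rsplit(p_0) \<otimes> p_1\<close>.\<close>
  have colin: "tassoc K BP P C (tmap K BP PC id \<rho> (splitting p)) = tmap K ?BT C splitting id (\<rho> p)"
    if p: "p \<in> carrier P" for p
  proof -
    have "tassoc K BP P C (tmap K BP PC id \<rho> (splitting p)) =
        tlift ?T (\<lambda>b q. tlift ?T (\<lambda>v w. tens K ?BT C (tens K BP P (id b) v) w) (\<rho> q)) (splitting p)"
      unfolding tassoc_def Let_def
    proof (rule tmap_eval[of BP P BP PC])
      show "bilin BP PC ?T (\<lambda>b t. tlift ?T (\<lambda>v w. tens K ?BT C (tens K BP P b v) w) t)"
        by (assumption | rule mlin)+
    qed (use p in auto)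
    also have "\<dots> = tlift ?T (\<lambda>u y. tlift ?T (\<lambda>v w. tens K ?BT C (tens K BP P (kappa u) v) w) (\<rho> y)) (rsplit p)"
      unfolding id_apply by (rule tlift_splitting; (assumption | rule p mlin)+)
    also have "\<dots> = tlift ?T (\<lambda>p0 c. tlift ?T (\<lambda>x y.
        tlift ?T (\<lambda>v w. tens K ?BT C (tens K BP P (kappa (p0 \<otimes>\<^bsub>P\<^esub> x)) v) w) (\<rho> y)) (l c)) (\<rho> p)"
      by (rule tlift_rsplit; (assumption | rule p mlin)+)
    also have "\<dots> = tlift ?T (\<lambda>p0 c. tlift ?T (\<lambda>c1 c2. tlift ?T (\<lambda>x y.
        tens K ?BT C (tens K BP P (kappa (p0 \<otimes>\<^bsub>P\<^esub> x)) y) c2) (l c1)) (\<Delta> c)) (\<rho> p)"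
      by (rule tlift_cong, (assumption | rule p mlin)+, rule l_right; (assumption | rule p mlin)+)
    also have "\<dots> = tlift ?T (\<lambda>p0 c. tlift ?T (\<lambda>p1 c1. tlift ?T (\<lambda>x y.
        tens K ?BT C (tens K BP P (kappa (p1 \<otimes>\<^bsub>P\<^esub> x)) y) c) (l c1)) (\<rho> p0)) (\<rho> p)"
      by (rule right_coassoc[OF right_coaction, symmetric]; (assumption | rule p mlin)+)
    also have "\<dots> = tlift ?T (\<lambda>p0 c. tlift ?T (\<lambda>u y. tens K ?BT C (tens K BP P (kappa u) y) c) (rsplit p0)) (\<rho> p)"
      by (rule tlift_cong, (assumption | rule p mlin)+, rule tlift_rsplit[symmetric]; (assumption | rule p mlin)+)
    also have "\<dots> = tlift ?T (\<lambda>p0 c. tens K ?BT C (splitting p0) c) (\<rho> p)"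
      unfolding splitting_def
      by (rule tlift_cong, (assumption | rule p mlin)+,
        rule tlift_push[symmetric, where g = "\<lambda>s. tens K ?BT C s w" for w]; (assumption | rule p mlin)+)
    finally show ?thesis by (simp add: tmap_def)
  qed
  have "carrier BP = B" by simp
  then show ?thesis unfolding colinear_splitting_def Let_def
    using splitting_linear mult lin colin by blast
qed

theorem principal: "principal_coaug_alg K C e P"
  unfolding principal_coaug_alg_def principal_extension_def
  using coaug_alg can_bijective \<rho>_one entwining_bij colinear_splitting \<sigma>_eq by blast

end

section \<open>Principal extensions have strong connections\<close>

text \<open>\<open>\<tau>\<close> is a linear lift to \<open>P \<otimes> P\<close> of the
  translation map, the preimage of \<open>1 \<otimes> c\<close> under the canonical map, whose
  values lie only in the balanced tensor product. Its ambiguity disappears under balanced maps, see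
  \<open>canT_descend\<close>.\<close>

locale principal_data = coaug K C e P
  for K :: "'k ring" and C :: "('k, 'c) coalg" and e :: 'c and P :: "('k, 'p, 'c) coact_alg" +
  fixes s :: "'p \<Rightarrow> ('p \<times> 'p \<Rightarrow> 'k) set" and \<tau> :: "'c \<Rightarrow> ('p \<times> 'p \<Rightarrow> 'k) set"
  assumes can: "can_bijective K C P" and s: "colinear_splitting K C P s"
    and \<tau>_linear: "\<tau> \<in> linear_maps K C (tensor K P P)"
    and canT_\<tau>: "c \<in> carrier C \<Longrightarrow> canT (\<tau> c) = tens K P C \<one>\<^bsub>P\<^esub> c"
begin

sublocale tau: pre_connection K C e P \<tau>
  by unfold_locales (rule \<tau>_linear)

abbreviation "PP \<equiv> tensor K P P"

lemma s_linear [mlin]: "s \<in> linear_maps K P (tensor K BP P)"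
  and s_mult: "p \<in> carrier P \<Longrightarrow> tlift P (\<lambda>b q. b \<otimes>\<^bsub>P\<^esub> q) (s p) = p"
  and s_left: "b \<in> B \<Longrightarrow> p \<in> carrier P \<Longrightarrow> s (b \<otimes>\<^bsub>P\<^esub> p) = tmap K BP P (\<lambda>b'. b \<otimes>\<^bsub>P\<^esub> b') id (s p)"
  and s_right: "p \<in> carrier P \<Longrightarrow>
    tassoc K BP P C (tmap K BP PC id \<rho> (s p)) = tmap K (tensor K BP P) C s id (\<rho> p)"
  using s by (simp_all add: colinear_splitting_def Let_def)

lemmas s_closed [simp, mlin] = linear_closed[OF s_linear]

lemma bilin_BP: "bilin P P M F \<Longrightarrow> bilin BP P M F"
  using bilinD[of P P M F] by (intro bilinI BP_linear) (auto dest: coinvariants_closed)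

text \<open>The splitting regarded with values in \<open>P \<otimes> P\<close>, so that it can be
  composed with the maps defined there.\<close>

definition s' :: "'p \<Rightarrow> ('p \<times> 'p \<Rightarrow> 'k) set" where
  "s' p = tlift PP (tens K P P) (s p)"

lemma tlift_s':
  assumes M: "module K M" and F: "bilin P P M F" and p: "p \<in> carrier P"
  shows "tlift M F (s' p) = tlift M F (s p)"
proof -
  have "tlift M F (s' p) = tlift M (\<lambda>x y. tlift M F (tens K P P x y)) (s p)"
    unfolding s'_def using F M by (intro tlift_push[of BP P] tlift_linear) (auto simp: p dest: coinvariants_closed)
  also have "\<dots> = tlift M F (s p)"
    using F M p bilinD(3)[OF F] by (intro tlift_cong[of BP P]) (auto simp: tlift_tens dest: coinvariants_closed)
  finally show ?thesis .
qed

lemma s'_linear [mlin]: "s' \<in> linear_maps K P PP"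
  unfolding s'_def[abs_def]
  by (rule linear_tlift_arg[of BP P]) (auto intro!: bilin_BP tens_bilin s_linear)

lemmas s'_closed [simp, mlin] = linear_closed[OF s'_linear]

text \<open>What remains in \<open>P \<otimes> P\<close> of the fact that the left leg of the
  splitting lies in \<open>B\<close>: bilinear maps need only be compared on
  \<open>B \<times> P\<close>.\<close>

lemma s'_cong:
  assumes M: "module K M" and F: "bilin P P M F" and G: "bilin P P M G"
    and eq: "\<And>b q. b \<in> B \<Longrightarrow> q \<in> carrier P \<Longrightarrow> F b q = G b q" and p: "p \<in> carrier P"
  shows "tlift M F (s' p) = tlift M G (s' p)"
  unfolding tlift_s'[OF M F p] tlift_s'[OF M G p]
  by (rule tlift_cong[of BP P]) (use M p eq bilinD(3)[OF G] in \<open>auto dest: coinvariants_closed\<close>)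

lemma s'_mult: "p \<in> carrier P \<Longrightarrow> tlift P (mult P) (s' p) = p"
  by (simp add: tlift_s'[OF _ mult_bilin] s_mult)

lemma s'_left:
  assumes M: "module K M" and F: "bilin P P M F" and b: "b \<in> B" and p: "p \<in> carrier P"
  shows "tlift M F (s' (b \<otimes>\<^bsub>P\<^esub> p)) = tlift M (\<lambda>x y. F (b \<otimes>\<^bsub>P\<^esub> x) y) (s' p)"
proof -
  have bP: "b \<in> carrier P" using b by (rule coinvariants_closed)
  have G: "bilin P P M (\<lambda>x y. F (b \<otimes>\<^bsub>P\<^esub> x) y)"
    using bilinD[OF F] bP linear_comp[OF bilinD(2)[OF F] linear_mult(2)[OF bP linear_id]]
    by (intro bilinI) auto
  have "tlift M F (s (b \<otimes>\<^bsub>P\<^esub> p)) = tlift M (\<lambda>x y. F (b \<otimes>\<^bsub>P\<^esub> x) (id y)) (s p)"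
    unfolding s_left[OF b p]
    by (rule tmap_eval[of BP P BP P]) (use M p b in \<open>auto simp: bilin_BP[OF F] coinvariants_mult_closed\<close>)
  then show ?thesis using bP p by (simp add: tlift_s'[OF M F] tlift_s'[OF M G])
qed

lemma s'_right:
  assumes M [simp, mlin]: "module K M" and \<beta>: "trilin P P C M \<beta>" and p: "p \<in> carrier P"
  shows "tlift M (\<lambda>b q. tlift M (\<beta> b) (\<rho> q)) (s' p) =
    tlift M (\<lambda>p0 c. tlift M (\<lambda>b q. \<beta> b q c) (s' p0)) (\<rho> p)"
proof -
  note \<beta>' = trilinD[OF \<beta>]
  have \<beta>B: "trilin BP P C M \<beta>"
    using \<beta>' coinvariants_closed by (intro trilinI BP_linear) auto
  note [mlin] = \<beta>'(1,5) linear_comp[OF \<beta>'(2)] linear_comp[OF \<beta>'(3)] linear_comp[OF \<beta>'(4)]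
  have F: "bilin P P M (\<lambda>b q. tlift M (\<beta> b) (\<rho> q))" by (assumption | rule mlin)+
  have G: "bilin P P M (\<lambda>b q. \<beta> b q c)" if "c \<in> carrier C" for c by (assumption | rule that mlin)+
  have "tlift M (\<lambda>b q. tlift M (\<beta> b) (\<rho> q)) (s p) =
      tlift M (\<lambda>b t. tlift M (\<beta> b) t) (tmap K BP PC id \<rho> (s p))"
    by (subst tmap_eval[of BP P BP PC])
      (auto simp: p intro!: tlift_trilin_right \<beta>B)
  also have "\<dots> = tlift M (\<lambda>t w. tlift M (\<lambda>u v. \<beta> u v w) t) (tassoc K BP P C (tmap K BP PC id \<rho> (s p)))"
    using linear_id[of BP] \<rho>_linear p unfolding id_def
    by (intro tassoc_eval[symmetric] \<beta>B linear_closed[OF tmap_linear[of BP P]]) auto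
  also have "\<dots> = tlift M (\<lambda>p0 c. tlift M (\<lambda>u v. \<beta> u v c) (s p0)) (\<rho> p)"
    unfolding s_right[OF p]
    by (subst tmap_eval[of P C "tensor K BP P" C]) (auto simp: p intro!: tlift_trilin_left \<beta>B)
  also have "\<dots> = tlift M (\<lambda>p0 c. tlift M (\<lambda>b q. \<beta> b q c) (s' p0)) (\<rho> p)"
    using p by (intro tlift_cong[of P C]) (auto simp: tlift_s'[OF M G] dest: coinvariants_closed
        intro!: tlift_closed[of BP P] \<beta>'(5))
  finally show ?thesis using p by (simp add: tlift_s'[OF M F])
qed

text \<open>Injectivity of the canonical map: equal values of \<open>canT\<close> mean equal classes
  in the balanced tensor product, through which a balanced \<open>\<beta>\<close> factors.\<close>

lemma canT_descend:
  assumes M: "module K M" and \<beta>: "bilin P P M \<beta>"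
    and bal: "\<And>p b q. p \<in> carrier P \<Longrightarrow> b \<in> B \<Longrightarrow> q \<in> carrier P \<Longrightarrow> \<beta> (p \<otimes>\<^bsub>P\<^esub> b) q = \<beta> p (b \<otimes>\<^bsub>P\<^esub> q)"
    and u: "u \<in> carrier PP" "v \<in> carrier PP" and eq: "canT u = canT v"
  shows "tlift M \<beta> u = tlift M \<beta> v"
proof -
  let ?pr = "tlift BT (btens K P B)"
  have pr: "?pr u \<in> carrier BT" "?pr v \<in> carrier BT" using u by (auto intro!: tlift_closed[of P P])
  have "inj_on canT (carrier BT)" using can by (simp add: can_bijective_def can_map_eq bij_betw_def)
  then have "?pr u = ?pr v" by (rule inj_onD) (use pr u eq in \<open>simp_all add: can_proj\<close>)
  then show ?thesis using BT_lift_proj[OF M \<beta> bal u(1)] BT_lift_proj[OF M \<beta> bal u(2)] by simp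
qed

text \<open>The map \<open>x \<otimes> y \<mapsto> x s(y)\<close>. It is balanced over
  \<open>B\<close> because \<open>s\<close> is left \<open>B\<close>-linear, yet its values lie in
  the tensor product over the field; it thus lifts balanced tensors canonically.\<close>

definition bs :: "'p \<Rightarrow> 'p \<Rightarrow> ('p \<times> 'p \<Rightarrow> 'k) set" where
  "bs x y = tlift PP (\<lambda>b q. tens K P P (x \<otimes>\<^bsub>P\<^esub> b) q) (s' y)"

lemma bs_bilin: "bilin P P PP bs"
  unfolding bs_def[abs_def] by (assumption | rule mlin)+

lemmas bs_closed [simp, mlin] = bilinD(3)[OF bs_bilin]
lemmas bs_linear [mlin] = linear_comp[OF bilinD(1)[OF bs_bilin]] linear_comp[OF bilinD(2)[OF bs_bilin]]

lemma bs_balanced: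
  assumes "p \<in> carrier P" "b \<in> B" "q \<in> carrier P"
  shows "bs (p \<otimes>\<^bsub>P\<^esub> b) q = bs p (b \<otimes>\<^bsub>P\<^esub> q)"
proof -
  note bP [mlin] = coinvariants_closed[OF assms(2)]
  have "bs p (b \<otimes>\<^bsub>P\<^esub> q) = tlift PP (\<lambda>b' q. tens K P P (p \<otimes>\<^bsub>P\<^esub> (b \<otimes>\<^bsub>P\<^esub> b')) q) (s' q)"
    unfolding bs_def by (rule s'_left; (assumption | rule assms mlin)+)
  also have "\<dots> = bs (p \<otimes>\<^bsub>P\<^esub> b) q"
    unfolding bs_def using assms bP by (intro tlift_cong[of P P]) (auto simp: mult_assoc)
  finally show ?thesis by simp
qed

lemma tlift_bs:
  assumes M [simp, mlin]: "module K M" and F: "bilin P P M F" and x: "x \<in> carrier P" and y: "y \<in> carrier P"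
  shows "tlift M F (bs x y) = tlift M (\<lambda>b q. F (x \<otimes>\<^bsub>P\<^esub> b) q) (s' y)"
proof -
  have "tlift M F (bs x y) = tlift M (\<lambda>b q. tlift M F (tens K P P (x \<otimes>\<^bsub>P\<^esub> b) q)) (s' y)"
    unfolding bs_def using F by (intro tlift_push[of P P] tlift_linear) (auto simp: x y)
  also have "\<dots> = tlift M (\<lambda>b q. F (x \<otimes>\<^bsub>P\<^esub> b) q) (s' y)"
    using F x y bilinD(3)[OF F] by (intro tlift_cong[of P P]) (auto simp: tlift_tens)
  finally show ?thesis .
qed

definition l :: "'c \<Rightarrow> ('p \<times> 'p \<Rightarrow> 'k) set" where
  "l c = tlift PP bs (\<tau> c)"

sublocale pre_connection K C e P l
proof
  show "l \<in> linear_maps K C PP"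
    unfolding l_def[abs_def] by (assumption | rule mlin bs_bilin)+
qed

lemma tlift_l:
  assumes M [simp, mlin]: "module K M" and F: "bilin P P M F" and c: "c \<in> carrier C"
  shows "tlift M F (l c) = tlift M (\<lambda>x y. tlift M (\<lambda>b q. F (x \<otimes>\<^bsub>P\<^esub> b) q) (s' y)) (\<tau> c)"
proof -
  have "tlift M F (l c) = tlift M (\<lambda>x y. tlift M F (bs x y)) (\<tau> c)"
    unfolding l_def using F by (intro tlift_push[of P P] tlift_linear) (auto simp: c)
  also have "\<dots> = tlift M (\<lambda>x y. tlift M (\<lambda>b q. F (x \<otimes>\<^bsub>P\<^esub> b) q) (s' y)) (\<tau> c)"
    using F c bilinD(3)[OF F] by (intro tlift_cong[of P P]) (auto simp: tlift_bs intro!: tlift_closed[of P P])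
  finally show ?thesis .
qed

text \<open>The left leg \<open>b\<close> of \<open>s' y\<close> is coinvariant, so
  \<open>b \<rho>(q) = \<rho>(b q)\<close>, and the products \<open>b q\<close> sum up to
  \<open>y\<close>.\<close>

lemma s'_\<rho>:
  assumes "y \<in> carrier P"
  shows "canT (s' y) = \<rho> y"
proof -
  have "canT (s' y) = tlift PC (\<lambda>b q. \<rho> (b \<otimes>\<^bsub>P\<^esub> q)) (s' y)"
    unfolding canT_def by (rule s'_cong; (assumption | rule assms mlin coinvariants_mult[symmetric])+)
  also have "\<dots> = \<rho> (tlift P (mult P) (s' y))"
    by (rule tlift_push[symmetric]; (assumption | rule assms mlin)+)
  finally show ?thesis using assms by (simp add: s'_mult)
qed

lemma lmul_canT':
  assumes "p \<in> carrier P" "u \<in> carrier PP"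
  shows "lmul p (canT u) = tlift PC (\<lambda>x y. lmul (p \<otimes>\<^bsub>P\<^esub> x) (\<rho> y)) u"
proof -
  have "lmul p (canT u) = tlift PC (\<lambda>x y. lmul p (lmul x (\<rho> y))) u"
    unfolding canT_def by (rule tlift_push; (assumption | rule assms mlin)+)
  also have "\<dots> = tlift PC (\<lambda>x y. lmul (p \<otimes>\<^bsub>P\<^esub> x) (\<rho> y)) u"
    using assms by (intro tlift_cong[of P P]) (auto simp: lmul_lmul)
  finally show ?thesis .
qed

lemma canT_l:
  assumes c: "c \<in> carrier C"
  shows "canT (l c) = tens K P C \<one>\<^bsub>P\<^esub> c"
proof -
  have "canT (l c) = tlift PC (\<lambda>x y. tlift PC (\<lambda>b q. lmul (x \<otimes>\<^bsub>P\<^esub> b) (\<rho> q)) (s' y)) (\<tau> c)"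
    by (subst canT_def, rule tlift_l; (assumption | rule c mlin)+)
  also have "\<dots> = canT (\<tau> c)"
    unfolding canT_def[THEN fun_cong, of "\<tau> c"]
    using c by (intro tlift_cong[of P P]) (auto simp: s'_\<rho> simp flip: lmul_canT')
  finally show ?thesis using c by (simp add: canT_\<tau>)
qed

text \<open>The counit applied to \<open>x \<rho>(y)\<close> leaves \<open>x y\<close>. The
  normalisation \<open>l_mult\<close> is thereby read off from \<open>canT_l\<close>.\<close>

lemma counit_canT:
  assumes u: "u \<in> carrier PP"
  shows "tlift P (\<lambda>p c. \<epsilon> c \<odot>\<^bsub>P\<^esub> p) (canT u) = tlift P (mult P) u"
proof -
  have b: "bilin P C P (\<lambda>p c. \<epsilon> c \<odot>\<^bsub>P\<^esub> p)" by (assumption | rule mlin)+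
  have "tlift P (\<lambda>p c. \<epsilon> c \<odot>\<^bsub>P\<^esub> p) (canT u) = tlift P (\<lambda>x y. tlift P (\<lambda>p c. \<epsilon> c \<odot>\<^bsub>P\<^esub> p) (lmul x (\<rho> y))) u"
    unfolding canT_def by (rule tlift_push[OF _ _ tlift_linear[OF _ _ _ b]]; (assumption | rule u mlin)+)
  also have "\<dots> = tlift P (mult P) u"
  proof (rule tlift_cong[OF _ _ u])
    fix x y assume x: "x \<in> carrier P" and y: "y \<in> carrier P"
    have "tlift P (\<lambda>p c. \<epsilon> c \<odot>\<^bsub>P\<^esub> p) (lmul x (\<rho> y)) = tlift P (\<lambda>q c. \<epsilon> c \<odot>\<^bsub>P\<^esub> (x \<otimes>\<^bsub>P\<^esub> q)) (\<rho> y)"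
      by (rule tlift_lmul[OF _ b]) (auto simp: x y)
    also have "\<dots> = x \<otimes>\<^bsub>P\<^esub> y"
      by (rule right_counit[OF right_coaction]; (assumption | rule x y mlin)+)
    finally show "tlift P (\<lambda>p c. \<epsilon> c \<odot>\<^bsub>P\<^esub> p) (lmul x (\<rho> y)) = x \<otimes>\<^bsub>P\<^esub> y" .
  qed auto
  finally show ?thesis .
qed

lemma l_mult:
  assumes c: "c \<in> carrier C"
  shows "tlift P (mult P) (l c) = \<epsilon> c \<odot>\<^bsub>P\<^esub> \<one>\<^bsub>P\<^esub>"
proof -
  have b: "bilin P C P (\<lambda>p c. \<epsilon> c \<odot>\<^bsub>P\<^esub> p)" by (assumption | rule mlin)+
  show ?thesis using c counit_canT[OF l_closed[OF c]] by (simp add: canT_l tlift_tens[OF _ _ _ b])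
qed

text \<open>The splitting reconstructed from \<open>l\<close> is the given one. The elements
  \<open>y_0 \<tau>(y_1)\<close> and \<open>1 \<otimes> y\<close> have the same image
  \<open>\<rho> y\<close> under \<open>canT\<close>, so the balanced map \<open>bs\<close> agrees on
  them; it gives \<open>y_0 l(y_1)\<close> on the first and \<open>s' y\<close> on the
  second.\<close>

lemma rsplit_s':
  assumes y: "y \<in> carrier P"
  shows "rsplit y = s' y"
proof -
  let ?L = "\<lambda>p. tlift PP (\<lambda>x y. tens K P P (p \<otimes>\<^bsub>P\<^esub> x) y)"
  have L: "?L p \<in> linear_maps K PP PP" if "p \<in> carrier P" for p
    by (rule tlift_linear; (assumption | rule that mlin)+)
  have Lbs: "?L p (bs x z) = bs (p \<otimes>\<^bsub>P\<^esub> x) z" if p: "p \<in> carrier P" and x: "x \<in> carrier P" and z: "z \<in> carrier P" for p x z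
  proof -
    have "?L p (bs x z) = tlift PP (\<lambda>b q. tens K P P (p \<otimes>\<^bsub>P\<^esub> (x \<otimes>\<^bsub>P\<^esub> b)) q) (s' z)"
      by (rule tlift_bs; (assumption | rule p x z mlin)+)
    also have "\<dots> = bs (p \<otimes>\<^bsub>P\<^esub> x) z"
      unfolding bs_def using p x z by (intro tlift_cong[of P P]) (auto simp: mult_assoc)
    finally show ?thesis .
  qed
  have "canT (tau.rsplit y) = tlift PC (\<lambda>p0 c. tlift PC (\<lambda>x y. lmul (p0 \<otimes>\<^bsub>P\<^esub> x) (\<rho> y)) (\<tau> c)) (\<rho> y)"
    by (subst canT_def, rule tau.tlift_rsplit[OF _ can_bilin y]) simp
  also have "\<dots> = tlift PC (\<lambda>p0 c. tens K P C p0 c) (\<rho> y)"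
    using y by (intro tlift_cong[of P C]) (auto simp: canT_\<tau> simp flip: lmul_canT')
  also have "\<dots> = \<rho> y" using y by (simp add: tlift_id)
  finally have "canT (tau.rsplit y) = canT (tens K P P \<one>\<^bsub>P\<^esub> y)"
    using y by (simp add: canT_def tlift_tens[OF _ _ _ can_bilin])
  then have "tlift PP bs (tau.rsplit y) = tlift PP bs (tens K P P \<one>\<^bsub>P\<^esub> y)"
    using y by (intro canT_descend bs_bilin bs_balanced) auto
  also have "\<dots> = bs \<one>\<^bsub>P\<^esub> y" using y by (simp add: tlift_tens[OF _ _ _ bs_bilin])
  also have "\<dots> = tlift PP (tens K P P) (s' y)"
    unfolding bs_def using y by (intro tlift_cong[of P P]) auto
  also have "\<dots> = s' y" using y by (simp add: tlift_id)
  finally have "s' y = tlift PP bs (tau.rsplit y)" by simp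
  also have "\<dots> = tlift PP (\<lambda>p0 c. tlift PP (\<lambda>x y. bs (p0 \<otimes>\<^bsub>P\<^esub> x) y) (\<tau> c)) (\<rho> y)"
    by (rule tau.tlift_rsplit[OF _ bs_bilin y]) simp
  also have "\<dots> = tlift PP (\<lambda>p0 c. tlift PP (\<lambda>x y. ?L p0 (bs x y)) (\<tau> c)) (\<rho> y)"
    using y by (intro tlift_cong2[of _ P C _ P P]) (auto simp: Lbs)
  also have "\<dots> = tlift PP (\<lambda>p0 c. ?L p0 (l c)) (\<rho> y)"
    unfolding l_def using y
    by (intro tlift_cong[of P C] tlift_push[of P P, symmetric] L) (auto intro!: tlift_closed[of P P])
  finally show ?thesis by (simp add: rsplit_def)
qed

text \<open>Right colinearity of the splitting gives \<open>s'(y_0) \<otimes> y_1\<close>, which by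
  \<open>rsplit_s'\<close> is \<open>y_0 l(y_1) \<otimes> y_2\<close>. The value over
  \<open>\<tau> c\<close> is therefore a function of \<open>canT (\<tau> c) = 1 \<otimes> c\<close>
  alone.\<close>

lemma l_right:
  assumes M [simp, mlin]: "module K M" and \<beta>: "trilin P P C M \<beta>" and c: "c \<in> carrier C"
  shows "tlift M (\<lambda>x y. tlift M (\<beta> x) (\<rho> y)) (l c) =
    tlift M (\<lambda>c1 c2. tlift M (\<lambda>x y. \<beta> x y c2) (l c1)) (\<Delta> c)"
proof -
  note \<beta>' = trilinD[OF \<beta>]
  note [mlin] = \<beta>'(1,5) linear_comp[OF \<beta>'(2)] linear_comp[OF \<beta>'(3)] linear_comp[OF \<beta>'(4)]
  \<comment> \<open>The right-hand side of the claim with an extra left factor \<open>p\<close>. The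
    left-hand side turns out to be \<open>?H\<close> applied to \<open>canT (\<tau> c)\<close>, so
    that \<open>p\<close> becomes the unit.\<close>
  let ?H = "\<lambda>p d. tlift M (\<lambda>c1 c2. tlift M (\<lambda>u v. \<beta> (p \<otimes>\<^bsub>P\<^esub> u) v c2) (l c1)) (\<Delta> d)"
  have H: "bilin P C M ?H" by (assumption | rule mlin)+
  have inner: "tlift M (\<lambda>b q. tlift M (\<beta> (x \<otimes>\<^bsub>P\<^esub> b)) (\<rho> q)) (s' y) = tlift M ?H (lmul x (\<rho> y))"
    if x: "x \<in> carrier P" and y: "y \<in> carrier P" for x y
  proof -
    have "tlift M (\<lambda>b q. tlift M (\<beta> (x \<otimes>\<^bsub>P\<^esub> b)) (\<rho> q)) (s' y) =
        tlift M (\<lambda>p0 d. tlift M (\<lambda>b q. \<beta> (x \<otimes>\<^bsub>P\<^esub> b) q d) (s' p0)) (\<rho> y)"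
      by (rule s'_right; (assumption | rule x y mlin)+)
    also have "\<dots> = tlift M (\<lambda>p0 d. tlift M (\<lambda>p1 c'. tlift M (\<lambda>u v. \<beta> (x \<otimes>\<^bsub>P\<^esub> (p1 \<otimes>\<^bsub>P\<^esub> u)) v d) (l c')) (\<rho> p0)) (\<rho> y)"
    proof (rule tlift_cong[of P C])
      show "tlift M (\<lambda>b q. \<beta> (x \<otimes>\<^bsub>P\<^esub> b) q d) (s' p0) =
          tlift M (\<lambda>p1 c'. tlift M (\<lambda>u v. \<beta> (x \<otimes>\<^bsub>P\<^esub> (p1 \<otimes>\<^bsub>P\<^esub> u)) v d) (l c')) (\<rho> p0)"
        if p0: "p0 \<in> carrier P" and d: "d \<in> carrier C" for p0 d
        unfolding rsplit_s'[OF p0, symmetric] by (rule tlift_rsplit; (assumption | rule p0 d x mlin)+)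
    qed (assumption | rule x y mlin)+
    also have "\<dots> = tlift M (\<lambda>p0 d. tlift M (\<lambda>c1 c2. tlift M (\<lambda>u v. \<beta> (x \<otimes>\<^bsub>P\<^esub> (p0 \<otimes>\<^bsub>P\<^esub> u)) v c2) (l c1)) (\<Delta> d)) (\<rho> y)"
      by (rule right_coassoc[OF right_coaction]; (assumption | rule x y mlin)+)
    also have "\<dots> = tlift M (\<lambda>q d. ?H (x \<otimes>\<^bsub>P\<^esub> q) d) (\<rho> y)"
      by (rule tlift_cong, (assumption | rule x y mlin)+, rule tlift_cong2;
        (assumption | rule x y mlin | simp add: mult_assoc x)+)
    also have "\<dots> = tlift M ?H (lmul x (\<rho> y))"
      by (rule tlift_lmul[symmetric, OF _ H]) (auto simp: x y)
    finally show ?thesis .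
  qed
  have "tlift M (\<lambda>x y. tlift M (\<beta> x) (\<rho> y)) (l c) =
      tlift M (\<lambda>x y. tlift M (\<lambda>b q. tlift M (\<beta> (x \<otimes>\<^bsub>P\<^esub> b)) (\<rho> q)) (s' y)) (\<tau> c)"
    by (rule tlift_l; (assumption | rule c mlin)+)
  also have "\<dots> = tlift M (\<lambda>x y. tlift M ?H (lmul x (\<rho> y))) (\<tau> c)"
    by (rule tlift_cong; (assumption | rule c inner mlin)+)
  also have "\<dots> = tlift M ?H (canT (\<tau> c))"
    unfolding canT_def by (rule tlift_push[symmetric, OF _ _ tlift_linear]; (assumption | rule c mlin)+)
  also have "\<dots> = ?H \<one>\<^bsub>P\<^esub> c" using c by (simp add: canT_\<tau> tlift_tens[OF _ _ _ H])
  also have "\<dots> = tlift M (\<lambda>c1 c2. tlift M (\<lambda>x y. \<beta> x y c2) (l c1)) (\<Delta> c)"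
    by (rule tlift_cong2; (assumption | rule c mlin | simp)+)
  finally show ?thesis .
qed

text \<open>Expanding \<open>psi\<close> turns \<open>ract (\<rho> p) q\<close> into the sum of
  \<open>u \<rho>(y q)\<close> over the legs of \<open>rsplit p\<close>, which is
  \<open>s' p\<close>. There \<open>u\<close> is coinvariant and moves inside \<open>\<rho>\<close>,
  where \<open>u y\<close> sums up to \<open>p\<close>.\<close>

lemma \<rho>_mult:
  assumes p: "p \<in> carrier P" and q: "q \<in> carrier P"
  shows "\<rho> (p \<otimes>\<^bsub>P\<^esub> q) = ract (\<rho> p) q"
proof -
  have "ract (\<rho> p) q = tlift PC (\<lambda>p0 c. tlift PC (\<lambda>x y. lmul (p0 \<otimes>\<^bsub>P\<^esub> x) (\<rho> (y \<otimes>\<^bsub>P\<^esub> q))) (l c)) (\<rho> p)"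
    unfolding ract_def
  proof (rule tlift_cong[of P C])
    show "lmul p0 (psi d q) = tlift PC (\<lambda>x y. lmul (p0 \<otimes>\<^bsub>P\<^esub> x) (\<rho> (y \<otimes>\<^bsub>P\<^esub> q))) (l d)"
      if p0: "p0 \<in> carrier P" and d: "d \<in> carrier C" for p0 d
    proof -
      have "lmul p0 (psi d q) = tlift PC (\<lambda>x y. lmul p0 (lmul x (\<rho> (y \<otimes>\<^bsub>P\<^esub> q)))) (l d)"
        unfolding psi_def by (rule tlift_push; (assumption | rule p0 d q mlin)+)
      also have "\<dots> = tlift PC (\<lambda>x y. lmul (p0 \<otimes>\<^bsub>P\<^esub> x) (\<rho> (y \<otimes>\<^bsub>P\<^esub> q))) (l d)"
        using p0 d q by (intro tlift_cong[of P P]) (auto simp: lmul_lmul)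
      finally show ?thesis .
    qed
  qed (assumption | rule p q mlin)+
  also have "\<dots> = tlift PC (\<lambda>u y. lmul u (\<rho> (y \<otimes>\<^bsub>P\<^esub> q))) (s' p)"
    unfolding rsplit_s'[OF p, symmetric] by (rule tlift_rsplit[symmetric]; (assumption | rule p q mlin)+)
  also have "\<dots> = tlift PC (\<lambda>b y. \<rho> ((b \<otimes>\<^bsub>P\<^esub> y) \<otimes>\<^bsub>P\<^esub> q)) (s' p)"
  proof (rule s'_cong[OF _ _ _ _ p])
    show "lmul b (\<rho> (y \<otimes>\<^bsub>P\<^esub> q)) = \<rho> ((b \<otimes>\<^bsub>P\<^esub> y) \<otimes>\<^bsub>P\<^esub> q)" if "b \<in> B" "y \<in> carrier P" for b y
      using that q coinvariants_closed[of b] by (simp add: mult_assoc coinvariants_mult)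
  qed (assumption | rule p q mlin)+
  also have "\<dots> = \<rho> (tlift P (mult P) (s' p) \<otimes>\<^bsub>P\<^esub> q)"
    by (rule tlift_push[symmetric, where g = "\<lambda>z. \<rho> (z \<otimes>\<^bsub>P\<^esub> q)"]; (assumption | rule p q mlin)+)
  also have "\<dots> = \<rho> (p \<otimes>\<^bsub>P\<^esub> q)" using p by (simp add: s'_mult)
  finally show ?thesis by simp
qed

text \<open>Here left colinearity of \<open>l\<close> is not yet available. Writing
  \<open>psi\<close> through \<open>l c1\<close> gives two factors
  \<open>l(c_1) = u \<otimes> v\<close> and \<open>l(c_2) = x \<otimes> y\<close>; right colinearity
  of the first turns them into \<open>u \<otimes> v_0 l(v_1)\<close>, that is, \<open>u\<close> and
  the splitting of \<open>v\<close>. The left leg of the splitting is coinvariant and contributes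
  \<open>e\<close>. Undoing the step, the product \<open>u v\<close> collapses to
  \<open>\<epsilon>(c_1)\<close>.\<close>

lemma l_left_psi:
  assumes M [simp, mlin]: "module K M" and \<beta>: "trilin P C P M \<beta>" and c: "c \<in> carrier C"
  shows "tlift M (\<lambda>c1 c2. tlift M (\<lambda>x y. tlift M (\<lambda>z d. \<beta> z d y) (psi c1 x)) (l c2)) (\<Delta> c) =
    tlift M (\<lambda>x y. \<beta> x e y) (l c)"
proof -
  note \<beta>' = trilinD[OF \<beta>]
  note [mlin] = \<beta>'(5) linear_comp[OF \<beta>'(2)] linear_comp[OF \<beta>'(3)] linear_comp[OF \<beta>'(4)]
  have b [mlin]: "bilin P C M (\<lambda>z d. \<beta> z d y)" if "y \<in> carrier P" for y
    using \<beta>' that by (intro bilinI) auto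
  let ?G = "\<lambda>u v x y. tlift M (\<lambda>z d. \<beta> (u \<otimes>\<^bsub>P\<^esub> z) d y) (\<rho> (v \<otimes>\<^bsub>P\<^esub> x))"
  have psi: "tlift M (\<lambda>z d. \<beta> z d y) (psi c1 x) = tlift M (\<lambda>u v. ?G u v x y) (l c1)"
    if c1: "c1 \<in> carrier C" and x: "x \<in> carrier P" and y: "y \<in> carrier P" for c1 x y
  proof -
    have "tlift M (\<lambda>z d. \<beta> z d y) (psi c1 x) = tlift M (\<lambda>u v. tlift M (\<lambda>z d. \<beta> z d y) (lmul u (\<rho> (v \<otimes>\<^bsub>P\<^esub> x)))) (l c1)"
      unfolding psi_def by (rule tlift_push[OF _ _ tlift_linear]; (assumption | rule c1 x y mlin)+)
    also have "\<dots> = tlift M (\<lambda>u v. ?G u v x y) (l c1)"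
      by (rule tlift_cong; (assumption | rule c1 x y tlift_lmul mlin)+)
    finally show ?thesis .
  qed
  have G: "tlift M (\<lambda>v0 d. tlift M (\<lambda>x y. ?G u v0 x y) (l d)) (\<rho> v) =
      tlift M (\<lambda>v0 d. tlift M (\<lambda>x y. \<beta> (u \<otimes>\<^bsub>P\<^esub> (v0 \<otimes>\<^bsub>P\<^esub> x)) e y) (l d)) (\<rho> v)"
    if u: "u \<in> carrier P" and v: "v \<in> carrier P" for u v
  proof -
    have "tlift M (\<lambda>v0 d. tlift M (\<lambda>x y. ?G u v0 x y) (l d)) (\<rho> v) =
        tlift M (\<lambda>w y. tlift M (\<lambda>z d. \<beta> (u \<otimes>\<^bsub>P\<^esub> z) d y) (\<rho> w)) (rsplit v)"
      by (rule tlift_rsplit[symmetric]; (assumption | rule u v mlin)+)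
    also have "\<dots> = tlift M (\<lambda>w y. \<beta> (u \<otimes>\<^bsub>P\<^esub> w) e y) (rsplit v)"
      unfolding rsplit_s'[OF v]
    proof (rule s'_cong[OF _ _ _ _ v])
      show "tlift M (\<lambda>z d. \<beta> (u \<otimes>\<^bsub>P\<^esub> z) d y) (\<rho> w) = \<beta> (u \<otimes>\<^bsub>P\<^esub> w) e y" if w: "w \<in> B" and y: "y \<in> carrier P" for w y
        unfolding coinvariants_\<rho>[OF w]
        by (rule tlift_tens; (assumption | rule u v w y coinvariants_closed[OF w] mlin)+)
    qed (assumption | rule u v mlin)+
    also have "\<dots> = tlift M (\<lambda>v0 d. tlift M (\<lambda>x y. \<beta> (u \<otimes>\<^bsub>P\<^esub> (v0 \<otimes>\<^bsub>P\<^esub> x)) e y) (l d)) (\<rho> v)"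
      by (rule tlift_rsplit; (assumption | rule u v mlin)+)
    finally show ?thesis .
  qed
  have "tlift M (\<lambda>c1 c2. tlift M (\<lambda>x y. tlift M (\<lambda>z d. \<beta> z d y) (psi c1 x)) (l c2)) (\<Delta> c) =
      tlift M (\<lambda>c1 c2. tlift M (\<lambda>x y. tlift M (\<lambda>u v. ?G u v x y) (l c1)) (l c2)) (\<Delta> c)"
    by (rule tlift_cong2; (assumption | rule c psi mlin)+)
  also have "\<dots> = tlift M (\<lambda>c1 c2. tlift M (\<lambda>u v. tlift M (\<lambda>x y. ?G u v x y) (l c2)) (l c1)) (\<Delta> c)"
    by (rule tlift_cong, (assumption | rule c mlin)+, rule tlift_swap; (assumption | rule c mlin)+)
  also have "\<dots> = tlift M (\<lambda>u v. tlift M (\<lambda>v0 d. tlift M (\<lambda>x y. ?G u v0 x y) (l d)) (\<rho> v)) (l c)"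
    by (rule l_right[symmetric]; (assumption | rule c mlin)+)
  also have "\<dots> = tlift M (\<lambda>u v. tlift M (\<lambda>v0 d. tlift M (\<lambda>x y. \<beta> (u \<otimes>\<^bsub>P\<^esub> (v0 \<otimes>\<^bsub>P\<^esub> x)) e y) (l d)) (\<rho> v)) (l c)"
    by (rule tlift_cong; (assumption | rule c G mlin)+)
  also have "\<dots> = tlift M (\<lambda>c1 c2. tlift M (\<lambda>u v. tlift M (\<lambda>x y. \<beta> (u \<otimes>\<^bsub>P\<^esub> (v \<otimes>\<^bsub>P\<^esub> x)) e y) (l c2)) (l c1)) (\<Delta> c)"
    by (rule l_right; (assumption | rule c mlin)+)
  also have "\<dots> = tlift M (\<lambda>c1 c2. \<epsilon> c1 \<odot>\<^bsub>M\<^esub> tlift M (\<lambda>x y. \<beta> x e y) (l c2)) (\<Delta> c)"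
  proof (rule tlift_cong[of C C])
    fix c1 c2 assume c1: "c1 \<in> carrier C" and c2: "c2 \<in> carrier C"
    let ?g = "\<lambda>z. tlift M (\<lambda>x y. \<beta> (z \<otimes>\<^bsub>P\<^esub> x) e y) (l c2)"
    have g: "?g \<in> linear_maps K P M" by (assumption | rule c2 mlin)+
    have "tlift M (\<lambda>u v. tlift M (\<lambda>x y. \<beta> (u \<otimes>\<^bsub>P\<^esub> (v \<otimes>\<^bsub>P\<^esub> x)) e y) (l c2)) (l c1) = tlift M (\<lambda>u v. ?g (u \<otimes>\<^bsub>P\<^esub> v)) (l c1)"
      by (rule tlift_cong2; (assumption | rule c1 c2 mlin | simp add: mult_assoc)+)
    also have "\<dots> = ?g (tlift P (mult P) (l c1))"
      by (rule tlift_push[OF _ _ g, symmetric]; (assumption | rule c1 mlin)+)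
    also have "\<dots> = \<epsilon> c1 \<odot>\<^bsub>M\<^esub> ?g \<one>\<^bsub>P\<^esub>" using c1 linear_smult[OF g] by (simp add: l_mult)
    also have "?g \<one>\<^bsub>P\<^esub> = tlift M (\<lambda>x y. \<beta> x e y) (l c2)"
      using c2 \<beta>'(5) by (intro tlift_cong[of P P]) auto
    finally show "tlift M (\<lambda>u v. tlift M (\<lambda>x y. \<beta> (u \<otimes>\<^bsub>P\<^esub> (v \<otimes>\<^bsub>P\<^esub> x)) e y) (l c2)) (l c1) =
      \<epsilon> c1 \<odot>\<^bsub>M\<^esub> tlift M (\<lambda>x y. \<beta> x e y) (l c2)" .
  qed (use c \<beta>'(5) in \<open>auto intro!: smult_simps(1) tlift_closed[of P P]\<close>)
  also have "\<dots> = tlift M (\<lambda>x y. \<beta> x e y) (l c)"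
    by (rule left_counit[OF left_comult, where g = "\<lambda>c. tlift M (\<lambda>x y. \<beta> x e y) (l c)"];
      (assumption | rule c mlin)+)
  finally show ?thesis .
qed

lemma strong_connection_l:
  assumes "principal_coaug_alg K C e P"
  shows "strong_connection K C e P l"
proof
  have ent: "entwining K C P t = Psi t" if "t \<in> carrier CP" for t
    by (rule entwining_eq_Psi[OF can canT_l that])
  have bij: "bij_betw (entwining K C P) (carrier CP) (carrier PC)"
    and \<sigma>: "p \<in> carrier P \<Longrightarrow> \<sigma> p = inv_into (carrier CP) (entwining K C P) (tens K P C p e)" for p
    using assms by (auto simp: principal_coaug_alg_def principal_extension_def)
  show inj: "inj_on Psi (carrier CP)"
    using bij ent by (auto simp: bij_betw_def inj_on_def)
  show Psi_\<sigma>: "Psi (\<sigma> p) = tens K P C p e" if p: "p \<in> carrier P" for p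
  proof -
    have "entwining K C P (\<sigma> p) = tens K P C p e"
      unfolding \<sigma>[OF p] by (rule f_inv_into_f) (use bij p in \<open>auto simp: bij_betw_def\<close>)
    then show ?thesis using p by (simp add: ent)
  qed
  show "tlift P (mult P) (l c) = \<epsilon> c \<odot>\<^bsub>P\<^esub> \<one>\<^bsub>P\<^esub>" if "c \<in> carrier C" for c
    using that by (rule l_mult)
  show "\<rho> (p \<otimes>\<^bsub>P\<^esub> q) = ract (\<rho> p) q" if "p \<in> carrier P" "q \<in> carrier P" for p q
    using that by (rule \<rho>_mult)
  show "tlift (tensor K P PC) (\<lambda>x y. tlift (tensor K P PC) (\<lambda>z d. tens K P PC x (tens K P C z d)) (\<rho> y)) (l c) =
      tlift (tensor K P PC) (\<lambda>c1 c2. tlift (tensor K P PC) (\<lambda>x y. tens K P PC x (tens K P C y c2)) (l c1)) (\<Delta> c)"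
    if c: "c \<in> carrier C" for c
    by (rule l_right; (assumption | rule c mlin)+)
  let ?T = "tensor K C PP"
  \<comment> \<open>Left colinearity is \<open>l_left_psi\<close> with the entwining inverted. The
    inverse has to be linear in order to be applied under the lifts.\<close>
  obtain \<Phi> where \<Phi>: "\<Phi> \<in> linear_maps K PC CP" and \<Phi>1: "\<And>t. t \<in> carrier CP \<Longrightarrow> Psi (\<Phi> (Psi t)) = Psi t"
    by (rule pseudo_inverse_exists[OF _ _ Psi_linear]) auto
  have \<Phi>P: "\<Phi> (Psi t) = t" if "t \<in> carrier CP" for t
    using inj \<Phi>1[OF that] by (rule inj_onD) (auto intro!: that linear_closed[OF \<Phi>] linear_closed[OF Psi_linear])
  note [mlin] = linear_comp[OF \<Phi>] linear_closed[OF \<Phi>]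
  let ?g = "\<lambda>y. tlift ?T (\<lambda>d x. tens K C PP d (tens K P P x y))"
  show "tlift ?T (\<lambda>x y. tlift ?T (\<lambda>d z. tens K C PP d (tens K P P z y)) (\<sigma> x)) (l c) =
      tlift ?T (\<lambda>c1 c2. tlift ?T (\<lambda>x y. tens K C PP c1 (tens K P P x y)) (l c2)) (\<Delta> c)"
    if c: "c \<in> carrier C" for c
  proof -
    have gt: "?g y (tens K C P d x) = tens K C PP d (tens K P P x y)"
      if d: "d \<in> carrier C" and x: "x \<in> carrier P" and y: "y \<in> carrier P" for d x y
      by (rule tlift_tens; (assumption | rule d x y mlin)+)
    have psi: "tlift ?T (\<lambda>z d. ?g y (\<Phi> (tens K P C z d))) (psi c1 x) = tens K C PP c1 (tens K P P x y)"
      if c1: "c1 \<in> carrier C" and x: "x \<in> carrier P" and y: "y \<in> carrier P" for c1 x y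
    proof -
      have "tlift ?T (\<lambda>z d. ?g y (\<Phi> (tens K P C z d))) (psi c1 x) = ?g y (\<Phi> (tlift PC (tens K P C) (psi c1 x)))"
        by (rule tlift_push[symmetric, where g = "\<lambda>t. ?g y (\<Phi> t)"]; (assumption | rule c1 x y mlin)+)
      also have "\<dots> = ?g y (\<Phi> (Psi (tens K C P c1 x)))" using c1 x by (simp add: tlift_id Psi_tens)
      also have "\<dots> = tens K C PP c1 (tens K P P x y)" using c1 x y by (simp add: \<Phi>P gt)
      finally show ?thesis .
    qed
    have "tlift ?T (\<lambda>x y. tlift ?T (\<lambda>d z. tens K C PP d (tens K P P z y)) (\<sigma> x)) (l c) =
        tlift ?T (\<lambda>x y. ?g y (\<Phi> (tens K P C x e))) (l c)"
      using c by (intro tlift_cong[of P P]) (auto simp flip: Psi_\<sigma> simp: \<Phi>P intro!: tlift_closed[of C P])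
    also have "\<dots> = tlift ?T (\<lambda>c1 c2. tlift ?T (\<lambda>x y. tlift ?T (\<lambda>z d. ?g y (\<Phi> (tens K P C z d))) (psi c1 x)) (l c2)) (\<Delta> c)"
      by (rule l_left_psi[symmetric]; (assumption | rule c mlin)+)
    also have "\<dots> = tlift ?T (\<lambda>c1 c2. tlift ?T (\<lambda>x y. tens K C PP c1 (tens K P P x y)) (l c2)) (\<Delta> c)"
      by (rule tlift_cong2; (assumption | rule c psi mlin)+)
    finally show ?thesis .
  qed
qed

end

text \<open>What is left to provide is a linear lift of the translation map. The map
  \<open>canT\<close> on \<open>P \<otimes> P\<close> is onto, being the projection to the balanced
  tensor product followed by the bijective canonical map, and a linear section of it applied to
  \<open>1 \<otimes> c\<close> is such a lift.\<close>

lemma (in coalgebra_point) principal_imp_strong_connection: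
  assumes pr: "principal_coaug_alg K C e P"
  shows "\<exists>l. strong_connection K C e P l"
proof -
  interpret coaug K C e P
    by unfold_locales (use pr in \<open>simp add: principal_coaug_alg_def\<close>)
  have can: "can_bijective K C P" and ex: "\<exists>s. colinear_splitting K C P s"
    using pr by (auto simp: principal_coaug_alg_def principal_extension_def)
  let ?PP = "tensor K P P"
  define proj where "proj = tlift BT (btens K P B)"
  have proj: "proj \<in> linear_maps K ?PP BT" unfolding proj_def using btens_bilin_BT by (intro tlift_linear) auto
  have proj_tens: "proj (tens K P P x y) = btens K P B x y" if "x \<in> carrier P" "y \<in> carrier P" for x y
    unfolding proj_def using that btens_bilin_BT by (intro tlift_tens) auto
  \<comment> \<open>A section of the projection; it shows that every balanced tensor has a preimage
    in \<open>P \<otimes> P\<close>, so that \<open>canT\<close> is onto there.\<close>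
  obtain h where h: "h \<in> linear_maps K BT ?PP" and ph: "\<And>u. u \<in> carrier ?PP \<Longrightarrow> proj (h (proj u)) = proj u"
    by (rule pseudo_inverse_exists[OF _ _ proj]) auto
  have projh: "proj (h w) = w" if w: "w \<in> carrier BT" for w
  proof (rule BT_eqI[of BT "\<lambda>w. proj (h w)" "\<lambda>w. w", OF _ linear_comp[OF proj h] linear_id _ w])
    show "proj (h (btens K P B x y)) = btens K P B x y" if "x \<in> carrier P" "y \<in> carrier P" for x y
      using ph[of "tens K P P x y"] that by (simp add: proj_tens)
  qed simp
  obtain g where g: "g \<in> linear_maps K PC ?PP" and cg: "\<And>u. u \<in> carrier ?PP \<Longrightarrow> canT (g (canT u)) = canT u"
    by (rule pseudo_inverse_exists[OF _ _ canT_linear]) auto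
  have cang: "canT (g t) = t" if t: "t \<in> carrier PC" for t
  proof -
    have "t \<in> canT ` carrier BT" using can t by (simp add: can_bijective_def can_map_eq bij_betw_def)
    then obtain w where w: "w \<in> carrier BT" "canT w = t" by blast
    have "canT (h w) = canT (proj (h w))" unfolding proj_def using w linear_closed[OF h] by (simp add: can_proj)
    also have "\<dots> = t" using w by (simp add: projh)
    finally show ?thesis using cg[of "h w"] w linear_closed[OF h] by simp
  qed
  obtain s where s: "colinear_splitting K C P s" using ex by blast
  interpret principal_data K C e P s "\<lambda>c. g (tens K P C \<one>\<^bsub>P\<^esub> c)"
    by unfold_locales (auto intro!: can s linear_comp[OF g] linear_tens2 simp: cang)
  show ?thesis using strong_connection_l[OF pr] by blast
qed

context vector_spaces
begin

lemma inv_into_linear: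
  assumes f: "f \<in> linear_maps K V W" and bij: "bij_betw f (carrier V) (carrier W)"
    and V: "module K V"
  shows "inv_into (carrier V) f \<in> linear_maps K W V"
proof -
  let ?g = "inv_into (carrier V) f"
  have g: "?g y \<in> carrier V" "f (?g y) = y" if "y \<in> carrier W" for y
    using bij that by (auto simp: bij_betw_def inv_into_into f_inv_into_f)
  have gf: "?g (f x) = x" if "x \<in> carrier V" for x
    using bij that by (simp add: bij_betw_def)
  show ?thesis
  proof (rule linear_mapsI)
    show "?g (x \<oplus>\<^bsub>W\<^esub> y) = ?g x \<oplus>\<^bsub>V\<^esub> ?g y" if "x \<in> carrier W" "y \<in> carrier W" for x y
      using gf[of "?g x \<oplus>\<^bsub>V\<^esub> ?g y"] g that V by (simp add: linear_add[OF f])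
    show "?g (a \<odot>\<^bsub>W\<^esub> x) = a \<odot>\<^bsub>V\<^esub> ?g x" if "a \<in> carrier K" "x \<in> carrier W" for a x
      using gf[of "a \<odot>\<^bsub>V\<^esub> ?g x"] g that V by (simp add: linear_smult[OF f])
  qed (use g in auto)
qed

end

context strong_connection
begin

definition Psi_inv :: "('p \<times> 'c \<Rightarrow> 'k) set \<Rightarrow> ('c \<times> 'p \<Rightarrow> 'k) set" where
  "Psi_inv = inv_into (carrier CP) Psi"

lemma Psi_bij: "bij_betw Psi (carrier CP) (carrier PC)"
  using Psi_inj Psi_surj linear_closed[OF Psi_linear] by (auto simp: bij_betw_def)

lemma Psi_inv_linear: "Psi_inv \<in> linear_maps K PC CP"
  unfolding Psi_inv_def by (rule inv_into_linear[OF Psi_linear Psi_bij]) simp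

lemmas Psi_inv_closed [simp, mlin] = linear_closed[OF Psi_inv_linear]
lemmas Psi_inv_linear_comp [mlin] = linear_comp[OF Psi_inv_linear]

lemma Psi_inv_Psi [simp]: "t \<in> carrier CP \<Longrightarrow> Psi_inv (Psi t) = t"
  unfolding Psi_inv_def by (rule inv_into_f_f[OF Psi_inj])

lemma psi_one: "c \<in> carrier C \<Longrightarrow> psi c \<one>\<^bsub>P\<^esub> = tens K P C \<one>\<^bsub>P\<^esub> c"
proof -
  assume c: "c \<in> carrier C"
  have "psi c \<one>\<^bsub>P\<^esub> = canT (l c)"
    unfolding psi_def canT_def using c by (intro tlift_cong[of P P]) auto
  then show ?thesis using c by (simp add: canT_l)
qed

end

section \<open>Colinear sections of surjections\<close>

locale coaug_hom = coalgebra_point K C e + P: coaug K C e P + Q: coaug K C e Q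
  for K :: "'k ring" and C :: "('k, 'c) coalg" and e :: 'c
    and P :: "('k, 'p, 'c) coact_alg" and Q :: "('k, 'q, 'c) coact_alg" +
  fixes f :: "'p \<Rightarrow> 'q"
  assumes hom: "coaug_alg_hom K C P Q f"
begin

lemma f_linear: "f \<in> linear_maps K P Q"
  and f_mult: "x \<in> carrier P \<Longrightarrow> y \<in> carrier P \<Longrightarrow> f (x \<otimes>\<^bsub>P\<^esub> y) = f x \<otimes>\<^bsub>Q\<^esub> f y"
  and f_one: "f \<one>\<^bsub>P\<^esub> = \<one>\<^bsub>Q\<^esub>"
  using hom by (auto simp: coaug_alg_hom_def ring_hom_def)

lemmas f_closed [simp, mlin] = linear_closed[OF f_linear]
lemmas f_linear_comp [mlin] = linear_comp[OF f_linear]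

lemma tlift_rcoact:
  assumes "module K M" "bilin Q C M \<beta>" "p \<in> carrier P"
  shows "tlift M \<beta> (rcoact Q (f p)) = tlift M (\<lambda>x c. \<beta> (f x) c) (rcoact P p)"
  using assms hom tmap_eval[of P C Q C M \<beta> "rcoact P p" f id] by (simp add: coaug_alg_hom_def)

lemma tlift_lcoact:
  assumes "module K M" "bilin C Q M \<beta>" "p \<in> carrier P"
  shows "tlift M \<beta> (lcoact Q (f p)) = tlift M (\<lambda>c x. \<beta> c (f x)) (lcoact P p)"
  using assms hom tmap_eval[of C P C Q M \<beta> "lcoact P p" id f] by (simp add: coaug_alg_hom_def)

definition T :: "('p \<times> 'c \<Rightarrow> 'k) set \<Rightarrow> ('q \<times> 'c \<Rightarrow> 'k) set" where
  "T = tlift Q.PC (\<lambda>x c. tens K Q C (f x) c)"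

definition S :: "('c \<times> 'p \<Rightarrow> 'k) set \<Rightarrow> ('c \<times> 'q \<Rightarrow> 'k) set" where
  "S = tlift Q.CP (\<lambda>c x. tens K C Q c (f x))"

lemma T_linear: "T \<in> linear_maps K P.PC Q.PC"
  unfolding T_def by (rule tlift_linear; (assumption | rule mlin)+)

lemma S_linear: "S \<in> linear_maps K P.CP Q.CP"
  unfolding S_def by (rule tlift_linear; (assumption | rule mlin)+)

lemmas TS_closed [simp, mlin] = linear_closed[OF T_linear] linear_closed[OF S_linear]
lemmas TS_linear_comp [mlin] = linear_comp[OF T_linear] linear_comp[OF S_linear]

lemma T_tens [simp]: "x \<in> carrier P \<Longrightarrow> c \<in> carrier C \<Longrightarrow> T (tens K P C x c) = tens K Q C (f x) c"
  unfolding T_def by (rule tlift_tens; (assumption | rule mlin)+)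

lemma S_tens [simp]: "x \<in> carrier P \<Longrightarrow> c \<in> carrier C \<Longrightarrow> S (tens K C P c x) = tens K C Q c (f x)"
  unfolding S_def by (rule tlift_tens; (assumption | rule mlin)+)

lemma T_rcoact: "p \<in> carrier P \<Longrightarrow> T (rcoact P p) = rcoact Q (f p)"
  using hom by (simp add: coaug_alg_hom_def T_def tmap_def)

lemma S_lcoact: "p \<in> carrier P \<Longrightarrow> S (lcoact P p) = lcoact Q (f p)"
  using hom by (simp add: coaug_alg_hom_def S_def tmap_def)

lemma T_lmul:
  assumes x: "x \<in> carrier P" and s: "s \<in> carrier P.PC"
  shows "T (P.lmul x s) = Q.lmul (f x) (T s)"
  by (rule tensor_eqI[of P C Q.PC "\<lambda>s. T (P.lmul x s)", OF _ _ _ _ _ _ s])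
    (assumption | rule x mlin | simp add: f_mult x)+

end

text \<open>Only a right connection is required of the source: naturality of the entwining is used
  to prove that the right connection of the fibre product is strong.\<close>

locale connection_hom = coaug_hom K C e P Q f + P: right_connection K C e P l + Q: strong_connection K C e Q lQ
  for K :: "'k ring" and C :: "('k, 'c) coalg" and e :: 'c
    and P :: "('k, 'p, 'c) coact_alg" and Q :: "('k, 'q, 'c) coact_alg" and f
    and l :: "'c \<Rightarrow> ('p \<times> 'p \<Rightarrow> 'k) set" and lQ :: "'c \<Rightarrow> ('q \<times> 'q \<Rightarrow> 'k) set"
begin

text \<open>\<open>f\<close> need not carry \<open>l\<close> to \<open>lQ\<close>. But the image of
  \<open>l c\<close> under \<open>f \<otimes> f\<close> is also a lift of
  \<open>1 \<otimes> c\<close> along the canonical map of \<open>Q\<close>, and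
  \<open>Q.psi_of_lift\<close> says that any such lift computes the entwining.\<close>

lemma T_psi:
  assumes c: "c \<in> carrier C" and p: "p \<in> carrier P"
  shows "T (P.psi c p) = Q.psi c (f p)"
proof -
  let ?QQ = "tensor K Q Q"
  let ?u = "tlift ?QQ (\<lambda>x y. tens K Q Q (f x) (f y)) (l c)"
  have u: "?u \<in> carrier ?QQ" by (assumption | rule c mlin)+
  have F: "tlift Q.PC F ?u = tlift Q.PC (\<lambda>x y. F (f x) (f y)) (l c)" if F: "bilin Q Q Q.PC F" for F
  proof -
    have "tlift Q.PC F ?u = tlift Q.PC (\<lambda>x y. tlift Q.PC F (tens K Q Q (f x) (f y))) (l c)"
      using F c by (intro tlift_push[of P P] tlift_linear) auto
    also have "\<dots> = tlift Q.PC (\<lambda>x y. F (f x) (f y)) (l c)"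
      using F c bilinD(3)[OF F] by (intro tlift_cong[of P P]) (auto simp: tlift_tens)
    finally show ?thesis .
  qed
  have "Q.canT ?u = tlift Q.PC (\<lambda>x y. Q.lmul (f x) (rcoact Q (f y))) (l c)"
    unfolding Q.canT_def by (rule F[OF Q.can_bilin])
  also have "\<dots> = tlift Q.PC (\<lambda>x y. T (P.lmul x (rcoact P y))) (l c)"
    using c by (intro tlift_cong[of P P]) (auto simp: T_lmul T_rcoact)
  also have "\<dots> = T (P.canT (l c))"
    unfolding P.canT_def by (rule tlift_push[OF _ _ T_linear, symmetric]; (assumption | rule c mlin)+)
  also have "\<dots> = tens K Q C \<one>\<^bsub>Q\<^esub> c" using c by (simp add: P.canT_l f_one)
  finally have can: "Q.canT ?u = tens K Q C \<one>\<^bsub>Q\<^esub> c" .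
  have "T (P.psi c p) = tlift Q.PC (\<lambda>x y. T (P.lmul x (rcoact P (y \<otimes>\<^bsub>P\<^esub> p)))) (l c)"
    unfolding P.psi_def by (rule tlift_push[OF _ _ T_linear]; (assumption | rule c p mlin)+)
  also have "\<dots> = tlift Q.PC (\<lambda>x y. Q.lmul (f x) (rcoact Q (f y \<otimes>\<^bsub>Q\<^esub> f p))) (l c)"
    using c p by (intro tlift_cong[of P P]) (auto simp: T_lmul T_rcoact f_mult)
  also have "\<dots> = tlift Q.PC (\<lambda>x y. Q.lmul x (rcoact Q (y \<otimes>\<^bsub>Q\<^esub> f p))) ?u"
    by (rule F[symmetric]; (assumption | rule c p mlin)+)
  also have "\<dots> = Q.psi c (f p)" using c p u can by (intro Q.psi_of_lift) auto
  finally show ?thesis .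
qed

lemma T_ract:
  assumes p: "p \<in> carrier P" and s: "s \<in> carrier P.PC"
  shows "T (P.ract s p) = Q.ract (T s) (f p)"
  by (rule tensor_eqI[of P C Q.PC "\<lambda>s. T (P.ract s p)", OF _ _ _ _ _ _ s])
    (assumption | rule p mlin | simp add: T_psi T_lmul p)+

lemma T_Psi:
  assumes t: "t \<in> carrier P.CP"
  shows "T (P.Psi t) = Q.Psi (S t)"
  by (rule tensor_eqI[of C P Q.PC "\<lambda>t. T (P.Psi t)", OF _ _ _ _ _ _ t])
    (assumption | rule mlin linear_comp[OF T_linear P.Psi_linear] linear_comp[OF Q.Psi_linear S_linear]
      | simp add: T_psi P.Psi_tens Q.Psi_tens)+

end

locale principal_surjection = coaug_hom K C e P Q f + P: strong_connection K C e P l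
  for K :: "'k ring" and C :: "('k, 'c) coalg" and e :: 'c
    and P :: "('k, 'p, 'c) coact_alg" and Q :: "('k, 'q, 'c) coact_alg" and f
    and l :: "'c \<Rightarrow> ('p \<times> 'p \<Rightarrow> 'k) set" +
  assumes surj: "f ` carrier P = carrier Q"
begin

text \<open>A pseudo-inverse of \<open>f\<close> restricted to \<open>B\<close>: a section over the
  image of \<open>B\<close> only, but linear on all of \<open>Q\<close> and with all its values in
  \<open>B\<close>.\<close>

definition sg :: "'q \<Rightarrow> 'p" where
  "sg = (SOME h. h \<in> linear_maps K Q P.BP \<and> (\<forall>b\<in>P.B. f (h (f b)) = f b))"

lemma sg_linear_BP: "sg \<in> linear_maps K Q P.BP"
  and f_sg: "b \<in> P.B \<Longrightarrow> f (sg (f b)) = f b"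
proof -
  have "\<exists>h. h \<in> linear_maps K Q P.BP \<and> (\<forall>b\<in>P.B. f (h (f b)) = f b)"
    by (rule pseudo_inverse_exists[OF _ _ P.BP_linear[OF f_linear]]) auto
  from someI_ex[OF this] show "sg \<in> linear_maps K Q P.BP" "b \<in> P.B \<Longrightarrow> f (sg (f b)) = f b"
    unfolding sg_def by blast+
qed

lemma sg_coinvariant: "z \<in> carrier Q \<Longrightarrow> sg z \<in> P.B"
  using linear_closed[OF sg_linear_BP] by simp

lemma sg_linear: "sg \<in> linear_maps K Q P"
  using sg_linear_BP P.coinvariants_closed by (auto simp: linear_maps_def)

lemmas sg_closed [simp, mlin] = linear_closed[OF sg_linear]
lemmas sg_linear_comp [mlin] = linear_comp[OF sg_linear]

text \<open>
  Sections of \<open>f\<close> that are right, respectively left, colinear: the linear section \<open>sg\<close> of the restriction of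
  \<open>f\<close> to coinvariants is extended along the splittings of \<open>Q\<close> given by the image of the strong connection.
\<close>

definition alphaR :: "'q \<Rightarrow> 'p" where
  "alphaR z = tlift P (\<lambda>z0 c. tlift P (\<lambda>x y. sg (z0 \<otimes>\<^bsub>Q\<^esub> f x) \<otimes>\<^bsub>P\<^esub> y) (l c)) (rcoact Q z)"

definition alphaL :: "'q \<Rightarrow> 'p" where
  "alphaL z = tlift P (\<lambda>c z0. tlift P (\<lambda>x y. x \<otimes>\<^bsub>P\<^esub> sg (f y \<otimes>\<^bsub>Q\<^esub> z0)) (l c)) (lcoact Q z)"

lemma alphaR_linear: "alphaR \<in> linear_maps K Q P"
  unfolding alphaR_def[abs_def] by (assumption | rule mlin)+

lemma alphaL_linear: "alphaL \<in> linear_maps K Q P"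
  unfolding alphaL_def[abs_def] by (assumption | rule mlin)+

lemmas alpha_closed [simp, mlin] = linear_closed[OF alphaR_linear] linear_closed[OF alphaL_linear]
lemmas alpha_linear_comp [mlin] = linear_comp[OF alphaR_linear] linear_comp[OF alphaL_linear]

lemma f_tlift_mult:
  assumes "u \<in> carrier (tensor K P P)"
  shows "tlift Q (\<lambda>x y. f x \<otimes>\<^bsub>Q\<^esub> f y) u = f (tlift P (mult P) u)"
proof -
  have "f (tlift P (mult P) u) = tlift Q (\<lambda>x y. f (x \<otimes>\<^bsub>P\<^esub> y)) u"
    by (rule tlift_push[OF _ _ f_linear]; (assumption | rule assms mlin)+)
  also have "\<dots> = tlift Q (\<lambda>x y. f x \<otimes>\<^bsub>Q\<^esub> f y) u"
    using assms by (intro tlift_cong[of P P]) (auto simp: f_mult)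
  finally show ?thesis by simp
qed

text \<open>Since \<open>f\<close> is colinear and multiplicative, the splitting of \<open>Q\<close>
  at \<open>f p\<close> is the image of \<open>rsplit p\<close>. As \<open>f\<close> is onto,
  coinvariance of the first leg of \<open>rsplit\<close> becomes available for
  \<open>alphaR\<close>.\<close>

lemma alphaR_f:
  assumes p: "p \<in> carrier P"
  shows "alphaR (f p) = tlift P (\<lambda>u y. sg (f u) \<otimes>\<^bsub>P\<^esub> y) (P.rsplit p)"
proof -
  have "alphaR (f p) = tlift P (\<lambda>p0 c. tlift P (\<lambda>x y. sg (f p0 \<otimes>\<^bsub>Q\<^esub> f x) \<otimes>\<^bsub>P\<^esub> y) (l c)) (rcoact P p)"
    unfolding alphaR_def by (rule tlift_rcoact; (assumption | rule p mlin)+)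
  also have "\<dots> = tlift P (\<lambda>p0 c. tlift P (\<lambda>x y. sg (f (p0 \<otimes>\<^bsub>P\<^esub> x)) \<otimes>\<^bsub>P\<^esub> y) (l c)) (rcoact P p)"
    using p by (intro tlift_cong2[of _ P C _ P P]) (auto simp: f_mult)
  also have "\<dots> = tlift P (\<lambda>u y. sg (f u) \<otimes>\<^bsub>P\<^esub> y) (P.rsplit p)"
    by (rule P.tlift_rsplit[symmetric]; (assumption | rule p mlin)+)
  finally show ?thesis .
qed

lemma alphaL_f:
  assumes p: "p \<in> carrier P"
  shows "alphaL (f p) = tlift P (\<lambda>x u. x \<otimes>\<^bsub>P\<^esub> sg (f u)) (P.lsplit p)"
proof -
  have "alphaL (f p) = tlift P (\<lambda>c p0. tlift P (\<lambda>x y. x \<otimes>\<^bsub>P\<^esub> sg (f y \<otimes>\<^bsub>Q\<^esub> f p0)) (l c)) (lcoact P p)"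
    unfolding alphaL_def by (rule tlift_lcoact; (assumption | rule p mlin)+)
  also have "\<dots> = tlift P (\<lambda>c p0. tlift P (\<lambda>x y. x \<otimes>\<^bsub>P\<^esub> sg (f (y \<otimes>\<^bsub>P\<^esub> p0))) (l c)) (lcoact P p)"
    using p by (intro tlift_cong2[of _ C P _ P P]) (auto simp: f_mult)
  also have "\<dots> = tlift P (\<lambda>x u. x \<otimes>\<^bsub>P\<^esub> sg (f u)) (P.lsplit p)"
    by (rule P.tlift_lsplit[symmetric]; (assumption | rule p mlin)+)
  finally show ?thesis .
qed

text \<open>\<open>sg\<close> is a section only over the image of \<open>B\<close>; inserting
  \<open>kappa\<close> by \<open>kappa_rsplit\<close> puts its argument there. What remains is
  \<open>f\<close> applied to the product of the legs of \<open>rsplit p\<close>.\<close>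

lemma f_alphaR:
  assumes z: "z \<in> carrier Q"
  shows "f (alphaR z) = z"
proof -
  obtain p where p: "p \<in> carrier P" and zp: "z = f p" using z surj by blast
  have F: "bilin P P Q (\<lambda>u y. f (sg (f u)) \<otimes>\<^bsub>Q\<^esub> f y)" by (assumption | rule mlin)+
  have G: "bilin P P Q (\<lambda>u y. f u \<otimes>\<^bsub>Q\<^esub> f y)" by (assumption | rule mlin)+
  have "f (alphaR z) = tlift Q (\<lambda>u y. f (sg (f u) \<otimes>\<^bsub>P\<^esub> y)) (P.rsplit p)"
    unfolding zp alphaR_f[OF p] by (rule tlift_push[OF _ _ f_linear]; (assumption | rule p mlin)+)
  also have "\<dots> = tlift Q (\<lambda>u y. f (sg (f u)) \<otimes>\<^bsub>Q\<^esub> f y) (P.rsplit p)"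
    using p by (intro tlift_cong[of P P]) (auto simp: f_mult)
  also have "\<dots> = tlift Q (\<lambda>u y. f (sg (f (P.kappa u))) \<otimes>\<^bsub>Q\<^esub> f y) (P.rsplit p)"
    by (rule P.kappa_rsplit[OF _ F p, symmetric]) simp
  also have "\<dots> = tlift Q (\<lambda>u y. f (P.kappa u) \<otimes>\<^bsub>Q\<^esub> f y) (P.rsplit p)"
    using p by (intro tlift_cong[of P P]) (auto simp: f_sg P.kappa_coinvariant)
  also have "\<dots> = z" using p by (simp add: P.kappa_rsplit[OF _ G] f_tlift_mult P.rsplit_mult zp)
  finally show ?thesis .
qed

lemma f_alphaL:
  assumes z: "z \<in> carrier Q"
  shows "f (alphaL z) = z"
proof -
  obtain p where p: "p \<in> carrier P" and zp: "z = f p" using z surj by blast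
  have F: "bilin P P Q (\<lambda>x u. f x \<otimes>\<^bsub>Q\<^esub> f (sg (f u)))" by (assumption | rule mlin)+
  have G: "bilin P P Q (\<lambda>u y. f u \<otimes>\<^bsub>Q\<^esub> f y)" by (assumption | rule mlin)+
  have "f (alphaL z) = tlift Q (\<lambda>x u. f (x \<otimes>\<^bsub>P\<^esub> sg (f u))) (P.lsplit p)"
    unfolding zp alphaL_f[OF p] by (rule tlift_push[OF _ _ f_linear]; (assumption | rule p mlin)+)
  also have "\<dots> = tlift Q (\<lambda>x u. f x \<otimes>\<^bsub>Q\<^esub> f (sg (f u))) (P.lsplit p)"
    using p by (intro tlift_cong[of P P]) (auto simp: f_mult)
  also have "\<dots> = tlift Q (\<lambda>x u. f x \<otimes>\<^bsub>Q\<^esub> f (sg (f (P.kappa u)))) (P.lsplit p)"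
    by (rule P.kappa_lsplit[OF _ F p, symmetric]) simp
  also have "\<dots> = tlift Q (\<lambda>x u. f x \<otimes>\<^bsub>Q\<^esub> f (P.kappa u)) (P.lsplit p)"
    using p by (intro tlift_cong[of P P]) (auto simp: f_sg P.kappa_coinvariant)
  also have "\<dots> = z" using p by (simp add: P.kappa_lsplit[OF _ G] f_tlift_mult P.lsplit_mult zp)
  finally show ?thesis .
qed

text \<open>The values of \<open>sg\<close> are coinvariant and pass through the right coaction,
  which then acts on the second leg of \<open>l\<close>; right colinearity of \<open>l\<close> and
  coassociativity in \<open>Q\<close> do the rest.\<close>

lemma tlift_rcoact_alphaR:
  assumes M [simp, mlin]: "module K M" and \<beta>: "bilin P C M \<beta>" and z: "z \<in> carrier Q"
  shows "tlift M \<beta> (rcoact P (alphaR z)) = tlift M (\<lambda>z0 c. \<beta> (alphaR z0) c) (rcoact Q z)"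
proof -
  note [mlin] = \<beta> bilinD(3)[OF \<beta>] linear_comp[OF bilinD(1)[OF \<beta>]] linear_comp[OF bilinD(2)[OF \<beta>]]
  have "tlift M \<beta> (rcoact P (alphaR z)) = tlift M (\<lambda>z0 c. tlift M (\<lambda>x y.
      tlift M \<beta> (rcoact P (sg (z0 \<otimes>\<^bsub>Q\<^esub> f x) \<otimes>\<^bsub>P\<^esub> y))) (l c)) (rcoact Q z)"
    unfolding alphaR_def
    by (rule tlift_push2[where g = "\<lambda>p. tlift M \<beta> (rcoact P p)"]; (assumption | rule z mlin)+)
  also have "\<dots> = tlift M (\<lambda>z0 c. tlift M (\<lambda>x y.
      tlift M (\<lambda>y0 d. \<beta> (sg (z0 \<otimes>\<^bsub>Q\<^esub> f x) \<otimes>\<^bsub>P\<^esub> y0) d) (rcoact P y)) (l c)) (rcoact Q z)"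
  proof (rule tlift_cong2[of _ Q C _ P P])
    show "tlift M \<beta> (rcoact P (sg (z0 \<otimes>\<^bsub>Q\<^esub> f x) \<otimes>\<^bsub>P\<^esub> y)) =
        tlift M (\<lambda>y0 d. \<beta> (sg (z0 \<otimes>\<^bsub>Q\<^esub> f x) \<otimes>\<^bsub>P\<^esub> y0) d) (rcoact P y)"
      if "z0 \<in> carrier Q" "x \<in> carrier P" "y \<in> carrier P" for z0 x y
      using that by (simp add: P.coinvariants_mult sg_coinvariant P.tlift_lmul[OF M \<beta>])
  qed (assumption | rule z mlin)+
  also have "\<dots> = tlift M (\<lambda>z0 c. tlift M (\<lambda>c1 c2. tlift M (\<lambda>x y.
      \<beta> (sg (z0 \<otimes>\<^bsub>Q\<^esub> f x) \<otimes>\<^bsub>P\<^esub> y) c2) (l c1)) (\<Delta> c)) (rcoact Q z)"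
    by (rule tlift_cong, (assumption | rule z mlin)+, rule P.l_right; (assumption | rule z mlin)+)
  also have "\<dots> = tlift M (\<lambda>z0 c. tlift M (\<lambda>z1 c1. tlift M (\<lambda>x y.
      \<beta> (sg (z1 \<otimes>\<^bsub>Q\<^esub> f x) \<otimes>\<^bsub>P\<^esub> y) c) (l c1)) (rcoact Q z0)) (rcoact Q z)"
    by (rule right_coassoc[OF Q.right_coaction, symmetric]; (assumption | rule z mlin)+)
  also have "\<dots> = tlift M (\<lambda>z0 c. \<beta> (alphaR z0) c) (rcoact Q z)"
  proof (rule tlift_cong[of Q C])
    show "tlift M (\<lambda>z1 c1. tlift M (\<lambda>x y. \<beta> (sg (z1 \<otimes>\<^bsub>Q\<^esub> f x) \<otimes>\<^bsub>P\<^esub> y) c) (l c1)) (rcoact Q z0) = \<beta> (alphaR z0) c"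
      if z0: "z0 \<in> carrier Q" and c: "c \<in> carrier C" for z0 c
      unfolding alphaR_def
      by (rule tlift_push2[where g = "\<lambda>p. \<beta> p c", symmetric]; (assumption | rule z0 c mlin)+)
  qed (assumption | rule z mlin)+
  finally show ?thesis .
qed

text \<open>The left coaction has no product formula of its own, so both sides are compared under
  the injective map \<open>Psi\<close>, where \<open>psi_mult\<close> splits the product. By
  \<open>l_left_psi\<close> the entwined factor becomes \<open>e\<close>, and the coinvariant values
  of \<open>sg\<close> leave \<open>e\<close> in place.\<close>

lemma lcoact_alphaL:
  assumes z: "z \<in> carrier Q"
  shows "lcoact P (alphaL z) = tlift P.CP (\<lambda>c z0. tens K C P c (alphaL z0)) (lcoact Q z)"
proof -
  have cl: "tlift P.CP (\<lambda>c z0. tens K C P c (alphaL z0)) (lcoact Q z) \<in> carrier P.CP"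
    by (assumption | rule z mlin)+
  have psi: "P.psi c1 (x \<otimes>\<^bsub>P\<^esub> b) = tlift P.PC (\<lambda>q d. P.lmul q (P.psi d b)) (P.psi c1 x)"
    if "c1 \<in> carrier C" "x \<in> carrier P" "b \<in> carrier P" for c1 x b
    using that by (simp add: P.psi_mult P.ract_def)
  have "P.Psi (tlift P.CP (\<lambda>c z0. tens K C P c (alphaL z0)) (lcoact Q z)) =
      tlift P.PC (\<lambda>c z0. P.Psi (tens K C P c (alphaL z0))) (lcoact Q z)"
    by (rule tlift_push[OF _ _ P.Psi_linear]; (assumption | rule z mlin)+)
  also have "\<dots> = tlift P.PC (\<lambda>c z0. P.psi c (alphaL z0)) (lcoact Q z)"
    using z by (intro tlift_cong[of C Q]) (auto simp: P.Psi_tens)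
  also have "\<dots> = tlift P.PC (\<lambda>c z0. tlift P.PC (\<lambda>c' z1. tlift P.PC (\<lambda>x y.
      P.psi c (x \<otimes>\<^bsub>P\<^esub> sg (f y \<otimes>\<^bsub>Q\<^esub> z1))) (l c')) (lcoact Q z0)) (lcoact Q z)"
  proof (rule tlift_cong[of C Q])
    show "P.psi c (alphaL z0) = tlift P.PC (\<lambda>c' z1. tlift P.PC (\<lambda>x y.
        P.psi c (x \<otimes>\<^bsub>P\<^esub> sg (f y \<otimes>\<^bsub>Q\<^esub> z1))) (l c')) (lcoact Q z0)"
      if c: "c \<in> carrier C" and z0: "z0 \<in> carrier Q" for c z0
      unfolding alphaL_def by (rule tlift_push2[where g = "P.psi c"]; (assumption | rule z0 c mlin)+)
  qed (assumption | rule z mlin)+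
  also have "\<dots> = tlift P.PC (\<lambda>c z0. tlift P.PC (\<lambda>c1 c2. tlift P.PC (\<lambda>x y.
      P.psi c1 (x \<otimes>\<^bsub>P\<^esub> sg (f y \<otimes>\<^bsub>Q\<^esub> z0))) (l c2)) (\<Delta> c)) (lcoact Q z)"
    by (rule left_coassoc[OF Q.left_coaction]; (assumption | rule z mlin)+)
  also have "\<dots> = tlift P.PC (\<lambda>c z0. tlift P.PC (\<lambda>x y. tens K P C (x \<otimes>\<^bsub>P\<^esub> sg (f y \<otimes>\<^bsub>Q\<^esub> z0)) e) (l c)) (lcoact Q z)"
  proof (rule tlift_cong[of C Q])
    show "tlift P.PC (\<lambda>c1 c2. tlift P.PC (\<lambda>x y. P.psi c1 (x \<otimes>\<^bsub>P\<^esub> sg (f y \<otimes>\<^bsub>Q\<^esub> z0))) (l c2)) (\<Delta> c) =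
        tlift P.PC (\<lambda>x y. tens K P C (x \<otimes>\<^bsub>P\<^esub> sg (f y \<otimes>\<^bsub>Q\<^esub> z0)) e) (l c)"
      if c: "c \<in> carrier C" and z0: "z0 \<in> carrier Q" for c z0
    proof -
      have "tlift P.PC (\<lambda>c1 c2. tlift P.PC (\<lambda>x y. P.psi c1 (x \<otimes>\<^bsub>P\<^esub> sg (f y \<otimes>\<^bsub>Q\<^esub> z0))) (l c2)) (\<Delta> c) =
          tlift P.PC (\<lambda>c1 c2. tlift P.PC (\<lambda>x y. tlift P.PC (\<lambda>q d.
            P.lmul q (P.psi d (sg (f y \<otimes>\<^bsub>Q\<^esub> z0)))) (P.psi c1 x)) (l c2)) (\<Delta> c)"
        by (rule tlift_cong2; (assumption | rule c z0 psi mlin)+)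
      also have "\<dots> = tlift P.PC (\<lambda>x y. P.lmul x (P.psi e (sg (f y \<otimes>\<^bsub>Q\<^esub> z0)))) (l c)"
        by (rule P.l_left_psi; (assumption | rule c z0 mlin)+)
      also have "\<dots> = tlift P.PC (\<lambda>x y. tens K P C (x \<otimes>\<^bsub>P\<^esub> sg (f y \<otimes>\<^bsub>Q\<^esub> z0)) e) (l c)"
        using c z0 by (intro tlift_cong[of P P]) (auto simp: P.psi_e P.coinvariants_\<rho> sg_coinvariant)
      finally show ?thesis .
    qed
  qed (assumption | rule z mlin)+
  also have "\<dots> = tens K P C (alphaL z) e"
    unfolding alphaL_def
    by (rule tlift_push2[where g = "\<lambda>p. tens K P C p e", symmetric]; (assumption | rule z mlin)+)
  also have "\<dots> = P.Psi (lcoact P (alphaL z))" using z by (simp add: P.Psi_\<sigma>)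
  finally show ?thesis
    using inj_onD[OF P.Psi_inj _ cl, of "lcoact P (alphaL z)"] z by simp
qed

lemma tlift_lcoact_alphaL:
  assumes M [simp, mlin]: "module K M" and \<beta>: "bilin C P M \<beta>" and z: "z \<in> carrier Q"
  shows "tlift M \<beta> (lcoact P (alphaL z)) = tlift M (\<lambda>c z0. \<beta> c (alphaL z0)) (lcoact Q z)"
proof -
  have "tlift M \<beta> (lcoact P (alphaL z)) = tlift M (\<lambda>c z0. tlift M \<beta> (tens K C P c (alphaL z0))) (lcoact Q z)"
    unfolding lcoact_alphaL[OF z] using \<beta> z by (intro tlift_push[of C Q] tlift_linear) auto
  also have "\<dots> = tlift M (\<lambda>c z0. \<beta> c (alphaL z0)) (lcoact Q z)"
    using \<beta> z bilinD(3)[OF \<beta>] by (intro tlift_cong[of C Q]) (auto simp: tlift_tens)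
  finally show ?thesis .
qed

end

section \<open>Fibre products\<close>

context vector_spaces
begin

lemma tmap_comp:
  assumes V: "module K V" "module K W" "module K V'" "module K W'" "module K V''" "module K W''"
    and f: "f \<in> linear_maps K V V'" and g: "g \<in> linear_maps K W W'"
    and f': "f' \<in> linear_maps K V' V''" and g': "g' \<in> linear_maps K W' W''"
    and t: "t \<in> carrier (tensor K V W)"
  shows "tmap K V'' W'' f' g' (tmap K V' W' f g t) = tmap K V'' W'' (\<lambda>x. f' (f x)) (\<lambda>y. g' (g y)) t"
  by (rule tensor_eqI[of V W "tensor K V'' W''" "\<lambda>t. tmap K V'' W'' f' g' (tmap K V' W' f g t)", OF _ _ _ _ _ _ t])
    (use V linear_closed[OF f] linear_closed[OF g] in
      \<open>auto intro!: linear_comp[OF tmap_linear tmap_linear] tmap_linear linear_comp[OF f' f] linear_comp[OF g' g] f g f' g'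
        simp: tmap_tens[OF _ _ _ _ f g] tmap_tens[OF _ _ _ _ f' g'] tmap_tens[OF _ _ _ _ linear_comp[OF f' f] linear_comp[OF g' g]]\<close>)

lemma tmap_cong:
  assumes "module K V" "module K W" "module K V'" "module K W'" "t \<in> carrier (tensor K V W)"
    and "\<And>x. x \<in> carrier V \<Longrightarrow> f x = f' x" "\<And>x. x \<in> carrier V \<Longrightarrow> f' x \<in> carrier V'"
    and "\<And>y. y \<in> carrier W \<Longrightarrow> g y = g' y" "\<And>y. y \<in> carrier W \<Longrightarrow> g' y \<in> carrier W'"
  shows "tmap K V' W' f g t = tmap K V' W' f' g' t"
  unfolding tmap_def using assms by (intro tlift_cong[of V W]) auto

lemma tmap_ident:
  assumes "module K V" "module K W" "t \<in> carrier (tensor K V W)"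
    and "\<And>x. x \<in> carrier V \<Longrightarrow> f x = x" "\<And>y. y \<in> carrier W \<Longrightarrow> g y = y"
  shows "tmap K V W f g t = t"
proof -
  have "tmap K V W f g t = tlift (tensor K V W) (tens K V W) t"
    unfolding tmap_def using assms by (intro tlift_cong[of V W]) auto
  then show ?thesis using assms by (simp add: tlift_id)
qed

lemma tmap_add:
  assumes V: "module K V" "module K W" "module K V'" "module K W'" and t: "t \<in> carrier (tensor K V W)"
    and f: "\<And>x. x \<in> carrier V \<Longrightarrow> f x \<in> carrier V'" and f': "\<And>x. x \<in> carrier V \<Longrightarrow> f' x \<in> carrier V'"
    and g: "\<And>y. y \<in> carrier W \<Longrightarrow> g y \<in> carrier W'" and g': "\<And>y. y \<in> carrier W \<Longrightarrow> g' y \<in> carrier W'"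
  shows "tmap K V' W' (\<lambda>x. f x \<oplus>\<^bsub>V'\<^esub> f' x) g t = tmap K V' W' f g t \<oplus>\<^bsub>tensor K V' W'\<^esub> tmap K V' W' f' g t"
    and "tmap K V' W' f (\<lambda>y. g y \<oplus>\<^bsub>W'\<^esub> g' y) t = tmap K V' W' f g t \<oplus>\<^bsub>tensor K V' W'\<^esub> tmap K V' W' f g' t"
proof -
  let ?T = "tensor K V' W'"
  note b = tens_bilin[OF V(3,4)] and [simp] = V t f f' g g'
  have "tmap K V' W' (\<lambda>x. f x \<oplus>\<^bsub>V'\<^esub> f' x) g t =
      tlift ?T (\<lambda>x y. tens K V' W' (f x) (g y) \<oplus>\<^bsub>?T\<^esub> tens K V' W' (f' x) (g y)) t"
    unfolding tmap_def by (intro tlift_cong[of V W]) (simp_all add: linear_add[OF bilinD(2)[OF b]])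
  also have "\<dots> = tmap K V' W' f g t \<oplus>\<^bsub>?T\<^esub> tmap K V' W' f' g t"
    unfolding tmap_def by (intro tlift_add[of V W]) simp_all
  finally show "tmap K V' W' (\<lambda>x. f x \<oplus>\<^bsub>V'\<^esub> f' x) g t = tmap K V' W' f g t \<oplus>\<^bsub>?T\<^esub> tmap K V' W' f' g t" .
  have "tmap K V' W' f (\<lambda>y. g y \<oplus>\<^bsub>W'\<^esub> g' y) t =
      tlift ?T (\<lambda>x y. tens K V' W' (f x) (g y) \<oplus>\<^bsub>?T\<^esub> tens K V' W' (f x) (g' y)) t"
    unfolding tmap_def by (intro tlift_cong[of V W]) (simp_all add: linear_add[OF bilinD(1)[OF b]])
  also have "\<dots> = tmap K V' W' f g t \<oplus>\<^bsub>?T\<^esub> tmap K V' W' f g' t"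
    unfolding tmap_def by (intro tlift_add[of V W]) simp_all
  finally show "tmap K V' W' f (\<lambda>y. g y \<oplus>\<^bsub>W'\<^esub> g' y) t = tmap K V' W' f g t \<oplus>\<^bsub>?T\<^esub> tmap K V' W' f g' t" .
qed

lemma tmap_diff:
  assumes V: "module K V" "module K W" "module K V'" "module K W'" and t: "t \<in> carrier (tensor K V W)"
    and f: "\<And>x. x \<in> carrier V \<Longrightarrow> f x \<in> carrier V'" and f': "\<And>x. x \<in> carrier V \<Longrightarrow> f' x \<in> carrier V'"
    and g: "\<And>y. y \<in> carrier W \<Longrightarrow> g y \<in> carrier W'" and g': "\<And>y. y \<in> carrier W \<Longrightarrow> g' y \<in> carrier W'"
  shows "tmap K V' W' (\<lambda>x. f x \<ominus>\<^bsub>V'\<^esub> f' x) g t = tmap K V' W' f g t \<ominus>\<^bsub>tensor K V' W'\<^esub> tmap K V' W' f' g t"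
    and "tmap K V' W' f (\<lambda>y. g y \<ominus>\<^bsub>W'\<^esub> g' y) t = tmap K V' W' f g t \<ominus>\<^bsub>tensor K V' W'\<^esub> tmap K V' W' f g' t"
proof -
  let ?T = "tensor K V' W'"
  note b = tens_bilin[OF V(3,4)] and [simp] = V t f f' g g'
  have "tmap K V' W' (\<lambda>x. f x \<ominus>\<^bsub>V'\<^esub> f' x) g t =
      tlift ?T (\<lambda>x y. tens K V' W' (f x) (g y) \<ominus>\<^bsub>?T\<^esub> tens K V' W' (f' x) (g y)) t"
    unfolding tmap_def by (intro tlift_cong[of V W]) (simp_all add: linear_diff[OF bilinD(2)[OF b]])
  also have "\<dots> = tmap K V' W' f g t \<ominus>\<^bsub>?T\<^esub> tmap K V' W' f' g t"
    unfolding tmap_def by (intro tlift_diff[of V W]) simp_all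
  finally show "tmap K V' W' (\<lambda>x. f x \<ominus>\<^bsub>V'\<^esub> f' x) g t = tmap K V' W' f g t \<ominus>\<^bsub>?T\<^esub> tmap K V' W' f' g t" .
  have "tmap K V' W' f (\<lambda>y. g y \<ominus>\<^bsub>W'\<^esub> g' y) t =
      tlift ?T (\<lambda>x y. tens K V' W' (f x) (g y) \<ominus>\<^bsub>?T\<^esub> tens K V' W' (f x) (g' y)) t"
    unfolding tmap_def by (intro tlift_cong[of V W]) (simp_all add: linear_diff[OF bilinD(1)[OF b]])
  also have "\<dots> = tmap K V' W' f g t \<ominus>\<^bsub>?T\<^esub> tmap K V' W' f g' t"
    unfolding tmap_def by (intro tlift_diff[of V W]) simp_all
  finally show "tmap K V' W' f (\<lambda>y. g y \<ominus>\<^bsub>W'\<^esub> g' y) t = tmap K V' W' f g t \<ominus>\<^bsub>?T\<^esub> tmap K V' W' f g' t" .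
qed

lemma tlift_zero:
  assumes "module K V" "module K W" "module K M" "t \<in> carrier (tensor K V W)"
  shows "tlift M (\<lambda>x y. \<zero>\<^bsub>M\<^esub>) t = \<zero>\<^bsub>M\<^esub>"
  using tlift_push[of V W "\<lambda>x. \<zero>\<^bsub>M\<^esub>" M M t "\<lambda>x y. \<zero>\<^bsub>M\<^esub>"] assms linear_zero_map[of M M] by simp

lemma tmap_zero:
  assumes V: "module K V" "module K W" "module K V'" "module K W'" and t: "t \<in> carrier (tensor K V W)"
  shows "(\<And>y. y \<in> carrier W \<Longrightarrow> g y \<in> carrier W') \<Longrightarrow> tmap K V' W' (\<lambda>x. \<zero>\<^bsub>V'\<^esub>) g t = \<zero>\<^bsub>tensor K V' W'\<^esub>"
    and "(\<And>x. x \<in> carrier V \<Longrightarrow> f x \<in> carrier V') \<Longrightarrow> tmap K V' W' f (\<lambda>y. \<zero>\<^bsub>W'\<^esub>) t = \<zero>\<^bsub>tensor K V' W'\<^esub>"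
proof -
  let ?T = "tensor K V' W'"
  have z: "w \<in> carrier W' \<Longrightarrow> tens K V' W' \<zero>\<^bsub>V'\<^esub> w = \<zero>\<^bsub>?T\<^esub>"
    "v \<in> carrier V' \<Longrightarrow> tens K V' W' v \<zero>\<^bsub>W'\<^esub> = \<zero>\<^bsub>?T\<^esub>" for v w
    using linear_zero[OF bilinD(2)[OF tens_bilin[of V' W']]] linear_zero[OF bilinD(1)[OF tens_bilin[of V' W']]]
      V(3,4) by simp_all
  have "tmap K V' W' h g t = tlift ?T (\<lambda>x y. \<zero>\<^bsub>?T\<^esub>) t"
    if "\<And>x y. x \<in> carrier V \<Longrightarrow> y \<in> carrier W \<Longrightarrow> tens K V' W' (h x) (g y) = \<zero>\<^bsub>?T\<^esub>" for h g
    unfolding tmap_def using V t that by (intro tlift_cong[of V W]) simp_all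
  then show "(\<And>y. y \<in> carrier W \<Longrightarrow> g y \<in> carrier W') \<Longrightarrow> tmap K V' W' (\<lambda>x. \<zero>\<^bsub>V'\<^esub>) g t = \<zero>\<^bsub>?T\<^esub>"
    "(\<And>x. x \<in> carrier V \<Longrightarrow> f x \<in> carrier V') \<Longrightarrow> tmap K V' W' f (\<lambda>y. \<zero>\<^bsub>W'\<^esub>) t = \<zero>\<^bsub>?T\<^esub>"
    using V t by (simp_all add: z tlift_zero[of V W])
qed

text \<open>
  \<open>id\<^sub>P = r\<^sub>1 p\<^sub>1 + r\<^sub>2 p\<^sub>2\<close> is preserved by tensoring; this is all the exactness of \<open>- \<otimes> W\<close> that is needed.
\<close>

definition split_pair ::
  "('k, 'x, 'l) module_scheme \<Rightarrow> ('k, 'v, 'm) module_scheme \<Rightarrow> ('k, 'w, 'n) module_scheme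
    \<Rightarrow> ('x \<Rightarrow> 'v) \<Rightarrow> ('x \<Rightarrow> 'w) \<Rightarrow> ('v \<Rightarrow> 'x) \<Rightarrow> ('w \<Rightarrow> 'x) \<Rightarrow> bool" where
  "split_pair P P1 P2 p1 p2 r1 r2 \<longleftrightarrow> module K P \<and> module K P1 \<and> module K P2 \<and>
    p1 \<in> linear_maps K P P1 \<and> p2 \<in> linear_maps K P P2 \<and> r1 \<in> linear_maps K P1 P \<and> r2 \<in> linear_maps K P2 P \<and>
    (\<forall>x\<in>carrier P. r1 (p1 x) \<oplus>\<^bsub>P\<^esub> r2 (p2 x) = x)"

lemma split_pair_eqI:
  assumes "split_pair P P1 P2 p1 p2 r1 r2" "x \<in> carrier P" "y \<in> carrier P" "p1 x = p1 y" "p2 x = p2 y"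
  shows "x = y"
  using assms unfolding split_pair_def by metis

lemma split_pair_tensor:
  assumes sp: "split_pair P P1 P2 p1 p2 r1 r2" and W: "module K W"
  shows "split_pair (tensor K P W) (tensor K P1 W) (tensor K P2 W)
      (tmap K P1 W p1 id) (tmap K P2 W p2 id) (tmap K P W r1 id) (tmap K P W r2 id)"
    and "split_pair (tensor K W P) (tensor K W P1) (tensor K W P2)
      (tmap K W P1 id p1) (tmap K W P2 id p2) (tmap K W P id r1) (tmap K W P id r2)"
proof -
  have M: "module K P" "module K P1" "module K P2" and p: "p1 \<in> linear_maps K P P1" "p2 \<in> linear_maps K P P2"
    and r: "r1 \<in> linear_maps K P1 P" "r2 \<in> linear_maps K P2 P"
    and dec: "\<And>x. x \<in> carrier P \<Longrightarrow> r1 (p1 x) \<oplus>\<^bsub>P\<^esub> r2 (p2 x) = x"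
    using sp unfolding split_pair_def by auto
  have i: "id \<in> linear_maps K W W" unfolding id_def by simp
  note cl = linear_closed[OF p(1)] linear_closed[OF p(2)] linear_closed[OF r(1)] linear_closed[OF r(2)]
  show "split_pair (tensor K P W) (tensor K P1 W) (tensor K P2 W)
      (tmap K P1 W p1 id) (tmap K P2 W p2 id) (tmap K P W r1 id) (tmap K P W r2 id)"
    unfolding split_pair_def
  proof (intro conjI ballI)
    fix t assume t: "t \<in> carrier (tensor K P W)"
    have "tmap K P W r1 id (tmap K P1 W p1 id t) \<oplus>\<^bsub>tensor K P W\<^esub> tmap K P W r2 id (tmap K P2 W p2 id t) =
        tmap K P W (\<lambda>x. r1 (p1 x) \<oplus>\<^bsub>P\<^esub> r2 (p2 x)) (\<lambda>y. id (id y)) t"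
      using M W cl t
      by (simp add: tmap_comp[OF M(1) W M(2) W M(1) W p(1) i r(1) i] tmap_comp[OF M(1) W M(3) W M(1) W p(2) i r(2) i]
          tmap_add(1)[of P W P W t])
    also have "\<dots> = t" using M W t by (intro tmap_ident) (auto simp: dec)
    finally show "tmap K P W r1 id (tmap K P1 W p1 id t) \<oplus>\<^bsub>tensor K P W\<^esub> tmap K P W r2 id (tmap K P2 W p2 id t) = t" .
  qed (use M W p r i in \<open>auto intro!: tmap_linear\<close>)
  show "split_pair (tensor K W P) (tensor K W P1) (tensor K W P2)
      (tmap K W P1 id p1) (tmap K W P2 id p2) (tmap K W P id r1) (tmap K W P id r2)"
    unfolding split_pair_def
  proof (intro conjI ballI)
    fix t assume t: "t \<in> carrier (tensor K W P)"
    have "tmap K W P id r1 (tmap K W P1 id p1 t) \<oplus>\<^bsub>tensor K W P\<^esub> tmap K W P id r2 (tmap K W P2 id p2 t) =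
        tmap K W P (\<lambda>y. id (id y)) (\<lambda>x. r1 (p1 x) \<oplus>\<^bsub>P\<^esub> r2 (p2 x)) t"
      using M W cl t
      by (simp add: tmap_comp[OF W M(1) W M(2) W M(1) i p(1) i r(1)] tmap_comp[OF W M(1) W M(3) W M(1) i p(2) i r(2)]
          tmap_add(2)[of W P W P t])
    also have "\<dots> = t" using M W t by (intro tmap_ident) (auto simp: dec)
    finally show "tmap K W P id r1 (tmap K W P1 id p1 t) \<oplus>\<^bsub>tensor K W P\<^esub> tmap K W P id r2 (tmap K W P2 id p2 t) = t" .
  qed (use M W p r i in \<open>auto intro!: tmap_linear\<close>)
qed

end

text \<open>The fibre product is described by its two projections instead of by pairs. The case in
  which the other map is surjective then follows by exchanging the roles of the projections.\<close>

locale fibre_modules = vector_spaces K for K :: "'k ring" +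
  fixes P :: "('k, 'x, 'l) module_scheme" and P1 :: "('k, 'p, 'm) module_scheme"
    and P2 :: "('k, 'q, 'n) module_scheme" and P12 :: "('k, 's, 'o) module_scheme"
    and p1 :: "'x \<Rightarrow> 'p" and p2 :: "'x \<Rightarrow> 'q" and f1 :: "'p \<Rightarrow> 's" and f2 :: "'q \<Rightarrow> 's"
  assumes mods: "module K P" "module K P1" "module K P2" "module K P12"
    and p1_lin: "p1 \<in> linear_maps K P P1" and p2_lin: "p2 \<in> linear_maps K P P2"
    and f1_lin: "f1 \<in> linear_maps K P1 P12" and f2_lin: "f2 \<in> linear_maps K P2 P12"
    and square: "x \<in> carrier P \<Longrightarrow> f1 (p1 x) = f2 (p2 x)"
    and joint_inj: "x \<in> carrier P \<Longrightarrow> y \<in> carrier P \<Longrightarrow> p1 x = p1 y \<Longrightarrow> p2 x = p2 y \<Longrightarrow> x = y"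
    and joint_surj: "a \<in> carrier P1 \<Longrightarrow> b \<in> carrier P2 \<Longrightarrow> f1 a = f2 b \<Longrightarrow> \<exists>x\<in>carrier P. p1 x = a \<and> p2 x = b"
    and f2_surj: "f2 ` carrier P2 = carrier P12"
begin

lemmas cl = linear_closed[OF p1_lin] linear_closed[OF p2_lin] linear_closed[OF f1_lin] linear_closed[OF f2_lin]

definition pair :: "'p \<Rightarrow> 'q \<Rightarrow> 'x" where
  "pair a b = (THE x. x \<in> carrier P \<and> p1 x = a \<and> p2 x = b)"

lemma pair:
  assumes "a \<in> carrier P1" "b \<in> carrier P2" "f1 a = f2 b"
  shows "pair a b \<in> carrier P" "p1 (pair a b) = a" "p2 (pair a b) = b"
proof -
  obtain x where x: "x \<in> carrier P" "p1 x = a" "p2 x = b" using joint_surj[OF assms] by blast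
  have "\<exists>!x. x \<in> carrier P \<and> p1 x = a \<and> p2 x = b"
    using x by (intro ex1I[of _ x]) (simp_all add: joint_inj)
  from theI'[OF this] show "pair a b \<in> carrier P" "p1 (pair a b) = a" "p2 (pair a b) = b"
    unfolding pair_def by blast+
qed

lemma pair_linear:
  assumes g: "g \<in> linear_maps K U P1" and h: "h \<in> linear_maps K U P2" and U: "module K U"
    and eq: "\<And>u. u \<in> carrier U \<Longrightarrow> f1 (g u) = f2 (h u)"
  shows "(\<lambda>u. pair (g u) (h u)) \<in> linear_maps K U P"
proof (rule linear_mapsI)
  note p = pair[OF linear_closed[OF g] linear_closed[OF h] eq]
  note [simp] = mods U
  show "pair (g u) (h u) \<in> carrier P" if "u \<in> carrier U" for u using p that by blast
  show "pair (g (u \<oplus>\<^bsub>U\<^esub> v)) (h (u \<oplus>\<^bsub>U\<^esub> v)) = pair (g u) (h u) \<oplus>\<^bsub>P\<^esub> pair (g v) (h v)"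
    if "u \<in> carrier U" "v \<in> carrier U" for u v
    using that p[of u] p[of v] p[of "u \<oplus>\<^bsub>U\<^esub> v"]
    by (intro joint_inj) (simp_all add: linear_add[OF p1_lin] linear_add[OF p2_lin] linear_add[OF g] linear_add[OF h])
  show "pair (g (a \<odot>\<^bsub>U\<^esub> u)) (h (a \<odot>\<^bsub>U\<^esub> u)) = a \<odot>\<^bsub>P\<^esub> pair (g u) (h u)"
    if "a \<in> carrier K" "u \<in> carrier U" for a u
    using that p[of u] p[of "a \<odot>\<^bsub>U\<^esub> u"]
    by (intro joint_inj) (simp_all add: linear_smult[OF p1_lin] linear_smult[OF p2_lin] linear_smult[OF g] linear_smult[OF h])
qed

context
  fixes s assumes s_lin: "s \<in> linear_maps K P12 P2" and f2_s: "\<And>z. z \<in> carrier P12 \<Longrightarrow> f2 (s z) = z"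
begin

text \<open>With a linear section \<open>s\<close> of \<open>f2\<close>, an element
  \<open>(a, b)\<close> is \<open>(a, s (f1 a)) + (0, b - s (f2 b))\<close>; each summand makes
  sense for arbitrary \<open>a\<close> and \<open>b\<close>, also for pairs that do not
  match.\<close>

definition r1 :: "'p \<Rightarrow> 'x" where "r1 a = pair a (s (f1 a))"
definition r2 :: "'q \<Rightarrow> 'x" where "r2 b = pair \<zero>\<^bsub>P1\<^esub> (b \<ominus>\<^bsub>P2\<^esub> s (f2 b))"

lemma r1_pair: "a \<in> carrier P1 \<Longrightarrow> r1 a \<in> carrier P" "a \<in> carrier P1 \<Longrightarrow> p1 (r1 a) = a"
  "a \<in> carrier P1 \<Longrightarrow> p2 (r1 a) = s (f1 a)"
  unfolding r1_def using pair[of a "s (f1 a)"] cl linear_closed[OF s_lin] f2_s by auto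

lemma r2_compat: "b \<in> carrier P2 \<Longrightarrow> f1 \<zero>\<^bsub>P1\<^esub> = f2 (b \<ominus>\<^bsub>P2\<^esub> s (f2 b))"
  using cl linear_closed[OF s_lin] f2_s mods
  by (simp add: linear_zero[OF f1_lin] linear_diff[OF f2_lin])

lemma r2_pair: "b \<in> carrier P2 \<Longrightarrow> r2 b \<in> carrier P" "b \<in> carrier P2 \<Longrightarrow> p1 (r2 b) = \<zero>\<^bsub>P1\<^esub>"
  "b \<in> carrier P2 \<Longrightarrow> p2 (r2 b) = b \<ominus>\<^bsub>P2\<^esub> s (f2 b)"
  unfolding r2_def using pair[OF _ _ r2_compat] cl linear_closed[OF s_lin] mods by auto

lemma r1_linear: "r1 \<in> linear_maps K P1 P"
  unfolding r1_def[abs_def] using cl linear_closed[OF s_lin] mods f2_s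
  by (intro pair_linear linear_id linear_comp[OF s_lin f1_lin]) auto

lemma r2_linear: "r2 \<in> linear_maps K P2 P"
  unfolding r2_def[abs_def] using mods r2_compat
  by (intro pair_linear linear_zero_map linear_minus linear_comp[OF s_lin f2_lin] linear_id) auto

lemma split_pair_r: "split_pair P P1 P2 p1 p2 r1 r2"
  unfolding split_pair_def
proof (intro conjI ballI mods p1_lin p2_lin r1_linear r2_linear)
  fix x assume x: "x \<in> carrier P"
  show "r1 (p1 x) \<oplus>\<^bsub>P\<^esub> r2 (p2 x) = x"
    using x mods cl r1_pair r2_pair linear_closed[OF s_lin]
    by (intro joint_inj) (simp_all add: linear_add[OF p1_lin] linear_add[OF p2_lin] square diff_add_cancel)
qed

end

lemma section_exists: "\<exists>s. s \<in> linear_maps K P12 P2 \<and> (\<forall>z\<in>carrier P12. f2 (s z) = z)"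
proof -
  obtain s where "s \<in> linear_maps K P12 P2" and s: "\<And>x. x \<in> carrier P2 \<Longrightarrow> f2 (s (f2 x)) = f2 x"
    by (rule pseudo_inverse_exists[OF mods(3,4) f2_lin], rule that)
  moreover have "f2 (s z) = z" if "z \<in> carrier P12" for z
  proof -
    have "z \<in> f2 ` carrier P2" using that f2_surj by simp
    then show ?thesis using s by auto
  qed
  ultimately show ?thesis by blast
qed

lemma split_pair_exists: "\<exists>r1 r2. split_pair P P1 P2 p1 p2 r1 r2"
  using section_exists split_pair_r by blast

text \<open>The preimage is the sum of the images of \<open>t1\<close> and \<open>t2\<close> under
  \<open>r1 \<otimes> id\<close> and \<open>r2 \<otimes> id\<close>. In the second component the
  contribution of \<open>s f1\<close> from \<open>t1\<close> cancels that of \<open>s f2\<close>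
  from \<open>t2\<close>, because the two tensors agree over \<open>P12\<close>.\<close>

lemma tensor_pair_exists:
  assumes W: "module K W"
  shows "\<lbrakk>t1 \<in> carrier (tensor K P1 W); t2 \<in> carrier (tensor K P2 W); tmap K P12 W f1 id t1 = tmap K P12 W f2 id t2\<rbrakk> \<Longrightarrow>
      \<exists>t\<in>carrier (tensor K P W). tmap K P1 W p1 id t = t1 \<and> tmap K P2 W p2 id t = t2"
    and "\<lbrakk>u1 \<in> carrier (tensor K W P1); u2 \<in> carrier (tensor K W P2); tmap K W P12 id f1 u1 = tmap K W P12 id f2 u2\<rbrakk> \<Longrightarrow>
      \<exists>t\<in>carrier (tensor K W P). tmap K W P1 id p1 t = u1 \<and> tmap K W P2 id p2 t = u2"
proof -
  obtain s where s: "s \<in> linear_maps K P12 P2" and fs: "\<And>z. z \<in> carrier P12 \<Longrightarrow> f2 (s z) = z"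
    using section_exists by blast
  let ?r1 = "r1 s" and ?r2 = "r2 s"
  note r1p = r1_pair[OF s fs] and r2p = r2_pair[OF s fs]
  note r1l = r1_linear[OF s fs] and r2l = r2_linear[OF s fs]
  have i: "id \<in> linear_maps K W W" unfolding id_def by simp
  note [simp] = mods W
  note sc = linear_closed[OF s]
  show "\<exists>t\<in>carrier (tensor K P W). tmap K P1 W p1 id t = t1 \<and> tmap K P2 W p2 id t = t2"
    if t1: "t1 \<in> carrier (tensor K P1 W)" and t2: "t2 \<in> carrier (tensor K P2 W)"
      and eq: "tmap K P12 W f1 id t1 = tmap K P12 W f2 id t2"
  proof (intro bexI conjI)
    let ?t = "tmap K P W ?r1 id t1 \<oplus>\<^bsub>tensor K P W\<^esub> tmap K P W ?r2 id t2"
    note c1 = linear_closed[OF tmap_linear[of P1 W P W, OF _ _ _ _ r1l i] t1]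
    note c2 = linear_closed[OF tmap_linear[of P2 W P W, OF _ _ _ _ r2l i] t2]
    show "?t \<in> carrier (tensor K P W)" using c1 c2 by simp
    have add: "tmap K V W p id ?t = tmap K V W p id (tmap K P W ?r1 id t1) \<oplus>\<^bsub>tensor K V W\<^esub> tmap K V W p id (tmap K P W ?r2 id t2)"
      if "module K V" "p \<in> linear_maps K P V" for p and V :: "('k, 'y, 'z) module_scheme"
      using that c1 c2 by (intro linear_add[OF tmap_linear[of P W V W]] i) auto
    have "tmap K P1 W p1 id (tmap K P W ?r1 id t1) = t1"
      using t1 r1p by (simp add: tmap_comp[OF _ _ _ _ _ _ r1l i p1_lin i] tmap_ident)
    moreover have "tmap K P1 W p1 id (tmap K P W ?r2 id t2) = \<zero>\<^bsub>tensor K P1 W\<^esub>"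
    proof -
      have "tmap K P1 W p1 id (tmap K P W ?r2 id t2) = tmap K P1 W (\<lambda>x. p1 (?r2 x)) (\<lambda>y. id (id y)) t2"
        using t2 by (simp add: tmap_comp[OF _ _ _ _ _ _ r2l i p1_lin i])
      also have "\<dots> = tmap K P1 W (\<lambda>x. \<zero>\<^bsub>P1\<^esub>) id t2"
        using t2 r2p by (intro tmap_cong[of P2 W]) auto
      finally show ?thesis using t2 cl by (simp add: tmap_zero(1)[of P2 W])
    qed
    ultimately show "tmap K P1 W p1 id ?t = t1" using t1 by (simp add: add p1_lin)
    have "tmap K P2 W p2 id (tmap K P W ?r1 id t1) = tmap K P2 W s id (tmap K P12 W f1 id t1)"
      using t1 r1p cl sc
      by (simp add: tmap_comp[OF _ _ _ _ _ _ r1l i p2_lin i] tmap_comp[OF _ _ _ _ _ _ f1_lin i s i])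
        (intro tmap_cong[of P1 W]; simp)
    moreover have "tmap K P2 W p2 id (tmap K P W ?r2 id t2) = t2 \<ominus>\<^bsub>tensor K P2 W\<^esub> tmap K P2 W s id (tmap K P12 W f2 id t2)"
    proof -
      have "tmap K P2 W p2 id (tmap K P W ?r2 id t2) = tmap K P2 W (\<lambda>x. p2 (?r2 x)) (\<lambda>y. id (id y)) t2"
        using t2 by (simp add: tmap_comp[OF _ _ _ _ _ _ r2l i p2_lin i])
      also have "\<dots> = tmap K P2 W (\<lambda>x. x \<ominus>\<^bsub>P2\<^esub> s (f2 x)) (\<lambda>y. id (id y)) t2"
        using t2 r2p cl sc by (intro tmap_cong[of P2 W]) auto
      also have "\<dots> = tmap K P2 W (\<lambda>x. x) (\<lambda>y. id (id y)) t2 \<ominus>\<^bsub>tensor K P2 W\<^esub> tmap K P2 W (\<lambda>x. s (f2 x)) (\<lambda>y. id (id y)) t2"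
        using t2 cl sc by (intro tmap_diff(1)[of P2 W P2 W]) auto
      finally show ?thesis using t2 by (simp add: tmap_ident tmap_comp[OF _ _ _ _ _ _ f2_lin i s i])
    qed
    moreover have "tmap K P2 W s id (tmap K P12 W f2 id t2) \<in> carrier (tensor K P2 W)"
      using t2 by (intro linear_closed[OF tmap_linear[OF _ _ _ _ s i]] linear_closed[OF tmap_linear[OF _ _ _ _ f2_lin i]]) auto
    ultimately show "tmap K P2 W p2 id ?t = t2" using t2 by (simp add: add p2_lin eq diff_add_cancel)
  qed
  show "\<exists>t\<in>carrier (tensor K W P). tmap K W P1 id p1 t = u1 \<and> tmap K W P2 id p2 t = u2"
    if t1: "u1 \<in> carrier (tensor K W P1)" and t2: "u2 \<in> carrier (tensor K W P2)"
      and eq: "tmap K W P12 id f1 u1 = tmap K W P12 id f2 u2"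
  proof (intro bexI conjI)
    let ?t = "tmap K W P id ?r1 u1 \<oplus>\<^bsub>tensor K W P\<^esub> tmap K W P id ?r2 u2"
    note c1 = linear_closed[OF tmap_linear[of W P1 W P, OF _ _ _ _ i r1l] t1]
    note c2 = linear_closed[OF tmap_linear[of W P2 W P, OF _ _ _ _ i r2l] t2]
    show "?t \<in> carrier (tensor K W P)" using c1 c2 by simp
    have add: "tmap K W V id p ?t = tmap K W V id p (tmap K W P id ?r1 u1) \<oplus>\<^bsub>tensor K W V\<^esub> tmap K W V id p (tmap K W P id ?r2 u2)"
      if "module K V" "p \<in> linear_maps K P V" for p and V :: "('k, 'y, 'z) module_scheme"
      using that c1 c2 by (intro linear_add[OF tmap_linear[of W P W V]] i) auto
    have "tmap K W P1 id p1 (tmap K W P id ?r1 u1) = u1"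
      using t1 r1p by (simp add: tmap_comp[OF _ _ _ _ _ _ i r1l i p1_lin] tmap_ident)
    moreover have "tmap K W P1 id p1 (tmap K W P id ?r2 u2) = \<zero>\<^bsub>tensor K W P1\<^esub>"
    proof -
      have "tmap K W P1 id p1 (tmap K W P id ?r2 u2) = tmap K W P1 (\<lambda>y. id (id y)) (\<lambda>x. p1 (?r2 x)) u2"
        using t2 by (simp add: tmap_comp[OF _ _ _ _ _ _ i r2l i p1_lin])
      also have "\<dots> = tmap K W P1 id (\<lambda>x. \<zero>\<^bsub>P1\<^esub>) u2"
        using t2 r2p by (intro tmap_cong[of W P2]) auto
      finally show ?thesis using t2 cl by (simp add: tmap_zero(2)[of W P2])
    qed
    ultimately show "tmap K W P1 id p1 ?t = u1" using t1 by (simp add: add p1_lin)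
    have "tmap K W P2 id p2 (tmap K W P id ?r1 u1) = tmap K W P2 id s (tmap K W P12 id f1 u1)"
      using t1 r1p cl sc
      by (simp add: tmap_comp[OF _ _ _ _ _ _ i r1l i p2_lin] tmap_comp[OF _ _ _ _ _ _ i f1_lin i s])
        (intro tmap_cong[of W P1]; simp)
    moreover have "tmap K W P2 id p2 (tmap K W P id ?r2 u2) = u2 \<ominus>\<^bsub>tensor K W P2\<^esub> tmap K W P2 id s (tmap K W P12 id f2 u2)"
    proof -
      have "tmap K W P2 id p2 (tmap K W P id ?r2 u2) = tmap K W P2 (\<lambda>y. id (id y)) (\<lambda>x. p2 (?r2 x)) u2"
        using t2 by (simp add: tmap_comp[OF _ _ _ _ _ _ i r2l i p2_lin])
      also have "\<dots> = tmap K W P2 (\<lambda>y. id (id y)) (\<lambda>x. x \<ominus>\<^bsub>P2\<^esub> s (f2 x)) u2"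
        using t2 r2p cl sc by (intro tmap_cong[of W P2]) auto
      also have "\<dots> = tmap K W P2 (\<lambda>y. id (id y)) (\<lambda>x. x) u2 \<ominus>\<^bsub>tensor K W P2\<^esub> tmap K W P2 (\<lambda>y. id (id y)) (\<lambda>x. s (f2 x)) u2"
        using t2 cl sc by (intro tmap_diff(2)[of W P2 W P2]) auto
      finally show ?thesis using t2 by (simp add: tmap_ident tmap_comp[OF _ _ _ _ _ _ i f2_lin i s])
    qed
    moreover have "tmap K W P2 id s (tmap K W P12 id f2 u2) \<in> carrier (tensor K W P2)"
      using t2 by (intro linear_closed[OF tmap_linear[OF _ _ _ _ i s]] linear_closed[OF tmap_linear[OF _ _ _ _ i f2_lin]]) auto
    ultimately show "tmap K W P2 id p2 ?t = u2" using t2 by (simp add: add p2_lin eq diff_add_cancel)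
  qed
qed

end

section \<open>Transfer of the comodule axioms along colinear maps\<close>

context coalgebra_point
begin

lemma id_linear [simp]: "id \<in> linear_maps K W W"
  by (simp add: id_def)

context
  fixes V :: "('k, 'v, 'l) module_scheme" and V' :: "('k, 'w, 'm) module_scheme" and g
  assumes V [simp, mlin]: "module K V" and V' [simp, mlin]: "module K V'" and g: "g \<in> linear_maps K V V'"
begin

text \<open>Only \<open>\<rho>'\<close> is known to be a coaction. A map \<open>\<rho>\<close> that
  it intertwines with via \<open>g\<close> is coassociative after applying \<open>g\<close>; two
  such maps that are jointly injective on tensor products give coassociativity itself.\<close>

lemma right_coassoc_transfer:
  assumes \<rho>: "\<rho> \<in> linear_maps K V (tensor K V C)" and \<rho>': "right_coaction K C V' \<rho>'"
    and eq: "\<And>x. x \<in> carrier V \<Longrightarrow> tmap K V' C g id (\<rho> x) = \<rho>' (g x)" and v: "v \<in> carrier V"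
  shows "tmap K (tensor K V' C) C (tmap K V' C g id) id (tmap K (tensor K V C) C \<rho> id (\<rho> v)) =
    tmap K (tensor K V' C) C (tmap K V' C g id) id (tassoc K V C C (tmap K V (tensor K C C) id \<Delta> (\<rho> v)))"
proof -
  note [mlin] = linear_closed[OF g] linear_comp[OF g] and [simp] = linear_closed[OF g]
  let ?VC = "tensor K V C" and ?VC' = "tensor K V' C" and ?CC = "tensor K C C"
  let ?T = "tensor K ?VC C" and ?T' = "tensor K ?VC' C"
  note [mlin] = linear_closed[OF \<rho>] linear_comp[OF \<rho>]
  have \<rho>'l: "\<rho>' \<in> linear_maps K V' ?VC'" using \<rho>' by (simp add: right_coaction_def)
  have g': "tmap K V' C g id \<in> linear_maps K ?VC ?VC'" using g by (intro tmap_linear) auto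
  have gg: "tmap K ?VC' C (tmap K V' C g id) id \<in> linear_maps K ?T ?T'"
    by (rule tmap_linear[OF _ _ _ _ g' id_linear]) auto
  have rv: "\<rho> v \<in> carrier ?VC" using v linear_closed[OF \<rho>] by blast
  have "tmap K ?VC' C (tmap K V' C g id) id (tmap K ?VC C \<rho> id (\<rho> v)) =
      tmap K ?VC' C (\<lambda>x. tmap K V' C g id (\<rho> x)) (\<lambda>y. id (id y)) (\<rho> v)"
    using rv by (intro tmap_comp[OF _ _ _ _ _ _ \<rho> _ g']) auto
  also have "\<dots> = tmap K ?VC' C (\<lambda>x. \<rho>' (g x)) (\<lambda>y. id (id y)) (\<rho> v)"
    using rv linear_closed[OF \<rho>'l] by (intro tmap_cong[of V C]) (auto simp: eq)
  also have "\<dots> = tmap K ?VC' C \<rho>' id (tmap K V' C g id (\<rho> v))"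
    using rv by (intro tmap_comp[symmetric, OF _ _ _ _ _ _ g _ \<rho>'l]) auto
  also have "\<dots> = tassoc K V' C C (tmap K V' ?CC id \<Delta> (tmap K V' C g id (\<rho> v)))"
    using \<rho>' v linear_closed[OF g] by (simp add: eq right_coaction_def)
  also have "tmap K V' ?CC id \<Delta> (tmap K V' C g id (\<rho> v)) = tmap K V' ?CC (\<lambda>x. id (g x)) (\<lambda>c. \<Delta> (id c)) (\<rho> v)"
    using rv comult_linear by (intro tmap_comp[OF _ _ _ _ _ _ g]) auto
  also have "tassoc K V' C C \<dots> =
      tlift ?T' (\<lambda>x c. tlift ?T' (\<lambda>d d'. tens K ?VC' C (tens K V' C (id (g x)) d) d') (\<Delta> (id c))) (\<rho> v)"
    unfolding tassoc_def Let_def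
    by (rule tmap_eval[of V C V' ?CC]; (assumption | rule rv mlin | simp)+)
  also have "\<dots> = tlift ?T' (\<lambda>x c. tlift ?T' (\<lambda>d d'. tens K ?VC' C (tens K V' C (g x) d) d') (\<Delta> c)) (\<rho> v)"
    by (simp only: id_apply)
  also have "\<dots> = tlift ?T' (\<lambda>x c. tlift ?T' (\<lambda>d d'.
      tmap K ?VC' C (tmap K V' C g id) id (tens K ?VC C (tens K V C x d) d')) (\<Delta> c)) (\<rho> v)"
    using rv g g' by (intro tlift_cong2[of _ V C _ C C]) (auto simp: tmap_tens)
  also have "\<dots> = tmap K ?VC' C (tmap K V' C g id) id
      (tlift ?T (\<lambda>x c. tlift ?T (\<lambda>d d'. tens K ?VC C (tens K V C x d) d') (\<Delta> c)) (\<rho> v))"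
    by (rule tlift_push2[OF gg, symmetric]; (assumption | rule rv mlin)+)
  also have "tlift ?T (\<lambda>x c. tlift ?T (\<lambda>d d'. tens K ?VC C (tens K V C x d) d') (\<Delta> c)) (\<rho> v) =
      tlift ?T (\<lambda>x c. tlift ?T (\<lambda>d d'. tens K ?VC C (tens K V C (id x) d) d') (\<Delta> c)) (\<rho> v)"
    by simp
  also have "\<dots> = tassoc K V C C (tmap K V ?CC id \<Delta> (\<rho> v))"
    unfolding tassoc_def Let_def
    by (rule tmap_eval[of V C V ?CC, symmetric]; (assumption | rule rv mlin | simp)+)
  finally show ?thesis .
qed

lemma left_coassoc_transfer:
  assumes \<sigma>: "\<sigma> \<in> linear_maps K V (tensor K C V)" and \<sigma>': "left_coaction K C V' \<sigma>'"
    and eq: "\<And>x. x \<in> carrier V \<Longrightarrow> tmap K C V' id g (\<sigma> x) = \<sigma>' (g x)" and v: "v \<in> carrier V"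
  shows "tmap K (tensor K C C) V' id g (tassoc K C C V (tmap K C (tensor K C V) id \<sigma> (\<sigma> v))) =
    tmap K (tensor K C C) V' id g (tmap K (tensor K C C) V \<Delta> id (\<sigma> v))"
proof -
  note [mlin] = linear_closed[OF g] linear_comp[OF g] and [simp] = linear_closed[OF g]
  let ?CV = "tensor K C V" and ?CV' = "tensor K C V'" and ?CC = "tensor K C C"
  let ?T = "tensor K ?CC V" and ?T' = "tensor K ?CC V'"
  note [mlin] = linear_closed[OF \<sigma>] linear_comp[OF \<sigma>]
  have \<sigma>'l: "\<sigma>' \<in> linear_maps K V' ?CV'" using \<sigma>' by (simp add: left_coaction_def)
  note [mlin] = linear_closed[OF \<sigma>'l] linear_comp[OF \<sigma>'l]
  have g': "tmap K C V' id g \<in> linear_maps K ?CV ?CV'" using g by (intro tmap_linear) auto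
  have gg: "tmap K ?CC V' id g \<in> linear_maps K ?T ?T'" using g by (intro tmap_linear) auto
  have sv: "\<sigma> v \<in> carrier ?CV" using v linear_closed[OF \<sigma>] by blast
  have eval: "tlift ?T' (\<lambda>d y. tens K ?CC V' (tens K C C c d) y) (\<sigma>' (g x)) =
      tlift ?T' (\<lambda>d y. tens K ?CC V' (tens K C C c d) (g y)) (\<sigma> x)"
    if c: "c \<in> carrier C" and x: "x \<in> carrier V" for c x
  proof -
    have "tlift ?T' (\<lambda>d y. tens K ?CC V' (tens K C C c d) y) (tmap K C V' id g (\<sigma> x)) =
        tlift ?T' (\<lambda>d y. tens K ?CC V' (tens K C C c (id d)) (g y)) (\<sigma> x)"
      by (rule tmap_eval[of C V C V']; (assumption | rule c x mlin | simp)+)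
    then show ?thesis using x by (simp add: eq)
  qed
  have "tmap K ?CC V' id g (tassoc K C C V (tmap K C ?CV id \<sigma> (\<sigma> v))) =
      tmap K ?CC V' id g (tlift ?T (\<lambda>c x. tlift ?T (\<lambda>d y. tens K ?CC V (tens K C C (id c) d) y) (\<sigma> x)) (\<sigma> v))"
    unfolding tassoc_def Let_def
    by (rule arg_cong[where f = "tmap K ?CC V' id g"], rule tmap_eval[of C V C ?CV]; (assumption | rule sv mlin | simp)+)
  also have "\<dots> = tmap K ?CC V' id g (tlift ?T (\<lambda>c x. tlift ?T (\<lambda>d y. tens K ?CC V (tens K C C c d) y) (\<sigma> x)) (\<sigma> v))"
    by (simp only: id_apply)
  also have "\<dots> = tlift ?T' (\<lambda>c x. tlift ?T' (\<lambda>d y. tmap K ?CC V' id g (tens K ?CC V (tens K C C c d) y)) (\<sigma> x)) (\<sigma> v)"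
    by (rule tlift_push2[OF gg]; (assumption | rule sv mlin)+)
  also have "\<dots> = tlift ?T' (\<lambda>c x. tlift ?T' (\<lambda>d y. tens K ?CC V' (tens K C C c d) (g y)) (\<sigma> x)) (\<sigma> v)"
    using sv g linear_closed[OF \<sigma>] by (intro tlift_cong2[of _ C V _ C V]) (auto simp: tmap_tens)
  also have "\<dots> = tlift ?T' (\<lambda>c x. tlift ?T' (\<lambda>d y. tens K ?CC V' (tens K C C (id c) d) y) (\<sigma>' (g x))) (\<sigma> v)"
    by (simp only: id_apply, rule tlift_cong; (assumption | rule sv eval[symmetric] mlin)+)
  also have "\<dots> = tlift ?T' (\<lambda>c x. tlift ?T' (\<lambda>d y. tens K ?CC V' (tens K C C c d) y) (\<sigma>' x)) (tmap K C V' id g (\<sigma> v))"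
    by (rule tmap_eval[of C V C V', symmetric]; (assumption | rule sv mlin | simp)+)
  also have "\<dots> = tlift ?T' (\<lambda>c x. tlift ?T' (\<lambda>d y. tens K ?CC V' (tens K C C (id c) d) y) (\<sigma>' x)) (\<sigma>' (g v))"
    using v by (simp add: eq)
  also have "\<dots> = tassoc K C C V' (tmap K C ?CV' id \<sigma>' (\<sigma>' (g v)))"
    unfolding tassoc_def Let_def
    by (rule tmap_eval[of C V' C ?CV', symmetric]; (assumption | rule v mlin | simp)+)
  also have "\<dots> = tmap K ?CC V' \<Delta> id (tmap K C V' id g (\<sigma> v))"
    using \<sigma>' v linear_closed[OF g] by (simp add: eq left_coaction_def)
  also have "\<dots> = tmap K ?CC V' (\<lambda>c. \<Delta> (id c)) (\<lambda>x. id (g x)) (\<sigma> v)"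
    using sv comult_linear by (intro tmap_comp[OF _ _ _ _ _ _ _ g]) auto
  also have "\<dots> = tmap K ?CC V' (\<lambda>c. id (\<Delta> c)) (\<lambda>x. g (id x)) (\<sigma> v)" by simp
  also have "\<dots> = tmap K ?CC V' id g (tmap K ?CC V \<Delta> id (\<sigma> v))"
    using sv comult_linear by (intro tmap_comp[symmetric, OF _ _ _ _ _ _ _ _ _ g]) auto
  finally show ?thesis .
qed

lemma right_counit_transfer:
  assumes \<rho>: "\<rho> v \<in> carrier (tensor K V C)" and \<rho>': "right_coaction K C V' \<rho>'"
    and eq: "tmap K V' C g id (\<rho> v) = \<rho>' (g v)" and v: "v \<in> carrier V"
  shows "g (tlift V (\<lambda>x c. \<epsilon> c \<odot>\<^bsub>V\<^esub> x) (\<rho> v)) = g v"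
proof -
  note [mlin] = linear_closed[OF g] linear_comp[OF g] and [simp] = linear_closed[OF g]
  have "g (tlift V (\<lambda>x c. \<epsilon> c \<odot>\<^bsub>V\<^esub> x) (\<rho> v)) = tlift V' (\<lambda>x c. g (\<epsilon> c \<odot>\<^bsub>V\<^esub> x)) (\<rho> v)"
    using \<rho> by (intro tlift_push[of V C g]) (auto intro: g)
  also have "\<dots> = tlift V' (\<lambda>x c. \<epsilon> (id c) \<odot>\<^bsub>V'\<^esub> g x) (\<rho> v)"
    using \<rho> by (intro tlift_cong[of V C]) (auto simp: linear_smult[OF g])
  also have "\<dots> = tlift V' (\<lambda>x c. \<epsilon> c \<odot>\<^bsub>V'\<^esub> x) (\<rho>' (g v))"
    unfolding eq[symmetric] by (rule tmap_eval[of V C V' C, symmetric]; (assumption | rule \<rho> mlin | simp)+)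
  also have "\<dots> = g v"
    using \<rho>' v linear_closed[OF g] by (simp add: right_coaction_def)
  finally show ?thesis .
qed

lemma left_counit_transfer:
  assumes \<sigma>: "\<sigma> v \<in> carrier (tensor K C V)" and \<sigma>': "left_coaction K C V' \<sigma>'"
    and eq: "tmap K C V' id g (\<sigma> v) = \<sigma>' (g v)" and v: "v \<in> carrier V"
  shows "g (tlift V (\<lambda>c x. \<epsilon> c \<odot>\<^bsub>V\<^esub> x) (\<sigma> v)) = g v"
proof -
  note [mlin] = linear_closed[OF g] linear_comp[OF g] and [simp] = linear_closed[OF g]
  have "g (tlift V (\<lambda>c x. \<epsilon> c \<odot>\<^bsub>V\<^esub> x) (\<sigma> v)) = tlift V' (\<lambda>c x. g (\<epsilon> c \<odot>\<^bsub>V\<^esub> x)) (\<sigma> v)"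
    using \<sigma> by (intro tlift_push[of C V g]) (auto intro: g)
  also have "\<dots> = tlift V' (\<lambda>c x. \<epsilon> (id c) \<odot>\<^bsub>V'\<^esub> g x) (\<sigma> v)"
    using \<sigma> by (intro tlift_cong[of C V]) (auto simp: linear_smult[OF g])
  also have "\<dots> = tlift V' (\<lambda>c x. \<epsilon> c \<odot>\<^bsub>V'\<^esub> x) (\<sigma>' (g v))"
    unfolding eq[symmetric] by (rule tmap_eval[of C V C V', symmetric]; (assumption | rule \<sigma> mlin | simp)+)
  also have "\<dots> = g v"
    using \<sigma>' v linear_closed[OF g] by (simp add: left_coaction_def)
  finally show ?thesis .
qed

end

end

section \<open>The coactions of the fibre product\<close>

locale fibre_coaction = coalgebra_point K C e + P1: coaug K C e P1 + P2: coaug K C e P2 + P12: coaug K C e P12 +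
  A: coaug_hom K C e P1 P12 f1 + B: coaug_hom K C e P2 P12 f2 + fibre_modules K P P1 P2 P12 p1 p2 f1 f2
  for K :: "'k ring" and C :: "('k, 'c) coalg" and e :: 'c
    and P :: "('k, 'x, 'c) coact_alg" and P1 :: "('k, 'p, 'c) coact_alg"
    and P2 :: "('k, 'q, 'c) coact_alg" and P12 :: "('k, 's, 'c) coact_alg" and p1 p2 f1 f2 +
  assumes alg: "unital_algebra K P"
    and p1_hom: "p1 \<in> ring_hom P P1" and p2_hom: "p2 \<in> ring_hom P P2"
    and rcoact_eq: "x \<in> carrier P \<Longrightarrow> rcoact P x = (THE t. t \<in> carrier (tensor K P C) \<and>
        tmap K P1 C p1 id t = rcoact P1 (p1 x) \<and> tmap K P2 C p2 id t = rcoact P2 (p2 x))"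
    and lcoact_eq: "x \<in> carrier P \<Longrightarrow> lcoact P x = (THE t. t \<in> carrier (tensor K C P) \<and>
        tmap K C P1 id p1 t = lcoact P1 (p1 x) \<and> tmap K C P2 id p2 t = lcoact P2 (p2 x))"
begin

lemmas [simp] = mods(1)

lemma tensor_eqI_right:
  assumes "module K W" "t \<in> carrier (tensor K P W)" "u \<in> carrier (tensor K P W)"
    "tmap K P1 W p1 id t = tmap K P1 W p1 id u" "tmap K P2 W p2 id t = tmap K P2 W p2 id u"
  shows "t = u"
  using split_pair_exists split_pair_eqI[OF split_pair_tensor(1)] assms by metis

lemma tensor_eqI_left:
  assumes "module K W" "t \<in> carrier (tensor K W P)" "u \<in> carrier (tensor K W P)"
    "tmap K W P1 id p1 t = tmap K W P1 id p1 u" "tmap K W P2 id p2 t = tmap K W P2 id p2 u"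
  shows "t = u"
  using split_pair_exists split_pair_eqI[OF split_pair_tensor(2)] assms by metis

lemma tensor_eqI_right2:
  assumes "module K W" "module K W'" "t \<in> carrier (tensor K (tensor K P W) W')" "u \<in> carrier (tensor K (tensor K P W) W')"
    "tmap K (tensor K P1 W) W' (tmap K P1 W p1 id) id t = tmap K (tensor K P1 W) W' (tmap K P1 W p1 id) id u"
    "tmap K (tensor K P2 W) W' (tmap K P2 W p2 id) id t = tmap K (tensor K P2 W) W' (tmap K P2 W p2 id) id u"
  shows "t = u"
  using split_pair_exists split_pair_eqI[OF split_pair_tensor(1)[OF split_pair_tensor(1)]] assms by metis

text \<open>Existence: the coactions of the two components agree over \<open>P12\<close> by
  colinearity of \<open>f1\<close> and \<open>f2\<close>, so \<open>tensor_pair_exists\<close>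
  applies. Uniqueness: the two projections are jointly injective on
  \<open>P \<otimes> C\<close>.\<close>

lemma rcoact:
  assumes x: "x \<in> carrier P"
  shows "rcoact P x \<in> carrier (tensor K P C)" "tmap K P1 C p1 id (rcoact P x) = rcoact P1 (p1 x)"
    "tmap K P2 C p2 id (rcoact P x) = rcoact P2 (p2 x)"
proof -
  have "tmap K P12 C f1 id (rcoact P1 (p1 x)) = tmap K P12 C f2 id (rcoact P2 (p2 x))"
    using A.hom B.hom cl x square[OF x] by (simp add: coaug_alg_hom_def) metis
  then obtain t where t: "t \<in> carrier (tensor K P C)" "tmap K P1 C p1 id t = rcoact P1 (p1 x)"
    "tmap K P2 C p2 id t = rcoact P2 (p2 x)"
    using tensor_pair_exists(1)[OF module_C, of "rcoact P1 (p1 x)" "rcoact P2 (p2 x)"] cl x by auto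
  then have "\<exists>!t. t \<in> carrier (tensor K P C) \<and> tmap K P1 C p1 id t = rcoact P1 (p1 x) \<and>
      tmap K P2 C p2 id t = rcoact P2 (p2 x)"
  proof (intro ex1I[of _ t], goal_cases)
    case (2 u)
    then show ?case by (intro tensor_eqI_right[OF module_C]) simp_all
  qed simp
  from theI'[OF this] show "rcoact P x \<in> carrier (tensor K P C)"
    "tmap K P1 C p1 id (rcoact P x) = rcoact P1 (p1 x)" "tmap K P2 C p2 id (rcoact P x) = rcoact P2 (p2 x)"
    unfolding rcoact_eq[OF x] by blast+
qed

lemma lcoact:
  assumes x: "x \<in> carrier P"
  shows "lcoact P x \<in> carrier (tensor K C P)" "tmap K C P1 id p1 (lcoact P x) = lcoact P1 (p1 x)"
    "tmap K C P2 id p2 (lcoact P x) = lcoact P2 (p2 x)"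
proof -
  have "tmap K C P12 id f1 (lcoact P1 (p1 x)) = tmap K C P12 id f2 (lcoact P2 (p2 x))"
    using A.hom B.hom cl x square[OF x] by (simp add: coaug_alg_hom_def) metis
  then obtain t where t: "t \<in> carrier (tensor K C P)" "tmap K C P1 id p1 t = lcoact P1 (p1 x)"
    "tmap K C P2 id p2 t = lcoact P2 (p2 x)"
    using tensor_pair_exists(2)[OF module_C, of "lcoact P1 (p1 x)" "lcoact P2 (p2 x)"] cl x by auto
  then have "\<exists>!t. t \<in> carrier (tensor K C P) \<and> tmap K C P1 id p1 t = lcoact P1 (p1 x) \<and>
      tmap K C P2 id p2 t = lcoact P2 (p2 x)"
  proof (intro ex1I[of _ t], goal_cases)
    case (2 u)
    then show ?case by (intro tensor_eqI_left[OF module_C]) simp_all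
  qed simp
  from theI'[OF this] show "lcoact P x \<in> carrier (tensor K C P)"
    "tmap K C P1 id p1 (lcoact P x) = lcoact P1 (p1 x)" "tmap K C P2 id p2 (lcoact P x) = lcoact P2 (p2 x)"
    unfolding lcoact_eq[OF x] by blast+
qed

lemma T_linear:
  "tmap K P1 C p1 id \<in> linear_maps K (tensor K P C) (tensor K P1 C)"
  "tmap K P2 C p2 id \<in> linear_maps K (tensor K P C) (tensor K P2 C)"
  "tmap K C P1 id p1 \<in> linear_maps K (tensor K C P) (tensor K C P1)"
  "tmap K C P2 id p2 \<in> linear_maps K (tensor K C P) (tensor K C P2)"
  by (intro tmap_linear p1_lin p2_lin; simp)+

lemma rcoact_linear: "rcoact P \<in> linear_maps K P (tensor K P C)"
proof (rule linear_mapsI)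
  show "rcoact P (x \<oplus>\<^bsub>P\<^esub> y) = rcoact P x \<oplus>\<^bsub>tensor K P C\<^esub> rcoact P y" if "x \<in> carrier P" "y \<in> carrier P" for x y
    using that cl rcoact[of x] rcoact[of y] rcoact[of "x \<oplus>\<^bsub>P\<^esub> y"]
    by (intro tensor_eqI_right[of C])
      (simp_all add: linear_add[OF T_linear(1)] linear_add[OF T_linear(2)] linear_add[OF p1_lin] linear_add[OF p2_lin]
        linear_add[OF P1.\<rho>_linear] linear_add[OF P2.\<rho>_linear])
  show "rcoact P (a \<odot>\<^bsub>P\<^esub> x) = a \<odot>\<^bsub>tensor K P C\<^esub> rcoact P x" if "a \<in> carrier K" "x \<in> carrier P" for a x
    using that cl rcoact[of x] rcoact[of "a \<odot>\<^bsub>P\<^esub> x"]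
    by (intro tensor_eqI_right[of C])
      (simp_all add: linear_smult[OF T_linear(1)] linear_smult[OF T_linear(2)] linear_smult[OF p1_lin] linear_smult[OF p2_lin]
        linear_smult[OF P1.\<rho>_linear] linear_smult[OF P2.\<rho>_linear])
qed (rule rcoact)

lemma lcoact_linear: "lcoact P \<in> linear_maps K P (tensor K C P)"
proof (rule linear_mapsI)
  show "lcoact P (x \<oplus>\<^bsub>P\<^esub> y) = lcoact P x \<oplus>\<^bsub>tensor K C P\<^esub> lcoact P y" if "x \<in> carrier P" "y \<in> carrier P" for x y
    using that cl lcoact[of x] lcoact[of y] lcoact[of "x \<oplus>\<^bsub>P\<^esub> y"]
    by (intro tensor_eqI_left[of C])
      (simp_all add: linear_add[OF T_linear(3)] linear_add[OF T_linear(4)] linear_add[OF p1_lin] linear_add[OF p2_lin]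
        linear_add[OF P1.\<sigma>_linear] linear_add[OF P2.\<sigma>_linear])
  show "lcoact P (a \<odot>\<^bsub>P\<^esub> x) = a \<odot>\<^bsub>tensor K C P\<^esub> lcoact P x" if "a \<in> carrier K" "x \<in> carrier P" for a x
    using that cl lcoact[of x] lcoact[of "a \<odot>\<^bsub>P\<^esub> x"]
    by (intro tensor_eqI_left[of C])
      (simp_all add: linear_smult[OF T_linear(3)] linear_smult[OF T_linear(4)] linear_smult[OF p1_lin] linear_smult[OF p2_lin]
        linear_smult[OF P1.\<sigma>_linear] linear_smult[OF P2.\<sigma>_linear])
qed (rule lcoact)

text \<open>Each axiom is an equation between elements determined by their two projections, and
  there it is the axiom for \<open>P1\<close> or \<open>P2\<close>.\<close>

lemma right_coaction_P: "right_coaction K C P (rcoact P)"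
  unfolding right_coaction_def
proof (intro conjI ballI rcoact_linear)
  fix v assume v: "v \<in> carrier P"
  note rv = rcoact(1)[OF v] and [mlin] = mods(1)
  have c: "tlift P (\<lambda>x c. \<epsilon> c \<odot>\<^bsub>P\<^esub> x) (rcoact P v) \<in> carrier P"
    using rv by (intro tlift_closed[of P C]) auto
  show "tlift P (\<lambda>x c. \<epsilon> c \<odot>\<^bsub>P\<^esub> x) (rcoact P v) = v"
    by (rule joint_inj[OF c v])
      (rule right_counit_transfer[where \<rho> = "rcoact P" and v = v, OF _ _ p1_lin rv P1.right_coaction rcoact(2)[OF v] v]
        right_counit_transfer[where \<rho> = "rcoact P" and v = v, OF _ _ p2_lin rv P2.right_coaction rcoact(3)[OF v] v]; simp)+
  show "tmap K (tensor K P C) C (rcoact P) id (rcoact P v) =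
      tassoc K P C C (tmap K P (tensor K C C) id \<Delta> (rcoact P v))"
  proof (rule tensor_eqI_right2[of C C])
    show "tmap K (tensor K P C) C (rcoact P) id (rcoact P v) \<in> carrier (tensor K (tensor K P C) C)"
      by (rule linear_closed[OF tmap_linear[OF _ _ _ _ rcoact_linear id_linear] rv]) simp_all
    let ?T = "tensor K (tensor K P C) C"
    have "tmap K P (tensor K C C) id \<Delta> (rcoact P v) \<in> carrier (tensor K P (tensor K C C))"
      by (rule linear_closed[OF tmap_linear[OF _ _ _ _ id_linear comult_linear] rv]) simp_all
    then show "tassoc K P C C (tmap K P (tensor K C C) id \<Delta> (rcoact P v)) \<in> carrier ?T"
      unfolding tassoc_def Let_def by (intro tlift_closed[of P "tensor K C C"] tlift_closed[of C C]) auto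
  qed (rule right_coassoc_transfer[where \<rho> = "rcoact P" and v = v, OF _ _ p1_lin rcoact_linear P1.right_coaction rcoact(2) v]
        right_coassoc_transfer[where \<rho> = "rcoact P" and v = v, OF _ _ p2_lin rcoact_linear P2.right_coaction rcoact(3) v] module_C; simp)+
qed

lemma left_coaction_P: "left_coaction K C P (lcoact P)"
  unfolding left_coaction_def
proof (intro conjI ballI lcoact_linear)
  fix v assume v: "v \<in> carrier P"
  note rv = lcoact(1)[OF v] and [mlin] = mods(1)
  have c: "tlift P (\<lambda>c x. \<epsilon> c \<odot>\<^bsub>P\<^esub> x) (lcoact P v) \<in> carrier P"
    using rv by (intro tlift_closed[of C P]) auto
  show "tlift P (\<lambda>c x. \<epsilon> c \<odot>\<^bsub>P\<^esub> x) (lcoact P v) = v"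
    by (rule joint_inj[OF c v])
      (rule left_counit_transfer[where \<sigma> = "lcoact P" and v = v, OF _ _ p1_lin rv P1.left_coaction lcoact(2)[OF v] v]
        left_counit_transfer[where \<sigma> = "lcoact P" and v = v, OF _ _ p2_lin rv P2.left_coaction lcoact(3)[OF v] v]; simp)+
  show "tassoc K C C P (tmap K C (tensor K C P) id (lcoact P) (lcoact P v)) =
      tmap K (tensor K C C) P \<Delta> id (lcoact P v)"
  proof (rule tensor_eqI_left[of "tensor K C C"])
    show "tmap K (tensor K C C) P \<Delta> id (lcoact P v) \<in> carrier (tensor K (tensor K C C) P)"
      by (rule linear_closed[OF tmap_linear[OF _ _ _ _ comult_linear id_linear] rv]) simp_all
    let ?T = "tensor K (tensor K C C) P"
    have "tmap K C (tensor K C P) id (lcoact P) (lcoact P v) \<in> carrier (tensor K C (tensor K C P))"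
      by (rule linear_closed[OF tmap_linear[OF _ _ _ _ id_linear lcoact_linear] rv]) simp_all
    then show "tassoc K C C P (tmap K C (tensor K C P) id (lcoact P) (lcoact P v)) \<in> carrier ?T"
      unfolding tassoc_def Let_def by (intro tlift_closed[of C "tensor K C P"] tlift_closed[of C P]) auto
  qed (rule left_coassoc_transfer[where \<sigma> = "lcoact P" and v = v, OF _ _ p1_lin lcoact_linear P1.left_coaction lcoact(2) v]
        left_coassoc_transfer[where \<sigma> = "lcoact P" and v = v, OF _ _ p2_lin lcoact_linear P2.left_coaction lcoact(3) v] module_tensor; simp)+
qed

lemma coaug_P: "coaug_alg K C e P"
proof -
  have one: "p1 \<one>\<^bsub>P\<^esub> = \<one>\<^bsub>P1\<^esub>" "p2 \<one>\<^bsub>P\<^esub> = \<one>\<^bsub>P2\<^esub>" using p1_hom p2_hom by (auto simp: ring_hom_def)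
  note P = unital_algebraD(3)[OF alg]
  note i = id_linear[of C]
  have "rcoact P \<one>\<^bsub>P\<^esub> = tens K P C \<one>\<^bsub>P\<^esub> e"
    using P rcoact[OF P] mods
    by (intro tensor_eqI_right[of C])
      (simp_all add: one P1.\<rho>_one P2.\<rho>_one tmap_tens[OF _ _ _ _ p1_lin i] tmap_tens[OF _ _ _ _ p2_lin i])
  moreover have "lcoact P \<one>\<^bsub>P\<^esub> = tens K C P e \<one>\<^bsub>P\<^esub>"
    using P lcoact[OF P] mods
    by (intro tensor_eqI_left[of C])
      (simp_all add: one P1.\<sigma>_one P2.\<sigma>_one tmap_tens[OF _ _ _ _ i p1_lin] tmap_tens[OF _ _ _ _ i p2_lin])
  ultimately show ?thesis
    using alg right_coaction_P left_coaction_P by (simp add: coaug_alg_def)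
qed

lemma p1_coaug_hom: "coaug_alg_hom K C P P1 p1"
  using p1_hom p1_lin rcoact lcoact by (simp add: coaug_alg_hom_def)

lemma p2_coaug_hom: "coaug_alg_hom K C P P2 p2"
  using p2_hom p2_lin rcoact lcoact by (simp add: coaug_alg_hom_def)

end

section \<open>The strong connection of a fibre product\<close>

context coalgebra_point
begin

lemma tlift_plus:
  assumes "module K V" "module K W" "module K M" "bilin V W M F" "x \<in> carrier (tensor K V W)" "y \<in> carrier (tensor K V W)"
  shows "tlift M F (x \<oplus>\<^bsub>tensor K V W\<^esub> y) = tlift M F x \<oplus>\<^bsub>M\<^esub> tlift M F y"
  using assms by (intro linear_add[OF tlift_linear]) auto

lemma tlift_comult_add:
  assumes V: "module K V" "module K W" and M: "module K M" and c: "c \<in> carrier C"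
    and \<gamma>: "\<And>c1 c2. c1 \<in> carrier C \<Longrightarrow> c2 \<in> carrier C \<Longrightarrow> bilin V W M (\<gamma> c1 c2)"
    and u: "\<And>c1 c2. c1 \<in> carrier C \<Longrightarrow> c2 \<in> carrier C \<Longrightarrow> u c1 c2 \<in> carrier (tensor K V W)"
    and v: "\<And>c1 c2. c1 \<in> carrier C \<Longrightarrow> c2 \<in> carrier C \<Longrightarrow> v c1 c2 \<in> carrier (tensor K V W)"
  shows "tlift M (\<lambda>c1 c2. tlift M (\<gamma> c1 c2) (u c1 c2 \<oplus>\<^bsub>tensor K V W\<^esub> v c1 c2)) (\<Delta> c) =
    tlift M (\<lambda>c1 c2. tlift M (\<gamma> c1 c2) (u c1 c2)) (\<Delta> c) \<oplus>\<^bsub>M\<^esub> tlift M (\<lambda>c1 c2. tlift M (\<gamma> c1 c2) (v c1 c2)) (\<Delta> c)"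
proof -
  have cl: "tlift M (\<gamma> c1 c2) (u c1 c2) \<in> carrier M" "tlift M (\<gamma> c1 c2) (v c1 c2) \<in> carrier M"
    if "c1 \<in> carrier C" "c2 \<in> carrier C" for c1 c2
    using that bilinD(3)[OF \<gamma>] by (auto intro!: tlift_closed[OF V u M] tlift_closed[OF V v M])
  have "tlift M (\<lambda>c1 c2. tlift M (\<gamma> c1 c2) (u c1 c2 \<oplus>\<^bsub>tensor K V W\<^esub> v c1 c2)) (\<Delta> c) =
      tlift M (\<lambda>c1 c2. tlift M (\<gamma> c1 c2) (u c1 c2) \<oplus>\<^bsub>M\<^esub> tlift M (\<gamma> c1 c2) (v c1 c2)) (\<Delta> c)"
    using c M cl by (intro tlift_cong[of C C]) (auto simp: tlift_plus[OF V M \<gamma> u v])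
  also have "\<dots> = tlift M (\<lambda>c1 c2. tlift M (\<gamma> c1 c2) (u c1 c2)) (\<Delta> c) \<oplus>\<^bsub>M\<^esub>
      tlift M (\<lambda>c1 c2. tlift M (\<gamma> c1 c2) (v c1 c2)) (\<Delta> c)"
    using c M cl by (intro tlift_add[of C C]) auto
  finally show ?thesis .
qed

end

locale fibre_principal = coalgebra_point K C e + P1: strong_connection K C e P1 l1 + P2: strong_connection K C e P2 l2 +
  P12: coaug K C e P12 + P: coaug K C e P +
  A: coaug_hom K C e P1 P12 f1 + B: principal_surjection K C e P2 P12 f2 l2 +
  p1: coaug_hom K C e P P1 p1 + p2: coaug_hom K C e P P2 p2 + fibre_modules K P P1 P2 P12 p1 p2 f1 f2
  for K :: "'k ring" and C :: "('k, 'c) coalg" and e :: 'c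
    and P :: "('k, 'x, 'c) coact_alg" and P1 :: "('k, 'p, 'c) coact_alg"
    and P2 :: "('k, 'q, 'c) coact_alg" and P12 :: "('k, 's, 'c) coact_alg" and p1 p2 f1 f2 l1 l2
begin

lemma TP_eqI:
  assumes "t \<in> carrier P.PC" "u \<in> carrier P.PC" "p1.T t = p1.T u" "p2.T t = p2.T u"
  shows "t = u"
  using split_pair_exists split_pair_eqI[OF split_pair_tensor(1)[OF _ module_C]] assms
  unfolding p1.T_def p2.T_def tmap_def id_def by metis

lemma SP_eqI:
  assumes "t \<in> carrier P.CP" "u \<in> carrier P.CP" "p1.S t = p1.S u" "p2.S t = p2.S u"
  shows "t = u"
  using split_pair_exists split_pair_eqI[OF split_pair_tensor(2)[OF _ module_C]] assms
  unfolding p1.S_def p2.S_def tmap_def id_def by metis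

section \<open>Colinear maps into the fibre product\<close>

definition fR :: "'p \<Rightarrow> 'q" where "fR a = B.alphaR (f1 a)"
definition fL :: "'p \<Rightarrow> 'q" where "fL a = B.alphaL (f1 a)"
definition jR :: "'p \<Rightarrow> 'x" where "jR a = pair a (fR a)"
definition jL :: "'p \<Rightarrow> 'x" where "jL a = pair a (fL a)"
text \<open>A right colinear projection of \<open>P2\<close> onto the kernel of \<open>f2\<close>.
  It makes \<open>j2\<close>, the embedding of this kernel as pairs with first component zero, a
  linear map on all of \<open>P2\<close>.\<close>

definition k2 :: "'q \<Rightarrow> 'q" where "k2 b = b \<ominus>\<^bsub>P2\<^esub> B.alphaR (f2 b)"
definition j2 :: "'q \<Rightarrow> 'x" where "j2 b = pair \<zero>\<^bsub>P1\<^esub> (k2 b)"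

lemma fR_linear: "fR \<in> linear_maps K P1 P2"
  unfolding fR_def[abs_def] by (assumption | rule mlin)+

lemma fL_linear: "fL \<in> linear_maps K P1 P2"
  unfolding fL_def[abs_def] by (assumption | rule mlin)+

lemma k2_linear: "k2 \<in> linear_maps K P2 P2"
  unfolding k2_def[abs_def] by (rule linear_minus; (assumption | rule mlin)+)

lemmas fRL_closed [simp, mlin] = linear_closed[OF fR_linear] linear_closed[OF fL_linear] linear_closed[OF k2_linear]
lemmas fRL_linear_comp [mlin] = linear_comp[OF fR_linear] linear_comp[OF fL_linear] linear_comp[OF k2_linear]

lemma f2_f [simp]: "a \<in> carrier P1 \<Longrightarrow> f2 (fR a) = f1 a" "a \<in> carrier P1 \<Longrightarrow> f2 (fL a) = f1 a"
  by (simp_all add: fR_def fL_def B.f_alphaR B.f_alphaL)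

lemma f2_k2: "b \<in> carrier P2 \<Longrightarrow> f1 \<zero>\<^bsub>P1\<^esub> = f2 (k2 b)"
  by (simp add: k2_def linear_zero[OF A.f_linear] linear_diff[OF B.f_linear] B.f_alphaR)

lemma j_linear: "jR \<in> linear_maps K P1 P" "jL \<in> linear_maps K P1 P" "j2 \<in> linear_maps K P2 P"
  unfolding jR_def[abs_def] jL_def[abs_def] j2_def[abs_def]
  by (rule pair_linear; (assumption | rule fR_linear fL_linear k2_linear linear_zero_map mlin | simp add: f2_k2)+)+

lemmas j_closed [simp, mlin] = j_linear[THEN linear_closed]
lemmas j_linear_comp [mlin] = j_linear[THEN linear_comp]

lemma p_j [simp]:
  "a \<in> carrier P1 \<Longrightarrow> p1 (jR a) = a" "a \<in> carrier P1 \<Longrightarrow> p2 (jR a) = fR a"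
  "a \<in> carrier P1 \<Longrightarrow> p1 (jL a) = a" "a \<in> carrier P1 \<Longrightarrow> p2 (jL a) = fL a"
  "b \<in> carrier P2 \<Longrightarrow> p1 (j2 b) = \<zero>\<^bsub>P1\<^esub>" "b \<in> carrier P2 \<Longrightarrow> p2 (j2 b) = k2 b"
  unfolding jR_def jL_def j2_def
  using pair[of a "fR a"] pair[of a "fL a"] pair[of "\<zero>\<^bsub>P1\<^esub>" "k2 b"] f2_k2[of b] by auto

lemma k2_kernel: "b \<in> carrier P2 \<Longrightarrow> f2 b = \<zero>\<^bsub>P12\<^esub> \<Longrightarrow> k2 b = b"
  using diff_add_cancel(1)[of P2 b "\<zero>\<^bsub>P2\<^esub>"] by (simp add: k2_def linear_zero[OF B.alphaR_linear])

lemma rcoact_fR: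
  assumes [simp, mlin]: "module K M" and \<beta>: "bilin P2 C M \<beta>" and a: "a \<in> carrier P1"
  shows "tlift M \<beta> (rcoact P2 (fR a)) = tlift M (\<lambda>a0 c. \<beta> (fR a0) c) (rcoact P1 a)"
proof -
  note [mlin] = linear_comp[OF bilinD(1)[OF \<beta>]] linear_comp[OF bilinD(2)[OF \<beta>]]
  have "tlift M \<beta> (rcoact P2 (fR a)) = tlift M (\<lambda>z0 c. \<beta> (B.alphaR z0) c) (rcoact P12 (f1 a))"
    unfolding fR_def by (rule B.tlift_rcoact_alphaR[OF _ \<beta>]) (simp_all add: a)
  also have "\<dots> = tlift M (\<lambda>a0 c. \<beta> (fR a0) c) (rcoact P1 a)"
    unfolding fR_def by (rule A.tlift_rcoact; (assumption | rule a mlin)+)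
  finally show ?thesis .
qed

lemma lcoact_fL:
  assumes [simp, mlin]: "module K M" and \<beta>: "bilin C P2 M \<beta>" and a: "a \<in> carrier P1"
  shows "tlift M \<beta> (lcoact P2 (fL a)) = tlift M (\<lambda>c a0. \<beta> c (fL a0)) (lcoact P1 a)"
proof -
  note [mlin] = linear_comp[OF bilinD(1)[OF \<beta>]] linear_comp[OF bilinD(2)[OF \<beta>]]
  have "tlift M \<beta> (lcoact P2 (fL a)) = tlift M (\<lambda>c z0. \<beta> c (B.alphaL z0)) (lcoact P12 (f1 a))"
    unfolding fL_def by (rule B.tlift_lcoact_alphaL[OF _ \<beta>]) (simp_all add: a)
  also have "\<dots> = tlift M (\<lambda>c a0. \<beta> c (fL a0)) (lcoact P1 a)"
    unfolding fL_def by (rule A.tlift_lcoact; (assumption | rule a mlin)+)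
  finally show ?thesis .
qed

text \<open>Reduces colinearity of a map into \<open>P\<close> to its two components, since an
  element of \<open>P \<otimes> C\<close> is determined by its projections.\<close>

lemma rcoact_lift:
  assumes h: "h \<in> linear_maps K U P" and U [simp, mlin]: "module K U" and s: "s \<in> carrier (tensor K U C)"
    and p: "p \<in> carrier P"
    and eq1: "rcoact P1 (p1 p) = tlift P1.PC (\<lambda>u c. tens K P1 C (p1 (h u)) c) s"
    and eq2: "rcoact P2 (p2 p) = tlift P2.PC (\<lambda>u c. tens K P2 C (p2 (h u)) c) s"
    and M: "module K M" and \<beta>: "bilin P C M \<beta>"
  shows "tlift M \<beta> (rcoact P p) = tlift M (\<lambda>u c. \<beta> (h u) c) s"
proof -
  note [mlin] = linear_closed[OF h] linear_comp[OF h] and [simp] = linear_closed[OF h]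
  have cl: "tlift P.PC (\<lambda>u c. tens K P C (h u) c) s \<in> carrier P.PC" by (assumption | rule s mlin)+
  have "p1.T (tlift P.PC (\<lambda>u c. tens K P C (h u) c) s) = tlift P1.PC (\<lambda>u c. p1.T (tens K P C (h u) c)) s"
    by (rule tlift_push[OF _ _ p1.T_linear]; (assumption | rule s mlin)+)
  also have "\<dots> = rcoact P1 (p1 p)" unfolding eq1 using s by (intro tlift_cong[of U C]) auto
  finally have 1: "p1.T (rcoact P p) = p1.T (tlift P.PC (\<lambda>u c. tens K P C (h u) c) s)"
    using p by (simp add: p1.T_rcoact)
  have "p2.T (tlift P.PC (\<lambda>u c. tens K P C (h u) c) s) = tlift P2.PC (\<lambda>u c. p2.T (tens K P C (h u) c)) s"
    by (rule tlift_push[OF _ _ p2.T_linear]; (assumption | rule s mlin)+)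
  also have "\<dots> = rcoact P2 (p2 p)" unfolding eq2 using s by (intro tlift_cong[of U C]) auto
  finally have 2: "p2.T (rcoact P p) = p2.T (tlift P.PC (\<lambda>u c. tens K P C (h u) c) s)"
    using p by (simp add: p2.T_rcoact)
  have "rcoact P p = tlift P.PC (\<lambda>u c. tens K P C (h u) c) s"
    using p cl 1 2 by (intro TP_eqI) auto
  then have "tlift M \<beta> (rcoact P p) = tlift M (\<lambda>u c. tlift M \<beta> (tens K P C (h u) c)) s"
    using s M \<beta> by (simp add: tlift_push[of U C "tlift M \<beta>" P.PC] tlift_linear)
  also have "\<dots> = tlift M (\<lambda>u c. \<beta> (h u) c) s"
    using s M \<beta> bilinD(3)[OF \<beta>] by (intro tlift_cong[of U C]) (auto simp: tlift_tens)
  finally show ?thesis .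
qed

lemma lcoact_lift:
  assumes h: "h \<in> linear_maps K U P" and U [simp, mlin]: "module K U" and s: "s \<in> carrier (tensor K C U)"
    and p: "p \<in> carrier P"
    and eq1: "lcoact P1 (p1 p) = tlift P1.CP (\<lambda>c u. tens K C P1 c (p1 (h u))) s"
    and eq2: "lcoact P2 (p2 p) = tlift P2.CP (\<lambda>c u. tens K C P2 c (p2 (h u))) s"
    and M: "module K M" and \<beta>: "bilin C P M \<beta>"
  shows "tlift M \<beta> (lcoact P p) = tlift M (\<lambda>c u. \<beta> c (h u)) s"
proof -
  note [mlin] = linear_closed[OF h] linear_comp[OF h] and [simp] = linear_closed[OF h]
  have cl: "tlift P.CP (\<lambda>c u. tens K C P c (h u)) s \<in> carrier P.CP" by (assumption | rule s mlin)+
  have "p1.S (tlift P.CP (\<lambda>c u. tens K C P c (h u)) s) = tlift P1.CP (\<lambda>c u. p1.S (tens K C P c (h u))) s"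
    by (rule tlift_push[OF _ _ p1.S_linear]; (assumption | rule s mlin)+)
  also have "\<dots> = lcoact P1 (p1 p)" unfolding eq1 using s by (intro tlift_cong[of C U]) auto
  finally have 1: "p1.S (lcoact P p) = p1.S (tlift P.CP (\<lambda>c u. tens K C P c (h u)) s)"
    using p by (simp add: p1.S_lcoact)
  have "p2.S (tlift P.CP (\<lambda>c u. tens K C P c (h u)) s) = tlift P2.CP (\<lambda>c u. p2.S (tens K C P c (h u))) s"
    by (rule tlift_push[OF _ _ p2.S_linear]; (assumption | rule s mlin)+)
  also have "\<dots> = lcoact P2 (p2 p)" unfolding eq2 using s by (intro tlift_cong[of C U]) auto
  finally have 2: "p2.S (lcoact P p) = p2.S (tlift P.CP (\<lambda>c u. tens K C P c (h u)) s)"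
    using p by (simp add: p2.S_lcoact)
  have "lcoact P p = tlift P.CP (\<lambda>c u. tens K C P c (h u)) s"
    using p cl 1 2 by (intro SP_eqI) auto
  then have "tlift M \<beta> (lcoact P p) = tlift M (\<lambda>c u. tlift M \<beta> (tens K C P c (h u))) s"
    using s M \<beta> by (simp add: tlift_push[of C U "tlift M \<beta>" P.CP] tlift_linear)
  also have "\<dots> = tlift M (\<lambda>c u. \<beta> c (h u)) s"
    using s M \<beta> bilinD(3)[OF \<beta>] by (intro tlift_cong[of C U]) (auto simp: tlift_tens)
  finally show ?thesis .
qed

lemma tens_zero [simp]:
  "module K V \<Longrightarrow> module K W \<Longrightarrow> w \<in> carrier W \<Longrightarrow> tens K V W \<zero>\<^bsub>V\<^esub> w = \<zero>\<^bsub>tensor K V W\<^esub>"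
  "module K V \<Longrightarrow> module K W \<Longrightarrow> v \<in> carrier V \<Longrightarrow> tens K V W v \<zero>\<^bsub>W\<^esub> = \<zero>\<^bsub>tensor K V W\<^esub>"
  using linear_zero[OF bilinD(2)[OF tens_bilin[of V W]]] linear_zero[OF bilinD(1)[OF tens_bilin[of V W]]]
  by simp_all

lemma rcoact_jR:
  assumes M: "module K M" and \<beta>: "bilin P C M \<beta>" and a: "a \<in> carrier P1"
  shows "tlift M \<beta> (rcoact P (jR a)) = tlift M (\<lambda>a0 c. \<beta> (jR a0) c) (rcoact P1 a)"
proof (rule rcoact_lift[OF j_linear(1) _ _ _ _ _ M \<beta>])
  show "rcoact P1 (p1 (jR a)) = tlift P1.PC (\<lambda>u c. tens K P1 C (p1 (jR u)) c) (rcoact P1 a)"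
  proof -
    have "tlift P1.PC (\<lambda>u c. tens K P1 C (p1 (jR u)) c) (rcoact P1 a) = tlift P1.PC (tens K P1 C) (rcoact P1 a)"
      using a by (intro tlift_cong[of P1 C]) auto
    then show ?thesis using a by (simp add: tlift_id)
  qed
  show "rcoact P2 (p2 (jR a)) = tlift P2.PC (\<lambda>u c. tens K P2 C (p2 (jR u)) c) (rcoact P1 a)"
  proof -
    have "tlift P2.PC (\<lambda>u c. tens K P2 C (p2 (jR u)) c) (rcoact P1 a) = tlift P2.PC (\<lambda>u c. tens K P2 C (fR u) c) (rcoact P1 a)"
      using a by (intro tlift_cong[of P1 C]) auto
    also have "\<dots> = tlift P2.PC (tens K P2 C) (rcoact P2 (fR a))"
      using a by (intro rcoact_fR[symmetric] tens_bilin) auto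
    finally show ?thesis using a by (simp add: tlift_id)
  qed
qed (simp_all add: a)

lemma lcoact_jL:
  assumes M: "module K M" and \<beta>: "bilin C P M \<beta>" and a: "a \<in> carrier P1"
  shows "tlift M \<beta> (lcoact P (jL a)) = tlift M (\<lambda>c a0. \<beta> c (jL a0)) (lcoact P1 a)"
proof (rule lcoact_lift[OF j_linear(2) _ _ _ _ _ M \<beta>])
  show "lcoact P1 (p1 (jL a)) = tlift P1.CP (\<lambda>c u. tens K C P1 c (p1 (jL u))) (lcoact P1 a)"
  proof -
    have "tlift P1.CP (\<lambda>c u. tens K C P1 c (p1 (jL u))) (lcoact P1 a) = tlift P1.CP (tens K C P1) (lcoact P1 a)"
      using a by (intro tlift_cong[of C P1]) auto
    then show ?thesis using a by (simp add: tlift_id)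
  qed
  show "lcoact P2 (p2 (jL a)) = tlift P2.CP (\<lambda>c u. tens K C P2 c (p2 (jL u))) (lcoact P1 a)"
  proof -
    have "tlift P2.CP (\<lambda>c u. tens K C P2 c (p2 (jL u))) (lcoact P1 a) = tlift P2.CP (\<lambda>c u. tens K C P2 c (fL u)) (lcoact P1 a)"
      using a by (intro tlift_cong[of C P1]) auto
    also have "\<dots> = tlift P2.CP (tens K C P2) (lcoact P2 (fL a))"
      using a by (intro lcoact_fL[symmetric] tens_bilin) auto
    finally show ?thesis using a by (simp add: tlift_id)
  qed
qed (simp_all add: a)

text \<open>In the second component this is right colinearity of \<open>k2\<close>, a difference of
  right colinear maps.\<close>

lemma rcoact_j2:
  assumes M: "module K M" and \<beta>: "bilin P C M \<beta>" and b: "b \<in> carrier P2"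
  shows "tlift M \<beta> (rcoact P (j2 b)) = tlift M (\<lambda>b0 c. \<beta> (j2 b0) c) (rcoact P2 b)"
proof (rule rcoact_lift[OF j_linear(3) _ _ _ _ _ M \<beta>])
  show "rcoact P1 (p1 (j2 b)) = tlift P1.PC (\<lambda>u c. tens K P1 C (p1 (j2 u)) c) (rcoact P2 b)"
  proof -
    have "tlift P1.PC (\<lambda>u c. tens K P1 C (p1 (j2 u)) c) (rcoact P2 b) = tlift P1.PC (\<lambda>u c. \<zero>\<^bsub>P1.PC\<^esub>) (rcoact P2 b)"
      using b by (intro tlift_cong[of P2 C]) auto
    then show ?thesis using b by (simp add: tlift_zero[of P2 C] linear_zero[OF P1.\<rho>_linear])
  qed
  show "rcoact P2 (p2 (j2 b)) = tlift P2.PC (\<lambda>u c. tens K P2 C (p2 (j2 u)) c) (rcoact P2 b)"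
  proof -
    have "tlift P2.PC (\<lambda>u c. tens K P2 C (p2 (j2 u)) c) (rcoact P2 b) =
        tlift P2.PC (\<lambda>u c. tens K P2 C u c \<ominus>\<^bsub>P2.PC\<^esub> tens K P2 C (B.alphaR (f2 u)) c) (rcoact P2 b)"
      using b by (intro tlift_cong[of P2 C]) (auto simp: k2_def linear_diff[OF bilinD(2)[OF tens_bilin]])
    also have "\<dots> = tlift P2.PC (tens K P2 C) (rcoact P2 b) \<ominus>\<^bsub>P2.PC\<^esub>
        tlift P2.PC (\<lambda>u c. tens K P2 C (B.alphaR (f2 u)) c) (rcoact P2 b)"
      using b by (intro tlift_diff[of P2 C]) auto
    also have "tlift P2.PC (\<lambda>u c. tens K P2 C (B.alphaR (f2 u)) c) (rcoact P2 b) =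
        tlift P2.PC (\<lambda>z c. tens K P2 C (B.alphaR z) c) (rcoact P12 (f2 b))"
      by (rule B.tlift_rcoact[symmetric]; (assumption | rule b mlin)+)
    also have "\<dots> = tlift P2.PC (tens K P2 C) (rcoact P2 (B.alphaR (f2 b)))"
      using b by (intro B.tlift_rcoact_alphaR[symmetric] tens_bilin) auto
    finally show ?thesis using b by (simp add: tlift_id k2_def linear_diff[OF P2.\<rho>_linear])
  qed
qed (simp_all add: b)

text \<open>The map \<open>k2\<close> uses \<open>alphaR\<close>, for which only right colinearity
  is established, so the argument is confined to the kernel of \<open>f2\<close>. There the part of
  the coaction involving \<open>alphaR\<close> factors through the left coaction of
  \<open>f2 b = \<zero>\<close> and vanishes.\<close>

lemma lcoact_j2:
  assumes M: "module K M" and \<beta>: "bilin C P M \<beta>" and b: "b \<in> carrier P2" and fb: "f2 b = \<zero>\<^bsub>P12\<^esub>"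
  shows "tlift M \<beta> (lcoact P (j2 b)) = tlift M (\<lambda>c b0. \<beta> c (j2 b0)) (lcoact P2 b)"
proof (rule lcoact_lift[OF j_linear(3) _ _ _ _ _ M \<beta>])
  show "lcoact P1 (p1 (j2 b)) = tlift P1.CP (\<lambda>c u. tens K C P1 c (p1 (j2 u))) (lcoact P2 b)"
  proof -
    have "tlift P1.CP (\<lambda>c u. tens K C P1 c (p1 (j2 u))) (lcoact P2 b) = tlift P1.CP (\<lambda>c u. \<zero>\<^bsub>P1.CP\<^esub>) (lcoact P2 b)"
      using b by (intro tlift_cong[of C P2]) auto
    then show ?thesis using b by (simp add: tlift_zero[of C P2] linear_zero[OF P1.\<sigma>_linear])
  qed
  show "lcoact P2 (p2 (j2 b)) = tlift P2.CP (\<lambda>c u. tens K C P2 c (p2 (j2 u))) (lcoact P2 b)"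
  proof -
    have b': "bilin C P12 P2.CP (\<lambda>c z. tens K C P2 c (B.alphaR z))" by (assumption | rule mlin)+
    have "tlift P2.CP (\<lambda>c u. tens K C P2 c (p2 (j2 u))) (lcoact P2 b) =
        tlift P2.CP (\<lambda>c u. tens K C P2 c u \<ominus>\<^bsub>P2.CP\<^esub> tens K C P2 c (B.alphaR (f2 u))) (lcoact P2 b)"
      using b by (intro tlift_cong[of C P2]) (auto simp: k2_def linear_diff[OF bilinD(1)[OF tens_bilin]])
    also have "\<dots> = tlift P2.CP (tens K C P2) (lcoact P2 b) \<ominus>\<^bsub>P2.CP\<^esub>
        tlift P2.CP (\<lambda>c u. tens K C P2 c (B.alphaR (f2 u))) (lcoact P2 b)"
      using b by (intro tlift_diff[of C P2]) auto
    also have "tlift P2.CP (\<lambda>c u. tens K C P2 c (B.alphaR (f2 u))) (lcoact P2 b) =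
        tlift P2.CP (\<lambda>c z. tens K C P2 c (B.alphaR z)) (lcoact P12 (f2 b))"
      by (rule B.tlift_lcoact[symmetric]; (assumption | rule b b' mlin)+)
    also have "\<dots> = \<zero>\<^bsub>P2.CP\<^esub>"
      unfolding fb using linear_zero[OF tlift_linear[OF _ _ _ b']] by (simp add: linear_zero[OF P12.\<sigma>_linear])
    finally show ?thesis
      using b fb diff_add_cancel(1)[of P2.CP "lcoact P2 b" "\<zero>\<^bsub>P2.CP\<^esub>"] by (simp add: tlift_id k2_kernel)
  qed
qed (simp_all add: b)

text \<open>
  \<open>m'\<close> measures how far the lift \<open>(fL \<otimes> fR) l1\<close> to \<open>P2 \<otimes> P2\<close> is from satisfying \<open>l_mult\<close>; the defect \<open>t\<close> takes
  values in the kernel of \<open>f2\<close> and commutes with the entwining, so multiplication by it preserves colinearity.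
\<close>

definition m' :: "'c \<Rightarrow> 'q" where
  "m' c = tlift P2 (\<lambda>x y. fL x \<otimes>\<^bsub>P2\<^esub> fR y) (l1 c)"

definition t :: "'c \<Rightarrow> 'q" where
  "t c = \<epsilon> c \<odot>\<^bsub>P2\<^esub> \<one>\<^bsub>P2\<^esub> \<ominus>\<^bsub>P2\<^esub> m' c"

lemma m'_linear: "m' \<in> linear_maps K C P2"
  unfolding m'_def[abs_def] by (assumption | rule mlin)+

lemmas m'_closed [simp, mlin] = linear_closed[OF m'_linear]
lemmas m'_linear_comp [mlin] = linear_comp[OF m'_linear]

lemma t_linear: "t \<in> linear_maps K C P2"
  unfolding t_def[abs_def] by (rule linear_minus; (assumption | rule mlin)+)

lemmas t_closed [simp, mlin] = linear_closed[OF t_linear]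
lemmas t_linear_comp [mlin] = linear_comp[OF t_linear]

text \<open>Over \<open>P12\<close> the lifts \<open>fL\<close> and \<open>fR\<close> both become
  \<open>f1\<close>, and the product of the legs of \<open>l1\<close> is the counit.\<close>

lemma f2_t:
  assumes c: "c \<in> carrier C"
  shows "f2 (t c) = \<zero>\<^bsub>P12\<^esub>"
proof -
  have "f2 (m' c) = tlift P12 (\<lambda>x y. f2 (fL x \<otimes>\<^bsub>P2\<^esub> fR y)) (l1 c)"
    unfolding m'_def by (rule tlift_push[OF _ _ B.f_linear]; (assumption | rule c mlin)+)
  also have "\<dots> = tlift P12 (\<lambda>x y. f1 (x \<otimes>\<^bsub>P1\<^esub> y)) (l1 c)"
    using c by (intro tlift_cong[of P1 P1]) (auto simp: B.f_mult A.f_mult)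
  also have "\<dots> = \<epsilon> c \<odot>\<^bsub>P12\<^esub> \<one>\<^bsub>P12\<^esub>"
    using P1.l_mult_lift[OF _ A.f_linear c] by (simp add: A.f_one)
  finally show ?thesis
    using c by (simp add: t_def linear_diff[OF B.f_linear] linear_smult[OF B.f_linear] B.f_one)
qed

lemma f2_t_mult: "c \<in> carrier C \<Longrightarrow> x \<in> carrier P2 \<Longrightarrow> f2 (t c \<otimes>\<^bsub>P2\<^esub> x) = \<zero>\<^bsub>P12\<^esub>"
  and f2_mult_t: "c \<in> carrier C \<Longrightarrow> x \<in> carrier P2 \<Longrightarrow> f2 (x \<otimes>\<^bsub>P2\<^esub> t c) = \<zero>\<^bsub>P12\<^esub>"
  using ring.ring_simprules(24,25)[OF P12.ring_P] by (simp_all add: B.f_mult f2_t)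

text \<open>Reads \<open>\<psi>(c_1 \<otimes> t(c_2)) = t(c_1) \<otimes> c_2\<close>, and is proved
  for \<open>\<epsilon>\<close> and \<open>m'\<close> separately. For \<open>m'\<close>, the factor
  \<open>fL x\<close> is entwined first: left colinearity of \<open>l1\<close> and \<open>fL\<close>
  makes it \<open>fL x \<otimes> e\<close>; acting on this by \<open>fR y\<close> gives
  \<open>fL x \<rho>(fR y)\<close>, and right colinearity of \<open>fR\<close> and \<open>l1\<close>
  yields \<open>m'(c_1) \<otimes> c_2\<close>.\<close>

lemma psi_t:
  assumes c: "c \<in> carrier C"
  shows "tlift P2.PC (\<lambda>c1 c2. P2.psi c1 (t c2)) (\<Delta> c) = tlift P2.PC (\<lambda>c1 c2. tens K P2 C (t c1) c2) (\<Delta> c)"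
proof -
  let ?T = "P2.PC"
  have m: "tlift ?T (\<lambda>c1 c2. P2.psi c1 (m' c2)) (\<Delta> c) = tlift ?T (\<lambda>c1 c2. tens K P2 C (m' c1) c2) (\<Delta> c)"
  proof -
    have "tlift ?T (\<lambda>c1 c2. P2.psi c1 (m' c2)) (\<Delta> c) =
        tlift ?T (\<lambda>c1 c2. tlift ?T (\<lambda>x y. P2.psi c1 (fL x \<otimes>\<^bsub>P2\<^esub> fR y)) (l1 c2)) (\<Delta> c)"
    proof (rule tlift_cong[of C C])
      show "P2.psi c1 (m' c2) = tlift ?T (\<lambda>x y. P2.psi c1 (fL x \<otimes>\<^bsub>P2\<^esub> fR y)) (l1 c2)"
        if "c1 \<in> carrier C" "c2 \<in> carrier C" for c1 c2
        unfolding m'_def by (rule tlift_push[where g = "P2.psi c1"]; (assumption | rule that mlin)+)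
    qed (assumption | rule c mlin)+
    also have "\<dots> = tlift ?T (\<lambda>c1 c2. tlift ?T (\<lambda>x y. P2.ract (P2.psi c1 (fL x)) (fR y)) (l1 c2)) (\<Delta> c)"
      using c by (intro tlift_cong2[of _ C C _ P1 P1]) (auto simp: P2.psi_mult)
    also have "\<dots> = tlift ?T (\<lambda>x y. tlift ?T (\<lambda>d z. P2.ract (P2.psi d (fL z)) (fR y)) (lcoact P1 x)) (l1 c)"
      by (rule P1.l_left[symmetric]; (assumption | rule c mlin)+)
    also have "\<dots> = tlift ?T (\<lambda>x y. tlift ?T (\<lambda>y0 d. tens K P2 C (fL x \<otimes>\<^bsub>P2\<^esub> fR y0) d) (rcoact P1 y)) (l1 c)"
    proof (rule tlift_cong[of P1 P1])
      fix x y assume x: "x \<in> carrier P1" and y: "y \<in> carrier P1"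
      have b: "bilin P2 C ?T (\<lambda>q d. tens K P2 C (fL x \<otimes>\<^bsub>P2\<^esub> q) d)" by (assumption | rule x mlin)+
      have "tlift ?T (\<lambda>d z. P2.ract (P2.psi d (fL z)) (fR y)) (lcoact P1 x) =
          P2.ract (tlift ?T (\<lambda>d z. P2.psi d (fL z)) (lcoact P1 x)) (fR y)"
        by (rule tlift_push[symmetric, where g = "\<lambda>s. P2.ract s (fR y)"]; (assumption | rule x y mlin)+)
      also have "tlift ?T (\<lambda>d z. P2.psi d (fL z)) (lcoact P1 x) = P2.Psi (lcoact P2 (fL x))"
        unfolding P2.Psi_def using x by (intro lcoact_fL[symmetric] P2.psi_bilin) auto
      also have "P2.ract \<dots> (fR y) = P2.lmul (fL x) (rcoact P2 (fR y))"
        using x y by (simp add: P2.Psi_\<sigma> P2.psi_e)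
      also have "\<dots> = tlift ?T (\<lambda>y0 d. tens K P2 C (fL x \<otimes>\<^bsub>P2\<^esub> fR y0) d) (rcoact P1 y)"
        unfolding P2.lmul_def by (rule rcoact_fR[OF _ b y]) simp
      finally show "tlift ?T (\<lambda>d z. P2.ract (P2.psi d (fL z)) (fR y)) (lcoact P1 x) =
          tlift ?T (\<lambda>y0 d. tens K P2 C (fL x \<otimes>\<^bsub>P2\<^esub> fR y0) d) (rcoact P1 y)" .
    qed (assumption | rule c mlin)+
    also have "\<dots> = tlift ?T (\<lambda>c1 c2. tlift ?T (\<lambda>x y. tens K P2 C (fL x \<otimes>\<^bsub>P2\<^esub> fR y) c2) (l1 c1)) (\<Delta> c)"
      by (rule P1.l_right; (assumption | rule c mlin)+)
    also have "\<dots> = tlift ?T (\<lambda>c1 c2. tens K P2 C (m' c1) c2) (\<Delta> c)"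
    proof (rule tlift_cong[of C C])
      show "tlift ?T (\<lambda>x y. tens K P2 C (fL x \<otimes>\<^bsub>P2\<^esub> fR y) c2) (l1 c1) = tens K P2 C (m' c1) c2"
        if "c1 \<in> carrier C" "c2 \<in> carrier C" for c1 c2
        unfolding m'_def by (rule tlift_push[symmetric, where g = "\<lambda>z. tens K P2 C z c2"]; (assumption | rule that mlin)+)
    qed (assumption | rule c mlin)+
    finally show ?thesis .
  qed
  have e1: "tlift ?T (\<lambda>c1 c2. P2.psi c1 (\<epsilon> c2 \<odot>\<^bsub>P2\<^esub> \<one>\<^bsub>P2\<^esub>)) (\<Delta> c) = tens K P2 C \<one>\<^bsub>P2\<^esub> c"
  proof -
    have "tlift ?T (\<lambda>c1 c2. P2.psi c1 (\<epsilon> c2 \<odot>\<^bsub>P2\<^esub> \<one>\<^bsub>P2\<^esub>)) (\<Delta> c) = tlift ?T (\<lambda>c1 c2. \<epsilon> c2 \<odot>\<^bsub>?T\<^esub> tens K P2 C \<one>\<^bsub>P2\<^esub> c1) (\<Delta> c)"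
      using c by (intro tlift_cong[of C C]) (auto simp: linear_smult[OF bilinD(1)[OF P2.psi_bilin]] P2.psi_one)
    also have "\<dots> = tens K P2 C \<one>\<^bsub>P2\<^esub> c"
      by (rule right_counit[OF right_comult]; (assumption | rule c mlin)+)
    finally show ?thesis .
  qed
  have e2: "tlift ?T (\<lambda>c1 c2. tens K P2 C (\<epsilon> c1 \<odot>\<^bsub>P2\<^esub> \<one>\<^bsub>P2\<^esub>) c2) (\<Delta> c) = tens K P2 C \<one>\<^bsub>P2\<^esub> c"
  proof -
    have "tlift ?T (\<lambda>c1 c2. tens K P2 C (\<epsilon> c1 \<odot>\<^bsub>P2\<^esub> \<one>\<^bsub>P2\<^esub>) c2) (\<Delta> c) = tlift ?T (\<lambda>c1 c2. \<epsilon> c1 \<odot>\<^bsub>?T\<^esub> tens K P2 C \<one>\<^bsub>P2\<^esub> c2) (\<Delta> c)"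
      using c by (intro tlift_cong[of C C]) (auto simp: smult_tens)
    also have "\<dots> = tens K P2 C \<one>\<^bsub>P2\<^esub> c"
      by (rule left_counit[OF left_comult]; (assumption | rule c mlin)+)
    finally show ?thesis .
  qed
  have "tlift ?T (\<lambda>c1 c2. P2.psi c1 (t c2)) (\<Delta> c) =
      tlift ?T (\<lambda>c1 c2. P2.psi c1 (\<epsilon> c2 \<odot>\<^bsub>P2\<^esub> \<one>\<^bsub>P2\<^esub>) \<ominus>\<^bsub>?T\<^esub> P2.psi c1 (m' c2)) (\<Delta> c)"
    using c by (intro tlift_cong[of C C]) (auto simp: t_def linear_diff[OF bilinD(1)[OF P2.psi_bilin]])
  also have "\<dots> = tens K P2 C \<one>\<^bsub>P2\<^esub> c \<ominus>\<^bsub>?T\<^esub> tlift ?T (\<lambda>c1 c2. tens K P2 C (m' c1) c2) (\<Delta> c)"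
    using c by (subst tlift_diff[of C C]) (auto simp: e1 m)
  also have "\<dots> = tlift ?T (\<lambda>c1 c2. tens K P2 C (\<epsilon> c1 \<odot>\<^bsub>P2\<^esub> \<one>\<^bsub>P2\<^esub>) c2 \<ominus>\<^bsub>?T\<^esub> tens K P2 C (m' c1) c2) (\<Delta> c)"
    using c by (subst tlift_diff[of C C]) (auto simp: e2)
  also have "\<dots> = tlift ?T (\<lambda>c1 c2. tens K P2 C (t c1) c2) (\<Delta> c)"
    using c by (intro tlift_cong[of C C]) (auto simp: t_def linear_diff[OF bilinD(2)[OF tens_bilin]])
  finally show ?thesis .
qed

abbreviation "QP \<equiv> tensor K P2 P"

text \<open>
  A bicolinear \<open>w : C \<rightarrow> P2 \<otimes> P\<close> with \<open>m (id \<otimes> p2) w = \<epsilon>\<close>: the lift of \<open>l1\<close>, corrected in the kernel of \<open>p1\<close>.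
  In the same way, \<open>l\<close> below corrects the lift \<open>lA\<close> of \<open>l1\<close> to \<open>P \<otimes> P\<close> by \<open>t w\<close>.
\<close>

definition wA :: "'c \<Rightarrow> ('q \<times> 'x \<Rightarrow> 'k) set" where
  "wA c = tlift QP (\<lambda>x y. tens K P2 P (fL x) (jR y)) (l1 c)"

definition wB :: "'c \<Rightarrow> ('q \<times> 'x \<Rightarrow> 'k) set" where
  "wB c = tlift QP (\<lambda>c1 c2. tlift QP (\<lambda>x y. tens K P2 P x (j2 (y \<otimes>\<^bsub>P2\<^esub> t c2))) (l2 c1)) (\<Delta> c)"

definition w :: "'c \<Rightarrow> ('q \<times> 'x \<Rightarrow> 'k) set" where
  "w c = wA c \<oplus>\<^bsub>QP\<^esub> wB c"

lemma wAB_linear: "wA \<in> linear_maps K C QP" "wB \<in> linear_maps K C QP"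
  unfolding wA_def[abs_def] wB_def[abs_def] by ((assumption | rule mlin)+)+

lemma w_linear: "w \<in> linear_maps K C QP"
  unfolding w_def[abs_def] by (intro linear_plus wAB_linear) simp

lemmas w_closed [simp, mlin] = wAB_linear[THEN linear_closed] linear_closed[OF w_linear]
lemmas w_linear_comp [mlin] = wAB_linear[THEN linear_comp] linear_comp[OF w_linear]

context
  fixes M :: "('k, 'y, 'z) module_scheme"
  assumes M [simp, mlin]: "module K M"
begin

lemma tlift_wA:
  assumes F: "bilin P2 P M F" and c: "c \<in> carrier C"
  shows "tlift M F (wA c) = tlift M (\<lambda>x y. F (fL x) (jR y)) (l1 c)"
proof -
  have "tlift M F (wA c) = tlift M (\<lambda>x y. tlift M F (tens K P2 P (fL x) (jR y))) (l1 c)"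
    unfolding wA_def by (rule tlift_push[OF _ _ tlift_linear[OF _ _ _ F]]; (assumption | rule c mlin)+)
  also have "\<dots> = tlift M (\<lambda>x y. F (fL x) (jR y)) (l1 c)"
    using c F bilinD(3)[OF F] by (intro tlift_cong[of P1 P1]) (auto simp: tlift_tens)
  finally show ?thesis .
qed

lemma tlift_wB:
  assumes F: "bilin P2 P M F" and c: "c \<in> carrier C"
  shows "tlift M F (wB c) = tlift M (\<lambda>c1 c2. tlift M (\<lambda>x y. F x (j2 (y \<otimes>\<^bsub>P2\<^esub> t c2))) (l2 c1)) (\<Delta> c)"
proof -
  have "tlift M F (wB c) =
      tlift M (\<lambda>c1 c2. tlift M (\<lambda>x y. tlift M F (tens K P2 P x (j2 (y \<otimes>\<^bsub>P2\<^esub> t c2)))) (l2 c1)) (\<Delta> c)"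
    unfolding wB_def by (rule tlift_push2[OF tlift_linear[OF _ _ _ F]]; (assumption | rule c mlin)+)
  also have "\<dots> = tlift M (\<lambda>c1 c2. tlift M (\<lambda>x y. F x (j2 (y \<otimes>\<^bsub>P2\<^esub> t c2))) (l2 c1)) (\<Delta> c)"
    using c F bilinD(3)[OF F] by (intro tlift_cong2[of _ C C _ P2 P2]) (auto simp: tlift_tens)
  finally show ?thesis .
qed

lemma wA_right:
  assumes \<beta>: "trilin P2 P C M \<beta>" and c: "c \<in> carrier C"
  shows "tlift M (\<lambda>x y. tlift M (\<beta> x) (rcoact P y)) (wA c) =
    tlift M (\<lambda>c1 c2. tlift M (\<lambda>x y. \<beta> x y c2) (wA c1)) (\<Delta> c)"
proof -
  note \<beta>' = trilinD[OF \<beta>]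
  note [mlin] = \<beta>'(1,5) linear_comp[OF \<beta>'(2)] linear_comp[OF \<beta>'(3)] linear_comp[OF \<beta>'(4)]
  have "tlift M (\<lambda>x y. tlift M (\<beta> x) (rcoact P y)) (wA c) = tlift M (\<lambda>x y. tlift M (\<beta> (fL x)) (rcoact P (jR y))) (l1 c)"
    by (rule tlift_wA; (assumption | rule c mlin)+)
  also have "\<dots> = tlift M (\<lambda>x y. tlift M (\<lambda>y0 d. \<beta> (fL x) (jR y0) d) (rcoact P1 y)) (l1 c)"
    by (rule tlift_cong; (assumption | rule c rcoact_jR mlin)+)
  also have "\<dots> = tlift M (\<lambda>c1 c2. tlift M (\<lambda>x y. \<beta> (fL x) (jR y) c2) (l1 c1)) (\<Delta> c)"
    by (rule P1.l_right; (assumption | rule c mlin)+)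
  also have "\<dots> = tlift M (\<lambda>c1 c2. tlift M (\<lambda>x y. \<beta> x y c2) (wA c1)) (\<Delta> c)"
    by (rule tlift_cong, (assumption | rule c mlin)+, rule tlift_wA[symmetric]; (assumption | rule c mlin)+)
  finally show ?thesis .
qed

lemma wA_left:
  assumes \<beta>: "trilin C P2 P M \<beta>" and c: "c \<in> carrier C"
  shows "tlift M (\<lambda>x y. tlift M (\<lambda>d z. \<beta> d z y) (lcoact P2 x)) (wA c) =
    tlift M (\<lambda>c1 c2. tlift M (\<beta> c1) (wA c2)) (\<Delta> c)"
proof -
  note \<beta>' = trilinD[OF \<beta>]
  note [mlin] = \<beta>'(1,5) linear_comp[OF \<beta>'(2)] linear_comp[OF \<beta>'(3)] linear_comp[OF \<beta>'(4)]
  have "tlift M (\<lambda>x y. tlift M (\<lambda>d z. \<beta> d z y) (lcoact P2 x)) (wA c) =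
      tlift M (\<lambda>x y. tlift M (\<lambda>d z. \<beta> d z (jR y)) (lcoact P2 (fL x))) (l1 c)"
    by (rule tlift_wA; (assumption | rule c mlin)+)
  also have "\<dots> = tlift M (\<lambda>x y. tlift M (\<lambda>d z. \<beta> d (fL z) (jR y)) (lcoact P1 x)) (l1 c)"
    by (rule tlift_cong, (assumption | rule c mlin)+, rule lcoact_fL; (assumption | rule c mlin)+)
  also have "\<dots> = tlift M (\<lambda>c1 c2. tlift M (\<lambda>x y. \<beta> c1 (fL x) (jR y)) (l1 c2)) (\<Delta> c)"
    by (rule P1.l_left; (assumption | rule c mlin)+)
  also have "\<dots> = tlift M (\<lambda>c1 c2. tlift M (\<beta> c1) (wA c2)) (\<Delta> c)"
    by (rule tlift_cong, (assumption | rule c mlin)+, rule tlift_wA[symmetric]; (assumption | rule c mlin)+)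
  finally show ?thesis .
qed

text \<open>The coaction of \<open>y t(c_2)\<close> is
  \<open>y_0 \<psi>(y_1 \<otimes> t(c_2))\<close>. Right colinearity of \<open>l2\<close> and
  coassociativity make the entwined factor the coproduct neighbour of the argument of
  \<open>t\<close>, so \<open>psi_t\<close> applies.\<close>

lemma wB_right:
  assumes \<beta>: "trilin P2 P C M \<beta>" and c: "c \<in> carrier C"
  shows "tlift M (\<lambda>x y. tlift M (\<beta> x) (rcoact P y)) (wB c) =
    tlift M (\<lambda>c1 c2. tlift M (\<lambda>x y. \<beta> x y c2) (wB c1)) (\<Delta> c)"
proof -
  note \<beta>' = trilinD[OF \<beta>]
  note [mlin] = \<beta>'(1,5) linear_comp[OF \<beta>'(2)] linear_comp[OF \<beta>'(3)] linear_comp[OF \<beta>'(4)]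
  let ?G = "\<lambda>x. tlift M (\<lambda>q d. \<beta> x (j2 q) d)"
  have bG [mlin]: "bilin P2 C M (\<lambda>q d. \<beta> x (j2 q) d)" if "x \<in> carrier P2" for x
    by (assumption | rule that mlin)+
  have G: "?G x \<in> linear_maps K P2.PC M" if "x \<in> carrier P2" for x
    using that by (intro tlift_linear bG) auto
  have step: "tlift M (\<beta> x) (rcoact P (j2 (y \<otimes>\<^bsub>P2\<^esub> t c2))) = tlift M (\<lambda>y0 d. ?G x (P2.lmul y0 (P2.psi d (t c2)))) (rcoact P2 y)"
    if x: "x \<in> carrier P2" and y: "y \<in> carrier P2" and c2: "c2 \<in> carrier C" for x y c2
  proof -
    have "tlift M (\<beta> x) (rcoact P (j2 (y \<otimes>\<^bsub>P2\<^esub> t c2))) = ?G x (rcoact P2 (y \<otimes>\<^bsub>P2\<^esub> t c2))"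
      by (rule rcoact_j2; (assumption | rule x y c2 mlin)+)
    also have "\<dots> = tlift M (\<lambda>y0 d. ?G x (P2.lmul y0 (P2.psi d (t c2)))) (rcoact P2 y)"
      unfolding P2.\<rho>_mult[OF y t_closed[OF c2]] P2.ract_def
      by (rule tlift_push[OF _ _ G[OF x]]; (assumption | rule x y c2 mlin)+)
    finally show ?thesis .
  qed
  have inner: "tlift M (\<lambda>c2 c3. tlift M (\<lambda>x y. ?G x (P2.lmul y (P2.psi c2 (t c3)))) (l2 c1)) (\<Delta> c') =
      tlift M (\<lambda>c2 c3. tlift M (\<lambda>x y. \<beta> x (j2 (y \<otimes>\<^bsub>P2\<^esub> t c2)) c3) (l2 c1)) (\<Delta> c')"
    if c1: "c1 \<in> carrier C" and c': "c' \<in> carrier C" for c1 c'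
  proof -
    \<comment> \<open>The surrounding lift as one linear map on \<open>P2 \<otimes> C\<close>;
      \<open>psi_t\<close>, an equation there, can be applied inside it.\<close>
    let ?N = "\<lambda>s. tlift M (\<lambda>x y. ?G x (P2.lmul y s)) (l2 c1)"
    have N: "?N \<in> linear_maps K P2.PC M" by (assumption | rule c1 mlin)+
    have "tlift M (\<lambda>c2 c3. ?N (P2.psi c2 (t c3))) (\<Delta> c') = ?N (tlift P2.PC (\<lambda>c2 c3. P2.psi c2 (t c3)) (\<Delta> c'))"
      by (rule tlift_push[OF _ _ N, symmetric]; (assumption | rule c' mlin)+)
    also have "\<dots> = ?N (tlift P2.PC (\<lambda>c2 c3. tens K P2 C (t c2) c3) (\<Delta> c'))" by (simp only: psi_t[OF c'])
    also have "\<dots> = tlift M (\<lambda>c2 c3. ?N (tens K P2 C (t c2) c3)) (\<Delta> c')"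
      by (rule tlift_push[OF _ _ N]; (assumption | rule c' mlin)+)
    also have "\<dots> = tlift M (\<lambda>c2 c3. tlift M (\<lambda>x y. \<beta> x (j2 (y \<otimes>\<^bsub>P2\<^esub> t c2)) c3) (l2 c1)) (\<Delta> c')"
      by (rule tlift_cong2; (assumption | rule c1 c' mlin | simp add: tlift_tens[OF _ _ _ bG])+)
    finally show ?thesis .
  qed
  have "tlift M (\<lambda>x y. tlift M (\<beta> x) (rcoact P y)) (wB c) =
      tlift M (\<lambda>c1 c2. tlift M (\<lambda>x y. tlift M (\<beta> x) (rcoact P (j2 (y \<otimes>\<^bsub>P2\<^esub> t c2)))) (l2 c1)) (\<Delta> c)"
    by (rule tlift_wB; (assumption | rule c mlin)+)
  also have "\<dots> = tlift M (\<lambda>c1 c2. tlift M (\<lambda>x y.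
      tlift M (\<lambda>y0 d. ?G x (P2.lmul y0 (P2.psi d (t c2)))) (rcoact P2 y)) (l2 c1)) (\<Delta> c)"
    by (rule tlift_cong2; (assumption | rule c step mlin)+)
  also have "\<dots> = tlift M (\<lambda>c' c3. tlift M (\<lambda>c1 c2. tlift M (\<lambda>x y.
      ?G x (P2.lmul y (P2.psi c2 (t c3)))) (l2 c1)) (\<Delta> c')) (\<Delta> c)"
    by (rule tlift_cong, (assumption | rule c mlin)+, rule P2.l_right; (assumption | rule c mlin)+)
  also have "\<dots> = tlift M (\<lambda>c1 c'. tlift M (\<lambda>c2 c3. tlift M (\<lambda>x y.
      ?G x (P2.lmul y (P2.psi c2 (t c3)))) (l2 c1)) (\<Delta> c')) (\<Delta> c)"
    by (rule right_coassoc[OF right_comult]; (assumption | rule c mlin)+)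
  also have "\<dots> = tlift M (\<lambda>c1 c'. tlift M (\<lambda>c2 c3. tlift M (\<lambda>x y.
      \<beta> x (j2 (y \<otimes>\<^bsub>P2\<^esub> t c2)) c3) (l2 c1)) (\<Delta> c')) (\<Delta> c)"
    by (rule tlift_cong; (assumption | rule c inner mlin)+)
  also have "\<dots> = tlift M (\<lambda>c' c3. tlift M (\<lambda>c1 c2. tlift M (\<lambda>x y.
      \<beta> x (j2 (y \<otimes>\<^bsub>P2\<^esub> t c2)) c3) (l2 c1)) (\<Delta> c')) (\<Delta> c)"
    by (rule right_coassoc[OF right_comult, symmetric]; (assumption | rule c mlin)+)
  also have "\<dots> = tlift M (\<lambda>c1 c2. tlift M (\<lambda>x y. \<beta> x y c2) (wB c1)) (\<Delta> c)"
    by (rule tlift_cong, (assumption | rule c mlin)+, rule tlift_wB[symmetric]; (assumption | rule c mlin)+)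
  finally show ?thesis .
qed

lemma wB_left:
  assumes \<beta>: "trilin C P2 P M \<beta>" and c: "c \<in> carrier C"
  shows "tlift M (\<lambda>x y. tlift M (\<lambda>d z. \<beta> d z y) (lcoact P2 x)) (wB c) =
    tlift M (\<lambda>c1 c2. tlift M (\<beta> c1) (wB c2)) (\<Delta> c)"
proof -
  note \<beta>' = trilinD[OF \<beta>]
  note [mlin] = \<beta>'(1,5) linear_comp[OF \<beta>'(2)] linear_comp[OF \<beta>'(3)] linear_comp[OF \<beta>'(4)]
  have "tlift M (\<lambda>x y. tlift M (\<lambda>d z. \<beta> d z y) (lcoact P2 x)) (wB c) =
      tlift M (\<lambda>c' c3. tlift M (\<lambda>x y. tlift M (\<lambda>d z. \<beta> d z (j2 (y \<otimes>\<^bsub>P2\<^esub> t c3))) (lcoact P2 x)) (l2 c')) (\<Delta> c)"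
    by (rule tlift_wB; (assumption | rule c mlin)+)
  also have "\<dots> = tlift M (\<lambda>c' c3. tlift M (\<lambda>c1 c2. tlift M (\<lambda>x y. \<beta> c1 x (j2 (y \<otimes>\<^bsub>P2\<^esub> t c3))) (l2 c2)) (\<Delta> c')) (\<Delta> c)"
    by (rule tlift_cong, (assumption | rule c mlin)+, rule P2.l_left; (assumption | rule c mlin)+)
  also have "\<dots> = tlift M (\<lambda>c1 c'. tlift M (\<lambda>c2 c3. tlift M (\<lambda>x y. \<beta> c1 x (j2 (y \<otimes>\<^bsub>P2\<^esub> t c3))) (l2 c2)) (\<Delta> c')) (\<Delta> c)"
    by (rule right_coassoc[OF right_comult]; (assumption | rule c mlin)+)
  also have "\<dots> = tlift M (\<lambda>c1 c2. tlift M (\<beta> c1) (wB c2)) (\<Delta> c)"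
    by (rule tlift_cong, (assumption | rule c mlin)+, rule tlift_wB[symmetric]; (assumption | rule c mlin)+)
  finally show ?thesis .
qed

lemma w_right:
  assumes \<beta>: "trilin P2 P C M \<beta>" and c: "c \<in> carrier C"
  shows "tlift M (\<lambda>x y. tlift M (\<beta> x) (rcoact P y)) (w c) =
    tlift M (\<lambda>c1 c2. tlift M (\<lambda>x y. \<beta> x y c2) (w c1)) (\<Delta> c)"
proof -
  note \<beta>' = trilinD[OF \<beta>]
  note [mlin] = \<beta>'(1,5) linear_comp[OF \<beta>'(2)] linear_comp[OF \<beta>'(3)] linear_comp[OF \<beta>'(4)]
  have F: "bilin P2 P M (\<lambda>x y. tlift M (\<beta> x) (rcoact P y))" by (assumption | rule mlin)+
  have "tlift M (\<lambda>c1 c2. tlift M (\<lambda>x y. \<beta> x y c2) (w c1)) (\<Delta> c) =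
    tlift M (\<lambda>c1 c2. tlift M (\<lambda>x y. \<beta> x y c2) (wA c1)) (\<Delta> c) \<oplus>\<^bsub>M\<^esub>
    tlift M (\<lambda>c1 c2. tlift M (\<lambda>x y. \<beta> x y c2) (wB c1)) (\<Delta> c)"
    unfolding w_def by (rule tlift_comult_add; (assumption | rule c mlin)+)
  then show ?thesis
    using c by (simp add: w_def tlift_plus[OF _ _ _ F] wA_right[OF \<beta>] wB_right[OF \<beta>])
qed

lemma w_left:
  assumes \<beta>: "trilin C P2 P M \<beta>" and c: "c \<in> carrier C"
  shows "tlift M (\<lambda>x y. tlift M (\<lambda>d z. \<beta> d z y) (lcoact P2 x)) (w c) =
    tlift M (\<lambda>c1 c2. tlift M (\<beta> c1) (w c2)) (\<Delta> c)"
proof -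
  note \<beta>' = trilinD[OF \<beta>]
  note [mlin] = \<beta>'(1,5) linear_comp[OF \<beta>'(2)] linear_comp[OF \<beta>'(3)] linear_comp[OF \<beta>'(4)]
  have F: "bilin P2 P M (\<lambda>x y. tlift M (\<lambda>d z. \<beta> d z y) (lcoact P2 x))" by (assumption | rule mlin)+
  have "tlift M (\<lambda>c1 c2. tlift M (\<beta> c1) (w c2)) (\<Delta> c) =
    tlift M (\<lambda>c1 c2. tlift M (\<beta> c1) (wA c2)) (\<Delta> c) \<oplus>\<^bsub>M\<^esub> tlift M (\<lambda>c1 c2. tlift M (\<beta> c1) (wB c2)) (\<Delta> c)"
    unfolding w_def by (rule tlift_comult_add; (assumption | rule c mlin)+)
  then show ?thesis
    using c by (simp add: w_def tlift_plus[OF _ _ _ F] wA_left[OF \<beta>] wB_left[OF \<beta>])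
qed

text \<open>The analogue for \<open>w\<close> of \<open>l_left_psi\<close>: left colinearity
  expressed by the entwining of \<open>P2\<close>. It is needed where a factor stands to the left of
  \<open>w\<close>, as in \<open>lB_left\<close>.\<close>

lemma w_left_psi:
  assumes \<beta>: "trilin P2 C P M \<beta>" and c: "c \<in> carrier C"
  shows "tlift M (\<lambda>c1 c2. tlift M (\<lambda>x y. tlift M (\<lambda>z d. \<beta> z d y) (P2.psi c1 x)) (w c2)) (\<Delta> c) =
    tlift M (\<lambda>x y. \<beta> x e y) (w c)"
proof -
  note \<beta>' = trilinD[OF \<beta>]
  note [mlin] = \<beta>'(5) linear_comp[OF \<beta>'(2)] linear_comp[OF \<beta>'(3)] linear_comp[OF \<beta>'(4)]
  have b [mlin]: "bilin P2 C M (\<lambda>z d. \<beta> z d y)" if "y \<in> carrier P" for y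
    using \<beta>' that by (intro bilinI) auto
  have "tlift M (\<lambda>c1 c2. tlift M (\<lambda>x y. tlift M (\<lambda>z d. \<beta> z d y) (P2.psi c1 x)) (w c2)) (\<Delta> c) =
      tlift M (\<lambda>x y. tlift M (\<lambda>d z. tlift M (\<lambda>z d. \<beta> z d y) (P2.psi d z)) (lcoact P2 x)) (w c)"
    by (rule w_left[symmetric]; (assumption | rule c mlin)+)
  also have "\<dots> = tlift M (\<lambda>x y. \<beta> x e y) (w c)"
  proof (rule tlift_cong[OF _ _ w_closed(3)[OF c]])
    fix x y assume x: "x \<in> carrier P2" and y: "y \<in> carrier P"
    have "tlift M (\<lambda>d z. tlift M (\<lambda>z d. \<beta> z d y) (P2.psi d z)) (lcoact P2 x) = tlift M (\<lambda>z d. \<beta> z d y) (P2.Psi (lcoact P2 x))"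
      unfolding P2.Psi_def by (rule tlift_push[symmetric, OF _ _ tlift_linear]; (assumption | rule x y mlin)+)
    also have "\<dots> = \<beta> x e y" using x y b[OF y] by (simp add: P2.Psi_\<sigma> tlift_tens)
    finally show "tlift M (\<lambda>d z. tlift M (\<lambda>z d. \<beta> z d y) (P2.psi d z)) (lcoact P2 x) = \<beta> x e y" .
  qed (use \<beta>'(5) in auto)
  finally show ?thesis .
qed

end

text \<open>Since \<open>y t(c)\<close> lies in the kernel of \<open>f2\<close>, \<open>j2\<close>
  keeps it as second component. The two parts of \<open>w\<close> contribute \<open>m'\<close> and
  \<open>\<epsilon> * t = t\<close>, with sum \<open>\<epsilon>\<close>.\<close>

lemma w_mult:
  assumes c: "c \<in> carrier C"
  shows "tlift P2 (\<lambda>x y. x \<otimes>\<^bsub>P2\<^esub> p2 y) (w c) = \<epsilon> c \<odot>\<^bsub>P2\<^esub> \<one>\<^bsub>P2\<^esub>"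
proof -
  have F: "bilin P2 P P2 (\<lambda>x y. x \<otimes>\<^bsub>P2\<^esub> p2 y)" by (assumption | rule mlin)+
  have "tlift P2 (\<lambda>x y. x \<otimes>\<^bsub>P2\<^esub> p2 y) (wA c) = tlift P2 (\<lambda>x y. fL x \<otimes>\<^bsub>P2\<^esub> p2 (jR y)) (l1 c)"
    by (rule tlift_wA[OF _ F c]) simp
  also have "\<dots> = m' c" unfolding m'_def using c by (intro tlift_cong[of P1 P1]) auto
  finally have A: "tlift P2 (\<lambda>x y. x \<otimes>\<^bsub>P2\<^esub> p2 y) (wA c) = m' c" .
  have "tlift P2 (\<lambda>x y. x \<otimes>\<^bsub>P2\<^esub> p2 y) (wB c) =
      tlift P2 (\<lambda>c1 c2. tlift P2 (\<lambda>x y. x \<otimes>\<^bsub>P2\<^esub> p2 (j2 (y \<otimes>\<^bsub>P2\<^esub> t c2))) (l2 c1)) (\<Delta> c)"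
    by (rule tlift_wB[OF _ F c]) simp
  also have "\<dots> = tlift P2 (\<lambda>c1 c2. tlift P2 (\<lambda>x y. (x \<otimes>\<^bsub>P2\<^esub> y) \<otimes>\<^bsub>P2\<^esub> t c2) (l2 c1)) (\<Delta> c)"
    using c by (intro tlift_cong2[of _ C C _ P2 P2]) (auto simp: k2_kernel f2_mult_t P2.mult_assoc)
  also have "\<dots> = tlift P2 (\<lambda>c1 c2. \<epsilon> c1 \<odot>\<^bsub>P2\<^esub> t c2) (\<Delta> c)"
  proof (rule tlift_cong[of C C])
    fix c1 c2 assume c12: "c1 \<in> carrier C" "c2 \<in> carrier C"
    have "tlift P2 (\<lambda>x y. (x \<otimes>\<^bsub>P2\<^esub> y) \<otimes>\<^bsub>P2\<^esub> t c2) (l2 c1) = \<epsilon> c1 \<odot>\<^bsub>P2\<^esub> (\<one>\<^bsub>P2\<^esub> \<otimes>\<^bsub>P2\<^esub> t c2)"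
      by (rule P2.l_mult_lift[where g = "\<lambda>z. z \<otimes>\<^bsub>P2\<^esub> t c2"]; (assumption | rule c12 mlin)+)
    then show "tlift P2 (\<lambda>x y. (x \<otimes>\<^bsub>P2\<^esub> y) \<otimes>\<^bsub>P2\<^esub> t c2) (l2 c1) = \<epsilon> c1 \<odot>\<^bsub>P2\<^esub> t c2" using c12 by simp
  qed (use c in auto)
  also have "\<dots> = t c" by (rule left_counit[OF left_comult _ _ t_linear c]) simp_all
  finally have B: "tlift P2 (\<lambda>x y. x \<otimes>\<^bsub>P2\<^esub> p2 y) (wB c) = t c" .
  show ?thesis
    using c A B by (simp add: w_def tlift_plus[OF _ _ _ F] t_def diff_add_cancel)
qed

abbreviation "PP \<equiv> tensor K P P"

definition lA :: "'c \<Rightarrow> ('x \<times> 'x \<Rightarrow> 'k) set" where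
  "lA c = tlift PP (\<lambda>x y. tens K P P (jL x) (jR y)) (l1 c)"

definition lB :: "'c \<Rightarrow> ('x \<times> 'x \<Rightarrow> 'k) set" where
  "lB c = tlift PP (\<lambda>c1 c2. tlift PP (\<lambda>x y. tens K P P (j2 (t c1 \<otimes>\<^bsub>P2\<^esub> x)) y) (w c2)) (\<Delta> c)"

definition l :: "'c \<Rightarrow> ('x \<times> 'x \<Rightarrow> 'k) set" where
  "l c = lA c \<oplus>\<^bsub>PP\<^esub> lB c"

lemma lAB_linear: "lA \<in> linear_maps K C PP" "lB \<in> linear_maps K C PP"
  unfolding lA_def[abs_def] lB_def[abs_def] by ((assumption | rule mlin)+)+

lemma l_linear: "l \<in> linear_maps K C PP"
  unfolding l_def[abs_def] by (intro linear_plus lAB_linear) simp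

lemmas l_closed [simp, mlin] = lAB_linear[THEN linear_closed] linear_closed[OF l_linear]

context
  fixes M :: "('k, 'y, 'z) module_scheme"
  assumes M [simp, mlin]: "module K M"
begin

lemma tlift_lA:
  assumes F: "bilin P P M F" and c: "c \<in> carrier C"
  shows "tlift M F (lA c) = tlift M (\<lambda>x y. F (jL x) (jR y)) (l1 c)"
proof -
  have "tlift M F (lA c) = tlift M (\<lambda>x y. tlift M F (tens K P P (jL x) (jR y))) (l1 c)"
    unfolding lA_def by (rule tlift_push[OF _ _ tlift_linear[OF _ _ _ F]]; (assumption | rule c mlin)+)
  also have "\<dots> = tlift M (\<lambda>x y. F (jL x) (jR y)) (l1 c)"
    using c F bilinD(3)[OF F] by (intro tlift_cong[of P1 P1]) (auto simp: tlift_tens)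
  finally show ?thesis .
qed

lemma tlift_lB:
  assumes F: "bilin P P M F" and c: "c \<in> carrier C"
  shows "tlift M F (lB c) = tlift M (\<lambda>c1 c2. tlift M (\<lambda>x y. F (j2 (t c1 \<otimes>\<^bsub>P2\<^esub> x)) y) (w c2)) (\<Delta> c)"
proof -
  have "tlift M F (lB c) =
      tlift M (\<lambda>c1 c2. tlift M (\<lambda>x y. tlift M F (tens K P P (j2 (t c1 \<otimes>\<^bsub>P2\<^esub> x)) y)) (w c2)) (\<Delta> c)"
    unfolding lB_def by (rule tlift_push2[OF tlift_linear[OF _ _ _ F]]; (assumption | rule c mlin)+)
  also have "\<dots> = tlift M (\<lambda>c1 c2. tlift M (\<lambda>x y. F (j2 (t c1 \<otimes>\<^bsub>P2\<^esub> x)) y) (w c2)) (\<Delta> c)"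
    using c F bilinD(3)[OF F] by (intro tlift_cong2[of _ C C _ P2 P]) (auto simp: tlift_tens)
  finally show ?thesis .
qed

lemma lA_right:
  assumes \<beta>: "trilin P P C M \<beta>" and c: "c \<in> carrier C"
  shows "tlift M (\<lambda>x y. tlift M (\<beta> x) (rcoact P y)) (lA c) =
    tlift M (\<lambda>c1 c2. tlift M (\<lambda>x y. \<beta> x y c2) (lA c1)) (\<Delta> c)"
proof -
  note \<beta>' = trilinD[OF \<beta>]
  note [mlin] = \<beta>'(1,5) linear_comp[OF \<beta>'(2)] linear_comp[OF \<beta>'(3)] linear_comp[OF \<beta>'(4)]
  have "tlift M (\<lambda>x y. tlift M (\<beta> x) (rcoact P y)) (lA c) = tlift M (\<lambda>x y. tlift M (\<beta> (jL x)) (rcoact P (jR y))) (l1 c)"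
    by (rule tlift_lA; (assumption | rule c mlin)+)
  also have "\<dots> = tlift M (\<lambda>x y. tlift M (\<lambda>y0 d. \<beta> (jL x) (jR y0) d) (rcoact P1 y)) (l1 c)"
    by (rule tlift_cong; (assumption | rule c rcoact_jR mlin)+)
  also have "\<dots> = tlift M (\<lambda>c1 c2. tlift M (\<lambda>x y. \<beta> (jL x) (jR y) c2) (l1 c1)) (\<Delta> c)"
    by (rule P1.l_right; (assumption | rule c mlin)+)
  also have "\<dots> = tlift M (\<lambda>c1 c2. tlift M (\<lambda>x y. \<beta> x y c2) (lA c1)) (\<Delta> c)"
    by (rule tlift_cong, (assumption | rule c mlin)+, rule tlift_lA[symmetric]; (assumption | rule c mlin)+)
  finally show ?thesis .
qed

lemma lA_left:
  assumes \<beta>: "trilin C P P M \<beta>" and c: "c \<in> carrier C"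
  shows "tlift M (\<lambda>x y. tlift M (\<lambda>d z. \<beta> d z y) (lcoact P x)) (lA c) =
    tlift M (\<lambda>c1 c2. tlift M (\<beta> c1) (lA c2)) (\<Delta> c)"
proof -
  note \<beta>' = trilinD[OF \<beta>]
  note [mlin] = \<beta>'(1,5) linear_comp[OF \<beta>'(2)] linear_comp[OF \<beta>'(3)] linear_comp[OF \<beta>'(4)]
  have "tlift M (\<lambda>x y. tlift M (\<lambda>d z. \<beta> d z y) (lcoact P x)) (lA c) =
      tlift M (\<lambda>x y. tlift M (\<lambda>d z. \<beta> d z (jR y)) (lcoact P (jL x))) (l1 c)"
    by (rule tlift_lA; (assumption | rule c mlin)+)
  also have "\<dots> = tlift M (\<lambda>x y. tlift M (\<lambda>d z. \<beta> d (jL z) (jR y)) (lcoact P1 x)) (l1 c)"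
    by (rule tlift_cong, (assumption | rule c mlin)+, rule lcoact_jL; (assumption | rule c mlin)+)
  also have "\<dots> = tlift M (\<lambda>c1 c2. tlift M (\<lambda>x y. \<beta> c1 (jL x) (jR y)) (l1 c2)) (\<Delta> c)"
    by (rule P1.l_left; (assumption | rule c mlin)+)
  also have "\<dots> = tlift M (\<lambda>c1 c2. tlift M (\<beta> c1) (lA c2)) (\<Delta> c)"
    by (rule tlift_cong, (assumption | rule c mlin)+, rule tlift_lA[symmetric]; (assumption | rule c mlin)+)
  finally show ?thesis .
qed

lemma lB_right:
  assumes \<beta>: "trilin P P C M \<beta>" and c: "c \<in> carrier C"
  shows "tlift M (\<lambda>x y. tlift M (\<beta> x) (rcoact P y)) (lB c) =
    tlift M (\<lambda>c1 c2. tlift M (\<lambda>x y. \<beta> x y c2) (lB c1)) (\<Delta> c)"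
proof -
  note \<beta>' = trilinD[OF \<beta>]
  note [mlin] = \<beta>'(1,5) linear_comp[OF \<beta>'(2)] linear_comp[OF \<beta>'(3)] linear_comp[OF \<beta>'(4)]
  have "tlift M (\<lambda>x y. tlift M (\<beta> x) (rcoact P y)) (lB c) =
      tlift M (\<lambda>c1 c'. tlift M (\<lambda>x y. tlift M (\<beta> (j2 (t c1 \<otimes>\<^bsub>P2\<^esub> x))) (rcoact P y)) (w c')) (\<Delta> c)"
    by (rule tlift_lB; (assumption | rule c mlin)+)
  also have "\<dots> = tlift M (\<lambda>c1 c'. tlift M (\<lambda>c2 c3. tlift M (\<lambda>x y. \<beta> (j2 (t c1 \<otimes>\<^bsub>P2\<^esub> x)) y c3) (w c2)) (\<Delta> c')) (\<Delta> c)"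
    by (rule tlift_cong, (assumption | rule c mlin)+, rule w_right; (assumption | rule c mlin)+)
  also have "\<dots> = tlift M (\<lambda>c' c3. tlift M (\<lambda>c1 c2. tlift M (\<lambda>x y. \<beta> (j2 (t c1 \<otimes>\<^bsub>P2\<^esub> x)) y c3) (w c2)) (\<Delta> c')) (\<Delta> c)"
    by (rule right_coassoc[OF right_comult, symmetric]; (assumption | rule c mlin)+)
  also have "\<dots> = tlift M (\<lambda>c1 c2. tlift M (\<lambda>x y. \<beta> x y c2) (lB c1)) (\<Delta> c)"
    by (rule tlift_cong, (assumption | rule c mlin)+, rule tlift_lB[symmetric]; (assumption | rule c mlin)+)
  finally show ?thesis .
qed

text \<open>For want of a product formula for the left coaction, \<open>\<sigma> (t(c_1) x)\<close>
  is rewritten as the inverse entwining of \<open>t(c_1) (x \<otimes> e)\<close>. Then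
  \<open>w_left_psi\<close> replaces \<open>x \<otimes> e\<close> by
  \<open>\<psi>(c_2 \<otimes> x)\<close>, \<open>psi_t\<close> turns
  \<open>t(c_1) \<otimes> c_2\<close> into \<open>\<psi>(c_1 \<otimes> t(c_2))\<close>, and
  \<open>psi_mult\<close> recombines this into
  \<open>\<psi>(c_1 \<otimes> t(c_2) x)\<close>.\<close>

lemma lB_left:
  assumes \<beta>: "trilin C P P M \<beta>" and c: "c \<in> carrier C"
  shows "tlift M (\<lambda>x y. tlift M (\<lambda>d z. \<beta> d z y) (lcoact P x)) (lB c) =
    tlift M (\<lambda>c1 c2. tlift M (\<beta> c1) (lB c2)) (\<Delta> c)"
proof -
  note \<beta>' = trilinD[OF \<beta>]
  note [mlin] = \<beta>'(1,5) linear_comp[OF \<beta>'(2)] linear_comp[OF \<beta>'(3)] linear_comp[OF \<beta>'(4)]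
  let ?G = "\<lambda>y. tlift M (\<lambda>d z. \<beta> d (j2 z) y)"
  have bG [mlin]: "bilin C P2 M (\<lambda>d z. \<beta> d (j2 z) y)" if "y \<in> carrier P" for y
    by (assumption | rule that mlin)+
  let ?\<Gamma> = "\<lambda>y s. ?G y (P2.Psi_inv s)"
  have step: "tlift M (\<lambda>d z. \<beta> d z y) (lcoact P (j2 (t c1 \<otimes>\<^bsub>P2\<^esub> x))) = ?\<Gamma> y (P2.lmul (t c1) (tens K P2 C x e))"
    if c1: "c1 \<in> carrier C" and x: "x \<in> carrier P2" and y: "y \<in> carrier P" for c1 x y
  proof -
    have "tlift M (\<lambda>d z. \<beta> d z y) (lcoact P (j2 (t c1 \<otimes>\<^bsub>P2\<^esub> x))) = ?G y (lcoact P2 (t c1 \<otimes>\<^bsub>P2\<^esub> x))"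
      by (rule lcoact_j2; (assumption | rule c1 x y f2_t_mult mlin)+)
    also have "lcoact P2 (t c1 \<otimes>\<^bsub>P2\<^esub> x) = P2.Psi_inv (P2.Psi (lcoact P2 (t c1 \<otimes>\<^bsub>P2\<^esub> x)))"
      using c1 x by simp
    also have "P2.Psi (lcoact P2 (t c1 \<otimes>\<^bsub>P2\<^esub> x)) = P2.lmul (t c1) (tens K P2 C x e)"
      using c1 x by (simp add: P2.Psi_\<sigma>)
    finally show ?thesis .
  qed
  have inner: "tlift M (\<lambda>c1 c2. tlift M (\<lambda>x y. ?\<Gamma> y (P2.lmul (t c1) (P2.psi c2 x))) (w c3)) (\<Delta> c') =
      tlift M (\<lambda>c1 c2. tlift M (\<lambda>x y. \<beta> c1 (j2 (t c2 \<otimes>\<^bsub>P2\<^esub> x)) y) (w c3)) (\<Delta> c')"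
    if c3: "c3 \<in> carrier C" and c': "c' \<in> carrier C" for c3 c'
  proof -
    \<comment> \<open>\<open>t(c_1) \<psi>(c_2 \<otimes> x)\<close> is the right action of
      \<open>x\<close> on \<open>t(c_1) \<otimes> c_2\<close>; this exposes the tensor to which
      \<open>psi_t\<close> refers.\<close>
    let ?N = "\<lambda>s. tlift M (\<lambda>x y. ?\<Gamma> y (P2.ract s x)) (w c3)"
    have N: "?N \<in> linear_maps K P2.PC M" by (assumption | rule c3 mlin)+
    have eval: "?\<Gamma> y (P2.ract (P2.psi c1 (t c2)) x) = \<beta> c1 (j2 (t c2 \<otimes>\<^bsub>P2\<^esub> x)) y"
      if "c1 \<in> carrier C" "c2 \<in> carrier C" "x \<in> carrier P2" "y \<in> carrier P" for c1 c2 x y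
    proof -
      have "P2.ract (P2.psi c1 (t c2)) x = P2.Psi (tens K C P2 c1 (t c2 \<otimes>\<^bsub>P2\<^esub> x))"
        using that by (simp add: P2.Psi_tens P2.psi_mult)
      then show ?thesis using that by (simp add: tlift_tens[OF _ _ _ bG])
    qed
    have "tlift M (\<lambda>c1 c2. tlift M (\<lambda>x y. ?\<Gamma> y (P2.lmul (t c1) (P2.psi c2 x))) (w c3)) (\<Delta> c') =
        tlift M (\<lambda>c1 c2. ?N (tens K P2 C (t c1) c2)) (\<Delta> c')"
      by (rule tlift_cong2; (assumption | rule c3 c' mlin | simp)+)
    also have "\<dots> = ?N (tlift P2.PC (\<lambda>c1 c2. tens K P2 C (t c1) c2) (\<Delta> c'))"
      by (rule tlift_push[OF _ _ N, symmetric]; (assumption | rule c' mlin)+)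
    also have "\<dots> = ?N (tlift P2.PC (\<lambda>c1 c2. P2.psi c1 (t c2)) (\<Delta> c'))" by (simp only: psi_t[OF c'])
    also have "\<dots> = tlift M (\<lambda>c1 c2. ?N (P2.psi c1 (t c2))) (\<Delta> c')"
      by (rule tlift_push[OF _ _ N]; (assumption | rule c' mlin)+)
    also have "\<dots> = tlift M (\<lambda>c1 c2. tlift M (\<lambda>x y. \<beta> c1 (j2 (t c2 \<otimes>\<^bsub>P2\<^esub> x)) y) (w c3)) (\<Delta> c')"
      by (rule tlift_cong2; (assumption | rule c3 c' eval mlin)+)
    finally show ?thesis .
  qed
  have psiw: "tlift M (\<lambda>x y. ?\<Gamma> y (P2.lmul (t c1) (tens K P2 C x e))) (w c') =
      tlift M (\<lambda>c2 c3. tlift M (\<lambda>x y. ?\<Gamma> y (P2.lmul (t c1) (P2.psi c2 x))) (w c3)) (\<Delta> c')"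
    if c1: "c1 \<in> carrier C" and c': "c' \<in> carrier C" for c1 c'
  proof -
    have eval: "tlift M (\<lambda>z d. ?\<Gamma> y (P2.lmul (t c1) (tens K P2 C z d))) (P2.psi c2 x) = ?\<Gamma> y (P2.lmul (t c1) (P2.psi c2 x))"
      if c2: "c2 \<in> carrier C" and x: "x \<in> carrier P2" and y: "y \<in> carrier P" for c2 x y
    proof -
      have "tlift M (\<lambda>z d. ?\<Gamma> y (P2.lmul (t c1) (tens K P2 C z d))) (P2.psi c2 x) =
          ?\<Gamma> y (P2.lmul (t c1) (tlift P2.PC (tens K P2 C) (P2.psi c2 x)))"
        by (rule tlift_push[symmetric, where g = "\<lambda>s. ?\<Gamma> y (P2.lmul (t c1) s)"]; (assumption | rule c1 c2 x y mlin)+)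
      then show ?thesis using c2 x by (simp add: tlift_id)
    qed
    have "tlift M (\<lambda>x y. ?\<Gamma> y (P2.lmul (t c1) (tens K P2 C x e))) (w c') =
        tlift M (\<lambda>c2 c3. tlift M (\<lambda>x y. tlift M (\<lambda>z d. ?\<Gamma> y (P2.lmul (t c1) (tens K P2 C z d))) (P2.psi c2 x)) (w c3)) (\<Delta> c')"
      by (rule w_left_psi[symmetric]; (assumption | rule c1 c' mlin)+)
    also have "\<dots> = tlift M (\<lambda>c2 c3. tlift M (\<lambda>x y. ?\<Gamma> y (P2.lmul (t c1) (P2.psi c2 x))) (w c3)) (\<Delta> c')"
      by (rule tlift_cong2; (assumption | rule c1 c' eval mlin)+)
    finally show ?thesis .
  qed
  have "tlift M (\<lambda>x y. tlift M (\<lambda>d z. \<beta> d z y) (lcoact P x)) (lB c) =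
      tlift M (\<lambda>c1 c'. tlift M (\<lambda>x y. tlift M (\<lambda>d z. \<beta> d z y) (lcoact P (j2 (t c1 \<otimes>\<^bsub>P2\<^esub> x)))) (w c')) (\<Delta> c)"
    by (rule tlift_lB; (assumption | rule c mlin)+)
  also have "\<dots> = tlift M (\<lambda>c1 c'. tlift M (\<lambda>x y. ?\<Gamma> y (P2.lmul (t c1) (tens K P2 C x e))) (w c')) (\<Delta> c)"
    by (rule tlift_cong2; (assumption | rule c step mlin)+)
  also have "\<dots> = tlift M (\<lambda>c1 c'. tlift M (\<lambda>c2 c3. tlift M (\<lambda>x y. ?\<Gamma> y (P2.lmul (t c1) (P2.psi c2 x))) (w c3)) (\<Delta> c')) (\<Delta> c)"
    by (rule tlift_cong; (assumption | rule c psiw mlin)+)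
  also have "\<dots> = tlift M (\<lambda>c' c3. tlift M (\<lambda>c1 c2. tlift M (\<lambda>x y. ?\<Gamma> y (P2.lmul (t c1) (P2.psi c2 x))) (w c3)) (\<Delta> c')) (\<Delta> c)"
    by (rule right_coassoc[OF right_comult, symmetric]; (assumption | rule c mlin)+)
  also have "\<dots> = tlift M (\<lambda>c' c3. tlift M (\<lambda>c1 c2. tlift M (\<lambda>x y. \<beta> c1 (j2 (t c2 \<otimes>\<^bsub>P2\<^esub> x)) y) (w c3)) (\<Delta> c')) (\<Delta> c)"
    by (rule tlift_cong; (assumption | rule c inner mlin)+)
  also have "\<dots> = tlift M (\<lambda>c1 c'. tlift M (\<lambda>c2 c3. tlift M (\<lambda>x y. \<beta> c1 (j2 (t c2 \<otimes>\<^bsub>P2\<^esub> x)) y) (w c3)) (\<Delta> c')) (\<Delta> c)"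
    by (rule right_coassoc[OF right_comult]; (assumption | rule c mlin)+)
  also have "\<dots> = tlift M (\<lambda>c1 c2. tlift M (\<beta> c1) (lB c2)) (\<Delta> c)"
    by (rule tlift_cong, (assumption | rule c mlin)+, rule tlift_lB[symmetric]; (assumption | rule c mlin)+)
  finally show ?thesis .
qed

lemma l_right:
  assumes \<beta>: "trilin P P C M \<beta>" and c: "c \<in> carrier C"
  shows "tlift M (\<lambda>x y. tlift M (\<beta> x) (rcoact P y)) (l c) =
    tlift M (\<lambda>c1 c2. tlift M (\<lambda>x y. \<beta> x y c2) (l c1)) (\<Delta> c)"
proof -
  note \<beta>' = trilinD[OF \<beta>]
  note [mlin] = \<beta>'(1,5) linear_comp[OF \<beta>'(2)] linear_comp[OF \<beta>'(3)] linear_comp[OF \<beta>'(4)]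
  have F: "bilin P P M (\<lambda>x y. tlift M (\<beta> x) (rcoact P y))" by (assumption | rule mlin)+
  have "tlift M (\<lambda>c1 c2. tlift M (\<lambda>x y. \<beta> x y c2) (l c1)) (\<Delta> c) =
    tlift M (\<lambda>c1 c2. tlift M (\<lambda>x y. \<beta> x y c2) (lA c1)) (\<Delta> c) \<oplus>\<^bsub>M\<^esub>
    tlift M (\<lambda>c1 c2. tlift M (\<lambda>x y. \<beta> x y c2) (lB c1)) (\<Delta> c)"
    unfolding l_def by (rule tlift_comult_add; (assumption | rule c mlin)+)
  then show ?thesis
    using c by (simp add: l_def tlift_plus[OF _ _ _ F] lA_right[OF \<beta>] lB_right[OF \<beta>])
qed

lemma l_left:
  assumes \<beta>: "trilin C P P M \<beta>" and c: "c \<in> carrier C"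
  shows "tlift M (\<lambda>x y. tlift M (\<lambda>d z. \<beta> d z y) (lcoact P x)) (l c) =
    tlift M (\<lambda>c1 c2. tlift M (\<beta> c1) (l c2)) (\<Delta> c)"
proof -
  note \<beta>' = trilinD[OF \<beta>]
  note [mlin] = \<beta>'(1,5) linear_comp[OF \<beta>'(2)] linear_comp[OF \<beta>'(3)] linear_comp[OF \<beta>'(4)]
  have F: "bilin P P M (\<lambda>x y. tlift M (\<lambda>d z. \<beta> d z y) (lcoact P x))" by (assumption | rule mlin)+
  have "tlift M (\<lambda>c1 c2. tlift M (\<beta> c1) (l c2)) (\<Delta> c) =
    tlift M (\<lambda>c1 c2. tlift M (\<beta> c1) (lA c2)) (\<Delta> c) \<oplus>\<^bsub>M\<^esub> tlift M (\<lambda>c1 c2. tlift M (\<beta> c1) (lB c2)) (\<Delta> c)"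
    unfolding l_def by (rule tlift_comult_add; (assumption | rule c mlin)+)
  then show ?thesis
    using c by (simp add: l_def tlift_plus[OF _ _ _ F] lA_left[OF \<beta>] lB_left[OF \<beta>])
qed

end

text \<open>Checked in the two components. In the first, \<open>j2\<close> vanishes and the product
  along \<open>l1\<close> remains; in the second, \<open>lA\<close> contributes \<open>m'\<close>
  and \<open>lB\<close> contributes \<open>t * \<epsilon> = t\<close> by
  \<open>w_mult\<close>.\<close>

lemma l_mult:
  assumes c: "c \<in> carrier C"
  shows "tlift P (mult P) (l c) = \<epsilon> c \<odot>\<^bsub>P\<^esub> \<one>\<^bsub>P\<^esub>"
proof (rule joint_inj)
  show "tlift P (mult P) (l c) \<in> carrier P" "\<epsilon> c \<odot>\<^bsub>P\<^esub> \<one>\<^bsub>P\<^esub> \<in> carrier P"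
    using c by (auto intro!: tlift_closed[of P P])
  have z1: "\<zero>\<^bsub>P1\<^esub> \<otimes>\<^bsub>P1\<^esub> y = \<zero>\<^bsub>P1\<^esub>" if "y \<in> carrier P1" for y
    using that ring.ring_simprules(24)[OF P1.ring_P] by simp
  show "p1 (tlift P (mult P) (l c)) = p1 (\<epsilon> c \<odot>\<^bsub>P\<^esub> \<one>\<^bsub>P\<^esub>)"
  proof -
    have F: "bilin P P P1 (\<lambda>x y. p1 (x \<otimes>\<^bsub>P\<^esub> y))" by (assumption | rule mlin)+
    have A: "tlift P1 (\<lambda>x y. p1 (x \<otimes>\<^bsub>P\<^esub> y)) (lA c) = \<epsilon> c \<odot>\<^bsub>P1\<^esub> \<one>\<^bsub>P1\<^esub>"
    proof -
      have "tlift P1 (\<lambda>x y. p1 (x \<otimes>\<^bsub>P\<^esub> y)) (lA c) = tlift P1 (\<lambda>x y. p1 (jL x \<otimes>\<^bsub>P\<^esub> jR y)) (l1 c)"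
        by (rule tlift_lA[OF _ F c]) simp
      also have "\<dots> = tlift P1 (mult P1) (l1 c)"
        using c by (intro tlift_cong[of P1 P1]) (auto simp: p1.f_mult)
      finally show ?thesis using c by (simp add: P1.l_mult)
    qed
    have B: "tlift P1 (\<lambda>x y. p1 (x \<otimes>\<^bsub>P\<^esub> y)) (lB c) = \<zero>\<^bsub>P1\<^esub>"
    proof -
      have "tlift P1 (\<lambda>x y. p1 (x \<otimes>\<^bsub>P\<^esub> y)) (lB c) =
          tlift P1 (\<lambda>c1 c2. tlift P1 (\<lambda>x y. p1 (j2 (t c1 \<otimes>\<^bsub>P2\<^esub> x) \<otimes>\<^bsub>P\<^esub> y)) (w c2)) (\<Delta> c)"
        by (rule tlift_lB[OF _ F c]) simp
      also have "\<dots> = tlift P1 (\<lambda>c1 c2. tlift P1 (\<lambda>x y. \<zero>\<^bsub>P1\<^esub>) (w c2)) (\<Delta> c)"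
        using c by (intro tlift_cong2[of _ C C _ P2 P]) (auto simp: p1.f_mult z1)
      also have "\<dots> = tlift P1 (\<lambda>c1 c2. \<zero>\<^bsub>P1\<^esub>) (\<Delta> c)"
        using c by (intro tlift_cong[of C C]) (auto simp: tlift_zero[of P2 P])
      finally show ?thesis using c by (simp add: tlift_zero[of C C])
    qed
    have "p1 (tlift P (mult P) (l c)) = tlift P1 (\<lambda>x y. p1 (x \<otimes>\<^bsub>P\<^esub> y)) (l c)"
      by (rule tlift_push[OF _ _ p1.f_linear]; (assumption | rule c mlin)+)
    then show ?thesis
      using c by (simp add: l_def tlift_plus[OF _ _ _ F] A B linear_smult[OF p1.f_linear] p1.f_one)
  qed
  show "p2 (tlift P (mult P) (l c)) = p2 (\<epsilon> c \<odot>\<^bsub>P\<^esub> \<one>\<^bsub>P\<^esub>)"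
  proof -
    have F: "bilin P P P2 (\<lambda>x y. p2 (x \<otimes>\<^bsub>P\<^esub> y))" by (assumption | rule mlin)+
    have A: "tlift P2 (\<lambda>x y. p2 (x \<otimes>\<^bsub>P\<^esub> y)) (lA c) = m' c"
    proof -
      have "tlift P2 (\<lambda>x y. p2 (x \<otimes>\<^bsub>P\<^esub> y)) (lA c) = tlift P2 (\<lambda>x y. p2 (jL x \<otimes>\<^bsub>P\<^esub> jR y)) (l1 c)"
        by (rule tlift_lA[OF _ F c]) simp
      also have "\<dots> = m' c" unfolding m'_def
        using c by (intro tlift_cong[of P1 P1]) (auto simp: p2.f_mult)
      finally show ?thesis .
    qed
    have B: "tlift P2 (\<lambda>x y. p2 (x \<otimes>\<^bsub>P\<^esub> y)) (lB c) = t c"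
    proof -
      have "tlift P2 (\<lambda>x y. p2 (x \<otimes>\<^bsub>P\<^esub> y)) (lB c) =
          tlift P2 (\<lambda>c1 c2. tlift P2 (\<lambda>x y. p2 (j2 (t c1 \<otimes>\<^bsub>P2\<^esub> x) \<otimes>\<^bsub>P\<^esub> y)) (w c2)) (\<Delta> c)"
        by (rule tlift_lB[OF _ F c]) simp
      also have "\<dots> = tlift P2 (\<lambda>c1 c2. tlift P2 (\<lambda>x y. t c1 \<otimes>\<^bsub>P2\<^esub> (x \<otimes>\<^bsub>P2\<^esub> p2 y)) (w c2)) (\<Delta> c)"
        using c by (intro tlift_cong2[of _ C C _ P2 P]) (auto simp: p2.f_mult k2_kernel f2_t_mult P2.mult_assoc)
      also have "\<dots> = tlift P2 (\<lambda>c1 c2. \<epsilon> c2 \<odot>\<^bsub>P2\<^esub> t c1) (\<Delta> c)"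
      proof (rule tlift_cong[of C C])
        fix c1 c2 assume c12: "c1 \<in> carrier C" "c2 \<in> carrier C"
        have "tlift P2 (\<lambda>x y. t c1 \<otimes>\<^bsub>P2\<^esub> (x \<otimes>\<^bsub>P2\<^esub> p2 y)) (w c2) = t c1 \<otimes>\<^bsub>P2\<^esub> tlift P2 (\<lambda>x y. x \<otimes>\<^bsub>P2\<^esub> p2 y) (w c2)"
          by (rule tlift_push[symmetric]; (assumption | rule c12 mlin)+)
        then show "tlift P2 (\<lambda>x y. t c1 \<otimes>\<^bsub>P2\<^esub> (x \<otimes>\<^bsub>P2\<^esub> p2 y)) (w c2) = \<epsilon> c2 \<odot>\<^bsub>P2\<^esub> t c1"
          using c12 by (simp add: w_mult P2.mult_smult)
      qed (use c in auto)
      also have "\<dots> = t c" by (rule right_counit[OF right_comult _ _ t_linear c]) simp_all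
      finally show ?thesis .
    qed
    have "p2 (tlift P (mult P) (l c)) = tlift P2 (\<lambda>x y. p2 (x \<otimes>\<^bsub>P\<^esub> y)) (l c)"
      by (rule tlift_push[OF _ _ p2.f_linear]; (assumption | rule c mlin)+)
    then show ?thesis
      using c by (simp add: l_def tlift_plus[OF _ _ _ F] A B t_def diff_add_cancel linear_smult[OF p2.f_linear] p2.f_one)
  qed
qed

lemma right_connection_l: "right_connection K C e P l"
proof unfold_locales
  fix c assume c: "c \<in> carrier C"
  show "tlift (tensor K P P.PC) (\<lambda>x y. tlift (tensor K P P.PC) (\<lambda>z d. tens K P P.PC x (tens K P C z d)) (rcoact P y)) (l c) =
      tlift (tensor K P P.PC) (\<lambda>c1 c2. tlift (tensor K P P.PC) (\<lambda>x y. tens K P P.PC x (tens K P C y c2)) (l c1)) (\<Delta> c)"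
    by (rule l_right; (assumption | rule c mlin)+)
qed (auto intro: l_linear simp: l_mult)

text \<open>Beyond colinearity every condition concerns the entwining. The projections intertwine
  the actions and the maps \<open>Psi\<close> of \<open>P\<close>, \<open>P1\<close> and
  \<open>P2\<close>, and they are jointly injective on \<open>P \<otimes> C\<close> and
  \<open>C \<otimes> P\<close>; so each condition follows from those for \<open>P1\<close> and
  \<open>P2\<close>.\<close>

theorem strong_connection_l: "strong_connection K C e P l"
proof -
  interpret R: right_connection K C e P l by (rule right_connection_l)
  interpret h1: connection_hom K C e P P1 p1 l l1 by unfold_locales
  interpret h2: connection_hom K C e P P2 p2 l l2 by unfold_locales
  show ?thesis
  proof unfold_locales
    fix c assume c: "c \<in> carrier C"
    show "tlift (tensor K C (tensor K P P))
        (\<lambda>x y. tlift (tensor K C (tensor K P P)) (\<lambda>d z. tens K C (tensor K P P) d (tens K P P z y)) (lcoact P x)) (l c) =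
      tlift (tensor K C (tensor K P P))
        (\<lambda>c1 c2. tlift (tensor K C (tensor K P P)) (\<lambda>x y. tens K C (tensor K P P) c1 (tens K P P x y)) (l c2)) (\<Delta> c)"
      by (rule l_left; (assumption | rule c mlin)+)
  next
    fix p q assume pq: "p \<in> carrier P" "q \<in> carrier P"
    show "rcoact P (p \<otimes>\<^bsub>P\<^esub> q) = R.ract (rcoact P p) q"
      using pq by (intro TP_eqI)
        (simp_all add: h1.T_ract h2.T_ract p1.T_rcoact p2.T_rcoact p1.f_mult p2.f_mult P1.\<rho>_mult P2.\<rho>_mult)
  next
    fix p assume p: "p \<in> carrier P"
    show "R.Psi (lcoact P p) = tens K P C p e"
      using p linear_closed[OF R.Psi_linear] by (intro TP_eqI)
        (simp_all add: h1.T_Psi h2.T_Psi p1.S_lcoact p2.S_lcoact P1.Psi_\<sigma> P2.Psi_\<sigma>)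
  next
    show "inj_on R.Psi (carrier P.CP)"
    proof (rule inj_onI)
      fix s u assume su: "s \<in> carrier P.CP" "u \<in> carrier P.CP" and eq: "R.Psi s = R.Psi u"
      have "P1.Psi (p1.S s) = P1.Psi (p1.S u)" using h1.T_Psi[OF su(1)] h1.T_Psi[OF su(2)] eq by simp
      moreover have "P2.Psi (p2.S s) = P2.Psi (p2.S u)" using h2.T_Psi[OF su(1)] h2.T_Psi[OF su(2)] eq by simp
      ultimately show "s = u"
        using su inj_onD[OF P1.Psi_inj] inj_onD[OF P2.Psi_inj] by (intro SP_eqI) auto
    qed
  qed
qed

end

section \<open>Principality of the fibre product and the pullback itself\<close>

lemma (in fibre_coaction) principal_P:
  assumes pr1: "principal_coaug_alg K C e P1" and pr2: "principal_coaug_alg K C e P2"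
  shows "principal_coaug_alg K C e P"
proof -
  obtain l1 where l1: "strong_connection K C e P1 l1" using principal_imp_strong_connection[OF pr1] by blast
  obtain l2 where l2: "strong_connection K C e P2 l2" using principal_imp_strong_connection[OF pr2] by blast
  interpret L1: strong_connection K C e P1 l1 by (rule l1)
  interpret L2: strong_connection K C e P2 l2 by (rule l2)
  interpret P: coaug K C e P by unfold_locales (rule coaug_P)
  interpret p1: coaug_hom K C e P P1 p1 by unfold_locales (rule p1_coaug_hom)
  interpret p2: coaug_hom K C e P P2 p2 by unfold_locales (rule p2_coaug_hom)
  interpret S: principal_surjection K C e P2 P12 f2 l2 by unfold_locales (rule f2_surj)
  interpret F: fibre_principal K C e P P1 P2 P12 p1 p2 f1 f2 l1 l2 by unfold_locales
  show ?thesis by (rule strong_connection.principal[OF F.strong_connection_l])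
qed

context vector_spaces
begin

text \<open>The operations enter through equations on an arbitrary record scheme, because the
  pullback is the record of \<open>fibre_alg\<close> extended by two coactions.\<close>

lemma unital_algebra_fibre:
  fixes R :: "('k, 'p \<times> 'q, 'n) module_scheme"
    and P :: "('k, 'p, 'l) module_scheme" and Q :: "('k, 'q, 'm) module_scheme"
    and S :: "('k, 's, 'o) module_scheme"
  assumes P: "unital_algebra K P" and Q: "unital_algebra K Q" and S: "unital_algebra K S"
    and f: "f \<in> linear_maps K P S" "f \<in> ring_hom P S" and g: "g \<in> linear_maps K Q S" "g \<in> ring_hom Q S"
    and R: "carrier R = {(p, q). p \<in> carrier P \<and> q \<in> carrier Q \<and> f p = g q}"
      "\<And>p q p' q'. (p, q) \<otimes>\<^bsub>R\<^esub> (p', q') = (p \<otimes>\<^bsub>P\<^esub> p', q \<otimes>\<^bsub>Q\<^esub> q')" "\<one>\<^bsub>R\<^esub> = (\<one>\<^bsub>P\<^esub>, \<one>\<^bsub>Q\<^esub>)"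
      "\<And>p q p' q'. (p, q) \<oplus>\<^bsub>R\<^esub> (p', q') = (p \<oplus>\<^bsub>P\<^esub> p', q \<oplus>\<^bsub>Q\<^esub> q')" "\<zero>\<^bsub>R\<^esub> = (\<zero>\<^bsub>P\<^esub>, \<zero>\<^bsub>Q\<^esub>)"
      "\<And>a p q. a \<odot>\<^bsub>R\<^esub> (p, q) = (a \<odot>\<^bsub>P\<^esub> p, a \<odot>\<^bsub>Q\<^esub> q)"
  shows "unital_algebra K R"
proof -
  note PD = unital_algebraD[OF P] and QD = unital_algebraD[OF Q] and SD = unital_algebraD[OF S]
  note [simp] = PD(1-4,6-9) QD(1-4,6-9) SD(1)
  note hom = linear_add[OF f(1)] linear_add[OF g(1)] linear_smult[OF f(1)] linear_smult[OF g(1)]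
    linear_zero[OF f(1) PD(1) SD(1)] linear_zero[OF g(1) QD(1) SD(1)]
    linear_neg[OF f(1) PD(1) SD(1)] linear_neg[OF g(1) QD(1) SD(1)]
    ring_hom_mult[OF f(2)] ring_hom_mult[OF g(2)] ring_hom_one[OF f(2)] ring_hom_one[OF g(2)]
  have ab: "abelian_group R"
  proof (rule abelian_groupI)
    show "\<exists>y\<in>carrier R. y \<oplus>\<^bsub>R\<^esub> x = \<zero>\<^bsub>R\<^esub>" if "x \<in> carrier R" for x
    proof -
      obtain p q where x: "x = (p, q)" by (cases x)
      then have "p \<in> carrier P" "q \<in> carrier Q" "f p = g q" using that by (simp_all add: R)
      then show ?thesis
        unfolding x by (intro bexI[of _ "(\<ominus>\<^bsub>P\<^esub> p, \<ominus>\<^bsub>Q\<^esub> q)"])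
          (simp_all add: R hom ring.ring_simprules(3,9)[OF PD(2)] ring.ring_simprules(3,9)[OF QD(2)])
    qed
  next
    show "(x \<oplus>\<^bsub>R\<^esub> y) \<oplus>\<^bsub>R\<^esub> z = x \<oplus>\<^bsub>R\<^esub> (y \<oplus>\<^bsub>R\<^esub> z)"
      if "x \<in> carrier R" "y \<in> carrier R" "z \<in> carrier R" for x y z
      using that by (auto simp: R add_ac(1)[OF PD(1)] add_ac(1)[OF QD(1)])
  next
    show "x \<oplus>\<^bsub>R\<^esub> y = y \<oplus>\<^bsub>R\<^esub> x" if "x \<in> carrier R" "y \<in> carrier R" for x y
      using that by (auto simp: R intro: add_ac(2)[OF PD(1)] add_ac(2)[OF QD(1)])
  qed (auto simp: R hom)
  have mod: "module K R"
    by (rule moduleI[OF cring_K ab])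
      (auto simp: R hom smult_distribs(1-3)[OF PD(1)] smult_distribs(1-3)[OF QD(1)])
  have "monoid R"
    by (rule monoidI) (auto simp: R hom PD(5) QD(5))
  then have "ring R"
    by (rule ringI[OF ab])
      (auto simp: R ring.ring_simprules(13,23)[OF PD(2)] ring.ring_simprules(13,23)[OF QD(2)])
  then show ?thesis unfolding unital_algebra_def using mod by (auto simp: R)
qed

end

theorem theorem2p2:
  fixes K :: "'k ring"
    and C :: "('k, 'c) coalg"
    and e :: 'c
    and P1 :: "('k, 'p1, 'c) coact_alg"
    and P2 :: "('k, 'p2, 'c) coact_alg"
    and P12 :: "('k, 'p12, 'c) coact_alg"
    and \<pi>1 :: "'p1 \<Rightarrow> 'p12"
    and \<pi>2 :: "'p2 \<Rightarrow> 'p12"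
  assumes "field K"
    and "coalgebra K C"
    and "group_like K C e"
    and "coaug_alg K C e P12"
    and "principal_coaug_alg K C e P1"
    and "principal_coaug_alg K C e P2"
    and "coaug_alg_hom K C P1 P12 \<pi>1"
    and "coaug_alg_hom K C P2 P12 \<pi>2"
    and "\<pi>1 ` carrier P1 = carrier P12 \<or> \<pi>2 ` carrier P2 = carrier P12"
  shows "principal_coaug_alg K C e (pullback_alg K C P1 P2 \<pi>1 \<pi>2)"
proof -
  interpret coalgebra_point K C e
    using assms(1-3) by (intro coalgebra_point.intro vector_spaces.intro coalgebra_point_axioms.intro)
  interpret P1: coaug K C e P1
    by unfold_locales (use assms(5) in \<open>simp add: principal_coaug_alg_def\<close>)
  interpret P2: coaug K C e P2
    by unfold_locales (use assms(6) in \<open>simp add: principal_coaug_alg_def\<close>)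
  interpret P12: coaug K C e P12 by unfold_locales (rule assms(4))
  interpret A: coaug_hom K C e P1 P12 \<pi>1 by unfold_locales (rule assms(7))
  interpret B: coaug_hom K C e P2 P12 \<pi>2 by unfold_locales (rule assms(8))
  define P where "P = pullback_alg K C P1 P2 \<pi>1 \<pi>2"
  have P [simp]: "carrier P = {(p, q). p \<in> carrier P1 \<and> q \<in> carrier P2 \<and> \<pi>1 p = \<pi>2 q}"
    "(p, q) \<otimes>\<^bsub>P\<^esub> (p', q') = (p \<otimes>\<^bsub>P1\<^esub> p', q \<otimes>\<^bsub>P2\<^esub> q')" "\<one>\<^bsub>P\<^esub> = (\<one>\<^bsub>P1\<^esub>, \<one>\<^bsub>P2\<^esub>)"
    "(p, q) \<oplus>\<^bsub>P\<^esub> (p', q') = (p \<oplus>\<^bsub>P1\<^esub> p', q \<oplus>\<^bsub>P2\<^esub> q')" "\<zero>\<^bsub>P\<^esub> = (\<zero>\<^bsub>P1\<^esub>, \<zero>\<^bsub>P2\<^esub>)"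
    "a \<odot>\<^bsub>P\<^esub> (p, q) = (a \<odot>\<^bsub>P1\<^esub> p, a \<odot>\<^bsub>P2\<^esub> q)" for p q p' q' a
    by (simp_all add: P_def pullback_alg_def fibre_alg_def module.extend_def Let_def)
  \<comment> \<open>The tensor product is built from carrier, addition and scalar multiplication
    alone, so extending the record of \<open>fibre_alg\<close> by coactions leaves it
    unchanged.\<close>
  have tens: "tensor K (fibre_alg P1 P2 \<pi>1 \<pi>2) C = tensor K P C" "tensor K C (fibre_alg P1 P2 \<pi>1 \<pi>2) = tensor K C P"
    by (simp_all add: tensor_def tensor_rels_def P_def pullback_alg_def fibre_alg_def module.extend_def Let_def)
  have rc: "rcoact P x = (THE t. t \<in> carrier (tensor K P C) \<and>
        tmap K P1 C fst id t = rcoact P1 (fst x) \<and> tmap K P2 C snd id t = rcoact P2 (snd x))"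
    and lc: "lcoact P x = (THE t. t \<in> carrier (tensor K C P) \<and>
        tmap K C P1 id fst t = lcoact P1 (fst x) \<and> tmap K C P2 id snd t = lcoact P2 (snd x))" for x
    unfolding tens[symmetric] by (simp_all add: P_def pullback_alg_def module.extend_def Let_def)
  have homs: "\<pi>1 \<in> ring_hom P1 P12" "\<pi>2 \<in> ring_hom P2 P12"
    using assms(7,8) by (simp_all add: coaug_alg_hom_def)
  have alg: "unital_algebra K P"
    by (rule unital_algebra_fibre[OF P1.alg P2.alg P12.alg A.f_linear homs(1) B.f_linear homs(2)]) simp_all
  note modP = unital_algebraD(1)[OF alg]
  have lin: "fst \<in> linear_maps K P P1" "snd \<in> linear_maps K P P2"
    by (auto intro!: linear_mapsI)
  have hom: "fst \<in> ring_hom P P1" "snd \<in> ring_hom P P2"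
    by (auto simp: ring_hom_def)
  have sq: "\<pi>1 (fst x) = \<pi>2 (snd x)" if "x \<in> carrier P" for x
    using that by auto
  have surj_pair: "\<exists>x\<in>carrier P. fst x = a \<and> snd x = b"
    if "a \<in> carrier P1" "b \<in> carrier P2" "\<pi>1 a = \<pi>2 b" for a b
    using that by (intro bexI[of _ "(a, b)"]) simp_all
  note mods = modP P1.module_P P2.module_P P12.module_P
  from assms(9) show ?thesis
  proof
    assume surj: "\<pi>2 ` carrier P2 = carrier P12"
    have fm: "fibre_modules K P P1 P2 P12 fst snd \<pi>1 \<pi>2"
      by (intro fibre_modules.intro fibre_modules_axioms.intro vector_spaces_axioms)
        (fact mods lin A.f_linear B.f_linear surj | erule sq | erule (2) surj_pair | erule (1) prod_eqI)+
    interpret fibre_coaction K C e P P1 P2 P12 fst snd \<pi>1 \<pi>2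
      by (intro fibre_coaction.intro fibre_coaction_axioms.intro fm)
        (fact coalgebra_point_axioms P1.coaug_axioms P2.coaug_axioms P12.coaug_axioms
          A.coaug_hom_axioms B.coaug_hom_axioms alg hom | rule rc lc)+
    show ?thesis using principal_P[OF assms(5,6)] by (simp add: P_def)
  next
    \<comment> \<open>The roles of the two algebras are exchanged, with the same \<open>P\<close>
      and with \<open>snd\<close> as first projection; the descriptions of the coactions only have
      their last two conditions interchanged.\<close>
    assume surj: "\<pi>1 ` carrier P1 = carrier P12"
    have surj_pair': "\<exists>x\<in>carrier P. snd x = b \<and> fst x = a"
      if "b \<in> carrier P2" "a \<in> carrier P1" "\<pi>2 b = \<pi>1 a" for a b
      using surj_pair[OF that(2,1) that(3)[symmetric]] by blast
    have fm: "fibre_modules K P P2 P1 P12 snd fst \<pi>2 \<pi>1"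
      by (intro fibre_modules.intro fibre_modules_axioms.intro vector_spaces_axioms)
        (fact mods lin A.f_linear B.f_linear surj | erule sq[symmetric]
          | erule (2) surj_pair' | erule (1) prod_eqI[rotated])+
    have rc': "rcoact P x = (THE t. t \<in> carrier (tensor K P C) \<and>
        tmap K P2 C snd id t = rcoact P2 (snd x) \<and> tmap K P1 C fst id t = rcoact P1 (fst x))"
      and lc': "lcoact P x = (THE t. t \<in> carrier (tensor K C P) \<and>
        tmap K C P2 id snd t = lcoact P2 (snd x) \<and> tmap K C P1 id fst t = lcoact P1 (fst x))" for x
      unfolding rc lc by (rule arg_cong[of _ _ The], rule ext, rule conj_cong[OF refl conj_commute])+
    interpret fibre_coaction K C e P P2 P1 P12 snd fst \<pi>2 \<pi>1
      by (intro fibre_coaction.intro fibre_coaction_axioms.intro fm)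
        (fact coalgebra_point_axioms P1.coaug_axioms P2.coaug_axioms P12.coaug_axioms
          A.coaug_hom_axioms B.coaug_hom_axioms alg hom | rule rc' lc')+
    show ?thesis using principal_P[OF assms(6,5)] by (simp add: P_def)
  qed
qed

end
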